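(* Let $Y$ be a subspace of $\mathfrak{X}_{wh}$ generated by a sequence $(y_n)_{n=1}^\infty$ with pairwise disjoint supports, and let $T\in\mathcal{L}(Y)$. Then there exist a diagonal operator $D':\mathfrak{X}_{wh}\to\mathfrak{X}_{wh}$ (i.e. $D'e_n=\mu_ne_n$ for some scalar sequence $(\mu_n)$, where $(e_n)$ is the unit vector basis) and a strictly singular operator $S\in\mathcal{L}(Y)$ such that $T=D'|_Y+S$.
   Context: $\mathcal{L}(Y)$ is the space of bounded linear operators on $Y$; the subspace generated by a sequence is its closed linear span. An operator is strictly singular if its restriction to any infinite dimensional subspace is not an isomorphism (onto its image). The space $\mathfrak{X}_{wh}$. $c_{00}$ is the space of finitely supported real sequences with unit vectors $(e_n)$; $\operatorname{supp}x$ is the support of $x$. $Ba(\ell_2)$ is the closed unit ball of $\ell_2$ (finite sequences are regarded as elements of $\ell_2$). Schreier families: $\mathcal{S}_1=\{F\subset\mathbb{N}:|F|\le\min F\}$ and $\mathcal{S}_{n+1}=\{\bigcup_{i=1}^dF_i: F_1<\dots<F_d,\ F_i\in\mathcal{S}_n,\ \{\min F_i\}_{i=1}^d\in\mathcal{S}_1\}$. A finite sequence of sets $(E_i)_{i=1}^d$ is $\mathcal{S}_n$-allowable if the $E_i$ are pairwise disjoint finite subsets of $\mathbb{N}$ and $\{\min E_i\}_{i=1}^d\in\mathcal{S}_n$; a sequence of vectors is $\mathcal{S}_n$-allowable if its supports are. Fix increasing sequences of positive integers $(m_j)_{j\ge0}$, $(n_j)_{j\ge0}$ with $m_0=m_1=2$,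 $n_0=1$, and for $j\ge2$: $m_{j+1}\ge m_j^3$, and $n_j$ is such that $\ell_j(n_{j-1}+1)<n_j$, where $\ell_j=3\log_2(m_j)+1$. Fix disjoint infinite $N_1,N_2\subset\mathbb{N}$ with $\mathbb{N}=N_1\cup N_2$, and let $\Sigma$ be the set of finite sequences $(E_i,2j_i)_{i=1}^n$ with $E_i\subset\mathbb{N}$ finite and pairwise disjoint, $j_1<\dots<j_n$, $j_1\in N_1$ and $j_i\in N_2$ for $i>1$. Fix an injective $\sigma:\Sigma\to N_2$ with $m_{2\sigma((E_1,2j_1),\dots,(E_{i+1},2j_{i+1}))}>m_{2\sigma((E_1,2j_1),\dots,(E_i,2j_i))}(\max E_i)^2$ and with $m_{2\sigma((E_1,2j_1),\dots,(E_p,2j_p))}>m_{2j_p}(\max E_p)^2$. A sequence $(E_i,2j_i)_i$ is $\sigma$-special if $j_1\in N_1$ and $\sigma((E_1,2j_1),\dots,(E_i,2j_i))=j_{i+1}$ for each $i\ge1$; a finite $\sigma$-special sequence $(E_i,2j_i)_{i=1}^p$ is $\mathcal{S}_{n_{2j+1}}$ $\sigma$-special if $\{\min E_i\}_{i=1}^p\in\mathcal{S}_{n_{2j+1}}$ and $2j_1>2j+2$. A sequence $(f_i)_{i=1}^p\subset c_{00}$ is an $\mathcal{S}_{n_{2j+1}}$ $\sigma$-special sequence of functionals if there is an $\mathcal{S}_{n_{2j+1}}$ $\sigma$-special sequence $(E_i,2j_i)_{i=1}^p$ with $\operatorname{supp}f_i\subset E_i$ and $w(f_i)=m_{2j_i}$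 for all $i$. $D_{wh}\subset c_{00}$ is the smallest set such that: (1) $\pm e_n^*\in D_{wh}$ for all $n$; (2) for each $j\ge0$, $\frac1{m_{2j}}\sum_{i=1}^d\lambda_if_i\in D_{wh}$ whenever $(f_i)_{i=1}^d\subset D_{wh}$ is $\mathcal{S}_{n_{2j}}$-allowable and $(\lambda_i)\in Ba(\ell_2)$; (3) for each $j\ge 0$, $\frac1{m_{2j+1}}\sum_{i=1}^p\lambda_if_i\in D_{wh}$ whenever $(f_i)_{i=1}^p\subset D_{wh}$ is an $\mathcal{S}_{n_{2j+1}}$ $\sigma$-special sequence of functionals and $(\lambda_i)\in Ba(\ell_2)$. The weight $w(f)$ of a functional produced by (2) or (3) is $m_{2j}$ or $m_{2j+1}$ respectively. $\mathfrak{X}_{wh}$ is the completion of $c_{00}$ under $\|x\|=\sup\{f(x):f\in D_{wh}\}$. *)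

theory Defs
  imports "HOL-Analysis.Analysis" "HOL-Probability.Discrete_Topology"
begin

text \<open>Throughout, the natural numbers of the construction start at 1. Elements of
  \<open>c00\<close> and functionals on it are functions \<^typ>\<open>nat \<Rightarrow> real\<close> vanishing at 0
  and outside a finite set.\<close>

section \<open>Schreier families\<close>

text \<open>\<^term>\<open>Min {}\<close> is unspecified, so the empty set, which belongs to every Schreier
  family, is listed separately, and the sets whose minima are taken are required to be nonempty.
  The value at index 0 is not used.\<close>

fun schreier :: "nat \<Rightarrow> nat set set" where
  "schreier 0 = {}"
| "schreier (Suc 0) = {F. F = {} \<or> (finite F \<and> F \<subseteq> {1..} \<and> card F \<le> Min F)}"
| "schreier (Suc (Suc k)) =
     {\<Union> (set Fs) | Fs. {} \<notin> set Fs \<and> set Fs \<subseteq> schreier (Suc k) \<and>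
        sorted_wrt (\<lambda>A B. Max A < Min B) Fs \<and> Min ` set Fs \<in> schreier (Suc 0)}"

definition schreier_allowable :: "nat \<Rightarrow> nat \<Rightarrow> (nat \<Rightarrow> nat set) \<Rightarrow> bool" where
  "schreier_allowable k d E \<longleftrightarrow>
     (\<forall>i<d. finite (E i) \<and> E i \<noteq> {}) \<and> disjoint_family_on E {..<d} \<and>
     (\<lambda>i. Min (E i)) ` {..<d} \<in> schreier k"

section \<open>Parameters and the coding function\<close>

definition wh_parameters :: "(nat \<Rightarrow> nat) \<Rightarrow> (nat \<Rightarrow> nat) \<Rightarrow> nat set \<Rightarrow> nat set \<Rightarrow> bool" where
  "wh_parameters m n N1 N2 \<longleftrightarrow>
     mono m \<and> mono n \<and> (\<forall>j. 0 < m j) \<and> (\<forall>j. 0 < n j) \<and>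
     m 0 = 2 \<and> m 1 = 2 \<and> n 0 = 1 \<and>
     (\<forall>j\<ge>2. m (j + 1) \<ge> m j ^ 3) \<and>
     (\<forall>j\<ge>2. (3 * log 2 (real (m j)) + 1) * (real (n (j - 1)) + 1) < real (n j)) \<and>
     infinite N1 \<and> infinite N2 \<and> N1 \<inter> N2 = {} \<and> N1 \<union> N2 = {1..}"

text \<open>The pair \<open>(E, 2j)\<close> is stored as \<open>(E, j)\<close>.\<close>

definition wh_sequences :: "nat set \<Rightarrow> nat set \<Rightarrow> (nat set \<times> nat) list set" where
  "wh_sequences N1 N2 =
     {s. s \<noteq> [] \<and>
         (\<forall>E \<in> fst ` set s. finite E \<and> E \<noteq> {} \<and> E \<subseteq> {1..}) \<and>
         sorted_wrt disjnt (map fst s) \<and> sorted_wrt (<) (map snd s) \<and>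
         snd (hd s) \<in> N1 \<and> snd ` set (tl s) \<subseteq> N2}"

definition wh_coding ::
    "(nat \<Rightarrow> nat) \<Rightarrow> nat set \<Rightarrow> nat set \<Rightarrow> ((nat set \<times> nat) list \<Rightarrow> nat) \<Rightarrow> bool" where
  "wh_coding m N1 N2 \<sigma> \<longleftrightarrow>
     inj_on \<sigma> (wh_sequences N1 N2) \<and> \<sigma> ` wh_sequences N1 N2 \<subseteq> N2 \<and>
     (\<forall>s p. s \<noteq> [] \<and> s @ [p] \<in> wh_sequences N1 N2 \<longrightarrow>
        m (2 * \<sigma> (s @ [p])) > m (2 * \<sigma> s) * Max (fst (last s)) ^ 2) \<and>
     (\<forall>s \<in> wh_sequences N1 N2. m (2 * \<sigma> s) > m (2 * snd (last s)) * Max (fst (last s)) ^ 2)"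

definition sigma_special ::
    "nat set \<Rightarrow> nat set \<Rightarrow> ((nat set \<times> nat) list \<Rightarrow> nat) \<Rightarrow> (nat set \<times> nat) list \<Rightarrow> bool" where
  "sigma_special N1 N2 \<sigma> s \<longleftrightarrow>
     s \<in> wh_sequences N1 N2 \<and> (\<forall>i. 1 \<le> i \<and> i < length s \<longrightarrow> \<sigma> (take i s) = snd (s ! i))"

definition schreier_sigma_special ::
    "(nat \<Rightarrow> nat) \<Rightarrow> nat set \<Rightarrow> nat set \<Rightarrow> ((nat set \<times> nat) list \<Rightarrow> nat) \<Rightarrow>
     nat \<Rightarrow> (nat set \<times> nat) list \<Rightarrow> bool" where
  "schreier_sigma_special n N1 N2 \<sigma> j s \<longleftrightarrow>
     sigma_special N1 N2 \<sigma> s \<and> Min ` fst ` set s \<in> schreier (n (2 * j + 1)) \<and>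
     2 * snd (hd s) > 2 * j + 2"

section \<open>The norming set and the norm\<close>

definition supp :: "(nat \<Rightarrow> real) \<Rightarrow> nat set" where
  "supp x = {k. x k \<noteq> 0}"

definition c00 :: "(nat \<Rightarrow> real) set" where
  "c00 = {x. finite (supp x) \<and> x 0 = 0}"

text \<open>\<open>wh_functional m n N1 N2 \<sigma> f w\<close>: the functional \<open>f\<close> belongs to the norming set and can
  be produced with weight \<open>w\<close>, where \<^term>\<open>None\<close> stands for \<open>\<plusminus>e\<^sub>k\<^sup>*\<close>, which carry no weight.
  One \<open>f\<close> may have several weights; \<open>w(f) = a\<close> in the definition of special sequences
  means that \<open>a\<close> is one of them.\<close>

inductive wh_functional ::
    "(nat \<Rightarrow> nat) \<Rightarrow> (nat \<Rightarrow> nat) \<Rightarrow> nat set \<Rightarrow> nat set \<Rightarrow> ((nat set \<times> nat) list \<Rightarrow> nat) \<Rightarrow>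
     (nat \<Rightarrow> real) \<Rightarrow> nat option \<Rightarrow> bool"
  for m n :: "nat \<Rightarrow> nat" and N1 N2 :: "nat set" and \<sigma> :: "(nat set \<times> nat) list \<Rightarrow> nat"
where
  unit: "1 \<le> k \<Longrightarrow> \<epsilon> \<in> {1, -1} \<Longrightarrow>
     wh_functional m n N1 N2 \<sigma> (\<lambda>i. if i = k then \<epsilon> else 0) None"
| even: "(\<forall>i<d. \<exists>w. wh_functional m n N1 N2 \<sigma> (f i) w) \<Longrightarrow>
     schreier_allowable (n (2 * j)) d (\<lambda>i. supp (f i)) \<Longrightarrow>
     (\<Sum>i<d. (l i)\<^sup>2) \<le> 1 \<Longrightarrow>
     wh_functional m n N1 N2 \<sigma>
       (\<lambda>k. (1 / real (m (2 * j))) * (\<Sum>i<d. l i * f i k)) (Some (m (2 * j)))"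
| odd: "schreier_sigma_special n N1 N2 \<sigma> j s \<Longrightarrow> length s = p \<Longrightarrow>
     (\<forall>i<p. wh_functional m n N1 N2 \<sigma> (f i) (Some (m (2 * snd (s ! i)))) \<and>
            supp (f i) \<subseteq> fst (s ! i)) \<Longrightarrow>
     (\<Sum>i<p. (l i)\<^sup>2) \<le> 1 \<Longrightarrow>
     wh_functional m n N1 N2 \<sigma>
       (\<lambda>k. (1 / real (m (2 * j + 1))) * (\<Sum>i<p. l i * f i k)) (Some (m (2 * j + 1)))"

definition D_wh ::
    "(nat \<Rightarrow> nat) \<Rightarrow> (nat \<Rightarrow> nat) \<Rightarrow> nat set \<Rightarrow> nat set \<Rightarrow> ((nat set \<times> nat) list \<Rightarrow> nat) \<Rightarrow>
     (nat \<Rightarrow> real) set" where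
  "D_wh m n N1 N2 \<sigma> = {f. \<exists>w. wh_functional m n N1 N2 \<sigma> f w}"

definition wh_norm ::
    "(nat \<Rightarrow> nat) \<Rightarrow> (nat \<Rightarrow> nat) \<Rightarrow> nat set \<Rightarrow> nat set \<Rightarrow> ((nat set \<times> nat) list \<Rightarrow> nat) \<Rightarrow>
     (nat \<Rightarrow> real) \<Rightarrow> real" where
  "wh_norm m n N1 N2 \<sigma> x = (SUP f \<in> D_wh m n N1 N2 \<sigma>. \<Sum>k\<in>supp x. f k * x k)"

section \<open>The completion\<close>

definition closed_span :: "'x::real_normed_vector set \<Rightarrow> 'x set" where
  "closed_span A = closure (span A)"

text \<open>The completion is determined up to isometry: the vectors \<open>e k\<close>, \<open>k \<ge> 1\<close>, of an
  arbitrary Banach space are the images of the unit vectors under an isometric embedding of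
  \<open>c00\<close> with the above norm, and the completion is the closure \<open>X_wh e\<close> of the image.\<close>

definition wh_embedding ::
    "(nat \<Rightarrow> nat) \<Rightarrow> (nat \<Rightarrow> nat) \<Rightarrow> nat set \<Rightarrow> nat set \<Rightarrow> ((nat set \<times> nat) list \<Rightarrow> nat) \<Rightarrow>
     (nat \<Rightarrow> 'x::banach) \<Rightarrow> bool" where
  "wh_embedding m n N1 N2 \<sigma> e \<longleftrightarrow>
     (\<forall>x \<in> c00. norm (\<Sum>k\<in>supp x. x k *\<^sub>R e k) = wh_norm m n N1 N2 \<sigma> x)"

text \<open>Such an embedding exists: evaluate the functionals of the norming set. The coordinates of
  these functionals are bounded by 1, so the supremum in \<^const>\<open>wh_norm\<close> is finite.\<close>

lemma wh_functional_bounded: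
  assumes "wh_parameters m n N1 N2" and "wh_functional m n N1 N2 \<sigma> f w"
  shows "\<bar>f k\<bar> \<le> 1"
  using assms(2)
proof (induction arbitrary: k rule: wh_functional.induct)
  case (unit k' \<epsilon>)
  then show ?case by auto
next
  have single: "\<bar>1 / real (m q) * (\<Sum>i<d. l i * f i k)\<bar> \<le> 1"
    if disj: "disjoint_family_on (\<lambda>i. supp (f i)) {..<d}" and l: "(\<Sum>i<d. (l i)\<^sup>2) \<le> 1"
      and f: "\<forall>i<d. \<bar>f i k\<bar> \<le> 1"
    for q d k and f :: "nat \<Rightarrow> nat \<Rightarrow> real" and l :: "nat \<Rightarrow> real"
  proof -
    have "\<bar>\<Sum>i<d. l i * f i k\<bar> \<le> 1"
    proof (cases "\<exists>i<d. f i k \<noteq> 0")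
      case True
      then obtain i where i: "i < d" "f i k \<noteq> 0" by blast
      have "f i' k = 0" if "i' < d" "i' \<noteq> i" for i'
        using disj i that unfolding disjoint_family_on_def supp_def by auto
      then have "(\<Sum>i<d. l i * f i k) = (\<Sum>i'\<in>{i}. l i' * f i' k)"
        using i by (intro sum.mono_neutral_right) auto
      moreover have "(l i)\<^sup>2 \<le> (\<Sum>i<d. (l i)\<^sup>2)"
        using i by (intro member_le_sum) auto
      then have "\<bar>l i\<bar> \<le> 1"
        using l abs_square_le_1[of "l i"] by linarith
      ultimately show ?thesis
        using f i by (simp add: abs_mult mult_le_one)
    qed simp
    moreover have "1 \<le> real (m q)"
      using assms(1) unfolding wh_parameters_def by (metis One_nat_def Suc_leI of_nat_1 of_nat_le_iff)
    ultimately show ?thesis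
      by (simp add: abs_mult divide_le_eq)
  qed
  {
    case (even d f j l)
    then show ?case
      unfolding schreier_allowable_def by (intro single) auto
  next
    case (odd j s p f l)
    have "sorted_wrt disjnt (map fst s)"
      using odd.hyps(1) unfolding schreier_sigma_special_def sigma_special_def wh_sequences_def by auto
    then have *: "disjnt (fst (s ! a)) (fst (s ! b))" if "a < b" "b < p" for a b
      using that odd.hyps(2) by (auto simp: sorted_wrt_iff_nth_less)
    have "disjnt (fst (s ! a)) (fst (s ! b))" if "a \<noteq> b" "a < p" "b < p" for a b
    proof (cases "a < b")
      case True
      then show ?thesis using * that(3) by simp
    next
      case False
      then have "b < a" using that(1) by simp
      then show ?thesis using *[of b a] that(2) by (simp add: disjnt_def Int_commute)
    qed
    note dj = this
    have sub: "supp (f i) \<subseteq> fst (s ! i)" and le: "\<bar>f i k\<bar> \<le> 1" if "i < p" for i k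
      using odd.IH[rule_format, OF that] by simp_all
    have "supp (f a) \<inter> supp (f b) = {}" if "a \<noteq> b" "a < p" "b < p" for a b
      using dj[OF that] sub[OF that(2)] sub[OF that(3)] unfolding disjnt_def by fast
    then have "disjoint_family_on (\<lambda>i. supp (f i)) {..<p}"
      unfolding disjoint_family_on_def by simp
    then show ?case
      using odd.hyps(3) le by (intro single) simp_all
  }
qed

instance bcontfun :: (metric_space, banach) banach ..

lemma wh_embedding_exists:
  assumes "wh_parameters m n N1 N2"
  shows "\<exists>e :: nat \<Rightarrow> (nat \<Rightarrow> real) discrete \<Rightarrow>\<^sub>C real. wh_embedding m n N1 N2 \<sigma> e"
proof -
  let ?D = "D_wh m n N1 N2 \<sigma>"
  define g where "g k F = (if of_discrete F \<in> ?D then of_discrete F k else 0)"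
    for k :: nat and F :: "(nat \<Rightarrow> real) discrete"
  define e where "e k = Bcontfun (g k)" for k
  have bnd: "\<bar>f k\<bar> \<le> 1" if "f \<in> ?D" for f k
    using that wh_functional_bounded[OF assms] unfolding D_wh_def by blast
  have "g k \<in> bcontfun" for k
    by (rule bcontfun_normI[where b = 1])
      (auto simp: continuous_on_open_vimage open_discrete g_def bnd)
  then have app: "apply_bcontfun (e k) = g k" for k
    unfolding e_def by (simp add: Bcontfun_inverse)
  have sum_app: "apply_bcontfun (\<Sum>k\<in>A. x k *\<^sub>R e k) F = (\<Sum>k\<in>A. x k * g k F)"
    if "finite A" for A x F
    using that by (induction A rule: finite_induct) (auto simp: app)
  have "(\<lambda>i. if i = 1 then 1 else 0) \<in> ?D"
    unfolding D_wh_def mem_Collect_eq by (rule exI, rule wh_functional.unit) auto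
  then have ne: "?D \<noteq> {}" by blast
  have neg: "(\<lambda>k. - f k) \<in> ?D" if "f \<in> ?D" for f
  proof -
    from that obtain w where "wh_functional m n N1 N2 \<sigma> f w" unfolding D_wh_def by blast
    then have "\<exists>w. wh_functional m n N1 N2 \<sigma> (\<lambda>k. - f k) w"
    proof cases
      case (unit k \<epsilon>)
      have "(\<lambda>k. - f k) = (\<lambda>i. if i = k then - \<epsilon> else 0)" using unit by auto
      moreover have "- \<epsilon> \<in> {1, -1}" using unit by auto
      ultimately show ?thesis using wh_functional.unit[of k "- \<epsilon>"] unit by metis
    next
      case (even d f' j l)
      have "(\<lambda>k. - f k) = (\<lambda>k. 1 / real (m (2 * j)) * (\<Sum>i<d. - l i * f' i k))"
        using even by (auto simp: sum_negf)
      then show ?thesis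
        using wh_functional.even[of d m n N1 N2 \<sigma> f' j "\<lambda>i. - l i"] even by auto
    next
      case (odd j s p f' l)
      have "(\<lambda>k. - f k) = (\<lambda>k. 1 / real (m (2 * j + 1)) * (\<Sum>i<p. - l i * f' i k))"
        using odd by (auto simp: sum_negf)
      then show ?thesis
        using wh_functional.odd[of n N1 N2 \<sigma> j s p m f' "\<lambda>i. - l i"] odd by auto
    qed
    then show ?thesis unfolding D_wh_def by blast
  qed
  have "norm (\<Sum>k\<in>supp x. x k *\<^sub>R e k) = wh_norm m n N1 N2 \<sigma> x" if "x \<in> c00" for x
  proof -
    have fin: "finite (supp x)" using that unfolding c00_def by blast
    let ?u = "\<Sum>k\<in>supp x. x k *\<^sub>R e k"
    have le: "(\<Sum>k\<in>supp x. f k * x k) \<le> norm ?u" if "f \<in> ?D" for f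
      using norm_bounded[of ?u "discrete f"] that
      by (simp add: sum_app[OF fin] g_def discrete_inverse mult.commute)
    then have bdd: "bdd_above ((\<lambda>f. \<Sum>k\<in>supp x. f k * x k) ` ?D)"
      unfolding bdd_above_def by blast
    have up: "(\<Sum>k\<in>supp x. f k * x k) \<le> wh_norm m n N1 N2 \<sigma> x" if "f \<in> ?D" for f
      unfolding wh_norm_def using bdd that by (rule cSUP_upper2[where x = f]) auto
    have abs: "\<bar>\<Sum>k\<in>supp x. f k * x k\<bar> \<le> wh_norm m n N1 N2 \<sigma> x" if "f \<in> ?D" for f
      using up[OF that] up[OF neg[OF that]] by (simp add: sum_negf)
    have nonneg: "0 \<le> wh_norm m n N1 N2 \<sigma> x"
      using ne abs by force
    have "norm ?u \<le> wh_norm m n N1 N2 \<sigma> x"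
    proof (rule norm_bound)
      fix F
      show "norm (apply_bcontfun ?u F) \<le> wh_norm m n N1 N2 \<sigma> x"
        using abs[of "of_discrete F"] nonneg
        by (cases "of_discrete F \<in> ?D") (simp_all add: sum_app[OF fin] g_def mult.commute)
    qed
    moreover have "wh_norm m n N1 N2 \<sigma> x \<le> norm ?u"
      unfolding wh_norm_def using ne le by (intro cSUP_least) auto
    ultimately show ?thesis by simp
  qed
  then show ?thesis unfolding wh_embedding_def by blast
qed

definition X_wh :: "(nat \<Rightarrow> 'x::banach) \<Rightarrow> 'x set" where
  "X_wh e = closed_span (e ` {1..})"

text \<open>Support with respect to the Schauder basis \<open>(e k)\<close>, \<open>k \<ge> 1\<close>: the indices of the nonzero
  coefficients in the (unique) basis expansion.\<close>

definition basis_support :: "(nat \<Rightarrow> 'x::banach) \<Rightarrow> 'x \<Rightarrow> nat set" where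
  "basis_support e u = {k. \<exists>a. a 0 = 0 \<and> (\<lambda>i. a i *\<^sub>R e i) sums u \<and> a k \<noteq> 0}"

section \<open>Operators on subspaces\<close>

definition bounded_linear_on ::
    "'x::real_normed_vector set \<Rightarrow> ('x \<Rightarrow> 'y::real_normed_vector) \<Rightarrow> bool" where
  "bounded_linear_on U T \<longleftrightarrow>
     (\<forall>u\<in>U. \<forall>v\<in>U. T (u + v) = T u + T v) \<and> (\<forall>c. \<forall>u\<in>U. T (c *\<^sub>R u) = c *\<^sub>R T u) \<and>
     (\<exists>K. \<forall>u\<in>U. norm (T u) \<le> K * norm u)"

definition operators :: "'x::real_normed_vector set \<Rightarrow> ('x \<Rightarrow> 'x) set" where
  "operators U = {T. T ` U \<subseteq> U \<and> bounded_linear_on U T}"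

definition isomorphism_onto_image ::
    "'x::real_normed_vector set \<Rightarrow> ('x \<Rightarrow> 'y::real_normed_vector) \<Rightarrow> bool" where
  "isomorphism_onto_image Z T \<longleftrightarrow>
     bounded_linear_on Z T \<and> (\<exists>R. bounded_linear_on (T ` Z) R \<and> (\<forall>z\<in>Z. R (T z) = z))"

definition infinite_dimensional :: "'x::real_vector set \<Rightarrow> bool" where
  "infinite_dimensional Z \<longleftrightarrow> \<not> (\<exists>B. finite B \<and> Z \<subseteq> span B)"

definition strictly_singular ::
    "'x::real_normed_vector set \<Rightarrow> ('x \<Rightarrow> 'y::real_normed_vector) \<Rightarrow> bool" where
  "strictly_singular U S \<longleftrightarrow>
     (\<forall>Z. subspace Z \<and> Z \<subseteq> U \<and> infinite_dimensional Z \<longrightarrow> \<not> isomorphism_onto_image Z S)"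

definition diagonal_operators :: "(nat \<Rightarrow> 'x::banach) \<Rightarrow> ('x \<Rightarrow> 'x) set" where
  "diagonal_operators e =
     {D \<in> operators (X_wh e). \<exists>\<mu>. \<forall>k\<ge>1. D (e k) = \<mu> k *\<^sub>R e k}"

end

theory Submission
  imports Defs
begin

text \<open>Multiplying the coordinates by a sequence of modulus at most 1 does not increase the norm, so the
  band projections onto the supports of the \<open>y l\<close> act on \<open>Y\<close>, with range spanned by \<open>y l\<close>. Hence the
  diagonal part of \<open>T\<close> extends to a diagonal operator, and one has to show that the remaining part
  \<open>U\<close>, which has zero diagonal, is strictly singular.

  If \<open>U\<close> is bounded below on an infinite-dimensional \<open>Z\<close>, one finds in \<open>Z\<close> normalized repeated averages
  \<open>z\<close> on which all allowable families of functionals have a bounded square sum. A functional norming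
  \<open>U z\<close> can, by a maximal-cut argument using the zero diagonal, be made to act off the support of
  \<open>x' = proj (BL A) z\<close> while still being large on \<open>U x'\<close>. Along a rapidly increasing sequence of such
  blocks, choose a special sequence \<open>f t\<close> of combinations of these functionals and the corresponding
  combinations of the \<open>x' t\<close>. Since \<open>f t\<close> and \<open>x' t\<close> have disjoint supports, the only
  functionals that could give the combination \<open>v\<close> of the \<open>x' t\<close> a large norm vanish on it: its norm is
  of order \<open>1 / M\<^sup>2\<close>, where \<open>M = m (2 * j0 + 1)\<close>, while \<open>U v\<close> has norm at least of order
  \<open>1 / M\<close>. As \<open>M\<close> is arbitrarily large, this contradicts the boundedness of \<open>U\<close>.\<close>

section \<open>Schreier families\<close>

text \<open>The coefficients in the norming set range over the unit ball of l2, so the natural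
  quantity is not the value of one functional but the square sum over an allowable family
  (\<open>square_bound\<close>). It survives both moves used throughout: cutting all functionals
  along blocks (\<open>W_split\<close>) and replacing functionals by their children. Every
  replacement divides the squares by at least 4 and raises the order of the family; the growth of
  \<open>n\<close> against log \<open>m\<close> leaves room for enough replacements.

  On an average of blocks all but a small mass of the blocks is harmless. A functional that begins
  inside a block is charged to that block. Those that begin before it are few, and the weight of
  such a functional is too small, too large, or critical for one block only.

  For combinations along a special sequence the dangerous weight is that of the sequence itself.
  Injectivity of the coding makes any other special sequence agree with the given one up to the
  place where they part. So the sets recorded in the sequence have to be the supports of its
  functionals, not larger intervals: on the common part the other functionals then live off the
  vectors as well.\<close>

lemma schreier_finite_pos:
  assumes "F \<in> schreier k" shows "finite F \<and> 0 \<notin> F"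
  using assms
proof (induction k arbitrary: F rule: schreier.induct)
  case 1 then show ?case by simp
next
  case 2 then show ?case by auto
next
  case (3 k)
  from "3.prems" obtain Fs where Fs: "F = \<Union> (set Fs)" "set Fs \<subseteq> schreier (Suc k)" by auto
  have "finite A \<and> 0 \<notin> A" if "A \<in> set Fs" for A
    using "3.IH"[of A] Fs(2) that by blast
  then show ?case unfolding Fs(1) by auto
qed

lemma schreier_empty: "{} \<in> schreier (Suc k)"
proof (cases k)
  case 0 then show ?thesis by simp
next
  case (Suc k')
  have "\<exists>Fs. {} = \<Union> (set Fs) \<and> {} \<notin> set Fs \<and> set Fs \<subseteq> schreier (Suc k') \<and>
        sorted_wrt (\<lambda>A B. Max A < Min B) Fs \<and> Min ` set Fs \<in> schreier (Suc 0)"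
    by (rule exI[of _ "[]"]) auto
  then show ?thesis using Suc by simp
qed

lemma schreier_1_iff:
  "F \<in> schreier (Suc 0) \<longleftrightarrow> finite F \<and> 0 \<notin> F \<and> (\<forall>x\<in>F. card F \<le> x)"
proof (cases "F = {}")
  case False
  then have "finite F \<Longrightarrow> card F \<le> Min F \<longleftrightarrow> (\<forall>x\<in>F. card F \<le> x)" by simp
  moreover have "F \<subseteq> {1..} \<longleftrightarrow> 0 \<notin> F" by (auto simp: Suc_le_eq intro!: gr0I)
  ultimately show ?thesis using False unfolding schreier.simps by blast
qed simp

text \<open>Decompositions into possibly empty pieces: this form survives passing to subsets.\<close>

lemma schreier_SucI:
  fixes Fs :: "nat set list"
  assumes sub: "set Fs \<subseteq> schreier (Suc k)"
    and sorted: "sorted_wrt (\<lambda>A B. \<forall>a\<in>A. \<forall>b\<in>B. a < b) Fs"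
    and len: "\<And>A x. A \<in> set Fs \<Longrightarrow> x \<in> A \<Longrightarrow> length Fs \<le> x"
  shows "\<Union> (set Fs) \<in> schreier (Suc (Suc k))"
proof -
  define Gs where "Gs = filter (\<lambda>A. A \<noteq> {}) Fs"
  have fin: "finite A" "0 \<notin> A" if "A \<in> set Fs" for A
    using that sub schreier_finite_pos by blast+
  have U: "\<Union> (set Fs) = \<Union> (set Gs)" unfolding Gs_def by auto
  have "sorted_wrt (\<lambda>A B. \<forall>a\<in>A. \<forall>b\<in>B. a < b) Gs"
    unfolding Gs_def by (rule sorted_wrt_filter[OF sorted])
  then have s: "sorted_wrt (\<lambda>A B. Max A < Min B) Gs"
    by (rule sorted_wrt_mono_rel[rotated]) (auto simp: Gs_def fin)
  have c: "card (Min ` set Gs) \<le> length Fs"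
    by (metis Gs_def card_image_le card_length le_trans length_filter_le List.finite_set)
  have "length Fs \<le> x \<and> x \<noteq> 0" if x: "x \<in> Min ` set Gs" for x
  proof -
    from x obtain A where "A \<in> set Gs" "x = Min A" by auto
    then have "A \<in> set Fs" "x \<in> A" using fin by (auto simp: Gs_def)
    then show ?thesis using len fin by metis
  qed
  then have "Min ` set Gs \<in> schreier (Suc 0)"
    unfolding schreier_1_iff using c by force
  moreover have "set Gs \<subseteq> schreier (Suc k)" "{} \<notin> set Gs" using sub by (auto simp: Gs_def)
  ultimately show ?thesis unfolding U using s by auto
qed

lemma schreier_SucE:
  assumes "F \<in> schreier (Suc (Suc k))"
  obtains Fs where "F = \<Union> (set Fs)" "set Fs \<subseteq> schreier (Suc k)" "{} \<notin> set Fs"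
    "sorted_wrt (\<lambda>A B. \<forall>a\<in>A. \<forall>b\<in>B. a < b) Fs"
    "\<forall>x\<in>F. length Fs \<le> x" "Min ` set Fs \<in> schreier (Suc 0)"
proof -
  from assms obtain Fs where Fs: "F = \<Union> (set Fs)" "{} \<notin> set Fs" "set Fs \<subseteq> schreier (Suc k)"
     "sorted_wrt (\<lambda>A B. Max A < Min B) Fs" "Min ` set Fs \<in> schreier (Suc 0)" by auto
  have fin: "finite A" if "A \<in> set Fs" for A using that Fs(3) schreier_finite_pos by blast
  have lt: "a < b" if "A \<in> set Fs" "B \<in> set Fs" "Max A < Min B" "a \<in> A" "b \<in> B" for A B a b
  proof -
    have "a \<le> Max A" "Min B \<le> b" using that fin by auto
    then show ?thesis using that(3) by linarith
  qed
  have s: "sorted_wrt (\<lambda>A B. \<forall>a\<in>A. \<forall>b\<in>B. a < b) Fs"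
    by (rule sorted_wrt_mono_rel[OF _ Fs(4)]) (use lt in blast)
  \<comment> \<open>Distinct minima turn the Schreier bound on the number of minima into a bound on
    the number of pieces.\<close>
  have d: "distinct (map Min Fs)"
  proof -
    have "sorted_wrt (<) (map Min Fs)"
      unfolding sorted_wrt_map
    proof (rule sorted_wrt_mono_rel[OF _ Fs(4)])
      fix A B assume "A \<in> set Fs" "B \<in> set Fs" "Max A < Min B"
      moreover have "A \<noteq> {}" "B \<noteq> {}" using Fs(2) calculation by auto
      ultimately show "Min A < Min B"
        using lt[of A B "Min A" "Min B"] fin by auto
    qed
    then show ?thesis using strict_sorted_iff by blast
  qed
  have len: "length Fs = card (Min ` set Fs)"
    using distinct_card[OF d] by simp
  have "length Fs \<le> x" if x: "x \<in> F" for x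
  proof -
    from x Fs(1) obtain A where A: "A \<in> set Fs" "x \<in> A" by auto
    have "length Fs \<le> Min A" using A Fs(5) unfolding schreier_1_iff len by auto
    also have "... \<le> x" using A fin by auto
    finally show ?thesis .
  qed
  then show ?thesis using that[of Fs] Fs s by blast
qed

text \<open>The largest element \<open>b\<close> takes the largest value \<open>M\<close>, and the
  element \<open>h\<close> that had it takes over the value of \<open>b\<close>. This stays below
  the identity because \<open>\<rho> b \<le> M\<close>, \<open>M = \<rho> h\<close> and
  \<open>\<rho> h \<le> h\<close>. The remaining elements are rearranged by induction.\<close>

lemma monotone_rearrangement:
  fixes \<rho> :: "nat \<Rightarrow> nat"
  assumes "finite G" "inj_on \<rho> G" "\<And>g. g \<in> G \<Longrightarrow> \<rho> g \<le> g"
  shows "\<exists>\<psi>. strict_mono_on G \<psi> \<and> \<psi> ` G \<subseteq> \<rho> ` G \<and> (\<forall>g\<in>G. \<psi> g \<le> g)"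
  using assms
proof (induction G arbitrary: \<rho> rule: finite_linorder_max_induct)
  case empty then show ?case by (auto simp: monotone_on_def)
next
  case (insert b A)
  define M where "M = Max (\<rho> ` insert b A)"
  have "M \<in> \<rho> ` insert b A" unfolding M_def using insert.hyps(1) by (intro Max_in) auto
  then obtain h where h: "h \<in> insert b A" "M = \<rho> h" by blast
  have Mmax: "\<rho> g \<le> M" if "g \<in> insert b A" for g
    unfolding M_def using insert.hyps(1) that by (intro Max_ge) auto
  define \<rho>' where "\<rho>' g = (if g = h then \<rho> b else \<rho> g)" for g
  have b: "b \<notin> A" using insert.hyps(2) by auto
  have hb: "h \<le> b" using h(1) insert.hyps(2) by auto
  have inj: "g = g'" if "g \<in> insert b A" "g' \<in> insert b A" "\<rho> g = \<rho> g'" for g g'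
    using inj_onD[OF insert.prems(1) that(3) that(1,2)] .
  have 1: "inj_on \<rho>' A"
  proof (rule inj_onI)
    fix g g' assume g: "g \<in> A" "g' \<in> A" "\<rho>' g = \<rho>' g'"
    have "g \<noteq> b" "g' \<noteq> b" using g(1,2) b by auto
    then show "g = g'" using g inj[of g g'] inj[of b g'] inj[of g b]
      by (simp add: \<rho>'_def split: if_splits)
  qed
  have 2: "\<rho>' g \<le> g" if "g \<in> A" for g
  proof (cases "g = h")
    case True
    have "\<rho> b \<le> \<rho> h" using Mmax[of b] h by simp
    also have "\<rho> h \<le> h" using insert.prems(2) h(1) by blast
    finally show ?thesis using True by (simp add: \<rho>'_def)
  next
    case False
    then show ?thesis using insert.prems(2)[of g] that by (simp add: \<rho>'_def)
  qed
  from insert.IH[OF 1 2] obtain \<psi> where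
    \<psi>: "strict_mono_on A \<psi>" "\<psi> ` A \<subseteq> \<rho>' ` A" "\<forall>g\<in>A. \<psi> g \<le> g" by blast
  have lt: "\<rho>' g < M \<and> \<rho>' g \<in> \<rho> ` insert b A" if g: "g \<in> A" for g
  proof -
    have "\<rho>' g \<noteq> M"
      using g b h inj[of b h] inj[of g h] by (auto simp: \<rho>'_def)
    moreover have "\<rho>' g \<in> \<rho> ` insert b A" using g by (auto simp: \<rho>'_def)
    moreover have "\<rho>' g \<le> M" using Mmax g by (auto simp: \<rho>'_def)
    ultimately show ?thesis by simp
  qed
  define \<psi>' where "\<psi>' g = (if g = b then M else \<psi> g)" for g
  have ps: "\<psi> g < M \<and> \<psi> g \<in> \<rho> ` insert b A" if "g \<in> A" for g
  proof -
    have "\<psi> g \<in> \<rho>' ` A" using \<psi>(2) imageI[OF that] by (rule subsetD)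
    then obtain g' where "g' \<in> A" "\<psi> g = \<rho>' g'" by (rule imageE) simp
    then show ?thesis using lt[of g'] by simp
  qed
  have "strict_mono_on (insert b A) \<psi>'"
  proof (rule strict_mono_onI)
    fix r s assume rs: "r \<in> insert b A" "s \<in> insert b A" "r < s"
    then have "r \<in> A" using insert.hyps(2) by force
    then show "\<psi>' r < \<psi>' s"
      using rs b ps[of r] \<psi>(1) by (auto simp: \<psi>'_def strict_mono_on_def)
  qed
  moreover have "\<psi>' ` insert b A \<subseteq> \<rho> ` insert b A"
    using ps h by (auto simp: \<psi>'_def)
  moreover have "\<psi>' g \<le> g" if "g \<in> insert b A" for g
  proof -
    have "M \<le> b" using insert.prems(2) h hb by (metis le_trans)
    then show ?thesis using that \<psi>(3) by (auto simp: \<psi>'_def)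
  qed
  ultimately show ?case by blast
qed

text \<open>The pieces of \<open>F\<close> pull back along \<open>\<psi>\<close>. Preimages of
  successive pieces are successive because \<open>\<psi>\<close> increases, and their points are no
  smaller than the images, so the number of pieces stays admissible. Preimages may be empty, which
  \<open>schreier_SucI\<close> tolerates.\<close>

lemma schreier_spread_mono:
  assumes "F \<in> schreier (Suc k)" "strict_mono_on G \<psi>" "\<psi> ` G \<subseteq> F" "\<And>g. g \<in> G \<Longrightarrow> \<psi> g \<le> g"
  shows "G \<in> schreier (Suc k)"
  using assms
proof (induction k arbitrary: F G)
  case 0
  have inj: "inj_on \<psi> G" using 0(2) by (rule strict_mono_on_imp_inj_on)
  have F: "finite F" "0 \<notin> F" "\<And>x. x \<in> F \<Longrightarrow> card F \<le> x"
    using 0(1) unfolding schreier_1_iff by auto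
  have "finite G" using inj F(1) 0(3) by (meson finite_imageD finite_subset)
  moreover have "card G \<le> card F" using card_image[OF inj] card_mono[OF F(1) 0(3)] by simp
  moreover have "card F \<le> g \<and> g \<noteq> 0" if "g \<in> G" for g
  proof -
    have "\<psi> g \<in> F" using 0(3) that by blast
    then show ?thesis using F(2) F(3)[of "\<psi> g"] 0(4)[OF that]
      by (metis le_trans le_zero_eq)
  qed
  ultimately show ?case unfolding schreier_1_iff by (metis le_trans)
next
  case (Suc k)
  obtain Fs where Fs: "F = \<Union> (set Fs)" "set Fs \<subseteq> schreier (Suc k)" "{} \<notin> set Fs"
    "sorted_wrt (\<lambda>A B. \<forall>a\<in>A. \<forall>b\<in>B. a < b) Fs" "\<forall>x\<in>F. length Fs \<le> x"
    by (rule schreier_SucE[OF Suc.prems(1)])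
  define q where "q A = {g \<in> G. \<psi> g \<in> A}" for A
  have "G = \<Union> (set (map q Fs))" using Suc.prems(3) Fs(1) by (auto simp: q_def)
  moreover have "\<Union> (set (map q Fs)) \<in> schreier (Suc (Suc k))"
  proof (rule schreier_SucI)
    show "set (map q Fs) \<subseteq> schreier (Suc k)"
    proof
      fix B assume "B \<in> set (map q Fs)"
      then obtain A where A: "A \<in> set Fs" "B = q A" by auto
      show "B \<in> schreier (Suc k)"
        unfolding A(2)
      proof (rule Suc.IH)
        show "A \<in> schreier (Suc k)" using A Fs(2) by blast
        show "strict_mono_on (q A) \<psi>" using Suc.prems(2) by (auto simp: q_def strict_mono_on_def)
      qed (use Suc.prems(4) in \<open>auto simp: q_def\<close>)
    qed
    show "sorted_wrt (\<lambda>A B. \<forall>a\<in>A. \<forall>b\<in>B. a < b) (map q Fs)"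
      unfolding sorted_wrt_map
    proof (rule sorted_wrt_mono_rel[OF _ Fs(4)])
      fix A B :: "nat set" assume AB: "\<forall>a\<in>A. \<forall>b\<in>B. a < b"
      show "\<forall>a\<in>q A. \<forall>b\<in>q B. a < b"
      proof (intro ballI)
        fix a b assume ab: "a \<in> q A" "b \<in> q B"
        then have "\<psi> a < \<psi> b" using AB by (auto simp: q_def)
        then show "a < b" using ab Suc.prems(2)
          by (metis (mono_tags, lifting) mem_Collect_eq not_less_iff_gr_or_eq q_def strict_mono_on_def)
      qed
    qed
    fix B x assume "B \<in> set (map q Fs)" "x \<in> B"
    then have x: "x \<in> G" by (auto simp: q_def)
    then have "length Fs \<le> \<psi> x" using Fs(5) Suc.prems(3) by blast
    then show "length (map q Fs) \<le> x" using Suc.prems(4)[OF x] by simp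
  qed
  ultimately show ?case by simp
qed

text \<open>When supports shrink, their minima move to the right and may change their order, so the
  map back to the old minima is injective but not increasing. Rearranging it restores
  monotonicity.\<close>

lemma schreier_spread:
  assumes "F \<in> schreier k" "1 \<le> k" "inj_on \<rho> G" "\<rho> ` G \<subseteq> F" "\<And>g. g \<in> G \<Longrightarrow> \<rho> g \<le> g"
  shows "G \<in> schreier k"
proof -
  have "finite F" using assms(1) schreier_finite_pos by blast
  then have "finite G" using assms by (meson finite_imageD finite_subset)
  then obtain \<psi> where "strict_mono_on G \<psi>" "\<psi> ` G \<subseteq> \<rho> ` G" "\<forall>g\<in>G. \<psi> g \<le> g"
    using monotone_rearrangement[of G \<rho>] assms by blast
  moreover obtain k' where "k = Suc k'" using assms(2) by (cases k) auto
  ultimately show ?thesis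
    using schreier_spread_mono[of F k' G \<psi>] assms(1,4) by auto
qed

lemma schreier_Suc_mono:
  assumes "F \<in> schreier (Suc k)" shows "F \<in> schreier (Suc (Suc k))"
proof -
  have f: "finite F" "0 \<notin> F" using schreier_finite_pos[OF assms] by auto
  have "\<Union> (set [F]) \<in> schreier (Suc (Suc k))"
  proof (rule schreier_SucI)
    fix A x assume "A \<in> set [F]" "x \<in> A"
    then have "x \<noteq> 0" using f by (metis empty_iff list.set(1) set_ConsD)
    then show "length [F] \<le> x" by (cases x) auto
  qed (use assms in auto)
  then show ?thesis by simp
qed

lemma schreier_mono:
  assumes "1 \<le> a" "a \<le> b" shows "schreier a \<subseteq> schreier b"
  using assms(2)
proof (induction rule: dec_induct)
  case (step n)
  obtain n' where "n = Suc n'" using step.hyps(1) assms(1) by (cases n) auto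
  then show ?case using step.IH schreier_Suc_mono by blast
qed simp

lemma schreier_convolution:
  assumes "set Gs \<subseteq> schreier b" "1 \<le> a" "1 \<le> b" "{} \<notin> set Gs"
    "sorted_wrt (\<lambda>A B. \<forall>a\<in>A. \<forall>b\<in>B. a < b) Gs" "Min ` set Gs \<in> schreier a"
  shows "\<Union> (set Gs) \<in> schreier (a + b)"
  using assms(2,1,4-)
proof (induction a arbitrary: Gs rule: dec_induct)
  case base
  obtain b' where b': "b = Suc b'" using assms(3) by (cases b) auto
  have fin: "finite A" if "A \<in> set Gs" for A using that base(1) schreier_finite_pos by blast
  have s: "sorted_wrt (\<lambda>A B. Max A < Min B) Gs"
    by (rule sorted_wrt_mono_rel[OF _ base(3)]) (metis base(2) fin Max_in Min_in)
  have "\<Union> (set Gs) \<in> schreier (Suc (Suc b'))"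
    using base s by (auto simp: b')
  then show ?case by (simp add: b')
next
  case (step a)
  obtain a' where a': "a = Suc a'" using step.hyps by (cases a) auto
  have "Min ` set Gs \<in> schreier (Suc (Suc a'))" using step.prems(4) a' by simp
  then obtain Hs where Hs: "Min ` set Gs = \<Union> (set Hs)" "set Hs \<subseteq> schreier (Suc a')" "{} \<notin> set Hs"
    "sorted_wrt (\<lambda>A B. \<forall>a\<in>A. \<forall>b\<in>B. a < b) Hs"
    "\<forall>x\<in>Min ` set Gs. length Hs \<le> x" "Min ` set Hs \<in> schreier (Suc 0)"
    by (rule schreier_SucE)
  have fin: "finite A" if "A \<in> set Gs" for A using that step.prems(1) schreier_finite_pos by blast
  have lt: "a < b" if AB: "A \<in> set Gs" "B \<in> set Gs" "Min A < Min B" "a \<in> A" "b \<in> B" for A B a b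
  proof -
    obtain i j where ij: "i < length Gs" "j < length Gs" "A = Gs ! i" "B = Gs ! j"
      using AB by (metis in_set_conv_nth)
    show ?thesis
    proof (cases "i < j")
      case True
      then show ?thesis using sorted_wrt_nth_less[OF step.prems(3) True] ij AB by blast
    next
      case False
      have "i \<noteq> j" using ij AB(3) by auto
      then have "j < i" using False by simp
      then have "\<forall>b\<in>B. \<forall>a\<in>A. b < a" using sorted_wrt_nth_less[OF step.prems(3)] ij by blast
      then have "Min B < Min A" using fin AB by (metis Min_in empty_iff)
      then show ?thesis using AB(3) by simp
    qed
  qed
  \<comment> \<open>The sets are sorted by the piece \<open>H\<close> of the set of minima that
    contains their minimum; within one piece the induction hypothesis applies.\<close>
  define V where "V H = \<Union> (set (filter (\<lambda>G. Min G \<in> H) Gs))" for H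
  have V: "V H \<in> schreier (a + b)" if H: "H \<in> set Hs" for H
    unfolding V_def
  proof (rule step.IH)
    show "set (filter (\<lambda>G. Min G \<in> H) Gs) \<subseteq> schreier b" using step.prems by auto
    show "{} \<notin> set (filter (\<lambda>G. Min G \<in> H) Gs)" using step.prems by auto
    show "sorted_wrt (\<lambda>A B. \<forall>a\<in>A. \<forall>b\<in>B. a < b) (filter (\<lambda>G. Min G \<in> H) Gs)"
      by (rule sorted_wrt_filter[OF step.prems(3)])
    have "Min ` set (filter (\<lambda>G. Min G \<in> H) Gs) = H" using Hs(1) H by fastforce
    then show "Min ` set (filter (\<lambda>G. Min G \<in> H) Gs) \<in> schreier a" using H Hs(2) a' by auto
  qed
  have "\<Union> (set Gs) = \<Union> (set (map V Hs))"
    using Hs(1) unfolding V_def by fastforce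
  moreover obtain k where k: "a + b = Suc k" using a' by simp
  have "\<Union> (set (map V Hs)) \<in> schreier (Suc (Suc k))"
  proof (rule schreier_SucI)
    show "set (map V Hs) \<subseteq> schreier (Suc k)" using V k by auto
    show "sorted_wrt (\<lambda>A B. \<forall>a\<in>A. \<forall>b\<in>B. a < b) (map V Hs)"
      unfolding sorted_wrt_map
    proof (rule sorted_wrt_mono_rel[OF _ Hs(4)])
      fix A B :: "nat set" assume "\<forall>a\<in>A. \<forall>b\<in>B. a < b"
      then show "\<forall>a\<in>V A. \<forall>b\<in>V B. a < b"
        unfolding V_def by (auto intro: lt)
    qed
    fix B x assume "B \<in> set (map V Hs)" "x \<in> B"
    then obtain G where G: "G \<in> set Gs" "x \<in> G" by (auto simp: V_def)
    have "length Hs \<le> Min G" using Hs(5) G by blast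
    also have "... \<le> x" using fin G by auto
    finally show "length (map V Hs) \<le> x" by simp
  qed
  ultimately show ?case using k by simp
qed

text \<open>The modified Schreier families: the pieces need not be successive. This makes them
  stable under arbitrary rearrangements, so that trees of allowable families compose.\<close>

fun mschreier :: "nat \<Rightarrow> nat set set" where
  "mschreier 0 = {F. finite F \<and> 0 \<notin> F \<and> card F \<le> 1}"
| "mschreier (Suc p) =
     {\<Union> \<G> | \<G>. finite \<G> \<and> \<G> \<subseteq> mschreier p \<and> (\<forall>x\<in>\<Union> \<G>. card \<G> \<le> x)}"

lemma mschreier_SucI:
  assumes "finite \<G>" "\<G> \<subseteq> mschreier p" "\<And>x. x \<in> \<Union> \<G> \<Longrightarrow> card \<G> \<le> x"
  shows "\<Union> \<G> \<in> mschreier (Suc p)"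
  unfolding mschreier.simps by (rule CollectI, rule exI[of _ \<G>]) (use assms in blast)

lemma mschreier_SucE:
  assumes "F \<in> mschreier (Suc p)"
  obtains \<G> where "F = \<Union> \<G>" "finite \<G>" "\<G> \<subseteq> mschreier p" "\<forall>x\<in>F. card \<G> \<le> x"
proof -
  from assms obtain \<G> where "F = \<Union> \<G>" "finite \<G>" "\<G> \<subseteq> mschreier p" "\<forall>x\<in>\<Union> \<G>. card \<G> \<le> x"
    unfolding mschreier.simps mem_Collect_eq by (elim exE conjE)
  then show ?thesis by (intro that[of \<G>]) simp_all
qed

lemma mschreier_finite_pos: "F \<in> mschreier p \<Longrightarrow> finite F \<and> 0 \<notin> F"
proof (induction p arbitrary: F)
  case (Suc p)
  obtain \<G> where G: "F = \<Union> \<G>" "finite \<G>" "\<G> \<subseteq> mschreier p" "\<forall>x\<in>F. card \<G> \<le> x"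
    by (rule mschreier_SucE[OF Suc.prems])
  then show ?case using Suc.IH by (metis Union_iff finite_Union subsetD)
qed simp

lemma mschreier_empty: "{} \<in> mschreier p"
proof (cases p)
  case (Suc k)
  show ?thesis using mschreier_SucI[of "{}" k] Suc by simp
qed simp

text \<open>Collisions under \<open>\<phi>\<close> can only make a cover smaller, and moving points
  to the right only relaxes the bound on its cardinality.\<close>

lemma mschreier_image:
  assumes "F \<in> mschreier p" "\<And>x. x \<in> F \<Longrightarrow> x \<le> \<phi> x"
  shows "\<phi> ` F \<in> mschreier p"
  using assms
proof (induction p arbitrary: F)
  case 0
  have "0 \<notin> \<phi> ` F"
  proof
    assume "0 \<in> \<phi> ` F"
    then obtain x where "x \<in> F" "\<phi> x = 0" by auto
    then show False using 0 by force
  qed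
  moreover have "card (\<phi> ` F) \<le> 1" using 0 card_image_le[of F \<phi>] by auto
  ultimately show ?case using 0 by auto
next
  case (Suc p)
  obtain \<G> where G: "F = \<Union> \<G>" "finite \<G>" "\<G> \<subseteq> mschreier p" "\<forall>x\<in>F. card \<G> \<le> x"
    by (rule mschreier_SucE[OF Suc.prems(1)])
  have "\<phi> ` F = \<Union> ((\<lambda>H. \<phi> ` H) ` \<G>)" unfolding G(1) by auto
  moreover have "(\<lambda>H. \<phi> ` H) ` \<G> \<subseteq> mschreier p"
    using Suc.IH G Suc.prems(2) by blast
  moreover have "card ((\<lambda>H. \<phi> ` H) ` \<G>) \<le> y" if "y \<in> \<phi> ` F" for y
  proof -
    from that obtain x where x: "x \<in> F" "y = \<phi> x" by blast
    have "card ((\<lambda>H. \<phi> ` H) ` \<G>) \<le> card \<G>" by (rule card_image_le[OF G(2)])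
    also have "... \<le> x" using G(4) x by blast
    also have "... \<le> y" using Suc.prems(2) x by blast
    finally show ?thesis .
  qed
  ultimately show ?case
    using mschreier_SucI[of "(\<lambda>H. \<phi> ` H) ` \<G>" p] G(2) by (metis finite_imageI)
qed

lemma mschreier_subset:
  assumes "F \<in> mschreier p" "F' \<subseteq> F" shows "F' \<in> mschreier p"
  using assms
proof (induction p arbitrary: F F')
  case 0
  then show ?case using card_mono[of F F'] finite_subset[of F' F] by auto
next
  case (Suc p)
  obtain \<G> where G: "F = \<Union> \<G>" "finite \<G>" "\<G> \<subseteq> mschreier p" "\<forall>x\<in>F. card \<G> \<le> x"
    by (rule mschreier_SucE[OF Suc.prems(1)])
  have eq: "F' = \<Union> ((\<lambda>H. H \<inter> F') ` \<G>)" using G(1) Suc.prems(2) by auto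
  moreover have "(\<lambda>H. H \<inter> F') ` \<G> \<subseteq> mschreier p"
  proof
    fix X assume "X \<in> (\<lambda>H. H \<inter> F') ` \<G>"
    then obtain H where "H \<in> \<G>" "X = H \<inter> F'" by blast
    then show "X \<in> mschreier p" using Suc.IH[of H X] G(3) by blast
  qed
  moreover have "card ((\<lambda>H. H \<inter> F') ` \<G>) \<le> x" if "x \<in> F'" for x
  proof -
    have "card \<G> \<le> x" using G(4) that Suc.prems(2) by blast
    then show ?thesis using card_image_le[OF G(2), of "\<lambda>H. H \<inter> F'"] by linarith
  qed
  ultimately have "\<Union> ((\<lambda>H. H \<inter> F') ` \<G>) \<in> mschreier (Suc p)"
    using G(2) by (intro mschreier_SucI) blast+
  then show ?case unfolding eq[symmetric] .
qed

lemma mschreier_Suc_mono: "mschreier p \<subseteq> mschreier (Suc p)"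
proof
  fix F assume F: "F \<in> mschreier p"
  then have "0 \<notin> F" using mschreier_finite_pos by blast
  then have "1 \<le> x" if "x \<in> F" for x using that by (cases x) auto
  then have "\<Union> {F} \<in> mschreier (Suc p)"
    using F by (intro mschreier_SucI) simp_all
  then show "F \<in> mschreier (Suc p)" by simp
qed

lemma mschreier_mono: "p \<le> p' \<Longrightarrow> mschreier p \<subseteq> mschreier p'"
  using lift_Suc_mono_le[of mschreier p p', OF mschreier_Suc_mono] .

text \<open>A cover of \<open>R\<close> induces a cover of the union with no more pieces; its size
  remains admissible because the points of \<open>B r\<close> are at least \<open>r\<close>.\<close>

lemma mschreier_convolution:
  assumes "R \<in> mschreier p" "\<And>r. r \<in> R \<Longrightarrow> B r \<in> mschreier p'"
    "\<And>r x. r \<in> R \<Longrightarrow> x \<in> B r \<Longrightarrow> r \<le> x"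
  shows "\<Union> (B ` R) \<in> mschreier (p + p')"
  using assms
proof (induction p arbitrary: R)
  case 0
  show ?case
  proof (cases "R = {}")
    case True then show ?thesis by (simp add: mschreier_empty)
  next
    case False
    then obtain r where "R = {r}" using 0
      by (metis (no_types, lifting) card_0_eq card_1_singletonE le_antisym less_one linorder_not_le mem_Collect_eq mschreier.simps(1))
    then show ?thesis using 0(2)[of r] by simp
  qed
next
  case (Suc p)
  obtain \<G> where G: "R = \<Union> \<G>" "finite \<G>" "\<G> \<subseteq> mschreier p" "\<forall>x\<in>R. card \<G> \<le> x"
    by (rule mschreier_SucE[OF Suc.prems(1)])
  have "\<Union> (B ` R) = \<Union> ((\<lambda>H. \<Union> (B ` H)) ` \<G>)" unfolding G(1) by auto
  moreover have "(\<lambda>H. \<Union> (B ` H)) ` \<G> \<subseteq> mschreier (p + p')"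
  proof
    fix X assume "X \<in> (\<lambda>H. \<Union> (B ` H)) ` \<G>"
    then obtain H where H: "H \<in> \<G>" "X = \<Union> (B ` H)" by blast
    show "X \<in> mschreier (p + p')" unfolding H(2)
    proof (rule Suc.IH)
      show "H \<in> mschreier p" using H G(3) by blast
      have "H \<subseteq> R" using H G(1) by blast
      then show "r \<le> x" if "r \<in> H" "x \<in> B r" for r x
        using Suc.prems(3)[of r x] that by blast
      show "B r \<in> mschreier p'" if "r \<in> H" for r
        using Suc.prems(2)[of r] that \<open>H \<subseteq> R\<close> by blast
    qed
  qed
  moreover have "card ((\<lambda>H. \<Union> (B ` H)) ` \<G>) \<le> x" if "x \<in> \<Union> (B ` R)" for x
  proof -
    from that obtain r where r: "r \<in> R" "x \<in> B r" by blast
    have "card ((\<lambda>H. \<Union> (B ` H)) ` \<G>) \<le> card \<G>" by (rule card_image_le[OF G(2)])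
    also have "... \<le> r" using G(4) r by blast
    also have "... \<le> x" using Suc.prems(3) r by blast
    finally show ?thesis .
  qed
  ultimately show ?case
    using mschreier_SucI[of "(\<lambda>H. \<Union> (B ` H)) ` \<G>" "p + p'"] G(2) unfolding add_Suc
    by (metis finite_imageI)
qed

lemma mschreier_1I:
  assumes "finite F" "0 \<notin> F" "\<And>x. x \<in> F \<Longrightarrow> card F \<le> x"
  shows "F \<in> mschreier 1"
proof -
  have "F = \<Union> ((\<lambda>x. {x}) ` F)" by auto
  moreover have "(\<lambda>x. {x}) ` F \<subseteq> mschreier 0" using assms(2) by auto
  moreover have "card ((\<lambda>x. {x}) ` F) \<le> x" if "x \<in> F" for x
    using assms(3)[OF that] card_image_le[OF assms(1), of "\<lambda>x. {x}"] by linarith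
  ultimately show ?thesis
    using mschreier_SucI[of "(\<lambda>x. {x}) ` F" 0] assms(1) unfolding One_nat_def by (metis finite_imageI)
qed

text \<open>At order 1 the modified family is the usual one, so a modified set of order 1 can be fed
  into a functional of weight \<open>m 0\<close>, for which \<open>n 0 = 1\<close>.\<close>

lemma mschreier_1D:
  assumes "F \<in> mschreier (Suc 0)" "x \<in> F" shows "card F \<le> x"
proof -
  obtain \<G> where G: "F = \<Union> \<G>" "finite \<G>" "\<G> \<subseteq> mschreier 0" "\<forall>x\<in>F. card \<G> \<le> x"
    by (rule mschreier_SucE[OF assms(1)])
  have "card F \<le> (\<Sum>H\<in>\<G>. card H)" unfolding G(1) by (rule card_Union_le_sum_card)
  also have "... \<le> (\<Sum>H\<in>\<G>. 1)" using G(3) by (intro sum_mono) auto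
  also have "... \<le> x" using G(4) assms(2) by simp
  finally show ?thesis .
qed

text \<open>Upper estimates are stated for the modified families; this inclusion makes them apply to
  the functionals of the norming set, whose rules speak of Schreier sets proper.\<close>

lemma schreier_le_mschreier:
  "schreier (Suc p) \<subseteq> mschreier (Suc p)"
proof (induction p)
  case 0
  show ?case
  proof
    fix F assume "F \<in> schreier (Suc 0)"
    then show "F \<in> mschreier (Suc 0)" unfolding schreier_1_iff using mschreier_1I[of F] by simp
  qed
next
  case (Suc p)
  show ?case
  proof
    fix F assume "F \<in> schreier (Suc (Suc p))"
    then obtain Fs where Fs: "F = \<Union> (set Fs)" "set Fs \<subseteq> schreier (Suc p)" "{} \<notin> set Fs"
      "sorted_wrt (\<lambda>A B. \<forall>a\<in>A. \<forall>b\<in>B. a < b) Fs"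
      "\<forall>x\<in>F. length Fs \<le> x" "Min ` set Fs \<in> schreier (Suc 0)"
      by (rule schreier_SucE)
    have c: "card (set Fs) \<le> x" if "x \<in> F" for x using bspec[OF Fs(5) that] card_length[of Fs] by linarith
    show "F \<in> mschreier (Suc (Suc p))"
      unfolding Fs(1)
    proof (rule mschreier_SucI)
      show "set Fs \<subseteq> mschreier (Suc p)" using Fs(2) Suc.IH by (rule subset_trans)
    qed (use c Fs(1) in simp_all)
  qed
qed

text \<open>The form in which families of functionals shrink: \<open>a\<close> gives the minima of
  the old supports, \<open>b\<close> those of the new, smaller ones.\<close>

lemma mschreier_dominate:
  assumes "F \<in> mschreier p" "inj_on a I" "a ` I \<subseteq> F" "\<And>i. i \<in> I \<Longrightarrow> a i \<le> b i"
  shows "b ` I \<in> mschreier p"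
proof -
  have "(\<lambda>v. b (inv_into I a v)) ` (a ` I) \<in> mschreier p"
    by (rule mschreier_image[OF mschreier_subset[OF assms(1,3)]])
      (use assms(2,4) in \<open>auto simp: inv_into_f_f\<close>)
  moreover have "(\<lambda>v. b (inv_into I a v)) ` (a ` I) = b ` I"
    using assms(2) by (auto simp: image_image inv_into_f_f)
  ultimately show ?thesis by simp
qed

lemma schreier_dominate:
  assumes "F \<in> schreier k" "1 \<le> k" "inj_on a I" "inj_on b I" "a ` I \<subseteq> F"
    "\<And>i. i \<in> I \<Longrightarrow> a i \<le> b i"
  shows "b ` I \<in> schreier k"
proof (rule schreier_spread[OF assms(1,2)])
  show "inj_on (\<lambda>v. a (inv_into I b v)) (b ` I)"
    using assms(3,4) by (auto simp: inj_on_def inv_into_f_f)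
  show "(\<lambda>v. a (inv_into I b v)) ` b ` I \<subseteq> F"
    using assms(4,5) by (auto simp: inv_into_f_f)
  show "a (inv_into I b g) \<le> g" if "g \<in> b ` I" for g
    using that assms(4,6) by (auto simp: inv_into_f_f)
qed

section \<open>Repeated averages\<close>

text \<open>The averages are taken over consecutive indices, with no freedom to skip: a special
  sequence has to be used from its first term on.\<close>

lemma repeated_averages:
  fixes s r :: "nat \<Rightarrow> nat"
  assumes sr: "\<And>k. s k \<le> r k" and rs: "\<And>k. r k < s (Suc k)" and s0: "1 \<le> s 0"
  shows "\<exists>K' b. K < K' \<and> (\<forall>k. 0 \<le> b k) \<and> (\<Sum>k\<in>{K..<K'}. b k) = (1::real) \<and>
    s ` {K..<K'} \<in> schreier (Suc p) \<and> 2 * s K \<le> s K' \<and>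
    (\<forall>G\<subseteq>{K..<K'}. r ` G \<in> mschreier p \<longrightarrow> (\<Sum>k\<in>G. b k) \<le> 3 ^ Suc p / real (s K))"
proof -
  have step: "s k < s (Suc k)" for k using sr[of k] rs[of k] by simp
  then have smono: "strict_mono s" by (simp add: strict_mono_Suc_iff)
  have sadd: "s i + j \<le> s (i + j)" for i j
  proof (induction j)
    case (Suc j) then show ?case using step[of "i + j"] by simp
  qed simp
  have spos: "1 \<le> s k" for k using sadd[of 0 k] s0 by simp
  have sle: "s i \<le> s j" if "i \<le> j" for i j using smono that by (simp add: strict_mono_less_eq)
  have rlt: "r i < r j" if "i < j" for i j
    using rs[of i] sle[of "Suc i" j] sr[of j] that by simp
  show ?thesis
  proof (induction p arbitrary: K)
    case 0
    \<comment> \<open>Equal weights on \<open>s K\<close> consecutive indices: the largest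
      cardinality that a first-order Schreier set beginning at \<open>s K\<close> may have.\<close>
    let ?b = "\<lambda>k::nat. 1 / real (s K)"
    have "(\<Sum>k\<in>G. ?b k) \<le> 3 ^ Suc 0 / real (s K)"
      if G: "G \<subseteq> {K..<K + s K}" "r ` G \<in> mschreier 0" for G
    proof -
      have "inj_on r G" using rlt by (metis inj_onI linorder_neqE_nat order_less_irrefl)
      then have "card G \<le> 1" using G(2) by (simp add: card_image)
      then have "real (card G) / real (s K) \<le> 3 / real (s K)"
        by (intro divide_right_mono) auto
      then show ?thesis by simp
    qed
    moreover have "s ` {K..<K + s K} \<in> schreier (Suc 0)"
    proof -
      have "0 \<notin> s ` {K..<K + s K}"
      proof
        assume "0 \<in> s ` {K..<K + s K}"
        then obtain k where "s k = 0" by force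
        then show False using spos[of k] by simp
      qed
      moreover have "card (s ` {K..<K + s K}) \<le> x" if "x \<in> s ` {K..<K + s K}" for x
      proof -
        have "card (s ` {K..<K + s K}) \<le> s K" using card_image_le[of "{K..<K + s K}" s] by simp
        then show ?thesis using that sle by fastforce
      qed
      ultimately show ?thesis unfolding schreier_1_iff by blast
    qed
    ultimately show ?case using spos[of K] sadd[of K "s K"]
      by (intro exI[of _ "K + s K"] exI[of _ ?b]) (auto simp: mult_2)
  next
    case (Suc p)
    define C :: real where "C = 3 ^ Suc p"
    have "\<exists>f. \<forall>K. K < fst (f K) \<and> (\<forall>k. 0 \<le> snd (f K) k) \<and>
      (\<Sum>k\<in>{K..<fst (f K)}. snd (f K) k) = (1::real) \<and>
      s ` {K..<fst (f K)} \<in> schreier (Suc p) \<and> 2 * s K \<le> s (fst (f K)) \<and>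
      (\<forall>G\<subseteq>{K..<fst (f K)}. r ` G \<in> mschreier p \<longrightarrow> (\<Sum>k\<in>G. snd (f K) k) \<le> C / real (s K))"
      unfolding C_def by (rule choice, rule allI) (use Suc.IH in auto)
    then obtain f where f: "\<And>K. K < fst (f K)" "\<And>K k. 0 \<le> snd (f K) k"
      "\<And>K. (\<Sum>k\<in>{K..<fst (f K)}. snd (f K) k) = (1::real)"
      "\<And>K. s ` {K..<fst (f K)} \<in> schreier (Suc p)" "\<And>K. 2 * s K \<le> s (fst (f K))"
      "\<And>K G. G \<subseteq> {K..<fst (f K)} \<Longrightarrow> r ` G \<in> mschreier p \<Longrightarrow>
          (\<Sum>k\<in>G. snd (f K) k) \<le> C / real (s K)" by metis
    \<comment> \<open>Averages of the lower order are lined up without gaps, each beginning where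
      the previous one ends; the first \<open>d = s K\<close> of them are averaged with equal
      weights.\<close>
    define \<kappa> where "\<kappa> i = ((\<lambda>K. fst (f K)) ^^ i) K" for i
    have \<kappa>0: "\<kappa> 0 = K" and \<kappa>S: "\<kappa> (Suc i) = fst (f (\<kappa> i))" for i by (simp_all add: \<kappa>_def)
    have \<kappa>step: "\<kappa> i < \<kappa> (Suc i)" for i using f(1) \<kappa>S by simp
    then have "strict_mono \<kappa>" by (simp add: strict_mono_Suc_iff)
    then have \<kappa>le: "\<kappa> i \<le> \<kappa> j" if "i \<le> j" for i j
      using that by (simp add: strict_mono_less_eq)
    define P where "P i = {\<kappa> i..<\<kappa> (Suc i)}" for i
    define d where "d = s K"
    have d: "0 < d" using spos[of K] by (simp add: d_def)
    have U: "{K..<\<kappa> j} = (\<Union>i<j. P i)" for j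
    proof (induction j)
      case (Suc j)
      have "{K..<\<kappa> (Suc j)} = {K..<\<kappa> j} \<union> P j"
        using \<kappa>le[of 0 j] \<kappa>step[of j] by (auto simp: P_def \<kappa>0)
      then show ?case using Suc by (auto simp: lessThan_Suc)
    qed (simp add: \<kappa>0)
    define b where "b k = (\<Sum>i<d. if k \<in> P i then snd (f (\<kappa> i)) k / real d else 0)" for k
    have bsum: "(\<Sum>k\<in>G. b k) = (\<Sum>i<d. (\<Sum>k\<in>G \<inter> P i. snd (f (\<kappa> i)) k)) / real d"
      if "finite G" for G
    proof -
      have "(\<Sum>k\<in>G. b k) = (\<Sum>i<d. \<Sum>k\<in>G. if k \<in> P i then snd (f (\<kappa> i)) k / real d else 0)"
        unfolding b_def by (rule sum.swap)
      also have "... = (\<Sum>i<d. (\<Sum>k\<in>G \<inter> P i. snd (f (\<kappa> i)) k / real d))"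
        using that by (simp add: sum.inter_restrict)
      finally show ?thesis by (simp add: sum_divide_distrib)
    qed
    have "(\<Sum>k\<in>{K..<\<kappa> d}. b k) = (\<Sum>i<d. 1) / real d"
    proof -
      have "(\<Sum>k\<in>{K..<\<kappa> d} \<inter> P i. snd (f (\<kappa> i)) k) = 1" if "i < d" for i
      proof -
        have "P i \<subseteq> {K..<\<kappa> d}" unfolding U using that by blast
        then have "{K..<\<kappa> d} \<inter> P i = P i" by blast
        then show ?thesis using f(3)[of "\<kappa> i"] by (simp add: P_def \<kappa>S)
      qed
      then show ?thesis by (simp add: bsum)
    qed
    then have c1: "(\<Sum>k\<in>{K..<\<kappa> d}. b k) = 1" using d by simp
    have c2: "\<forall>k. 0 \<le> b k" unfolding b_def using f(2) by (auto intro!: sum_nonneg)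
    have "\<Union> (set (map (\<lambda>i. s ` P i) [0..<d])) \<in> schreier (Suc (Suc p))"
    proof (rule schreier_SucI)
      show "set (map (\<lambda>i. s ` P i) [0..<d]) \<subseteq> schreier (Suc p)"
        using f(4) by (auto simp: P_def \<kappa>S)
      show "sorted_wrt (\<lambda>A B. \<forall>a\<in>A. \<forall>b\<in>B. a < b) (map (\<lambda>i. s ` P i) [0..<d])"
        unfolding sorted_wrt_map
      proof (rule sorted_wrt_mono_rel[OF _ sorted_wrt_upt])
        fix i j :: nat assume ij: "i < j"
        show "\<forall>a\<in>s ` P i. \<forall>b\<in>s ` P j. a < b"
          using \<kappa>le[of "Suc i" j] ij smono by (auto simp: P_def strict_mono_less)
      qed
      fix A x assume "A \<in> set (map (\<lambda>i. s ` P i) [0..<d])" "x \<in> A"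
      then obtain k i where "x = s k" "\<kappa> i \<le> k" by (auto simp: P_def)
      then show "length (map (\<lambda>i. s ` P i) [0..<d]) \<le> x"
        using sle[of K k] \<kappa>le[of 0 i] by (simp add: d_def \<kappa>0)
    qed
    moreover have "\<Union> (set (map (\<lambda>i. s ` P i) [0..<d])) = s ` {K..<\<kappa> d}"
      unfolding U image_UN by (simp add: atLeast0LessThan)
    ultimately have c3: "s ` {K..<\<kappa> d} \<in> schreier (Suc (Suc p))" by simp
    have c4: "2 * s K \<le> s (\<kappa> d)"
      using f(5)[of K] sle[of "\<kappa> 1" "\<kappa> d"] \<kappa>le[of 1 d] d by (simp add: \<kappa>0 \<kappa>S)
    have c5: "(\<Sum>k\<in>G. b k) \<le> 3 ^ Suc (Suc p) / real (s K)"
      if G: "G \<subseteq> {K..<\<kappa> d}" "r ` G \<in> mschreier (Suc p)" for G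
    proof (cases "G = {}")
      case True then show ?thesis by simp
    next
      case False
      have finG: "finite G" using G(1) finite_subset by blast
      obtain \<G> where \<G>: "r ` G = \<Union> \<G>" "finite \<G>" "\<G> \<subseteq> mschreier p" "\<forall>x\<in>r ` G. card \<G> \<le> x"
        by (rule mschreier_SucE[OF G(2)])
      \<comment> \<open>Only the first piece met by \<open>G\<close> can carry a large share. The
        number of sets in the cover is at most the end of a block in that piece, hence at most the
        start of the next piece, and the starts at least double from piece to piece.\<close>
      have ex: "\<exists>i. i < d \<and> G \<inter> P i \<noteq> {}" using False G(1) U[of d] by blast
      define i0 where "i0 = (LEAST i. i < d \<and> G \<inter> P i \<noteq> {})"
      have i0: "i0 < d \<and> G \<inter> P i0 \<noteq> {}" "\<And>j. j < i0 \<Longrightarrow> \<not> (j < d \<and> G \<inter> P j \<noteq> {})"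
        unfolding i0_def using LeastI_ex[OF ex] not_less_Least[of _ "\<lambda>i. i < d \<and> G \<inter> P i \<noteq> {}"] by blast+
      from i0(1) obtain k0 where k0: "k0 \<in> G" "k0 \<in> P i0" by auto
      have "card \<G> \<le> r k0" using \<G>(4) k0(1) by blast
      also have "... \<le> s (\<kappa> (Suc i0))"
        using rs[of k0] sle[of "Suc k0" "\<kappa> (Suc i0)"] k0(2) by (simp add: P_def)
      finally have cG: "card \<G> \<le> s (\<kappa> (Suc i0))" .
      have piece: "(\<Sum>k\<in>G \<inter> P i. snd (f (\<kappa> i)) k) \<le> real (card \<G>) * (C / real (s (\<kappa> i)))" for i
      proof -
        have "(\<Sum>k\<in>G \<inter> P i. snd (f (\<kappa> i)) k)
            \<le> (\<Sum>k\<in>G \<inter> P i. \<Sum>H\<in>\<G>. if r k \<in> H then snd (f (\<kappa> i)) k else 0)"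
        proof (rule sum_mono)
          fix k assume "k \<in> G \<inter> P i"
          then have "r k \<in> r ` G" by simp
          then obtain H where "H \<in> \<G>" "r k \<in> H" unfolding \<G>(1) by (rule UnionE)
          then show "snd (f (\<kappa> i)) k \<le> (\<Sum>H\<in>\<G>. if r k \<in> H then snd (f (\<kappa> i)) k else 0)"
            using member_le_sum[of H \<G> "\<lambda>H. if r k \<in> H then snd (f (\<kappa> i)) k else 0"] \<G>(2) f(2)
            by simp
        qed
        also have "... = (\<Sum>H\<in>\<G>. \<Sum>k\<in>G \<inter> P i. if r k \<in> H then snd (f (\<kappa> i)) k else 0)"
          by (rule sum.swap)
        also have "... \<le> (\<Sum>H\<in>\<G>. C / real (s (\<kappa> i)))"
        proof (rule sum_mono)
          fix H assume H: "H \<in> \<G>"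
          have "(\<Sum>k\<in>G \<inter> P i. if r k \<in> H then snd (f (\<kappa> i)) k else 0)
              = (\<Sum>k\<in>{k \<in> G \<inter> P i. r k \<in> H}. snd (f (\<kappa> i)) k)"
            using finG by (intro sum.inter_filter[symmetric]) auto
          also have "... \<le> C / real (s (\<kappa> i))"
          proof (rule f(6))
            show "{k \<in> G \<inter> P i. r k \<in> H} \<subseteq> {\<kappa> i..<fst (f (\<kappa> i))}" by (auto simp: P_def \<kappa>S)
            have "H \<in> mschreier p" using H \<G>(3) by blast
            then show "r ` {k \<in> G \<inter> P i. r k \<in> H} \<in> mschreier p"
              by (rule mschreier_subset) auto
          qed
          finally show "(\<Sum>k\<in>G \<inter> P i. if r k \<in> H then snd (f (\<kappa> i)) k else 0) \<le> C / real (s (\<kappa> i))" .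
        qed
        finally show ?thesis by simp
      qed
      \<comment> \<open>A potential whose decrements bound the shares of the pieces: 0 before
        \<open>i0\<close>, 1 at \<open>i0\<close>, then \<open>C / 2 ^ j\<close>. The telescoped
        total \<open>1 + 2 * C\<close> is at most \<open>3 * C\<close>, whence the powers of
        3.\<close>
      define v :: "nat \<Rightarrow> real" where
        "v i = (if i \<le> i0 then 1 + 2 * C else 2 * C / 2 ^ (i - Suc i0))" for i
      have C0: "1 \<le> C" unfolding C_def by (rule one_le_power) simp
      have bound: "(\<Sum>k\<in>G \<inter> P i. snd (f (\<kappa> i)) k) \<le> v i - v (Suc i)" if "i < d" for i
      proof -
        consider "i < i0" | "i = i0" | j where "i = Suc i0 + j"
          by (metis less_iff_Suc_add linorder_neqE_nat add_Suc)
        then show ?thesis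
        proof cases
          case 1
          then have "G \<inter> P i = {}" using i0(2) that by blast
          then show ?thesis using 1 by (simp add: v_def)
        next
          case 2
          have "(\<Sum>k\<in>G \<inter> P i. snd (f (\<kappa> i)) k) \<le> (\<Sum>k\<in>P i. snd (f (\<kappa> i)) k)"
            using f(2) by (intro sum_mono2) (auto simp: P_def)
          also have "... = 1" using f(3)[of "\<kappa> i"] by (simp add: P_def \<kappa>S)
          finally show ?thesis using 2 by (simp add: v_def)
        next
          case 3
          have grow: "2 ^ j * s (\<kappa> (Suc i0)) \<le> s (\<kappa> (Suc i0 + j))" for j
          proof (induction j)
            case (Suc j)
            then show ?case using f(5)[of "\<kappa> (Suc i0 + j)"] \<kappa>S[of "Suc i0 + j"] by simp
          qed simp
          have p0: "0 < s (\<kappa> i)" using spos[of "\<kappa> i"] by simp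
          have "2 ^ j * card \<G> \<le> s (\<kappa> i)"
            using grow[of j] cG 3 by (metis le_trans mult_le_mono2)
          then have "2 ^ j * real (card \<G>) \<le> real (s (\<kappa> i))"
            by (metis of_nat_le_iff of_nat_mult of_nat_numeral of_nat_power)
          then have "real (card \<G>) / real (s (\<kappa> i)) \<le> 1 / 2 ^ j"
            using p0 by (simp add: field_simps)
          then have "real (card \<G>) / real (s (\<kappa> i)) * C \<le> 1 / 2 ^ j * C"
            using C0 by (intro mult_right_mono) auto
          then have "real (card \<G>) * (C / real (s (\<kappa> i))) \<le> C / 2 ^ j" by simp
          moreover have "v i - v (Suc i) = C / 2 ^ j" using 3 by (simp add: v_def)
          ultimately show ?thesis using piece[of i] by simp
        qed
      qed
      have "(\<Sum>i<d. (\<Sum>k\<in>G \<inter> P i. snd (f (\<kappa> i)) k)) \<le> (\<Sum>i<d. v i - v (Suc i))"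
        by (rule sum_mono) (use bound in auto)
      also have "... = v 0 - v d" by (rule sum_lessThan_telescope')
      also have "... \<le> 1 + 2 * C" using C0 by (auto simp: v_def)
      also have "... \<le> 3 * C" using C0 by simp
      finally have "(\<Sum>k\<in>G. b k) \<le> 3 * C / real d"
        using d by (simp add: bsum[OF finG] divide_right_mono)
      then show ?thesis by (simp add: C_def d_def)
    qed
    have "K < \<kappa> d" using \<kappa>step[of 0] \<kappa>le[of 1 d] d by (simp add: \<kappa>0)
    then show ?case using c1 c2 c3 c4 c5
      by (intro exI[of _ "\<kappa> d"] exI[of _ b]) blast
  qed
qed

section \<open>The norming set\<close>

text \<open>The sum runs over the support of the functional and not of the vector, so it also
  applies to the coefficient sequences of vectors of the completion.\<close>

definition pair :: "(nat \<Rightarrow> real) \<Rightarrow> (nat \<Rightarrow> real) \<Rightarrow> real" where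
  "pair f x = (\<Sum>k\<in>supp f. f k * x k)"

lemma pair_superset:
  assumes "finite A" "supp f \<subseteq> A" shows "pair f x = (\<Sum>k\<in>A. f k * x k)"
  unfolding pair_def using assms by (intro sum.mono_neutral_left) (auto simp: supp_def)

lemma pair_add: "pair f (\<lambda>k. x k + y k) = pair f x + pair f y"
  by (simp add: pair_def distrib_left sum.distrib)

lemma pair_diff: "pair f (\<lambda>k. x k - y k) = pair f x - pair f y"
  by (simp add: pair_def right_diff_distrib sum_subtractf)

lemma pair_scale: "pair f (\<lambda>k. c * x k) = c * pair f x"
  by (simp add: pair_def sum_distrib_left mult.left_commute)

lemma pair_sum: "pair f (\<lambda>k. \<Sum>i\<in>I. a i * x i k) = (\<Sum>i\<in>I. a i * pair f (x i))"
  unfolding pair_def sum_distrib_left by (subst sum.swap) (simp add: mult.left_commute)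

lemma pair_cong: "(\<And>k. k \<in> supp f \<Longrightarrow> x k = y k) \<Longrightarrow> pair f x = pair f y"
  unfolding pair_def by (rule sum.cong) auto

lemma pair_disjoint: "supp f \<inter> supp x = {} \<Longrightarrow> pair f x = 0"
  unfolding pair_def by (rule sum.neutral) (auto simp: supp_def)

lemma pair_combo:
  assumes "finite I" "\<And>i. i \<in> I \<Longrightarrow> finite (supp (h i))"
  shows "pair (\<lambda>k. c * (\<Sum>i\<in>I. l i * h i k)) x = c * (\<Sum>i\<in>I. l i * pair (h i) x)"
proof -
  let ?A = "\<Union>i\<in>I. supp (h i)"
  have A: "finite ?A" using assms by blast
  have "supp (\<lambda>k. c * (\<Sum>i\<in>I. l i * h i k)) \<subseteq> ?A"
  proof
    fix k assume "k \<in> supp (\<lambda>k. c * (\<Sum>i\<in>I. l i * h i k))"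
    then have "(\<Sum>i\<in>I. l i * h i k) \<noteq> 0" by (auto simp: supp_def)
    then obtain i where "i \<in> I" "l i * h i k \<noteq> 0" by (rule sum.not_neutral_contains_not_neutral)
    then show "k \<in> ?A" by (auto simp: supp_def)
  qed
  then have "pair (\<lambda>k. c * (\<Sum>i\<in>I. l i * h i k)) x = (\<Sum>k\<in>?A. c * (\<Sum>i\<in>I. l i * h i k) * x k)"
    by (rule pair_superset[OF A])
  also have "... = (\<Sum>k\<in>?A. \<Sum>i\<in>I. c * (l i * (h i k * x k)))"
    by (simp add: sum_distrib_left sum_distrib_right mult_ac)
  also have "... = (\<Sum>i\<in>I. \<Sum>k\<in>?A. c * (l i * (h i k * x k)))" by (rule sum.swap)
  also have "... = (\<Sum>i\<in>I. c * (l i * pair (h i) x))"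
  proof (rule sum.cong)
    fix i assume i: "i \<in> I"
    have "pair (h i) x = (\<Sum>k\<in>?A. h i k * x k)" by (rule pair_superset[OF A]) (use i in auto)
    then show "(\<Sum>k\<in>?A. c * (l i * (h i k * x k))) = c * (l i * pair (h i) x)"
      by (simp add: sum_distrib_left)
  qed simp
  finally show ?thesis by (simp add: sum_distrib_left)
qed

lemma supp_combo:
  fixes h :: "'i \<Rightarrow> nat \<Rightarrow> real"
  assumes "finite I" "disjoint_family_on (\<lambda>i. supp (h i)) I" "c \<noteq> 0"
  shows "supp (\<lambda>k. c * (\<Sum>i\<in>I. l i * h i k)) = (\<Union>i\<in>{i\<in>I. l i \<noteq> 0}. supp (h i))"
proof -
  have eq: "(\<Sum>i\<in>I. l i * h i k) = l i0 * h i0 k" if "i0 \<in> I" "k \<in> supp (h i0)" for i0 k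
  proof -
    have "(\<Sum>i\<in>I. l i * h i k) = (\<Sum>i\<in>{i0}. l i * h i k)"
    proof (rule sum.mono_neutral_right)
      show "\<forall>i\<in>I - {i0}. l i * h i k = 0"
        using assms(2) that unfolding disjoint_family_on_def supp_def by fastforce
    qed (use that assms(1) in auto)
    then show ?thesis by simp
  qed
  show ?thesis
  proof (intro equalityI subsetI)
    fix k assume k: "k \<in> supp (\<lambda>k. c * (\<Sum>i\<in>I. l i * h i k))"
    then have "(\<Sum>i\<in>I. l i * h i k) \<noteq> 0" by (auto simp: supp_def)
    then obtain i where "i \<in> I" "l i * h i k \<noteq> 0" by (rule sum.not_neutral_contains_not_neutral)
    then show "k \<in> (\<Union>i\<in>{i\<in>I. l i \<noteq> 0}. supp (h i))" by (auto simp: supp_def)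
  next
    fix k assume "k \<in> (\<Union>i\<in>{i\<in>I. l i \<noteq> 0}. supp (h i))"
    then obtain i where i: "i \<in> I" "l i \<noteq> 0" "k \<in> supp (h i)" by blast
    then show "k \<in> supp (\<lambda>k. c * (\<Sum>i\<in>I. l i * h i k))"
      using eq[OF i(1,3)] assms(3) by (auto simp: supp_def)
  qed
qed

lemma supp_combo_mono:
  fixes f g :: "'i \<Rightarrow> nat \<Rightarrow> real"
  assumes "finite I" "disjoint_family_on (\<lambda>i. supp (f i)) I" "c \<noteq> 0"
    and g: "\<And>i. i \<in> I \<Longrightarrow> supp (g i) \<subseteq> supp (f i) \<inter> B" and l: "\<And>i. i \<in> I \<Longrightarrow> l i = 0 \<Longrightarrow> l' i = 0"
  shows "supp (\<lambda>k. c * (\<Sum>i\<in>I. l' i * g i k)) \<subseteq> supp (\<lambda>k. c * (\<Sum>i\<in>I. l i * f i k)) \<inter> B"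
proof
  fix k assume "k \<in> supp (\<lambda>k. c * (\<Sum>i\<in>I. l' i * g i k))"
  then have "(\<Sum>i\<in>I. l' i * g i k) \<noteq> 0" by (auto simp: supp_def)
  then obtain i where "i \<in> I" "l' i * g i k \<noteq> 0" by (rule sum.not_neutral_contains_not_neutral)
  then have i: "i \<in> I" "l i \<noteq> 0" "k \<in> supp (g i)" using l[of i] by (auto simp: supp_def)
  then have "k \<in> supp (f i)" "k \<in> B" using g by blast+
  then show "k \<in> supp (\<lambda>k. c * (\<Sum>i\<in>I. l i * f i k)) \<inter> B"
    unfolding supp_combo[OF assms(1-3)] using i by blast
qed

text \<open>The array of the products \<open>l i * c i k\<close> has square sum at most 1.
  \<open>C k\<close> is the l2 norm of its column \<open>k\<close>, and \<open>l' k\<close> is the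
  normalized column. A column of norm 0 is normalized to 0, division by 0 being 0, which is correct
  because all its entries vanish.\<close>

lemma split_coefficients:
  fixes l :: "'i \<Rightarrow> real" and c :: "'i \<Rightarrow> 'k \<Rightarrow> real"
  assumes I: "finite I" and c1: "\<And>i. i \<in> I \<Longrightarrow> (\<Sum>k\<in>F. (c i k)\<^sup>2) \<le> 1" and l1: "(\<Sum>i\<in>I. (l i)\<^sup>2) \<le> 1"
  obtains C l' where "(\<Sum>k\<in>F. (C k)\<^sup>2) \<le> 1" "\<And>k. (\<Sum>i\<in>I. (l' k i)\<^sup>2) \<le> 1"
    "\<And>k i. i \<in> I \<Longrightarrow> C k * l' k i = l i * c i k" "\<And>k i. l i = 0 \<Longrightarrow> l' k i = 0"
proof
  define C where "C k = sqrt (\<Sum>i\<in>I. (l i * c i k)\<^sup>2)" for k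
  have C2: "(C k)\<^sup>2 = (\<Sum>i\<in>I. (l i * c i k)\<^sup>2)" for k unfolding C_def by (simp add: sum_nonneg)
  define l' where "l' k i = l i * c i k / C k" for k i
  have "(\<Sum>k\<in>F. (C k)\<^sup>2) = (\<Sum>i\<in>I. \<Sum>k\<in>F. (l i * c i k)\<^sup>2)" unfolding C2 by (rule sum.swap)
  also have "... = (\<Sum>i\<in>I. (l i)\<^sup>2 * (\<Sum>k\<in>F. (c i k)\<^sup>2))" by (simp add: power_mult_distrib sum_distrib_left)
  also have "... \<le> (\<Sum>i\<in>I. (l i)\<^sup>2 * 1)" using c1 by (intro sum_mono mult_left_mono) auto
  finally show "(\<Sum>k\<in>F. (C k)\<^sup>2) \<le> 1" using l1 by simp
  show "(\<Sum>i\<in>I. (l' k i)\<^sup>2) \<le> 1" for k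
  proof -
    have "(\<Sum>i\<in>I. (l' k i)\<^sup>2) = (\<Sum>i\<in>I. (l i * c i k)\<^sup>2) / (C k)\<^sup>2"
      unfolding l'_def power_divide sum_divide_distrib ..
    then show ?thesis unfolding C2[symmetric] by (cases "C k = 0") auto
  qed
  show "C k * l' k i = l i * c i k" if i: "i \<in> I" for k i
  proof (cases "C k = 0")
    case True
    then have "(\<Sum>i\<in>I. (l i * c i k)\<^sup>2) = 0" using C2[of k] by simp
    then have "(l i * c i k)\<^sup>2 = 0" using i I by (simp add: sum_nonneg_eq_0_iff)
    then show ?thesis using True by simp
  qed (simp add: l'_def)
  show "l' k i = 0" if "l i = 0" for k i using that by (simp add: l'_def)
qed

lemma inj_on_Min_supp:
  assumes "disjoint_family_on (\<lambda>i. supp (h i)) I" "\<And>i. i \<in> I \<Longrightarrow> Min (supp (h i)) \<in> supp (h i)"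
  shows "inj_on (\<lambda>i. Min (supp (h i))) I"
proof (rule inj_onI)
  fix a b assume ab: "a \<in> I" "b \<in> I" "Min (supp (h a)) = Min (supp (h b))"
  then have "Min (supp (h a)) \<in> supp (h a) \<inter> supp (h b)" using assms(2)[of a] assms(2)[of b] by simp
  then show "a = b" using assms(1) ab unfolding disjoint_family_on_def by blast
qed

lemma sum_mult_square_le:
  fixes l a :: "'i \<Rightarrow> real"
  assumes "(\<Sum>i\<in>I. (l i)\<^sup>2) \<le> 1"
  shows "(\<Sum>i\<in>I. l i * a i)\<^sup>2 \<le> (\<Sum>i\<in>I. (a i)\<^sup>2)"
proof -
  have "(\<Sum>i\<in>I. l i * a i)\<^sup>2 \<le> (\<Sum>i\<in>I. (l i)\<^sup>2) * (\<Sum>i\<in>I. (a i)\<^sup>2)"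
    by (rule Cauchy_Schwarz_ineq_sum)
  also have "... \<le> 1 * (\<Sum>i\<in>I. (a i)\<^sup>2)"
    by (rule mult_right_mono[OF assms]) (simp add: sum_nonneg)
  finally show ?thesis by simp
qed

lemma schreier_sigma_special_disjoint:
  assumes "schreier_sigma_special n N1 N2 \<sigma> j s" "\<And>i. i < length s \<Longrightarrow> supp (f i) \<subseteq> fst (s ! i)"
  shows "disjoint_family_on (\<lambda>i. supp (f i)) {..<length s}"
proof -
  have "sorted_wrt disjnt (map fst s)"
    using assms(1) unfolding schreier_sigma_special_def sigma_special_def wh_sequences_def by auto
  then have lt: "fst (s ! a) \<inter> fst (s ! b) = {}" if "a < b" "b < length s" for a b
    using that by (auto simp: sorted_wrt_iff_nth_less disjnt_def)
  have ne: "fst (s ! a) \<inter> fst (s ! b) = {}" if "a \<noteq> b" "a < length s" "b < length s" for a b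
    using lt[of a b] lt[of b a] that by (cases "a < b") (simp_all add: Int_commute)
  show ?thesis unfolding disjoint_family_on_def
  proof (intro ballI impI)
    fix a b assume "a \<in> {..<length s}" "b \<in> {..<length s}" "a \<noteq> b"
    then have "fst (s ! a) \<inter> fst (s ! b) = {}" "supp (f a) \<subseteq> fst (s ! a)" "supp (f b) \<subseteq> fst (s ! b)"
      using ne assms(2) by simp_all
    then show "supp (f a) \<inter> supp (f b) = {}" by blast
  qed
qed

section \<open>Parameter inequalities and closure properties of the norming set\<close>

locale wh_space =
  fixes m n :: "nat \<Rightarrow> nat" and N1 N2 :: "nat set" and \<sigma> :: "(nat set \<times> nat) list \<Rightarrow> nat"
  assumes params: "wh_parameters m n N1 N2" and coding: "wh_coding m N1 N2 \<sigma>"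
begin

abbreviation W :: "(nat \<Rightarrow> real) \<Rightarrow> nat option \<Rightarrow> bool" where
  "W \<equiv> wh_functional m n N1 N2 \<sigma>"

abbreviation D :: "(nat \<Rightarrow> real) \<Rightarrow> bool" where
  "D f \<equiv> \<exists>w. W f w"

lemma m_mono: "i \<le> j \<Longrightarrow> m i \<le> m j" and n_mono: "i \<le> j \<Longrightarrow> n i \<le> n j"
  using params unfolding wh_parameters_def mono_def by auto

lemma m_0: "m 0 = 2" and m_1: "m (Suc 0) = 2" and n_0: "n 0 = 1"
  and m_cube: "2 \<le> j \<Longrightarrow> m j ^ 3 \<le> m (Suc j)" and n_pos: "1 \<le> n j"
  and N12: "infinite N1" "infinite N2" "N1 \<inter> N2 = {}" "N1 \<union> N2 = {1..}"
  using params unfolding wh_parameters_def by (auto simp: Suc_le_eq)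

lemma m_ge2: "2 \<le> m j"
  using m_mono[of 0 j] m_0 by simp

lemma m_strict:
  assumes "2 \<le> i" "i < j" shows "m i < m j"
proof -
  have "m i < m i ^ 3" using m_ge2[of i] by (intro power_strict_increasing[of 1 3, simplified]) auto
  also have "... \<le> m (Suc i)" by (rule m_cube[OF assms(1)])
  also have "... \<le> m j" using assms(2) by (intro m_mono) simp
  finally show ?thesis .
qed

text \<open>The bound 3 matters: \<open>m 0\<close> and \<open>m 1\<close> are both 2, and
  \<open>m 2\<close> may be 2 as well.\<close>

lemma m_inject:
  assumes "3 \<le> i" "m i = m j" shows "i = j"
proof (rule ccontr)
  assume "i \<noteq> j"
  moreover have "\<not> i < j" using m_strict[of i j] assms by auto
  moreover have "\<not> j < i"
  proof
    assume "j < i"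
    then have "m j \<le> m (i - 1)" by (intro m_mono) simp
    also have "... < m i" using assms(1) by (intro m_strict) auto
    finally show False using assms(2) by simp
  qed
  ultimately show False by simp
qed

lemma m_gt: "j < m (j + 2)"
proof (induction j)
  case 0 then show ?case using m_ge2[of "0 + 2"] by linarith
next
  case (Suc j) then show ?case using m_strict[of "j + 2" "Suc j + 2"] by simp
qed

lemma n_gap:
  assumes "2 \<le> j" shows "(3 * log 2 (real (m j)) + 1) * (real (n (j - 1)) + 1) < real (n j)"
  using params assms unfolding wh_parameters_def by blast

text \<open>This counts how often functionals of weight below \<open>m j\<close> can be replaced by
  their children. Each time the order of the family grows by at most \<open>n (j - 1)\<close>;
  \<open>Suc L\<close> such increments, with one order to spare for each, fit below
  \<open>n j\<close> as long as \<open>2 ^ L\<close> does not exceed \<open>m j ^ 3\<close>.\<close>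

lemma n_gap_levels:
  assumes "2 \<le> j" "2 ^ L \<le> m j ^ 3" shows "Suc L * (n (j - 1) + 1) < n j"
proof -
  have m: "0 < m j" using m_ge2[of j] by simp
  have "(2::real) ^ L \<le> real (m j) ^ 3" using assms(2) by (metis of_nat_le_iff of_nat_numeral of_nat_power)
  then have "log 2 (2 ^ L) \<le> log 2 (real (m j) ^ 3)" using m by (intro log_mono) auto
  then have "real L \<le> 3 * log 2 (real (m j))" using m by (simp add: log_nat_power)
  then have "real (Suc L) * (real (n (j - 1)) + 1) \<le> (3 * log 2 (real (m j)) + 1) * (real (n (j - 1)) + 1)"
    by (intro mult_right_mono) auto
  also have "... < real (n j)" by (rule n_gap[OF assms(1)])
  also have "real (Suc L) * (real (n (j - 1)) + 1) = real (Suc L * (n (j - 1) + 1))"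
    by (simp add: algebra_simps)
  finally show ?thesis unfolding of_nat_less_iff .
qed

lemma W_supp: "W f w \<Longrightarrow> finite (supp f) \<and> 0 \<notin> supp f"
proof (induction rule: wh_functional.induct)
  case (unit k \<epsilon>)
  have "supp (\<lambda>i. if i = k then \<epsilon> else 0) \<subseteq> {k}" by (auto simp: supp_def)
  then show ?case using unit by (auto intro: finite_subset)
next
  case (even d f j l)
  have "supp (\<lambda>k. 1 / real (m (2 * j)) * (\<Sum>i<d. l i * f i k)) \<subseteq> (\<Union>i<d. supp (f i))"
    by (auto simp: supp_def intro!: sum.neutral)
  moreover have "finite (\<Union>i<d. supp (f i)) \<and> 0 \<notin> (\<Union>i<d. supp (f i))" using even by auto
  ultimately show ?case by (meson finite_subset subsetD)
next
  case (odd j s p f l)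
  have "supp (\<lambda>k. 1 / real (m (2 * j + 1)) * (\<Sum>i<p. l i * f i k)) \<subseteq> (\<Union>i<p. supp (f i))"
    by (auto simp: supp_def intro!: sum.neutral)
  moreover have "finite (\<Union>i<p. supp (f i)) \<and> 0 \<notin> (\<Union>i<p. supp (f i))" using odd by auto
  ultimately show ?case by (meson finite_subset subsetD)
qed

lemma D_finite: "D f \<Longrightarrow> finite (supp f)" and D_0: "D f \<Longrightarrow> 0 \<notin> supp f"
  using W_supp by auto

lemma D_bounded: "D f \<Longrightarrow> \<bar>f k\<bar> \<le> 1"
  using wh_functional_bounded[OF params] by auto

lemma D_Min: "D f \<Longrightarrow> supp f \<noteq> {} \<Longrightarrow> Min (supp f) \<in> supp f"
  using D_finite by (intro Min_in) auto

text \<open>Rule \<open>even\<close> for any finite index set and for members that may vanish. The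
  rule insists on nonempty supports and on an enumeration, so the vanishing members are removed and
  the rest is enumerated.\<close>

lemma even_functional:
  fixes h :: "'i \<Rightarrow> nat \<Rightarrow> real"
  assumes I: "finite I" and D: "\<And>i. i \<in> I \<Longrightarrow> D (h i)"
    and disj: "disjoint_family_on (\<lambda>i. supp (h i)) I"
    and sch: "(\<lambda>i. Min (supp (h i))) ` {i\<in>I. supp (h i) \<noteq> {}} \<in> schreier (n (2 * j))"
    and l: "(\<Sum>i\<in>I. (l i)\<^sup>2) \<le> 1"
  shows "W (\<lambda>k. (1 / real (m (2 * j))) * (\<Sum>i\<in>I. l i * h i k)) (Some (m (2 * j)))"
proof -
  define J where "J = {i\<in>I. supp (h i) \<noteq> {}}"
  have J: "finite J" "J \<subseteq> I" using I by (auto simp: J_def)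
  obtain g where g: "bij_betw g {0..<card J} J" using ex_bij_betw_nat_finite[OF J(1)] by blast
  then have gb: "bij_betw g {..<card J} J" by (simp add: atLeast0LessThan)
  have gJ: "g i \<in> J" if "i < card J" for i using gb that by (auto simp: bij_betw_def)
  have "W (\<lambda>k. (1 / real (m (2 * j))) * (\<Sum>i<card J. l (g i) * h (g i) k)) (Some (m (2 * j)))"
  proof (rule wh_functional.even)
    show "\<forall>i<card J. \<exists>w. W (h (g i)) w" using gJ J D by blast
    show "schreier_allowable (n (2 * j)) (card J) (\<lambda>i. supp (h (g i)))"
      unfolding schreier_allowable_def
    proof (intro conjI allI impI)
      fix i assume "i < card J"
      then show "finite (supp (h (g i)))" "supp (h (g i)) \<noteq> {}"
        using gJ[of i] D_finite[OF D] by (auto simp: J_def)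
    next
      show "disjoint_family_on (\<lambda>i. supp (h (g i))) {..<card J}"
        unfolding disjoint_family_on_def
      proof (intro ballI impI)
        fix a b assume ab: "a \<in> {..<card J}" "b \<in> {..<card J}" "a \<noteq> b"
        then have "g a \<noteq> g b" using gb by (auto simp: bij_betw_def inj_on_def)
        then show "supp (h (g a)) \<inter> supp (h (g b)) = {}"
          using disj gJ ab J unfolding disjoint_family_on_def by auto
      qed
      have "(\<lambda>i. Min (supp (h (g i)))) ` {..<card J} = (\<lambda>i. Min (supp (h i))) ` J"
        using gb unfolding bij_betw_def by (metis (mono_tags, lifting) image_cong image_image)
      then show "(\<lambda>i. Min (supp (h (g i)))) ` {..<card J} \<in> schreier (n (2 * j))"
        using sch by (simp add: J_def)
    qed
    have "(\<Sum>i<card J. (l (g i))\<^sup>2) = (\<Sum>i\<in>J. (l i)\<^sup>2)" by (rule sum.reindex_bij_betw[OF gb])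
    also have "... \<le> (\<Sum>i\<in>I. (l i)\<^sup>2)" using I J by (intro sum_mono2) auto
    finally show "(\<Sum>i<card J. (l (g i))\<^sup>2) \<le> 1" using l by simp
  qed
  moreover have "(\<Sum>i<card J. l (g i) * h (g i) k) = (\<Sum>i\<in>I. l i * h i k)" for k
  proof -
    have "(\<Sum>i<card J. l (g i) * h (g i) k) = (\<Sum>i\<in>J. l i * h i k)"
      by (rule sum.reindex_bij_betw[OF gb])
    also have "... = (\<Sum>i\<in>I. l i * h i k)"
      using I by (intro sum.mono_neutral_left) (auto simp: J_def supp_def)
    finally show ?thesis .
  qed
  ultimately show ?thesis by simp
qed

lemma W_zero: "W (\<lambda>k. 0) (Some (m (2 * j)))"
proof -
  obtain k where "n (2 * j) = Suc k" using n_pos[of "2 * j"] by (cases "n (2 * j)") auto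
  then show ?thesis
    using even_functional[of "{}::nat set" "\<lambda>i k. 0" j "\<lambda>i. 0"] schreier_empty[of k] by (simp add: disjoint_family_on_def)
qed

text \<open>Unconditionality of the basis. A unit functional times a number of modulus below 1 need
  not be in the norming set, so \<open>f\<close> is not multiplied by \<open>\<mu>\<close>; instead
  a functional is adapted to \<open>x\<close>. Unit functionals take the sign of the coordinate of
  \<open>x\<close>, and coefficients are replaced by their absolute values. The weight is kept
  because rule \<open>odd\<close> reads the weights of its members.\<close>

lemma W_multiplier:
  assumes "W f w" "\<And>k. \<bar>\<mu> k\<bar> \<le> 1"
  shows "\<exists>g. W g w \<and> supp g \<subseteq> supp f \<and> \<bar>pair f (\<lambda>k. \<mu> k * x k)\<bar> \<le> pair g x"
  using assms(1)
proof (induction rule: wh_functional.induct)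
  case (unit k \<epsilon>)
  let ?e = "if x k \<ge> 0 then 1 else -1 :: real"
  let ?g = "\<lambda>i. if i = k then ?e else 0"
  have "W ?g None" using unit by (intro wh_functional.unit) auto
  moreover have s: "supp ?g \<subseteq> {k}" "supp (\<lambda>i. if i = k then \<epsilon> else 0) = {k}"
    using unit by (auto simp: supp_def)
  moreover have "pair ?g x = \<bar>x k\<bar>"
    using pair_superset[OF _ s(1), of x] by simp
  moreover have "pair (\<lambda>i. if i = k then \<epsilon> else 0) (\<lambda>k. \<mu> k * x k) = \<epsilon> * (\<mu> k * x k)"
    using s(2) by (simp add: pair_def)
  moreover have "\<bar>\<epsilon> * (\<mu> k * x k)\<bar> \<le> \<bar>x k\<bar>"
    using unit assms(2)[of k] by (auto simp: abs_mult mult_left_le_one_le)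
  ultimately show ?case by (intro exI[of _ ?g]) auto
next
  case (even d f j l)
  have "\<forall>i\<in>{..<d}. \<exists>g. D g \<and> supp g \<subseteq> supp (f i) \<and> \<bar>pair (f i) (\<lambda>k. \<mu> k * x k)\<bar> \<le> pair g x"
    using even.IH by blast
  from bchoice[OF this] obtain g where
    g: "\<forall>i\<in>{..<d}. D (g i) \<and> supp (g i) \<subseteq> supp (f i) \<and> \<bar>pair (f i) (\<lambda>k. \<mu> k * x k)\<bar> \<le> pair (g i) x" ..
  have df: "disjoint_family_on (\<lambda>i. supp (f i)) {..<d}"
    and fne: "\<And>i. i < d \<Longrightarrow> finite (supp (f i)) \<and> supp (f i) \<noteq> {}"
    and sch: "(\<lambda>i. Min (supp (f i))) ` {..<d} \<in> schreier (n (2 * j))"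
    using even.hyps unfolding schreier_allowable_def by auto
  have dg: "disjoint_family_on (\<lambda>i. supp (g i)) {..<d}"
    using df g unfolding disjoint_family_on_def by blast
  have m0: "1 / real (m (2 * j)) \<noteq> 0" using m_ge2[of "2 * j"] by simp
  let ?f = "\<lambda>k. 1 / real (m (2 * j)) * (\<Sum>i<d. l i * f i k)"
  let ?g = "\<lambda>k. 1 / real (m (2 * j)) * (\<Sum>i<d. \<bar>l i\<bar> * g i k)"
  have "W ?g (Some (m (2 * j)))"
  proof (rule even_functional)
    let ?I = "{i \<in> {..<d}. supp (g i) \<noteq> {}}"
    have gin: "Min (supp (g i)) \<in> supp (g i)" if "i \<in> ?I" for i using that g D_Min by blast
    have fin: "Min (supp (f i)) \<in> supp (f i)" if "i \<in> ?I" for i using that fne by auto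
    show "(\<lambda>i. Min (supp (g i))) ` ?I \<in> schreier (n (2 * j))"
    proof (rule schreier_dominate[OF sch n_pos, of "\<lambda>i. Min (supp (f i))"])
      show "inj_on (\<lambda>i. Min (supp (f i))) ?I"
        by (rule inj_on_Min_supp[OF disjoint_family_on_mono[OF _ df] fin]) auto
      show "inj_on (\<lambda>i. Min (supp (g i))) ?I"
        by (rule inj_on_Min_supp[OF disjoint_family_on_mono[OF _ dg] gin]) auto
      show "Min (supp (f i)) \<le> Min (supp (g i))" if "i \<in> ?I" for i
        using gin[OF that] g fne that by (intro Min_le) auto
    qed auto
  qed (use g dg even.hyps in auto)
  moreover have "supp ?g \<subseteq> supp ?f"
    by (rule order_trans[OF supp_combo_mono[OF _ df m0, where B = UNIV]]) (use g in auto)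
  moreover have "\<bar>pair ?f (\<lambda>k. \<mu> k * x k)\<bar> \<le> pair ?g x"
  proof -
    have "pair ?f (\<lambda>k. \<mu> k * x k) = 1 / real (m (2 * j)) * (\<Sum>i<d. l i * pair (f i) (\<lambda>k. \<mu> k * x k))"
      by (rule pair_combo) (use fne in auto)
    moreover have "pair ?g x = 1 / real (m (2 * j)) * (\<Sum>i<d. \<bar>l i\<bar> * pair (g i) x)"
      by (rule pair_combo) (use g D_finite in auto)
    moreover have "\<bar>\<Sum>i<d. l i * pair (f i) (\<lambda>k. \<mu> k * x k)\<bar> \<le> (\<Sum>i<d. \<bar>l i\<bar> * pair (g i) x)"
      by (rule order_trans[OF sum_abs]) (use g in \<open>auto simp: abs_mult intro!: sum_mono mult_left_mono\<close>)
    ultimately show ?thesis by (simp add: abs_mult divide_right_mono)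
  qed
  ultimately show ?case by blast
next
  case (odd j s p f l)
  have "\<forall>i\<in>{..<p}. \<exists>g. W g (Some (m (2 * snd (s ! i)))) \<and> supp g \<subseteq> supp (f i) \<and>
      \<bar>pair (f i) (\<lambda>k. \<mu> k * x k)\<bar> \<le> pair g x"
    using odd.IH by simp
  from bchoice[OF this] obtain g where
    g: "\<forall>i\<in>{..<p}. W (g i) (Some (m (2 * snd (s ! i)))) \<and> supp (g i) \<subseteq> supp (f i) \<and>
      \<bar>pair (f i) (\<lambda>k. \<mu> k * x k)\<bar> \<le> pair (g i) x" ..
  have fD: "W (f i) (Some (m (2 * snd (s ! i))))" "supp (f i) \<subseteq> fst (s ! i)" if "i < p" for i
    using odd.IH that by blast+
  have df: "disjoint_family_on (\<lambda>i. supp (f i)) {..<p}"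
    using schreier_sigma_special_disjoint[OF odd.hyps(1), of f] odd.hyps(2) fD(2) by simp
  have dg: "disjoint_family_on (\<lambda>i. supp (g i)) {..<p}"
    using df g unfolding disjoint_family_on_def by blast
  have m0: "1 / real (m (2 * j + 1)) \<noteq> 0" using m_ge2[of "2 * j + 1"] by simp
  let ?f = "\<lambda>k. 1 / real (m (2 * j + 1)) * (\<Sum>i<p. l i * f i k)"
  let ?g = "\<lambda>k. 1 / real (m (2 * j + 1)) * (\<Sum>i<p. \<bar>l i\<bar> * g i k)"
  have "W ?g (Some (m (2 * j + 1)))"
  proof (rule wh_functional.odd[OF odd.hyps(1,2)])
    show "\<forall>i<p. W (g i) (Some (m (2 * snd (s ! i)))) \<and> supp (g i) \<subseteq> fst (s ! i)"
      using g fD by (meson lessThan_iff order_trans)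
  qed (use odd.hyps in auto)
  moreover have "supp ?g \<subseteq> supp ?f"
    by (rule order_trans[OF supp_combo_mono[OF _ df m0, where B = UNIV]]) (use g in auto)
  moreover have "\<bar>pair ?f (\<lambda>k. \<mu> k * x k)\<bar> \<le> pair ?g x"
  proof -
    have "pair ?f (\<lambda>k. \<mu> k * x k) = 1 / real (m (2 * j + 1)) * (\<Sum>i<p. l i * pair (f i) (\<lambda>k. \<mu> k * x k))"
      by (rule pair_combo) (use W_supp[OF fD(1)] in auto)
    moreover have "pair ?g x = 1 / real (m (2 * j + 1)) * (\<Sum>i<p. \<bar>l i\<bar> * pair (g i) x)"
      by (rule pair_combo) (use g W_supp in auto)
    moreover have "\<bar>\<Sum>i<p. l i * pair (f i) (\<lambda>k. \<mu> k * x k)\<bar> \<le> (\<Sum>i<p. \<bar>l i\<bar> * pair (g i) x)"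
      by (rule order_trans[OF sum_abs]) (use g in \<open>auto simp: abs_mult intro!: sum_mono mult_left_mono\<close>)
    ultimately show ?thesis by (simp add: abs_mult divide_right_mono)
  qed
  ultimately show ?case by blast
qed

text \<open>A unit functional splits into zeros, hence loses its
  missing weight; all other weights are kept.\<close>

lemma W_split:
  fixes I :: "'k \<Rightarrow> nat set"
  assumes "W f w" and F: "finite F" and disj: "disjoint_family_on I F"
  shows "\<exists>c g. (\<forall>k\<in>F. (\<exists>w'. W (g k) w' \<and> (w \<noteq> None \<longrightarrow> w' = w)) \<and> supp (g k) \<subseteq> supp f \<inter> I k) \<and>
    (\<Sum>k\<in>F. (c k)\<^sup>2) \<le> 1 \<and> (\<forall>k\<in>F. \<forall>i\<in>I k. f i = c k * g k i)"
  using assms(1)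
proof (induction rule: wh_functional.induct)
  case (unit i \<epsilon>)
  let ?f = "\<lambda>k. if k = i then \<epsilon> else 0"
  have Wf: "W ?f None" using unit by (intro wh_functional.unit) auto
  define g where "g k = (if i \<in> I k then ?f else (\<lambda>_. 0))" for k
  define c :: "'k \<Rightarrow> real" where "c k = (if i \<in> I k then 1 else 0)" for k
  have "(\<Sum>k\<in>F. (c k)\<^sup>2) \<le> 1"
  proof (cases "\<exists>k\<in>F. i \<in> I k")
    case True
    then obtain k0 where k0: "k0 \<in> F" "i \<in> I k0" by blast
    have "(\<Sum>k\<in>F. (c k)\<^sup>2) = (\<Sum>k\<in>{k0}. (c k)\<^sup>2)"
      using k0 disj F unfolding disjoint_family_on_def by (intro sum.mono_neutral_right) (auto simp: c_def)
    then show ?thesis by (simp add: c_def)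
  next
    case False
    then have "(\<Sum>k\<in>F. (c k)\<^sup>2) = 0" by (intro sum.neutral) (auto simp: c_def)
    then show ?thesis by simp
  qed
  moreover have "\<exists>w'. W (g k) w'" for k using Wf W_zero[of 0] by (auto simp: g_def)
  moreover have "supp (g k) \<subseteq> supp ?f \<inter> I k" for k by (auto simp: g_def supp_def)
  moreover have "\<forall>k\<in>F. \<forall>a\<in>I k. ?f a = c k * g k a" by (auto simp: g_def c_def)
  ultimately show ?case by (intro exI[of _ c] exI[of _ g]) auto
next
  case (even d f j l)
  have "\<forall>i\<in>{..<d}. \<exists>cg. (\<forall>k\<in>F. D (snd cg k) \<and> supp (snd cg k) \<subseteq> supp (f i) \<inter> I k) \<and>
    (\<Sum>k\<in>F. (fst cg k)\<^sup>2) \<le> 1 \<and> (\<forall>k\<in>F. \<forall>a\<in>I k. f i a = fst cg k * snd cg k a)"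
  proof
    fix i assume "i \<in> {..<d}"
    then obtain c g w' where "\<forall>k\<in>F. (\<exists>w''. W (g k) w'' \<and> (w' \<noteq> None \<longrightarrow> w'' = w')) \<and> supp (g k) \<subseteq> supp (f i) \<inter> I k"
      "(\<Sum>k\<in>F. (c k)\<^sup>2) \<le> 1" "\<forall>k\<in>F. \<forall>a\<in>I k. f i a = c k * g k a" using even.IH by blast
    then show "\<exists>cg. (\<forall>k\<in>F. D (snd cg k) \<and> supp (snd cg k) \<subseteq> supp (f i) \<inter> I k) \<and>
      (\<Sum>k\<in>F. (fst cg k)\<^sup>2) \<le> 1 \<and> (\<forall>k\<in>F. \<forall>a\<in>I k. f i a = fst cg k * snd cg k a)"
      by (intro exI[of _ "(c, g)"]) auto
  qed
  from bchoice[OF this] obtain cg where cg0: "\<forall>i\<in>{..<d}. (\<forall>k\<in>F. D (snd (cg i) k) \<and> supp (snd (cg i) k) \<subseteq> supp (f i) \<inter> I k) \<and>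
    (\<Sum>k\<in>F. (fst (cg i) k)\<^sup>2) \<le> 1 \<and> (\<forall>k\<in>F. \<forall>a\<in>I k. f i a = fst (cg i) k * snd (cg i) k a)" ..
  define c where "c i k = fst (cg i) k" for i k
  define h where "h i k = snd (cg i) k" for i k
  have hD: "D (h i k)" and hs: "supp (h i k) \<subseteq> supp (f i) \<inter> I k" if "i < d" "k \<in> F" for i k
    using cg0 that by (auto simp: h_def)
  have c1: "(\<Sum>k\<in>F. (c i k)\<^sup>2) \<le> 1" if "i < d" for i using cg0 that by (auto simp: c_def)
  have fc: "f i a = c i k * h i k a" if "i < d" "k \<in> F" "a \<in> I k" for i k a
    using cg0 that by (auto simp: c_def h_def)
  obtain C l' where Csum: "(\<Sum>k\<in>F. (C k)\<^sup>2) \<le> 1" and lC: "\<And>k. (\<Sum>i<d. (l' k i)\<^sup>2) \<le> 1"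
    and Cl: "\<And>k i. i \<in> {..<d} \<Longrightarrow> C k * l' k i = l i * c i k" and l0: "\<And>k i. l i = 0 \<Longrightarrow> l' k i = 0"
    using split_coefficients[where I = "{..<d}" and F = F and c = c and l = l] c1 even.hyps by auto
  define g where "g k = (\<lambda>a. 1 / real (m (2 * j)) * (\<Sum>i<d. l' k i * h i k a))" for k
  have df: "disjoint_family_on (\<lambda>i. supp (f i)) {..<d}"
    and fne: "\<And>i. i < d \<Longrightarrow> finite (supp (f i)) \<and> supp (f i) \<noteq> {}"
    and sch: "(\<lambda>i. Min (supp (f i))) ` {..<d} \<in> schreier (n (2 * j))"
    using even.hyps unfolding schreier_allowable_def by auto
  have dh: "disjoint_family_on (\<lambda>i. supp (h i k)) {..<d}" if "k \<in> F" for k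
    using df hs[OF _ that] unfolding disjoint_family_on_def by blast
  have m0: "1 / real (m (2 * j)) \<noteq> 0" using m_ge2[of "2 * j"] by simp
  let ?f = "\<lambda>k. 1 / real (m (2 * j)) * (\<Sum>i<d. l i * f i k)"
  have Wg: "W (g k) (Some (m (2 * j)))" if k: "k \<in> F" for k
    unfolding g_def
  proof (rule even_functional)
    let ?J = "{i \<in> {..<d}. supp (h i k) \<noteq> {}}"
    have hin: "Min (supp (h i k)) \<in> supp (h i k)" if "i \<in> ?J" for i using that hD[OF _ k] D_Min by blast
    have fin: "Min (supp (f i)) \<in> supp (f i)" if "i \<in> ?J" for i using that fne by auto
    show "(\<lambda>i. Min (supp (h i k))) ` ?J \<in> schreier (n (2 * j))"
    proof (rule schreier_dominate[OF sch n_pos, of "\<lambda>i. Min (supp (f i))"])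
      show "inj_on (\<lambda>i. Min (supp (f i))) ?J"
        by (rule inj_on_Min_supp[OF disjoint_family_on_mono[OF _ df] fin]) auto
      show "inj_on (\<lambda>i. Min (supp (h i k))) ?J"
        by (rule inj_on_Min_supp[OF disjoint_family_on_mono[OF _ dh[OF k]] hin]) auto
      show "Min (supp (f i)) \<le> Min (supp (h i k))" if "i \<in> ?J" for i
        using hin[OF that] hs[OF _ k, of i] fne that by (intro Min_le) auto
    qed auto
  qed (use hD[OF _ k] dh[OF k] lC in auto)
  have sg: "supp (g k) \<subseteq> supp ?f \<inter> I k" if k: "k \<in> F" for k
    unfolding g_def by (rule supp_combo_mono[OF _ df m0]) (use hs[OF _ k] l0 in auto)
  have eq: "?f a = C k * g k a" if k: "k \<in> F" "a \<in> I k" for k a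
  proof -
    have "C k * g k a = 1 / real (m (2 * j)) * (\<Sum>i<d. C k * l' k i * h i k a)"
      unfolding g_def by (simp add: sum_distrib_left mult_ac)
    also have "(\<Sum>i<d. C k * l' k i * h i k a) = (\<Sum>i<d. l i * f i a)"
      by (rule sum.cong) (use Cl fc k in auto)
    finally show ?thesis by simp
  qed
  show ?case
    by (intro exI[of _ C] exI[of _ g]) (use Wg sg eq Csum in auto)
next
  case (odd j s p f l)
  have "\<forall>i\<in>{..<p}. \<exists>cg. (\<forall>k\<in>F. W (snd cg k) (Some (m (2 * snd (s ! i)))) \<and> supp (snd cg k) \<subseteq> supp (f i) \<inter> I k) \<and>
    (\<Sum>k\<in>F. (fst cg k)\<^sup>2) \<le> 1 \<and> (\<forall>k\<in>F. \<forall>a\<in>I k. f i a = fst cg k * snd cg k a)"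
  proof
    fix i assume "i \<in> {..<p}"
    then have "i < p" by simp
    with odd.IH obtain c g where
      "\<forall>k\<in>F. (\<exists>w'. W (g k) w' \<and> (Some (m (2 * snd (s ! i))) \<noteq> None \<longrightarrow> w' = Some (m (2 * snd (s ! i))))) \<and>
        supp (g k) \<subseteq> supp (f i) \<inter> I k"
      "(\<Sum>k\<in>F. (c k)\<^sup>2) \<le> 1" "\<forall>k\<in>F. \<forall>a\<in>I k. f i a = c k * g k a" by blast
    then show "\<exists>cg. (\<forall>k\<in>F. W (snd cg k) (Some (m (2 * snd (s ! i)))) \<and> supp (snd cg k) \<subseteq> supp (f i) \<inter> I k) \<and>
      (\<Sum>k\<in>F. (fst cg k)\<^sup>2) \<le> 1 \<and> (\<forall>k\<in>F. \<forall>a\<in>I k. f i a = fst cg k * snd cg k a)"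
      by (intro exI[of _ "(c, g)"]) auto
  qed
  from bchoice[OF this] obtain cg where cg0: "\<forall>i\<in>{..<p}. (\<forall>k\<in>F. W (snd (cg i) k) (Some (m (2 * snd (s ! i)))) \<and> supp (snd (cg i) k) \<subseteq> supp (f i) \<inter> I k) \<and>
    (\<Sum>k\<in>F. (fst (cg i) k)\<^sup>2) \<le> 1 \<and> (\<forall>k\<in>F. \<forall>a\<in>I k. f i a = fst (cg i) k * snd (cg i) k a)" ..
  define c where "c i k = fst (cg i) k" for i k
  define h where "h i k = snd (cg i) k" for i k
  have hD: "W (h i k) (Some (m (2 * snd (s ! i))))" and hs: "supp (h i k) \<subseteq> supp (f i) \<inter> I k" if "i < p" "k \<in> F" for i k
    using cg0 that by (auto simp: h_def)
  have c1: "(\<Sum>k\<in>F. (c i k)\<^sup>2) \<le> 1" if "i < p" for i using cg0 that by (auto simp: c_def)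
  have fc: "f i a = c i k * h i k a" if "i < p" "k \<in> F" "a \<in> I k" for i k a
    using cg0 that by (auto simp: c_def h_def)
  obtain C l' where Csum: "(\<Sum>k\<in>F. (C k)\<^sup>2) \<le> 1" and lC: "\<And>k. (\<Sum>i<p. (l' k i)\<^sup>2) \<le> 1"
    and Cl: "\<And>k i. i \<in> {..<p} \<Longrightarrow> C k * l' k i = l i * c i k" and l0: "\<And>k i. l i = 0 \<Longrightarrow> l' k i = 0"
    using split_coefficients[where I = "{..<p}" and F = F and c = c and l = l] c1 odd.hyps by auto
  define g where "g k = (\<lambda>a. 1 / real (m (2 * j + 1)) * (\<Sum>i<p. l' k i * h i k a))" for k
  have fD: "W (f i) (Some (m (2 * snd (s ! i))))" "supp (f i) \<subseteq> fst (s ! i)" if "i < p" for i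
    using odd.IH that by blast+
  have df: "disjoint_family_on (\<lambda>i. supp (f i)) {..<p}"
    using schreier_sigma_special_disjoint[OF odd.hyps(1), of f] odd.hyps(2) fD(2) by simp
  have dh: "disjoint_family_on (\<lambda>i. supp (h i k)) {..<p}" if "k \<in> F" for k
    using df hs[OF _ that] unfolding disjoint_family_on_def by blast
  have m0: "1 / real (m (2 * j + 1)) \<noteq> 0" using m_ge2[of "2 * j + 1"] by simp
  let ?f = "\<lambda>k. 1 / real (m (2 * j + 1)) * (\<Sum>i<p. l i * f i k)"
  have Wg: "W (g k) (Some (m (2 * j + 1)))" if k: "k \<in> F" for k
    unfolding g_def
  proof (rule wh_functional.odd[OF odd.hyps(1,2)])
    show "\<forall>i<p. W (h i k) (Some (m (2 * snd (s ! i)))) \<and> supp (h i k) \<subseteq> fst (s ! i)"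
    proof (intro allI impI)
      fix i assume i: "i < p"
      show "W (h i k) (Some (m (2 * snd (s ! i)))) \<and> supp (h i k) \<subseteq> fst (s ! i)"
        using hD[OF i k] hs[OF i k] fD(2)[OF i] by blast
    qed
  qed (rule lC)
  have sg: "supp (g k) \<subseteq> supp ?f \<inter> I k" if k: "k \<in> F" for k
    unfolding g_def by (rule supp_combo_mono[OF _ df m0]) (use hs[OF _ k] l0 in auto)
  have eq: "?f a = C k * g k a" if k: "k \<in> F" "a \<in> I k" for k a
  proof -
    have "C k * g k a = 1 / real (m (2 * j + 1)) * (\<Sum>i<p. C k * l' k i * h i k a)"
      unfolding g_def by (simp add: sum_distrib_left mult_ac)
    also have "(\<Sum>i<p. C k * l' k i * h i k a) = (\<Sum>i<p. l i * f i a)"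
      by (rule sum.cong) (use Cl fc k in auto)
    finally show ?thesis by simp
  qed
  show ?case
    by (intro exI[of _ C] exI[of _ g]) (use Wg sg eq Csum in auto)
qed

section \<open>Allowable families\<close>

text \<open>Both rules in one form. Terms with coefficient 0 are dropped, so that all remaining
  children are supported inside \<open>f\<close>. Their minima are placed in a modified family:
  under rule \<open>odd\<close> it is the sets of the special sequence whose minima are controlled,
  and the supports inside them may begin later.\<close>

lemma W_cases:
  assumes "W f w"
  obtains (unit) k where "w = None" "supp f = {k}"
  | (weight) i and J :: "nat set" and h l where "w = Some (m i)" "finite J"
      "\<And>k. i = 2 * k + 1 \<Longrightarrow> \<exists>s. schreier_sigma_special n N1 N2 \<sigma> k s \<and>
        (\<forall>j\<in>J. j < length s \<and> W (h j) (Some (m (2 * snd (s ! j)))) \<and> supp (h j) \<subseteq> fst (s ! j))"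
      "\<And>j. j \<in> J \<Longrightarrow> D (h j)"
      "disjoint_family_on (\<lambda>j. supp (h j)) J"
      "(\<lambda>j. Min (supp (h j))) ` {j\<in>J. supp (h j) \<noteq> {}} \<in> mschreier (n i)"
      "(\<Sum>j\<in>J. (l j)\<^sup>2) \<le> 1" "\<And>j. j \<in> J \<Longrightarrow> supp (h j) \<subseteq> supp f"
      "f = (\<lambda>k. 1 / real (m i) * (\<Sum>j\<in>J. l j * h j k))"
  using assms
proof cases
  case (unit k \<epsilon>)
  then have "supp f = {k}" by (auto simp: supp_def)
  then show ?thesis using unit that(1) by blast
next
  case (even d g j l)
  define J where "J = {i\<in>{..<d}. l i \<noteq> 0}"
  have m0: "1 / real (m (2 * j)) \<noteq> 0" using m_ge2[of "2 * j"] by simp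
  have dg: "disjoint_family_on (\<lambda>i. supp (g i)) {..<d}"
    and sch: "(\<lambda>i. Min (supp (g i))) ` {..<d} \<in> schreier (n (2 * j))"
    using even unfolding schreier_allowable_def by auto
  show ?thesis
  proof (rule that(2)[where i = "2 * j" and J = J and h = g and l = l])
    show "w = Some (m (2 * j))" "finite J" using even by (auto simp: J_def)
    show "\<exists>s. schreier_sigma_special n N1 N2 \<sigma> k s \<and>
        (\<forall>i\<in>J. i < length s \<and> W (g i) (Some (m (2 * snd (s ! i)))) \<and> supp (g i) \<subseteq> fst (s ! i))"
      if "2 * j = 2 * k + 1" for k
    proof -
      have False using that by presburger
      then show ?thesis ..
    qed
    show "D (g i)" if "i \<in> J" for i using even that by (auto simp: J_def)
    show "disjoint_family_on (\<lambda>j. supp (g j)) J"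
      by (rule disjoint_family_on_mono[OF _ dg]) (auto simp: J_def)
    obtain k where k: "n (2 * j) = Suc k" using n_pos[of "2 * j"] by (cases "n (2 * j)") auto
    have "(\<lambda>i. Min (supp (g i))) ` {..<d} \<in> mschreier (n (2 * j))"
      using sch schreier_le_mschreier[of k] unfolding k by blast
    then show "(\<lambda>j. Min (supp (g j))) ` {j\<in>J. supp (g j) \<noteq> {}} \<in> mschreier (n (2 * j))"
      by (rule mschreier_subset) (auto simp: J_def)
    have "(\<Sum>j\<in>J. (l j)\<^sup>2) \<le> (\<Sum>j<d. (l j)\<^sup>2)" by (rule sum_mono2) (auto simp: J_def)
    then show "(\<Sum>j\<in>J. (l j)\<^sup>2) \<le> 1" using even by simp
    show "supp (g i) \<subseteq> supp f" if "i \<in> J" for i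
      unfolding even(1) supp_combo[OF finite_lessThan dg m0, of l] using that by (auto simp: J_def)
    have "(\<Sum>j\<in>J. l j * g j k) = (\<Sum>j<d. l j * g j k)" for k
      by (rule sum.mono_neutral_left) (auto simp: J_def)
    then show "f = (\<lambda>k. 1 / real (m (2 * j)) * (\<Sum>j\<in>J. l j * g j k))" using even by simp
  qed
next
  case (odd j s p g l)
  define J where "J = {i\<in>{..<p}. l i \<noteq> 0}"
  have m0: "1 / real (m (2 * j + 1)) \<noteq> 0" using m_ge2[of "2 * j + 1"] by simp
  have gD: "W (g i) (Some (m (2 * snd (s ! i))))" "supp (g i) \<subseteq> fst (s ! i)" if "i < p" for i
    using odd that by blast+
  have dg: "disjoint_family_on (\<lambda>i. supp (g i)) {..<p}"
    using schreier_sigma_special_disjoint[OF odd(3), of g] odd(4) gD(2) by simp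
  have sE: "finite (fst (s ! i)) \<and> fst (s ! i) \<noteq> {}" if "i < p" for i
  proof -
    have "fst (s ! i) \<in> fst ` set s" using that odd(4) by simp
    then show ?thesis
      using odd(3) unfolding schreier_sigma_special_def sigma_special_def wh_sequences_def by blast
  qed
  have sch: "Min ` fst ` set s \<in> schreier (n (2 * j + 1))"
    using odd(3) unfolding schreier_sigma_special_def by blast
  obtain k where k: "n (2 * j + 1) = Suc k" using n_pos[of "2 * j + 1"] by (cases "n (2 * j + 1)") auto
  have msch: "Min ` fst ` set s \<in> mschreier (n (2 * j + 1))"
    using sch schreier_le_mschreier[of k] unfolding k by blast
  have sdisj: "fst (s ! a) \<inter> fst (s ! b) = {}" if "a < b" "b < p" for a b
  proof -
    have "sorted_wrt disjnt (map fst s)"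
      using odd(3) unfolding schreier_sigma_special_def sigma_special_def wh_sequences_def by auto
    then show ?thesis
      using that odd(4) by (auto simp: sorted_wrt_iff_nth_less disjnt_def)
  qed
  show ?thesis
  proof (rule that(2)[where i = "2 * j + 1" and J = J and h = g and l = l])
    show "w = Some (m (2 * j + 1))" "finite J" using odd by (auto simp: J_def)
    show "\<exists>s. schreier_sigma_special n N1 N2 \<sigma> k s \<and>
        (\<forall>i\<in>J. i < length s \<and> W (g i) (Some (m (2 * snd (s ! i)))) \<and> supp (g i) \<subseteq> fst (s ! i))"
      if "2 * j + 1 = 2 * k + 1" for k
      using that odd(3,4) gD by (intro exI[of _ s]) (simp add: J_def)
    show "D (g i)" if "i \<in> J" for i using gD(1)[of i] that by (auto simp: J_def)
    show "disjoint_family_on (\<lambda>j. supp (g j)) J"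
      by (rule disjoint_family_on_mono[OF _ dg]) (auto simp: J_def)
    show "(\<lambda>j. Min (supp (g j))) ` {j\<in>J. supp (g j) \<noteq> {}} \<in> mschreier (n (2 * j + 1))"
    proof (rule mschreier_dominate[OF msch])
      show "inj_on (\<lambda>i. Min (fst (s ! i))) {j\<in>J. supp (g j) \<noteq> {}}"
      proof (rule linorder_inj_onI')
        fix a b assume ab: "a \<in> {j\<in>J. supp (g j) \<noteq> {}}" "b \<in> {j\<in>J. supp (g j) \<noteq> {}}" "a < b"
        then have "a < p" "b < p" by (auto simp: J_def)
        then have "Min (fst (s ! a)) \<in> fst (s ! a)" "Min (fst (s ! b)) \<in> fst (s ! b)"
          using sE by (meson Min_in)+
        then show "Min (fst (s ! a)) \<noteq> Min (fst (s ! b))"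
          using sdisj[OF \<open>a < b\<close> \<open>b < p\<close>] by auto
      qed
      show "(\<lambda>i. Min (fst (s ! i))) ` {j\<in>J. supp (g j) \<noteq> {}} \<subseteq> Min ` fst ` set s"
        using odd(4) by (auto simp: J_def)
      fix i assume i: "i \<in> {j\<in>J. supp (g j) \<noteq> {}}"
      then have ip: "i < p" by (auto simp: J_def)
      have "D (g i)" using gD(1)[OF ip] by blast
      then have "Min (supp (g i)) \<in> supp (g i)" using i by (intro D_Min) auto
      then show "Min (fst (s ! i)) \<le> Min (supp (g i))"
        using gD(2)[OF ip] sE[OF ip] by (intro Min_le) auto
    qed
    have "(\<Sum>j\<in>J. (l j)\<^sup>2) \<le> (\<Sum>j<p. (l j)\<^sup>2)" by (rule sum_mono2) (auto simp: J_def)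
    then show "(\<Sum>j\<in>J. (l j)\<^sup>2) \<le> 1" using odd by simp
    show "supp (g i) \<subseteq> supp f" if "i \<in> J" for i
      unfolding odd(1) supp_combo[OF finite_lessThan dg m0, of l] using that by (auto simp: J_def)
    have "(\<Sum>j\<in>J. l j * g j k) = (\<Sum>j<p. l j * g j k)" for k
      by (rule sum.mono_neutral_left) (auto simp: J_def)
    then show "f = (\<lambda>k. 1 / real (m (2 * j + 1)) * (\<Sum>j\<in>J. l j * g j k))" using odd by simp
  qed
qed

definition allowable :: "nat \<Rightarrow> 'i set \<Rightarrow> ('i \<Rightarrow> nat \<Rightarrow> real) \<Rightarrow> bool" where
  "allowable p I h \<longleftrightarrow> finite I \<and> (\<forall>i\<in>I. D (h i)) \<and> disjoint_family_on (\<lambda>i. supp (h i)) I \<and>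
    (\<lambda>i. Min (supp (h i))) ` {i\<in>I. supp (h i) \<noteq> {}} \<in> mschreier p"

text \<open>The families are sets of functionals, so that one bound serves families with any index
  type; \<open>square_boundD\<close> returns to indexed families.\<close>

definition square_bound :: "nat \<Rightarrow> (nat \<Rightarrow> real) \<Rightarrow> real \<Rightarrow> bool" where
  "square_bound p x K \<longleftrightarrow> (\<forall>A. allowable p A (\<lambda>f. f) \<longrightarrow> (\<Sum>f\<in>A. (pair f x)\<^sup>2) \<le> K)"

definition norm_le :: "(nat \<Rightarrow> real) \<Rightarrow> real \<Rightarrow> bool" where
  "norm_le x C \<longleftrightarrow> (\<forall>f. D f \<longrightarrow> \<bar>pair f x\<bar> \<le> C)"

lemma allowableD:
  assumes "allowable p I h"
  shows "finite I" "i \<in> I \<Longrightarrow> D (h i)" "disjoint_family_on (\<lambda>i. supp (h i)) I"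
    "(\<lambda>i. Min (supp (h i))) ` {i\<in>I. supp (h i) \<noteq> {}} \<in> mschreier p"
  using assms unfolding allowable_def by auto

lemma allowable_mono: "allowable p I h \<Longrightarrow> p \<le> p' \<Longrightarrow> allowable p' I h"
  unfolding allowable_def using mschreier_mono by blast

lemma square_bound_mono:
  "square_bound p x K \<Longrightarrow> p' \<le> p \<Longrightarrow> K \<le> K' \<Longrightarrow> square_bound p' x K'"
  unfolding square_bound_def using allowable_mono order_trans by meson

lemma allowable_subset:
  assumes "allowable p I h" "I' \<subseteq> I" shows "allowable p I' h"
  unfolding allowable_def
proof (intro conjI ballI)
  note a = allowableD[OF assms(1)]
  show "finite I'" using a(1) assms(2) finite_subset by blast
  show "D (h i)" if "i \<in> I'" for i using a(2) assms(2) that by blast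
  show "disjoint_family_on (\<lambda>i. supp (h i)) I'" by (rule disjoint_family_on_mono[OF assms(2) a(3)])
  show "(\<lambda>i. Min (supp (h i))) ` {i\<in>I'. supp (h i) \<noteq> {}} \<in> mschreier p"
    by (rule mschreier_subset[OF a(4)]) (use assms(2) in auto)
qed

lemma allowable_Min_in:
  assumes "allowable p I h" "i \<in> I" "supp (h i) \<noteq> {}" shows "Min (supp (h i)) \<in> supp (h i)"
  by (rule D_Min[OF allowableD(2)[OF assms(1,2)] assms(3)])

lemma allowable_inj_Min:
  assumes "allowable p I h" shows "inj_on (\<lambda>i. Min (supp (h i))) {i\<in>I. supp (h i) \<noteq> {}}"
  by (rule inj_on_Min_supp[OF disjoint_family_on_mono[OF _ allowableD(3)[OF assms]]])
    (use allowable_Min_in[OF assms] in auto)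

lemma allowable_shrink:
  assumes a: "allowable p I h" and D': "\<And>i. i \<in> I \<Longrightarrow> D (h' i)"
    and sub: "\<And>i. i \<in> I \<Longrightarrow> supp (h' i) \<subseteq> supp (h i)"
  shows "allowable p I h'"
  unfolding allowable_def
proof (intro conjI ballI)
  show "finite I" by (rule allowableD(1)[OF a])
  show "D (h' i)" if "i \<in> I" for i using D' that .
  show "disjoint_family_on (\<lambda>i. supp (h' i)) I"
    using allowableD(3)[OF a] sub unfolding disjoint_family_on_def by blast
  let ?J = "{i\<in>I. supp (h' i) \<noteq> {}}"
  have J: "?J \<subseteq> {i\<in>I. supp (h i) \<noteq> {}}" using sub by blast
  show "(\<lambda>i. Min (supp (h' i))) ` ?J \<in> mschreier p"
  proof (rule mschreier_dominate[OF allowableD(4)[OF a] inj_on_subset[OF allowable_inj_Min[OF a] J]])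
    show "(\<lambda>i. Min (supp (h i))) ` ?J \<subseteq> (\<lambda>i. Min (supp (h i))) ` {i\<in>I. supp (h i) \<noteq> {}}"
      using J by blast
    fix i assume i: "i \<in> ?J"
    have "Min (supp (h' i)) \<in> supp (h' i)" using i D' D_Min by blast
    then show "Min (supp (h i)) \<le> Min (supp (h' i))"
      using i sub D_finite[OF allowableD(2)[OF a]] by (intro Min_le) auto
  qed
qed

text \<open>Nonempty disjoint supports make \<open>h\<close> injective, and the indices with empty
  support contribute nothing to the square sum.\<close>

lemma allowable_image:
  assumes a: "allowable p I h"
  shows "\<exists>J\<subseteq>I. allowable p (h ` J) (\<lambda>f. f) \<and> (\<Sum>f\<in>h ` J. (pair f x)\<^sup>2) = (\<Sum>i\<in>I. (pair (h i) x)\<^sup>2)"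
proof -
  let ?J = "{i\<in>I. supp (h i) \<noteq> {}}"
  have inj: "inj_on h ?J"
  proof (rule inj_onI)
    fix i j assume "i \<in> ?J" "j \<in> ?J" "h i = h j"
    then show "i = j" using allowableD(3)[OF a] unfolding disjoint_family_on_def by fastforce
  qed
  have "allowable p (h ` ?J) (\<lambda>f. f)"
    unfolding allowable_def
  proof (intro conjI ballI)
    show "finite (h ` ?J)" using allowableD(1)[OF a] by simp
    show "D f" if "f \<in> h ` ?J" for f using that allowableD(2)[OF a] by blast
    show "disjoint_family_on supp (h ` ?J)"
      using allowableD(3)[OF a] unfolding disjoint_family_on_def by fastforce
    have "(\<lambda>f. Min (supp f)) ` {f \<in> h ` ?J. supp f \<noteq> {}} = (\<lambda>i. Min (supp (h i))) ` ?J" by auto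
    then show "(\<lambda>f. Min (supp f)) ` {f \<in> h ` ?J. supp f \<noteq> {}} \<in> mschreier p"
      using allowableD(4)[OF a] by simp
  qed
  moreover have "(\<Sum>f\<in>h ` ?J. (pair f x)\<^sup>2) = (\<Sum>i\<in>?J. (pair (h i) x)\<^sup>2)"
    by (simp add: sum.reindex[OF inj])
  moreover have "(\<Sum>i\<in>?J. (pair (h i) x)\<^sup>2) = (\<Sum>i\<in>I. (pair (h i) x)\<^sup>2)"
    using allowableD(1)[OF a] by (intro sum.mono_neutral_left) (auto simp: pair_def)
  ultimately show ?thesis by (intro exI[of _ ?J]) auto
qed

lemma square_boundD:
  assumes "square_bound p x K" and "allowable p I h"
  shows "(\<Sum>i\<in>I. (pair (h i) x)\<^sup>2) \<le> K"
  using allowable_image[OF assms(2), of x] assms(1) unfolding square_bound_def by metis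

text \<open>Growing a tree of functionals by one level adds the orders. Children of different
  members may interlace, which is why the modified families are used here.\<close>

lemma allowable_Sigma:
  assumes a: "allowable p I h" and b: "\<And>i. i \<in> I \<Longrightarrow> allowable p' (J i) (g i)"
    and sub: "\<And>i j. i \<in> I \<Longrightarrow> j \<in> J i \<Longrightarrow> supp (g i j) \<subseteq> supp (h i)"
  shows "allowable (p + p') (Sigma I J) (\<lambda>z. g (fst z) (snd z))"
  unfolding allowable_def
proof (intro conjI ballI)
  show "finite (Sigma I J)" using allowableD(1)[OF a] allowableD(1)[OF b] by blast
  show "D (g (fst z) (snd z))" if "z \<in> Sigma I J" for z
    using that allowableD(2)[OF b] by auto
  show "disjoint_family_on (\<lambda>z. supp (g (fst z) (snd z))) (Sigma I J)"
    unfolding disjoint_family_on_def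
  proof (intro ballI impI)
    fix y z assume yz: "y \<in> Sigma I J" "z \<in> Sigma I J" "y \<noteq> z"
    obtain i j where y: "y = (i, j)" by (cases y)
    obtain i' j' where z: "z = (i', j')" by (cases z)
    have ij: "i \<in> I" "j \<in> J i" "i' \<in> I" "j' \<in> J i'" using yz y z by auto
    show "supp (g (fst y) (snd y)) \<inter> supp (g (fst z) (snd z)) = {}"
    proof (cases "i = i'")
      case True
      then have "j \<noteq> j'" using yz y z by simp
      then show ?thesis
        using allowableD(3)[OF b[OF ij(1)]] ij True y z unfolding disjoint_family_on_def by simp
    next
      case False
      then have "supp (h i) \<inter> supp (h i') = {}"
        using allowableD(3)[OF a] ij unfolding disjoint_family_on_def by simp
      then show ?thesis using sub[OF ij(1,2)] sub[OF ij(3,4)] y z by auto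
    qed
  qed
  let ?I = "{i\<in>I. supp (h i) \<noteq> {}}"
  let ?M = "\<lambda>i. Min (supp (h i))"
  \<comment> \<open>\<open>B v\<close> collects the minima of the children of that member whose own
    minimum is \<open>v\<close>; a minimum identifies the member because the supports are
    disjoint.\<close>
  define B where "B v = (let i = inv_into ?I ?M v in
     (\<lambda>j. Min (supp (g i j))) ` {j\<in>J i. supp (g i j) \<noteq> {}})" for v
  have B: "B (?M i) = (\<lambda>j. Min (supp (g i j))) ` {j\<in>J i. supp (g i j) \<noteq> {}}" if "i \<in> ?I" for i
    unfolding B_def by (simp only: inv_into_f_f[OF allowable_inj_Min[OF a] that] Let_def)
  have "\<Union> (B ` (?M ` ?I)) \<in> mschreier (p + p')"
  proof (rule mschreier_convolution[OF allowableD(4)[OF a]])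
    fix v assume "v \<in> ?M ` ?I"
    then obtain i where i: "i \<in> ?I" "v = ?M i" by blast
    then have i': "i \<in> I" by simp
    show "B v \<in> mschreier p'" unfolding i(2) B[OF i(1)] by (rule allowableD(4)[OF b[OF i']])
    fix x assume "x \<in> B v"
    then obtain j where j: "j \<in> J i" "supp (g i j) \<noteq> {}" "x = Min (supp (g i j))"
      unfolding i(2) B[OF i(1)] by blast
    have "x \<in> supp (h i)" using allowable_Min_in[OF b[OF i'] j(1,2)] sub[OF i' j(1)] j(3) by blast
    then show "v \<le> x" unfolding i(2) using D_finite[OF allowableD(2)[OF a i']] by (intro Min_le) auto
  qed
  moreover have "(\<lambda>z. Min (supp (g (fst z) (snd z)))) ` {z\<in>Sigma I J. supp (g (fst z) (snd z)) \<noteq> {}}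
      \<subseteq> \<Union> (B ` (?M ` ?I))"
  proof
    fix x assume "x \<in> (\<lambda>z. Min (supp (g (fst z) (snd z)))) ` {z\<in>Sigma I J. supp (g (fst z) (snd z)) \<noteq> {}}"
    then obtain z where z: "z \<in> Sigma I J" "supp (g (fst z) (snd z)) \<noteq> {}" "x = Min (supp (g (fst z) (snd z)))"
      by blast
    define i j where "i = fst z" and "j = snd z"
    have ij: "i \<in> I" "j \<in> J i" "supp (g i j) \<noteq> {}" "x = Min (supp (g i j))"
      using z by (auto simp: i_def j_def)
    have i: "i \<in> ?I" using sub[OF ij(1,2)] ij by blast
    have "x \<in> B (?M i)" unfolding B[OF i] using ij by blast
    then show "x \<in> \<Union> (B ` (?M ` ?I))" using i by blast
  qed
  ultimately show "(\<lambda>z. Min (supp (g (fst z) (snd z)))) ` {z\<in>Sigma I J. supp (g (fst z) (snd z)) \<noteq> {}}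
      \<in> mschreier (p + p')" by (rule mschreier_subset)
qed

text \<open>Members starting before \<open>s\<close> are few, so their restrictions to \<open>[s, \<infinity>)\<close> are 1-allowable.\<close>

lemma allowable_old:
  assumes a: "allowable p I h" and I': "I' \<subseteq> I" and D': "\<And>i. i \<in> I' \<Longrightarrow> D (g i)"
    and sub: "\<And>i. i \<in> I' \<Longrightarrow> supp (g i) \<subseteq> supp (h i) \<inter> {s..}"
    and old: "\<And>i. i \<in> I' \<Longrightarrow> Min (supp (h i)) < s"
  shows "allowable 1 I' g"
proof -
  have "allowable p I' g"
    by (rule allowable_shrink[OF allowable_subset[OF a I'] D']) (use sub in auto)
  note a' = allowableD[OF this]
  let ?J = "{i\<in>I'. supp (g i) \<noteq> {}}"
  have fJ: "finite ?J" using a'(1) by simp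
  have "card ?J = card ((\<lambda>i. Min (supp (h i))) ` ?J)"
  proof (rule card_image[symmetric], rule inj_on_subset[OF allowable_inj_Min[OF a]], rule subsetI)
    fix i assume i: "i \<in> ?J"
    then show "i \<in> {i\<in>I. supp (h i) \<noteq> {}}" using sub[of i] I' by blast
  qed
  also have "... \<le> card {..<s}" by (rule card_mono) (use old in auto)
  finally have "card ?J \<le> s" by simp
  then have c: "card ((\<lambda>i. Min (supp (g i))) ` ?J) \<le> s" using card_image_le[OF fJ, of "\<lambda>i. Min (supp (g i))"] by simp
  have in_supp: "Min (supp (g i)) \<in> supp (g i)" if "i \<in> ?J" for i using that D' D_Min by blast
  have "(\<lambda>i. Min (supp (g i))) ` ?J \<in> mschreier 1"
  proof (rule mschreier_1I)
    show "0 \<notin> (\<lambda>i. Min (supp (g i))) ` ?J"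
    proof
      assume "0 \<in> (\<lambda>i. Min (supp (g i))) ` ?J"
      then obtain i where "i \<in> ?J" "0 \<in> supp (g i)" using in_supp by fastforce
      then show False using D_0[OF D'] by auto
    qed
    show "card ((\<lambda>i. Min (supp (g i))) ` ?J) \<le> x" if x: "x \<in> (\<lambda>i. Min (supp (g i))) ` ?J" for x
    proof -
      from x obtain i where i: "i \<in> ?J" "x = Min (supp (g i))" by blast
      have "x \<in> supp (g i)" using in_supp i by blast
      then have "s \<le> x" using sub[of i] i by auto
      then show ?thesis using c by simp
    qed
  qed (use fJ in simp)
  then show ?thesis unfolding allowable_def using a' by blast
qed

text \<open>Each level of a modified family is realized by one functional of weight
  \<open>m 0 = 2\<close>, which accepts families of order \<open>n 0 = 1\<close>; hence the factor
  \<open>1 / 2 ^ Suc p\<close>. Inside a piece the coefficients are normalized by their l2 norm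
  \<open>q H\<close>, which becomes the coefficient of the piece one level up.\<close>

lemma allowable_combination:
  fixes h :: "'i \<Rightarrow> nat \<Rightarrow> real"
  assumes "allowable (Suc p) I h" "(\<Sum>i\<in>I. (\<gamma> i)\<^sup>2) \<le> 1"
  shows "D (\<lambda>k. 1 / 2 ^ Suc p * (\<Sum>i\<in>I. \<gamma> i * h i k))"
  using assms
proof (induction p arbitrary: I \<gamma>)
  case 0
  note a = allowableD[OF 0(1)]
  let ?M = "(\<lambda>i. Min (supp (h i))) ` {i\<in>I. supp (h i) \<noteq> {}}"
  have "?M \<in> schreier (Suc 0)"
    unfolding schreier_1_iff using mschreier_1D[OF a(4)] mschreier_finite_pos[OF a(4)] by blast
  then have "?M \<in> schreier (n (2 * 0))" using n_0 by simp
  from even_functional[OF a(1) a(2) a(3) this 0(2)] m_0 show ?case by auto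
next
  case (Suc p)
  note a = allowableD[OF Suc.prems(1)]
  let ?I = "{i\<in>I. supp (h i) \<noteq> {}}"
  let ?M = "\<lambda>i. Min (supp (h i))"
  obtain \<G> where G: "?M ` ?I = \<Union> \<G>" "finite \<G>" "\<G> \<subseteq> mschreier (Suc p)" "\<forall>x\<in>?M ` ?I. card \<G> \<le> x"
    by (rule mschreier_SucE[OF a(4)])
  have "\<forall>i\<in>?I. \<exists>H. H \<in> \<G> \<and> ?M i \<in> H"
  proof
    fix i assume "i \<in> ?I"
    then have "?M i \<in> \<Union> \<G>" unfolding G(1)[symmetric] by (rule imageI)
    then show "\<exists>H. H \<in> \<G> \<and> ?M i \<in> H" by blast
  qed
  \<comment> \<open>The pieces of a modified set may overlap, so every member is assigned to one
    piece that contains its minimum.\<close>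
  from bchoice[OF this] obtain c where c: "\<forall>i\<in>?I. c i \<in> \<G> \<and> ?M i \<in> c i" by blast
  define P where "P H = {i\<in>?I. c i = H}" for H
  define q where "q H = sqrt (\<Sum>i\<in>P H. (\<gamma> i)\<^sup>2)" for H
  have q2: "(q H)\<^sup>2 = (\<Sum>i\<in>P H. (\<gamma> i)\<^sup>2)" for H unfolding q_def by (simp add: sum_nonneg)
  have finI: "finite ?I" using a(1) by simp
  have finP: "finite (P H)" for H using a(1) by (simp add: P_def)
  have group: "(\<Sum>H\<in>\<G>. \<Sum>i\<in>P H. u i) = (\<Sum>i\<in>?I. u i)" for u :: "'i \<Rightarrow> real"
    unfolding P_def by (rule sum.group[OF finI G(2)]) (use c in auto)
  define \<phi> where "\<phi> H = (\<lambda>k. 1 / 2 ^ Suc p * (\<Sum>i\<in>P H. (\<gamma> i / q H) * h i k))" for H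
  have \<phi>D: "D (\<phi> H)" if H: "H \<in> \<G>" for H
    unfolding \<phi>_def
  proof (rule Suc.IH)
    show "allowable (Suc p) (P H) h"
      unfolding allowable_def
    proof (intro conjI ballI)
      show "disjoint_family_on (\<lambda>i. supp (h i)) (P H)"
        by (rule disjoint_family_on_mono[OF _ a(3)]) (auto simp: P_def)
      have "H \<in> mschreier (Suc p)" using G(3) H by blast
      then show "?M ` {i \<in> P H. supp (h i) \<noteq> {}} \<in> mschreier (Suc p)"
        by (rule mschreier_subset) (use c in \<open>auto simp: P_def\<close>)
    qed (use finP a(2) in \<open>auto simp: P_def\<close>)
    have "(\<Sum>i\<in>P H. (\<gamma> i / q H)\<^sup>2) = (q H)\<^sup>2 / (q H)\<^sup>2"
      unfolding q2 power_divide sum_divide_distrib ..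
    then show "(\<Sum>i\<in>P H. (\<gamma> i / q H)\<^sup>2) \<le> 1" by (cases "q H = 0") auto
  qed
  have \<phi>s: "supp (\<phi> H) \<subseteq> (\<Union>i\<in>P H. supp (h i))" for H
  proof
    fix k assume "k \<in> supp (\<phi> H)"
    then have "(\<Sum>i\<in>P H. (\<gamma> i / q H) * h i k) \<noteq> 0" by (auto simp: supp_def \<phi>_def)
    then obtain i where "i \<in> P H" "(\<gamma> i / q H) * h i k \<noteq> 0" by (rule sum.not_neutral_contains_not_neutral)
    then show "k \<in> (\<Union>i\<in>P H. supp (h i))" by (auto simp: supp_def)
  qed
  have "W (\<lambda>k. (1 / real (m (2 * 0))) * (\<Sum>H\<in>\<G>. q H * \<phi> H k)) (Some (m (2 * 0)))"
  proof (rule even_functional[OF G(2) \<phi>D])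
    show "disjoint_family_on (\<lambda>H. supp (\<phi> H)) \<G>"
      unfolding disjoint_family_on_def
    proof (intro ballI impI)
      fix H H' :: "nat set" assume "H \<noteq> H'"
      then have "supp (h i) \<inter> supp (h i') = {}" if "i \<in> P H" "i' \<in> P H'" for i i'
      proof -
        have "i \<in> I" "i' \<in> I" "i \<noteq> i'" using that \<open>H \<noteq> H'\<close> by (auto simp: P_def)
        then show ?thesis using a(3) unfolding disjoint_family_on_def by blast
      qed
      then show "supp (\<phi> H) \<inter> supp (\<phi> H') = {}" using \<phi>s[of H] \<phi>s[of H'] by blast
    qed
    have "(\<Sum>H\<in>\<G>. (q H)\<^sup>2) = (\<Sum>i\<in>?I. (\<gamma> i)\<^sup>2)" unfolding q2 by (rule group)
    also have "... \<le> (\<Sum>i\<in>I. (\<gamma> i)\<^sup>2)" by (rule sum_mono2) (use a(1) in auto)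
    finally show "(\<Sum>H\<in>\<G>. (q H)\<^sup>2) \<le> 1" using Suc.prems(2) by simp
    let ?S = "(\<lambda>H. Min (supp (\<phi> H))) ` {H\<in>\<G>. supp (\<phi> H) \<noteq> {}}"
    have "card ?S \<le> card \<G>"
      by (rule order_trans[OF card_image_le card_mono]) (use G(2) in auto)
    moreover have "card \<G> \<le> x \<and> x \<noteq> 0" if "x \<in> ?S" for x
    proof -
      from that obtain H where H: "H \<in> \<G>" "supp (\<phi> H) \<noteq> {}" "x = Min (supp (\<phi> H))" by blast
      have "x \<in> supp (\<phi> H)" using D_Min[OF \<phi>D[OF H(1)] H(2)] H(3) by simp
      moreover from this obtain i where i: "i \<in> P H" "x \<in> supp (h i)" using \<phi>s by blast
      have "?M i \<le> x" using i D_finite[OF a(2)] by (auto simp: P_def)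
      moreover have "card \<G> \<le> ?M i" using G(4) i by (auto simp: P_def)
      ultimately show ?thesis using D_0[OF \<phi>D[OF H(1)]] by (metis le_trans)
    qed
    ultimately have "?S \<in> schreier (Suc 0)" unfolding schreier_1_iff using G(2) by (metis (no_types, lifting) finite_imageI finite_subset le_trans mem_Collect_eq subsetI)
    then show "?S \<in> schreier (n (2 * 0))" using n_0 by simp
  qed
  moreover have "(1 / real (m (2 * 0))) * (\<Sum>H\<in>\<G>. q H * \<phi> H k) = 1 / 2 ^ Suc (Suc p) * (\<Sum>i\<in>I. \<gamma> i * h i k)" for k
  proof -
    have "(\<Sum>H\<in>\<G>. q H * \<phi> H k) = (\<Sum>H\<in>\<G>. \<Sum>i\<in>P H. 1 / 2 ^ Suc p * (\<gamma> i * h i k))"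
    proof (rule sum.cong)
      fix H :: "nat set"
      have "q H * (\<gamma> i / q H * h i k) = \<gamma> i * h i k" if "i \<in> P H" for i
      proof (cases "q H = 0")
        case True
        then have "(\<Sum>i\<in>P H. (\<gamma> i)\<^sup>2) = 0" using q2[of H] by simp
        then have "(\<gamma> i)\<^sup>2 = 0" using that finP by (simp add: sum_nonneg_eq_0_iff)
        then show ?thesis using True by simp
      qed simp
      then have "(\<Sum>i\<in>P H. q H * (\<gamma> i / q H * h i k)) = (\<Sum>i\<in>P H. \<gamma> i * h i k)" by (intro sum.cong) auto
      moreover have "q H * \<phi> H k = 1 / 2 ^ Suc p * (\<Sum>i\<in>P H. q H * (\<gamma> i / q H * h i k))"
        unfolding \<phi>_def by (simp only: sum_distrib_left mult.left_commute)
      ultimately show "q H * \<phi> H k = (\<Sum>i\<in>P H. 1 / 2 ^ Suc p * (\<gamma> i * h i k))"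
        by (simp only: sum_distrib_left)
    qed simp
    also have "... = 1 / 2 ^ Suc p * (\<Sum>i\<in>?I. \<gamma> i * h i k)" unfolding group by (simp only: sum_distrib_left)
    also have "(\<Sum>i\<in>?I. \<gamma> i * h i k) = (\<Sum>i\<in>I. \<gamma> i * h i k)"
      by (rule sum.mono_neutral_left) (use a(1) in \<open>auto simp: supp_def\<close>)
    finally show ?thesis using m_0 by simp
  qed
  ultimately show ?case by auto
qed

lemma norm_le_nonneg: "norm_le x C \<Longrightarrow> 0 \<le> C"
proof -
  assume "norm_le x C"
  moreover have "D (\<lambda>k. 0)" using W_zero by blast
  ultimately have "\<bar>pair (\<lambda>k. 0) x\<bar> \<le> C" unfolding norm_le_def by blast
  then show ?thesis by simp
qed

text \<open>Test \<open>x\<close> on the combination of the family whose coefficients are its own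
  values on \<open>x\<close>, normalized in l2.\<close>

lemma norm_le_square_bound:
  assumes "norm_le x C" shows "square_bound (Suc p) x (4 ^ Suc p * C\<^sup>2)"
  unfolding square_bound_def
proof (intro allI impI)
  fix A assume a: "allowable (Suc p) A (\<lambda>f. f)"
  define Q where "Q = (\<Sum>f\<in>A. (pair f x)\<^sup>2)"
  have Q0: "0 \<le> Q" unfolding Q_def by (simp add: sum_nonneg)
  show "Q \<le> 4 ^ Suc p * C\<^sup>2"
  proof (cases "Q = 0")
    case False
    have "(\<Sum>f\<in>A. (pair f x / sqrt Q)\<^sup>2) = Q / Q"
      unfolding power_divide sum_divide_distrib[symmetric] Q_def[symmetric] using Q0 by simp
    then have "D (\<lambda>k. 1 / 2 ^ Suc p * (\<Sum>f\<in>A. pair f x / sqrt Q * f k))"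
      using False by (intro allowable_combination[OF a]) simp
    then have "\<bar>pair (\<lambda>k. 1 / 2 ^ Suc p * (\<Sum>f\<in>A. pair f x / sqrt Q * f k)) x\<bar> \<le> C"
      using assms unfolding norm_le_def by blast
    also have "pair (\<lambda>k. 1 / 2 ^ Suc p * (\<Sum>f\<in>A. pair f x / sqrt Q * f k)) x
        = 1 / 2 ^ Suc p * (\<Sum>f\<in>A. pair f x / sqrt Q * pair f x)"
      by (rule pair_combo) (use allowableD[OF a] D_finite in auto)
    also have "(\<Sum>f\<in>A. pair f x / sqrt Q * pair f x) = Q / sqrt Q"
      unfolding Q_def by (simp add: power2_eq_square sum_divide_distrib)
    also have "Q / sqrt Q = sqrt Q" using Q0 by (simp add: real_div_sqrt)
    finally have "sqrt Q \<le> 2 ^ Suc p * C" using Q0 by (simp add: field_simps)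
    then have "(sqrt Q)\<^sup>2 \<le> (2 ^ Suc p * C)\<^sup>2" using Q0 by (intro power_mono) auto
    moreover have "(2 ^ Suc p * C)\<^sup>2 = 4 ^ Suc p * C\<^sup>2"
      by (simp only: power_mult_distrib power_even_eq[symmetric] power_mult[symmetric] mult.commute[of _ 2])
        (simp add: power_mult)
    ultimately show ?thesis using Q0 by simp
  qed simp
qed

text \<open>On block \<open>k\<close> the functional is a multiple of \<open>g k\<close>, the
  multiples form a vector of the unit ball of l2, and Cauchy-Schwarz applies. The pieces
  \<open>g\<close> depend on \<open>f\<close> and the blocks alone, not on the vectors.\<close>

lemma W_split_pair:
  fixes B :: "'k \<Rightarrow> nat set"
  assumes w: "W f w" and F: "finite F" and B: "disjoint_family_on B F"
  shows "\<exists>g. (\<forall>k\<in>F. (\<exists>w'. W (g k) w' \<and> (w \<noteq> None \<longrightarrow> w' = w)) \<and> supp (g k) \<subseteq> supp f \<inter> B k) \<and>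
    (\<forall>x c. (\<forall>k\<in>F. supp (x k) \<subseteq> B k) \<longrightarrow>
      (pair f (\<lambda>a. \<Sum>k\<in>F. c k * x k a))\<^sup>2 \<le> (\<Sum>k\<in>F. (c k)\<^sup>2 * (pair (g k) (x k))\<^sup>2))"
proof -
  obtain \<gamma> g where g: "\<forall>k\<in>F. (\<exists>w'. W (g k) w' \<and> (w \<noteq> None \<longrightarrow> w' = w)) \<and> supp (g k) \<subseteq> supp f \<inter> B k"
    "(\<Sum>k\<in>F. (\<gamma> k)\<^sup>2) \<le> 1" "\<forall>k\<in>F. \<forall>i\<in>B k. f i = \<gamma> k * g k i"
    using W_split[OF w F B] by blast
  have fin: "finite (supp f)" using W_supp[OF w] by blast
  have "(pair f (\<lambda>a. \<Sum>k\<in>F. c k * x k a))\<^sup>2 \<le> (\<Sum>k\<in>F. (c k)\<^sup>2 * (pair (g k) (x k))\<^sup>2)"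
    if x: "\<forall>k\<in>F. supp (x k) \<subseteq> B k" for x c
  proof -
    have "pair f (x k) = \<gamma> k * pair (g k) (x k)" if k: "k \<in> F" for k
    proof -
      have "pair (g k) (x k) = (\<Sum>a\<in>supp f. g k a * x k a)"
        by (rule pair_superset[OF fin]) (use g(1) k in blast)
      moreover have "f a * x k a = \<gamma> k * (g k a * x k a)" for a
        using g(3) x k by (cases "a \<in> B k") (auto simp: supp_def)
      then have "pair f (x k) = \<gamma> k * (\<Sum>a\<in>supp f. g k a * x k a)"
        unfolding pair_def sum_distrib_left by (intro sum.cong refl)
      ultimately show ?thesis by simp
    qed
    then have "pair f (\<lambda>a. \<Sum>k\<in>F. c k * x k a) = (\<Sum>k\<in>F. \<gamma> k * (c k * pair (g k) (x k)))"
      unfolding pair_sum by (intro sum.cong) auto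
    also have "(...)\<^sup>2 \<le> (\<Sum>k\<in>F. (c k * pair (g k) (x k))\<^sup>2)" by (rule sum_mult_square_le[OF g(2)])
    finally show ?thesis by (simp add: power_mult_distrib)
  qed
  then show ?thesis using g(1) by blast
qed

text \<open>The upper 2-estimate for blocks, with constant 1. The coefficients are written
  \<open>sqrt (b k)\<close> because the averages \<open>b\<close> act on squares.\<close>

lemma norm_le_sum:
  assumes F: "finite F" and B: "disjoint_family_on B F" and x: "\<And>k. k \<in> F \<Longrightarrow> supp (x k) \<subseteq> B k"
    and C: "\<And>k. k \<in> F \<Longrightarrow> norm_le (x k) C" and b: "\<And>k. k \<in> F \<Longrightarrow> 0 \<le> b k" "(\<Sum>k\<in>F. b k) \<le> 1" and C0: "0 \<le> C"
  shows "norm_le (\<lambda>a. \<Sum>k\<in>F. sqrt (b k) * x k a) C"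
  unfolding norm_le_def
proof (intro allI impI)
  fix f assume "D f"
  then obtain w where w: "W f w" by blast
  obtain g where g: "\<forall>k\<in>F. D (g k)" "(pair f (\<lambda>a. \<Sum>k\<in>F. sqrt (b k) * x k a))\<^sup>2 \<le> (\<Sum>k\<in>F. (sqrt (b k))\<^sup>2 * (pair (g k) (x k))\<^sup>2)"
    using W_split_pair[OF w F B] x by meson
  note g(2)
  also have "(\<Sum>k\<in>F. (sqrt (b k))\<^sup>2 * (pair (g k) (x k))\<^sup>2) \<le> (\<Sum>k\<in>F. b k * C\<^sup>2)"
  proof (rule sum_mono)
    fix k assume k: "k \<in> F"
    have "\<bar>pair (g k) (x k)\<bar> \<le> C" using C[OF k] g(1) k unfolding norm_le_def by blast
    then have "(pair (g k) (x k))\<^sup>2 \<le> C\<^sup>2" by (simp add: abs_le_square_iff[symmetric] C0)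
    then show "(sqrt (b k))\<^sup>2 * (pair (g k) (x k))\<^sup>2 \<le> b k * C\<^sup>2"
      using b(1)[OF k] by (simp add: mult_left_mono)
  qed
  also have "... \<le> 1 * C\<^sup>2" unfolding sum_distrib_right[symmetric] using b(2) by (intro mult_right_mono) auto
  finally show "\<bar>pair f (\<lambda>a. \<Sum>k\<in>F. sqrt (b k) * x k a)\<bar> \<le> C"
    using C0 by (simp add: abs_le_square_iff[symmetric])
qed

lemma W_weight: "W f (Some w) \<Longrightarrow> \<exists>i. w = m i"
  by (erule W_cases) auto

text \<open>The two bounds on the weights play different parts: \<open>m lo\<close> provides the
  gain in the squares, while \<open>m (Suc hi)\<close> limits the order of the families of children
  to \<open>n hi\<close>.\<close>

lemma allowable_children:
  fixes h :: "'i \<Rightarrow> nat \<Rightarrow> real"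
  assumes a: "allowable p I h"
    and w: "\<And>i. i \<in> I \<Longrightarrow> \<exists>w. m lo \<le> w \<and> w < m (Suc hi) \<and> W (h i) (Some w)"
  shows "\<exists>(J :: 'i \<Rightarrow> nat set) g. allowable (p + n hi) (Sigma I J) (\<lambda>z. g (fst z) (snd z)) \<and>
    (\<forall>i\<in>I. \<forall>j\<in>J i. supp (g i j) \<subseteq> supp (h i)) \<and>
    (\<forall>x. (\<Sum>i\<in>I. (pair (h i) x)\<^sup>2) \<le> (\<Sum>z\<in>Sigma I J. (pair (g (fst z) (snd z)) x)\<^sup>2) / (real (m lo))\<^sup>2)"
proof -
  have "\<forall>i\<in>I. \<exists>Jg :: nat set \<times> (nat \<Rightarrow> nat \<Rightarrow> real). allowable (n hi) (fst Jg) (snd Jg) \<and>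
    (\<forall>j\<in>fst Jg. supp (snd Jg j) \<subseteq> supp (h i)) \<and>
    (\<forall>x. (pair (h i) x)\<^sup>2 \<le> (\<Sum>j\<in>fst Jg. (pair (snd Jg j) x)\<^sup>2) / (real (m lo))\<^sup>2)"
  proof
    fix i assume "i \<in> I"
    from w[OF this] obtain w where w: "m lo \<le> w" "w < m (Suc hi)" "W (h i) (Some w)" by blast
    from w(3) obtain i' and J :: "nat set" and g l where c: "w = m i'" "finite J" "\<And>j. j \<in> J \<Longrightarrow> D (g j)"
      "disjoint_family_on (\<lambda>j. supp (g j)) J"
      "(\<lambda>j. Min (supp (g j))) ` {j\<in>J. supp (g j) \<noteq> {}} \<in> mschreier (n i')"
      "(\<Sum>j\<in>J. (l j)\<^sup>2) \<le> 1" "\<And>j. j \<in> J \<Longrightarrow> supp (g j) \<subseteq> supp (h i)"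
      "h i = (\<lambda>k. 1 / real (m i') * (\<Sum>j\<in>J. l j * g j k))"
      by (cases rule: W_cases) auto
    have "\<not> Suc hi \<le> i'" using w(2) c(1) m_mono[of "Suc hi" i'] by auto
    then have "n i' \<le> n hi" by (intro n_mono) simp
    then have "allowable (n hi) J g"
      unfolding allowable_def using c(2-5) mschreier_mono by blast
    moreover have "(pair (h i) x)\<^sup>2 \<le> (\<Sum>j\<in>J. (pair (g j) x)\<^sup>2) / (real (m lo))\<^sup>2" for x
    proof -
      have "pair (h i) x = 1 / real (m i') * (\<Sum>j\<in>J. l j * pair (g j) x)"
        unfolding c(8) by (rule pair_combo[OF c(2)]) (use D_finite[OF c(3)] in auto)
      then have "(pair (h i) x)\<^sup>2 = (\<Sum>j\<in>J. l j * pair (g j) x)\<^sup>2 / (real (m i'))\<^sup>2"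
        by (simp add: power_divide)
      also have "... \<le> (\<Sum>j\<in>J. (pair (g j) x)\<^sup>2) / (real (m i'))\<^sup>2"
        by (rule divide_right_mono[OF sum_mult_square_le[OF c(6)]]) simp
      also have "... \<le> (\<Sum>j\<in>J. (pair (g j) x)\<^sup>2) / (real (m lo))\<^sup>2"
        using w(1) c(1) m_ge2[of lo] by (intro divide_left_mono) (auto intro!: power_mono sum_nonneg)
      finally show ?thesis .
    qed
    ultimately show "\<exists>Jg :: nat set \<times> (nat \<Rightarrow> nat \<Rightarrow> real). allowable (n hi) (fst Jg) (snd Jg) \<and>
      (\<forall>j\<in>fst Jg. supp (snd Jg j) \<subseteq> supp (h i)) \<and>
      (\<forall>x. (pair (h i) x)\<^sup>2 \<le> (\<Sum>j\<in>fst Jg. (pair (snd Jg j) x)\<^sup>2) / (real (m lo))\<^sup>2)"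
      using c(7) by (intro exI[of _ "(J, g)"]) auto
  qed
  from bchoice[OF this] obtain Jg :: "'i \<Rightarrow> nat set \<times> (nat \<Rightarrow> nat \<Rightarrow> real)" where
    Jg: "\<forall>i\<in>I. allowable (n hi) (fst (Jg i)) (snd (Jg i)) \<and>
    (\<forall>j\<in>fst (Jg i). supp (snd (Jg i) j) \<subseteq> supp (h i)) \<and>
    (\<forall>x. (pair (h i) x)\<^sup>2 \<le> (\<Sum>j\<in>fst (Jg i). (pair (snd (Jg i) j) x)\<^sup>2) / (real (m lo))\<^sup>2)" ..
  define J where "J i = fst (Jg i)" for i
  define g where "g i = snd (Jg i)" for i
  have 1: "allowable (n hi) (J i) (g i)" if "i \<in> I" for i using Jg that by (simp add: J_def g_def)
  have 2: "supp (g i j) \<subseteq> supp (h i)" if "i \<in> I" "j \<in> J i" for i j using Jg that by (simp add: J_def g_def)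
  have 3: "(pair (h i) x)\<^sup>2 \<le> (\<Sum>j\<in>J i. (pair (g i j) x)\<^sup>2) / (real (m lo))\<^sup>2" if "i \<in> I" for i x
    using Jg that by (simp add: J_def g_def)
  have "(\<Sum>i\<in>I. (pair (h i) x)\<^sup>2) \<le> (\<Sum>z\<in>Sigma I J. (pair (g (fst z) (snd z)) x)\<^sup>2) / (real (m lo))\<^sup>2" for x
  proof -
    have "(\<Sum>i\<in>I. (pair (h i) x)\<^sup>2) \<le> (\<Sum>i\<in>I. (\<Sum>j\<in>J i. (pair (g i j) x)\<^sup>2) / (real (m lo))\<^sup>2)"
      by (rule sum_mono) (use 3 in auto)
    also have "... = (\<Sum>i\<in>I. \<Sum>j\<in>J i. (pair (g i j) x)\<^sup>2) / (real (m lo))\<^sup>2" by (simp add: sum_divide_distrib)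
    also have "(\<Sum>i\<in>I. \<Sum>j\<in>J i. (pair (g i j) x)\<^sup>2) = (\<Sum>z\<in>Sigma I J. (pair (g (fst z) (snd z)) x)\<^sup>2)"
      using allowableD(1)[OF a] allowableD(1)[OF 1] by (simp add: sum.Sigma case_prod_beta)
    finally show ?thesis .
  qed
  moreover have "allowable (p + n hi) (Sigma I J) (\<lambda>z. g (fst z) (snd z))"
    by (rule allowable_Sigma[OF a 1 2])
  ultimately show ?thesis using 2 by blast
qed

text \<open>Unit functionals have no children, so they are counted among the heavy ones, at which
  the expansion stops.\<close>

definition heavy :: "nat \<Rightarrow> (nat \<Rightarrow> real) \<Rightarrow> bool" where
  "heavy q f \<longleftrightarrow> W f None \<or> (\<exists>w. m q \<le> w \<and> W f (Some w))"

text \<open>Expanding the members of small weight level by level gains a factor \<open>1/4\<close> each time, at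
  the cost of raising the order of the family.\<close>

lemma square_bound_expand:
  assumes K: "square_bound p x K" "0 \<le> K" and H0: "0 \<le> H" and q: "1 \<le> q"
    and H: "\<And>A. allowable p A (\<lambda>f. f) \<Longrightarrow> \<forall>f\<in>A. heavy q f \<Longrightarrow> (\<Sum>f\<in>A. (pair f x)\<^sup>2) \<le> H"
  shows "p' + L * n (q - 1) \<le> p \<Longrightarrow> square_bound p' x (2 * H + K / 4 ^ L)"
proof (induction L arbitrary: p')
  case 0
  then show ?case using square_bound_mono[OF K(1)] H0 by simp
next
  case (Suc L)
  have IH: "square_bound (p' + n (q - 1)) x (2 * H + K / 4 ^ L)"
    by (rule Suc.IH) (use Suc.prems in simp)
  show ?case
    unfolding square_bound_def
  proof (intro allI impI)
    fix A assume a: "allowable p' A (\<lambda>f. f)"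
    define A1 where "A1 = {f\<in>A. heavy q f}"
    define A2 where "A2 = {f\<in>A. \<not> heavy q f}"
    have fA: "finite A" by (rule allowableD(1)[OF a])
    have "allowable p A1 (\<lambda>f. f)"
      by (rule allowable_mono[OF allowable_subset[OF a]]) (use Suc.prems in \<open>auto simp: A1_def\<close>)
    then have 1: "(\<Sum>f\<in>A1. (pair f x)\<^sup>2) \<le> H" by (rule H) (auto simp: A1_def)
    have a2: "allowable p' A2 (\<lambda>f. f)" by (rule allowable_subset[OF a]) (auto simp: A2_def)
    have "\<exists>w. m 0 \<le> w \<and> w < m (Suc (q - 1)) \<and> W f (Some w)" if f: "f \<in> A2" for f
    proof -
      obtain v where v: "W f v" using allowableD(2)[OF a2 f] by blast
      then obtain w where w: "v = Some w" using f by (cases v) (auto simp: A2_def heavy_def)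
      then have "w < m q" using f v by (auto simp: A2_def heavy_def not_less[symmetric])
      moreover obtain i where "w = m i" using W_weight v w by blast
      ultimately show ?thesis using v w q m_mono[of 0 i] by auto
    qed
    from allowable_children[OF a2 this] obtain J :: "_ \<Rightarrow> nat set" and g where
      J: "allowable (p' + n (q - 1)) (Sigma A2 J) (\<lambda>z. g (fst z) (snd z))"
      "\<forall>x. (\<Sum>f\<in>A2. (pair f x)\<^sup>2) \<le> (\<Sum>z\<in>Sigma A2 J. (pair (g (fst z) (snd z)) x)\<^sup>2) / (real (m 0))\<^sup>2"
      by blast
    have "(\<Sum>z\<in>Sigma A2 J. (pair (g (fst z) (snd z)) x)\<^sup>2) \<le> 2 * H + K / 4 ^ L"
      by (rule square_boundD[OF IH J(1)])
    then have 2: "(\<Sum>f\<in>A2. (pair f x)\<^sup>2) \<le> (2 * H + K / 4 ^ L) / 4"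
      using J(2)[rule_format, of x] m_0 by simp
    have "(\<Sum>f\<in>A. (pair f x)\<^sup>2) = (\<Sum>f\<in>A1. (pair f x)\<^sup>2) + (\<Sum>f\<in>A2. (pair f x)\<^sup>2)"
      unfolding A1_def A2_def using fA
      by (subst sum.union_disjoint[symmetric]) (auto intro: sum.cong)
    also have "... \<le> H + (2 * H + K / 4 ^ L) / 4" by (rule add_mono[OF 1 2])
    \<comment> \<open>\<open>H + 2 * H / 4\<close> is at most \<open>2 * H\<close>: this is why the
      bound carries the factor 2.\<close>
    also have "... \<le> 2 * H + K / 4 ^ Suc L" using H0 by simp
    finally show "(\<Sum>f\<in>A. (pair f x)\<^sup>2) \<le> 2 * H + K / 4 ^ Suc L" .
  qed
qed

end

lemma power_two_between:
  fixes x :: nat assumes "1 \<le> x" shows "\<exists>L. x \<le> 2 ^ L \<and> 2 ^ L \<le> 2 * x"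
  using assms
proof (induction x rule: dec_induct)
  case base then show ?case by (intro exI[of _ 0]) simp
next
  case (step x)
  then obtain L where L: "x \<le> 2 ^ L" "2 ^ L \<le> 2 * x" by blast
  show ?case
  proof (cases "x = 2 ^ L")
    case True then show ?thesis by (intro exI[of _ "Suc L"]) (use step.hyps in simp)
  next
    case False then show ?thesis using L by (intro exI[of _ L]) simp
  qed
qed

context wh_space
begin

section \<open>Averages of block sequences\<close>

text \<open>A probability on blocks, with the sets of small mass described through the right ends
  \<open>r\<close>: exceptional blocks are charged to functionals that begin no later than these
  ends.\<close>

definition small_average :: "nat \<Rightarrow> real \<Rightarrow> nat set \<Rightarrow> (nat \<Rightarrow> real) \<Rightarrow> (nat \<Rightarrow> nat) \<Rightarrow> bool" where
  "small_average p \<epsilon> F b r \<longleftrightarrow> finite F \<and> (\<forall>k\<in>F. 0 \<le> b k) \<and> (\<Sum>k\<in>F. b k) = 1 \<and>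
    (\<forall>G\<subseteq>F. r ` G \<in> mschreier p \<longrightarrow> (\<Sum>k\<in>G. b k) \<le> \<epsilon>)"

lemma small_averageD:
  assumes "small_average p \<epsilon> F b r"
  shows "finite F" "k \<in> F \<Longrightarrow> 0 \<le> b k" "(\<Sum>k\<in>F. b k) = 1"
    "G \<subseteq> F \<Longrightarrow> r ` G \<in> mschreier p \<Longrightarrow> (\<Sum>k\<in>G. b k) \<le> \<epsilon>" "0 \<le> \<epsilon>"
  using assms unfolding small_average_def using mschreier_empty[of p] by auto

lemma small_average_sum_le:
  assumes sa: "small_average p \<epsilon> F b r"
    and G: "G1 \<subseteq> F" "G2 \<subseteq> F" "G3 \<subseteq> F" "r ` G1 \<in> mschreier p" "r ` G2 \<in> mschreier p" "r ` G3 \<in> mschreier p"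
    and V: "0 \<le> V1" "0 \<le> V2" "0 \<le> V3"
    and S: "\<And>k. k \<in> F \<Longrightarrow> S k \<le> U + of_bool (k \<in> G1) * V1 + of_bool (k \<in> G2) * V2 + of_bool (k \<in> G3) * V3"
  shows "(\<Sum>k\<in>F. b k * S k) \<le> U + \<epsilon> * (V1 + V2 + V3)"
proof -
  note a = small_averageD[OF sa]
  have ind: "(\<Sum>k\<in>F. b k * (of_bool (k \<in> G) * V)) \<le> \<epsilon> * V"
    if "G \<subseteq> F" "r ` G \<in> mschreier p" "0 \<le> V" for G V
  proof -
    have "(\<Sum>k\<in>F. b k * (of_bool (k \<in> G) * V)) = (\<Sum>k\<in>G. b k * V)"
      using that(1) a(1) by (intro sum.mono_neutral_cong_right) auto
    also have "... \<le> \<epsilon> * V"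
      unfolding sum_distrib_right[symmetric] by (rule mult_right_mono[OF a(4)[OF that(1,2)] that(3)])
    finally show ?thesis .
  qed
  have "(\<Sum>k\<in>F. b k * S k) \<le> (\<Sum>k\<in>F. b k * (U + of_bool (k \<in> G1) * V1 + of_bool (k \<in> G2) * V2 + of_bool (k \<in> G3) * V3))"
    by (rule sum_mono, rule mult_left_mono) (use S a(2) in auto)
  also have "... = (\<Sum>k\<in>F. b k) * U + (\<Sum>k\<in>F. b k * (of_bool (k \<in> G1) * V1))
      + (\<Sum>k\<in>F. b k * (of_bool (k \<in> G2) * V2)) + (\<Sum>k\<in>F. b k * (of_bool (k \<in> G3) * V3))"
    by (simp only: distrib_left sum.distrib sum_distrib_right)
  also have "... \<le> 1 * U + \<epsilon> * V1 + \<epsilon> * V2 + \<epsilon> * V3"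
    unfolding a(3) by (intro add_mono order_refl ind G V)
  finally show ?thesis by (simp add: distrib_left)
qed

text \<open>A charging argument: every block in \<open>G\<close> is charged to a member that begins
  no later than the end of the block, and no member is charged twice. The ends of the blocks then
  dominate distinct minima of the family.\<close>

lemma allowable_marks:
  assumes a: "allowable p I h"
    and ex: "\<And>k. k \<in> G \<Longrightarrow> \<exists>i\<in>I. P i k \<and> supp (h i) \<noteq> {} \<and> Min (supp (h i)) \<le> r k"
    and inj: "\<And>i k k'. k \<in> G \<Longrightarrow> k' \<in> G \<Longrightarrow> P i k \<Longrightarrow> P i k' \<Longrightarrow> k = k'"
  shows "r ` G \<in> mschreier p"
proof -
  have "\<forall>k\<in>G. \<exists>i. i \<in> I \<and> P i k \<and> supp (h i) \<noteq> {} \<and> Min (supp (h i)) \<le> r k" using ex by blast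
  from bchoice[OF this] obtain c where
    c: "\<forall>k\<in>G. c k \<in> I \<and> P (c k) k \<and> supp (h (c k)) \<noteq> {} \<and> Min (supp (h (c k))) \<le> r k" ..
  show ?thesis
  proof (rule mschreier_dominate[OF allowableD(4)[OF a]])
    show "inj_on (\<lambda>k. Min (supp (h (c k)))) G"
    proof (rule inj_onI)
      fix k k' assume k: "k \<in> G" "k' \<in> G" "Min (supp (h (c k))) = Min (supp (h (c k')))"
      then have "c k = c k'" using c by (intro inj_onD[OF allowable_inj_Min[OF a]]) auto
      then show "k = k'" using c k(1,2) inj[of k k' "c k"] by metis
    qed
  qed (use c in auto)
qed

text \<open>A member begins in at most one of the disjoint blocks, so blocks in which some member
  begins can be charged to these members.\<close>

lemma allowable_new:
  assumes a: "allowable p I h" and B: "disjoint_family_on (\<lambda>k. {s k..r k}) F"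
    and g: "\<And>i k. i \<in> I \<Longrightarrow> k \<in> F \<Longrightarrow> supp (g i k) \<subseteq> supp (h i) \<inter> {s k..r k}"
  shows "r ` {k\<in>F. \<exists>i\<in>I. s k \<le> Min (supp (h i)) \<and> supp (g i k) \<noteq> {}} \<in> mschreier p"
proof -
  let ?P = "\<lambda>i k. i \<in> I \<and> s k \<le> Min (supp (h i)) \<and> supp (g i k) \<noteq> {}"
  let ?G = "{k\<in>F. \<exists>i\<in>I. s k \<le> Min (supp (h i)) \<and> supp (g i k) \<noteq> {}}"
  have mem: "supp (h i) \<noteq> {} \<and> Min (supp (h i)) \<in> {s k..r k}" if "?P i k" "k \<in> F" for i k
  proof -
    from that obtain x where x: "x \<in> supp (g i k)" by blast
    then have x': "x \<in> supp (h i)" "x \<le> r k" using g[of i k] that by auto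
    then have "Min (supp (h i)) \<le> x" using D_finite[OF allowableD(2)[OF a]] that by (intro Min_le) auto
    then show ?thesis using x' that by auto
  qed
  show ?thesis
  proof (rule allowable_marks[OF a, where P = ?P])
    fix k assume k: "k \<in> ?G"
    then obtain i where i: "?P i k" by blast
    have "supp (h i) \<noteq> {} \<and> Min (supp (h i)) \<in> {s k..r k}" by (rule mem[OF i]) (use k in simp)
    then show "\<exists>i\<in>I. ?P i k \<and> supp (h i) \<noteq> {} \<and> Min (supp (h i)) \<le> r k" using i by auto
  next
    fix i k k' assume k: "k \<in> ?G" "k' \<in> ?G" "?P i k" "?P i k'"
    have "k \<in> F" "k' \<in> F" using k by auto
    moreover have "Min (supp (h i)) \<in> {s k..r k} \<inter> {s k'..r k'}"
      using mem[OF k(3)] mem[OF k(4)] calculation by blast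
    ultimately show "k = k'" using B unfolding disjoint_family_on_def by blast
  qed
qed

text \<open>All members are cut along all blocks at once, which turns the square sum over the family
  into a \<open>b\<close>-average of square sums over single blocks. Weights are carried along
  because later estimates distinguish them.\<close>

lemma split_family:
  fixes h :: "'i \<Rightarrow> nat \<Rightarrow> real" and B :: "'k \<Rightarrow> nat set"
  assumes w: "\<And>i. i \<in> I \<Longrightarrow> W (h i) (w i)" and F: "finite F" and B: "disjoint_family_on B F"
  obtains g where "\<And>i k. i \<in> I \<Longrightarrow> k \<in> F \<Longrightarrow> D (g i k)"
    "\<And>i k v. i \<in> I \<Longrightarrow> k \<in> F \<Longrightarrow> w i = Some v \<Longrightarrow> W (g i k) (Some v)"
    "\<And>i k. i \<in> I \<Longrightarrow> k \<in> F \<Longrightarrow> supp (g i k) \<subseteq> supp (h i) \<inter> B k"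
    "\<And>x b. (\<And>k. k \<in> F \<Longrightarrow> supp (x k) \<subseteq> B k) \<Longrightarrow> (\<And>k. k \<in> F \<Longrightarrow> 0 \<le> b k) \<Longrightarrow>
      (\<Sum>i\<in>I. (pair (h i) (\<lambda>a. \<Sum>k\<in>F. sqrt (b k) * x k a))\<^sup>2) \<le> (\<Sum>k\<in>F. b k * (\<Sum>i\<in>I. (pair (g i k) (x k))\<^sup>2))"
proof -
  have "\<forall>i\<in>I. \<exists>g. (\<forall>k\<in>F. (\<exists>w'. W (g k) w' \<and> (w i \<noteq> None \<longrightarrow> w' = w i)) \<and> supp (g k) \<subseteq> supp (h i) \<inter> B k) \<and>
    (\<forall>x c. (\<forall>k\<in>F. supp (x k) \<subseteq> B k) \<longrightarrow>
      (pair (h i) (\<lambda>a. \<Sum>k\<in>F. c k * x k a))\<^sup>2 \<le> (\<Sum>k\<in>F. (c k)\<^sup>2 * (pair (g k) (x k))\<^sup>2))"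
    by (rule ballI) (rule W_split_pair[OF w F B])
  from bchoice[OF this] obtain g where g: "\<forall>i\<in>I. (\<forall>k\<in>F. (\<exists>w'. W (g i k) w' \<and> (w i \<noteq> None \<longrightarrow> w' = w i)) \<and> supp (g i k) \<subseteq> supp (h i) \<inter> B k) \<and>
    (\<forall>x c. (\<forall>k\<in>F. supp (x k) \<subseteq> B k) \<longrightarrow>
      (pair (h i) (\<lambda>a. \<Sum>k\<in>F. c k * x k a))\<^sup>2 \<le> (\<Sum>k\<in>F. (c k)\<^sup>2 * (pair (g i k) (x k))\<^sup>2))" ..
  show ?thesis
  proof (rule that[of g])
    fix i k assume "i \<in> I" "k \<in> F"
    then show "D (g i k)" "supp (g i k) \<subseteq> supp (h i) \<inter> B k" using g by blast+
    show "W (g i k) (Some v)" if "w i = Some v" for v using g \<open>i \<in> I\<close> \<open>k \<in> F\<close> that by (metis option.distinct(1))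
  next
    fix x :: "'k \<Rightarrow> nat \<Rightarrow> real" and b :: "'k \<Rightarrow> real"
    assume x: "\<And>k. k \<in> F \<Longrightarrow> supp (x k) \<subseteq> B k" and b: "\<And>k. k \<in> F \<Longrightarrow> 0 \<le> b k"
    have "(\<Sum>i\<in>I. (pair (h i) (\<lambda>a. \<Sum>k\<in>F. sqrt (b k) * x k a))\<^sup>2)
        \<le> (\<Sum>i\<in>I. \<Sum>k\<in>F. (sqrt (b k))\<^sup>2 * (pair (g i k) (x k))\<^sup>2)"
    proof (rule sum_mono)
      fix i assume "i \<in> I"
      from bspec[OF g this, THEN conjunct2, rule_format, of x "\<lambda>k. sqrt (b k)"] x
      show "(pair (h i) (\<lambda>a. \<Sum>k\<in>F. sqrt (b k) * x k a))\<^sup>2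
        \<le> (\<Sum>k\<in>F. (sqrt (b k))\<^sup>2 * (pair (g i k) (x k))\<^sup>2)" by blast
    qed
    also have "... = (\<Sum>k\<in>F. \<Sum>i\<in>I. (sqrt (b k))\<^sup>2 * (pair (g i k) (x k))\<^sup>2)" by (rule sum.swap)
    also have "... = (\<Sum>k\<in>F. b k * (\<Sum>i\<in>I. (pair (g i k) (x k))\<^sup>2))"
      by (rule sum.cong) (use b in \<open>simp_all add: sum_distrib_left\<close>)
    finally show "(\<Sum>i\<in>I. (pair (h i) (\<lambda>a. \<Sum>k\<in>F. sqrt (b k) * x k a))\<^sup>2) \<le> (\<Sum>k\<in>F. b k * (\<Sum>i\<in>I. (pair (g i k) (x k))\<^sup>2))" .
  qed
qed

lemma allowable_weights:
  assumes "allowable p I h" obtains w where "\<And>i. i \<in> I \<Longrightarrow> W (h i) (w i)"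
  using bchoice[of I "\<lambda>i w. W (h i) w"] allowableD(2)[OF assms] by blast

lemma norm_le_1_allowable:
  assumes "norm_le x C" "allowable 1 I h" shows "(\<Sum>i\<in>I. (pair (h i) x)\<^sup>2) \<le> 4 * C\<^sup>2"
  using square_boundD[OF norm_le_square_bound[OF assms(1), of 0]] assms(2) by simp

text \<open>A crude bound, exponential in the order of the family; it serves for members that begin
  inside a block, which happens on a small mass of blocks.\<close>

lemma new_sum_bound:
  assumes x: "norm_le x C" and a: "allowable p I h" and I': "I' \<subseteq> I"
    and D': "\<And>i. i \<in> I' \<Longrightarrow> D (g i)" and sub: "\<And>i. i \<in> I' \<Longrightarrow> supp (g i) \<subseteq> supp (h i)"
  shows "(\<Sum>i\<in>I'. (pair (g i) x)\<^sup>2) \<le> 4 ^ Suc p * C\<^sup>2"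
proof -
  have "allowable p I' g" by (rule allowable_shrink[OF allowable_subset[OF a I'] D' sub])
  from allowable_mono[OF this, of "Suc p"] have "allowable (Suc p) I' g" by simp
  from square_boundD[OF norm_le_square_bound[OF x] this] show ?thesis .
qed

text \<open>Each functional starting before a block only counts towards few functionals there; the
  remaining ones start inside the block, which happens for a small part of the average only.\<close>

lemma average_square_bound:
  assumes sa: "small_average p \<epsilon> F b r" and B: "disjoint_family_on (\<lambda>k. {s k..r k}) F"
    and x: "\<And>k. k \<in> F \<Longrightarrow> supp (x k) \<subseteq> {s k..r k}" and C: "\<And>k. k \<in> F \<Longrightarrow> norm_le (x k) C"
  shows "square_bound p (\<lambda>a. \<Sum>k\<in>F. sqrt (b k) * x k a) ((4 + \<epsilon> * 4 ^ Suc p) * C\<^sup>2)"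
  unfolding square_bound_def
proof (intro allI impI)
  fix A assume a: "allowable p A (\<lambda>f. f)"
  note sa' = small_averageD[OF sa]
  have fA: "finite A" by (rule allowableD(1)[OF a])
  obtain w where w: "\<And>f. f \<in> A \<Longrightarrow> W f (w f)" using allowable_weights[OF a] by blast
  obtain g where g: "\<And>i k. i \<in> A \<Longrightarrow> k \<in> F \<Longrightarrow> D (g i k)"
    "\<And>i k v. i \<in> A \<Longrightarrow> k \<in> F \<Longrightarrow> w i = Some v \<Longrightarrow> W (g i k) (Some v)"
    "\<And>i k. i \<in> A \<Longrightarrow> k \<in> F \<Longrightarrow> supp (g i k) \<subseteq> supp i \<inter> {s k..r k}"
    "\<And>x b. (\<And>k. k \<in> F \<Longrightarrow> supp (x k) \<subseteq> {s k..r k}) \<Longrightarrow> (\<And>k. k \<in> F \<Longrightarrow> 0 \<le> b k) \<Longrightarrow>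
      (\<Sum>i\<in>A. (pair i (\<lambda>a. \<Sum>k\<in>F. sqrt (b k) * x k a))\<^sup>2) \<le> (\<Sum>k\<in>F. b k * (\<Sum>i\<in>A. (pair (g i k) (x k))\<^sup>2))"
    using split_family[where I = A and h = "\<lambda>f. f" and w = w, OF w sa'(1) B] by blast
  let ?G = "{k\<in>F. \<exists>f\<in>A. s k \<le> Min (supp f) \<and> supp (g f k) \<noteq> {}}"
  have G: "r ` ?G \<in> mschreier p" by (rule allowable_new[OF a B g(3)])
  have "(\<Sum>f\<in>A. (pair f (\<lambda>a. \<Sum>k\<in>F. sqrt (b k) * x k a))\<^sup>2) \<le> (\<Sum>k\<in>F. b k * (\<Sum>f\<in>A. (pair (g f k) (x k))\<^sup>2))"
    by (rule g(4)) (use x sa'(2) in auto)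
  also have "... \<le> 4 * C\<^sup>2 + \<epsilon> * (4 ^ Suc p * C\<^sup>2 + 0 + 0)"
  proof (rule small_average_sum_le[OF sa, where ?G1.0 = ?G and ?G2.0 = "{}" and ?G3.0 = "{}"])
    fix k assume k: "k \<in> F"
    let ?O = "{f\<in>A. Min (supp f) < s k}" and ?N = "{f\<in>A. s k \<le> Min (supp f) \<and> supp (g f k) \<noteq> {}}"
    have sub: "supp (g f k) \<subseteq> supp f \<inter> {s k..}" if "f \<in> A" for f using g(3)[OF that k] by auto
    have "(\<Sum>f\<in>?O. (pair (g f k) (x k))\<^sup>2) \<le> 4 * C\<^sup>2"
      by (rule norm_le_1_allowable[OF C[OF k] allowable_old[OF a, where s = "s k"]])
        (use g(1)[OF _ k] sub in auto)
    moreover have "(\<Sum>f\<in>?N. (pair (g f k) (x k))\<^sup>2) \<le> of_bool (k \<in> ?G) * (4 ^ Suc p * C\<^sup>2)"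
    proof (cases "?N = {}")
      case False
      then have "k \<in> ?G" using k by blast
      moreover have "(\<Sum>f\<in>?N. (pair (g f k) (x k))\<^sup>2) \<le> 4 ^ Suc p * C\<^sup>2"
        by (rule new_sum_bound[OF C[OF k] a]) (use g(1)[OF _ k] g(3)[OF _ k] in auto)
      ultimately show ?thesis by simp
    next
      case True
      then show ?thesis unfolding True by simp
    qed
    moreover have "(\<Sum>f\<in>A. (pair (g f k) (x k))\<^sup>2)
        = (\<Sum>f\<in>?O. (pair (g f k) (x k))\<^sup>2) + (\<Sum>f\<in>?N. (pair (g f k) (x k))\<^sup>2)"
    proof -
      have "(\<Sum>f\<in>?O \<union> ?N. (pair (g f k) (x k))\<^sup>2) = (\<Sum>f\<in>A. (pair (g f k) (x k))\<^sup>2)"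
        using fA by (intro sum.mono_neutral_left) (auto simp: pair_def)
      then show ?thesis using fA by (subst (asm) sum.union_disjoint) auto
    qed
    ultimately show "(\<Sum>f\<in>A. (pair (g f k) (x k))\<^sup>2)
        \<le> 4 * C\<^sup>2 + of_bool (k \<in> ?G) * (4 ^ Suc p * C\<^sup>2) + of_bool (k \<in> {}) * 0 + of_bool (k \<in> {}) * 0"
      by simp
  qed (use G mschreier_empty in auto)
  finally show "(\<Sum>f\<in>A. (pair f (\<lambda>a. \<Sum>k\<in>F. sqrt (b k) * x k a))\<^sup>2) \<le> (4 + \<epsilon> * 4 ^ Suc p) * C\<^sup>2"
    by (simp add: distrib_right)
qed

section \<open>Rapidly increasing sequences\<close>

text \<open>At a given coordinate at most one child is nonzero, and its modulus there is at most
  1.\<close>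

lemma W_coordinate:
  assumes "W f (Some w)" shows "\<bar>f a\<bar> \<le> 1 / real w"
proof -
  from assms obtain i and J :: "nat set" and h l where c: "w = m i" "finite J" "\<And>j. j \<in> J \<Longrightarrow> D (h j)"
    "disjoint_family_on (\<lambda>j. supp (h j)) J" "(\<Sum>j\<in>J. (l j)\<^sup>2) \<le> 1"
    "f = (\<lambda>k. 1 / real (m i) * (\<Sum>j\<in>J. l j * h j k))"
    by (cases rule: W_cases) auto
  have "(\<Sum>j\<in>J. l j * h j a)\<^sup>2 \<le> (\<Sum>j\<in>J. (h j a)\<^sup>2)" by (rule sum_mult_square_le[OF c(5)])
  also have "... \<le> 1"
  proof (cases "\<exists>j\<in>J. a \<in> supp (h j)")
    case True
    then obtain j0 where j0: "j0 \<in> J" "a \<in> supp (h j0)" by blast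
    have "(\<Sum>j\<in>J. (h j a)\<^sup>2) = (\<Sum>j\<in>{j0}. (h j a)\<^sup>2)"
    proof (rule sum.mono_neutral_right)
      show "\<forall>j\<in>J - {j0}. (h j a)\<^sup>2 = 0"
        using c(4) j0 unfolding disjoint_family_on_def supp_def by fastforce
    qed (use j0 c(2) in auto)
    also have "... \<le> 1" using D_bounded[OF c(3)[OF j0(1)], of a] by (simp add: abs_square_le_1)
    finally show ?thesis .
  next
    case False
    then have "(\<Sum>j\<in>J. (h j a)\<^sup>2) = 0" by (intro sum.neutral) (auto simp: supp_def)
    then show ?thesis by simp
  qed
  finally have "\<bar>\<Sum>j\<in>J. l j * h j a\<bar> \<le> 1" by (simp add: abs_square_le_1)
  then show ?thesis unfolding c(6) using c(1) m_ge2[of i] by (simp add: abs_mult divide_right_mono)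
qed

lemma norm_le_coordinate:
  assumes "norm_le x C" "1 \<le> a" shows "\<bar>x a\<bar> \<le> C"
proof -
  let ?f = "\<lambda>i. if i = a then 1 else 0 :: real"
  have "D ?f" using wh_functional.unit[OF assms(2), of 1] by blast
  then have "\<bar>pair ?f x\<bar> \<le> C" using assms(1) unfolding norm_le_def by blast
  moreover have "supp ?f = {a}" by (auto simp: supp_def)
  ultimately show ?thesis by (simp add: pair_def)
qed

text \<open>A single functional is an allowable family of order 0, hence of every order.\<close>

lemma square_bound_norm_le:
  assumes "square_bound p x (C\<^sup>2)" "0 \<le> C" shows "norm_le x C"
  unfolding norm_le_def
proof (intro allI impI)
  fix f assume D: "D f"
  have "(\<lambda>g. Min (supp g)) ` {g\<in>{f}. supp g \<noteq> {}} \<in> mschreier 0"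
  proof (cases "supp f = {}")
    case False
    then have "{g\<in>{f}. supp g \<noteq> {}} = {f}" by auto
    moreover have "Min (supp f) \<noteq> 0" using D_Min[OF D False] D_0[OF D] by metis
    ultimately show ?thesis by simp
  next
    case True
    then have e: "{g\<in>{f}. supp g \<noteq> {}} = {}" by auto
    show ?thesis unfolding e by simp
  qed
  then have "allowable p {f} (\<lambda>f. f)"
    unfolding allowable_def using D mschreier_mono[of 0 p] by (auto simp: disjoint_family_on_def)
  then have "(pair f x)\<^sup>2 \<le> C\<^sup>2" using assms(1) unfolding square_bound_def by fastforce
  then show "\<bar>pair f x\<bar> \<le> C" using assms(2) by (simp add: abs_le_square_iff[symmetric])
qed

text \<open>The order \<open>n (q t - 1) + 1\<close> is that of the children of a first-order family
  with weights below \<open>m (q t)\<close>. The condition on \<open>r t ^ 3\<close> makes weights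
  from \<open>m (q (Suc t))\<close> on negligible on block \<open>t\<close>.\<close>

definition rapid :: "(nat \<Rightarrow> nat) \<Rightarrow> (nat \<Rightarrow> nat) \<Rightarrow> (nat \<Rightarrow> nat) \<Rightarrow> (nat \<Rightarrow> nat \<Rightarrow> real) \<Rightarrow> real \<Rightarrow> bool" where
  "rapid s r q x C \<longleftrightarrow> 0 \<le> C \<and> 1 \<le> s 0 \<and> (\<forall>t. s t \<le> r t \<and> r t < s (Suc t)) \<and>
    (\<forall>t. 3 \<le> q t \<and> q t < q (Suc t) \<and> r t ^ 3 \<le> m (q (Suc t))) \<and>
    (\<forall>t. supp (x t) \<subseteq> {s t..r t} \<and> square_bound (n (q t - 1) + 1) (x t) (C\<^sup>2))"

lemma rapidD:
  assumes "rapid s r q x C"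
  shows "0 \<le> C" "1 \<le> s 0" "s t \<le> r t" "r t < s (Suc t)" "3 \<le> q t" "q t < q (Suc t)"
    "r t ^ 3 \<le> m (q (Suc t))" "supp (x t) \<subseteq> {s t..r t}" "square_bound (n (q t - 1) + 1) (x t) (C\<^sup>2)"
    "norm_le (x t) C"
  using assms square_bound_norm_le unfolding rapid_def by blast+

lemma blocks_disjoint:
  assumes "\<And>t. s t \<le> r t" "\<And>t. r t < s (Suc t)"
  shows "disjoint_family_on (\<lambda>t. {s t..r t}) F" and "strict_mono s" and "strict_mono r"
proof -
  have "s t < s (Suc t)" for t using assms(1)[of t] assms(2)[of t] by simp
  then show sm: "strict_mono s" by (simp add: strict_mono_Suc_iff)
  have "r t < r (Suc t)" for t using assms(1)[of "Suc t"] assms(2)[of t] by simp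
  then show "strict_mono r" by (simp add: strict_mono_Suc_iff)
  have lt: "{s t..r t} \<inter> {s t'..r t'} = {}" if "t < t'" for t t'
  proof -
    have "s (Suc t) \<le> s t'" using sm that by (simp add: strict_mono_less_eq)
    then show ?thesis using assms(2)[of t] by auto
  qed
  show "disjoint_family_on (\<lambda>t. {s t..r t}) F"
    unfolding disjoint_family_on_def
  proof (intro ballI impI)
    fix t t' :: nat assume "t \<noteq> t'"
    then show "{s t..r t} \<inter> {s t'..r t'} = {}" using lt[of t t'] lt[of t' t] by (cases "t < t'") auto
  qed
qed

text \<open>For a block \<open>t\<close>, the members that begin before it and meet it are sorted by
  weight. Below \<open>m (q t)\<close> their children are covered by the square bound on
  \<open>x t\<close>, with a gain of \<open>1 / m s1\<close> squared. From
  \<open>m (q (Suc t))\<close> on, their coordinates are too small. In between, each member falls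
  into the window of one \<open>t\<close> only. Such blocks, and those in which a member begins,
  have small mass.\<close>

lemma rapid_heavy:
  assumes R: "rapid s r q x C" and sa: "small_average p \<epsilon> F b r"
    and le: "\<And>t. t \<in> F \<Longrightarrow> s1 \<le> q t" and eps: "\<epsilon> * 4 ^ Suc p * (real (m s1))\<^sup>2 \<le> 1"
    and a: "allowable p I h" and hv: "\<And>i. i \<in> I \<Longrightarrow> heavy s1 (h i)"
  shows "(\<Sum>i\<in>I. (pair (h i) (\<lambda>a. \<Sum>t\<in>F. sqrt (b t) * x t a))\<^sup>2) \<le> 4 * C\<^sup>2 / (real (m s1))\<^sup>2"
proof -
  note R' = rapidD[OF R] and sa' = small_averageD[OF sa]
  define M where "M = (real (m s1))\<^sup>2"
  have M: "4 \<le> M" unfolding M_def using m_ge2[of s1] power_mono[of 2 "real (m s1)" 2] by simp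
  have fI: "finite I" by (rule allowableD(1)[OF a])
  have bd: "disjoint_family_on (\<lambda>t. {s t..r t}) F" "strict_mono s"
    by (rule blocks_disjoint[of s r]; rule R')+
  have spos: "1 \<le> s t" for t
  proof -
    have "s 0 \<le> s t" using bd(2) by (simp add: strict_mono_less_eq)
    then show ?thesis using R'(2) by simp
  qed
  have "strict_mono q" using R'(6) by (simp add: strict_mono_Suc_iff)
  then have qmono: "q t \<le> q t'" if "t \<le> t'" for t t' using that by (simp add: strict_mono_less_eq)
  have "\<forall>i\<in>I. \<exists>w. W (h i) w \<and> (\<forall>v. w = Some v \<longrightarrow> m s1 \<le> v)" using hv unfolding heavy_def by fastforce
  from bchoice[OF this] obtain w where w: "\<forall>i\<in>I. W (h i) (w i) \<and> (\<forall>v. w i = Some v \<longrightarrow> m s1 \<le> v)" ..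
  obtain g where g: "\<And>i k. i \<in> I \<Longrightarrow> k \<in> F \<Longrightarrow> D (g i k)"
    "\<And>i k v. i \<in> I \<Longrightarrow> k \<in> F \<Longrightarrow> w i = Some v \<Longrightarrow> W (g i k) (Some v)"
    "\<And>i k. i \<in> I \<Longrightarrow> k \<in> F \<Longrightarrow> supp (g i k) \<subseteq> supp (h i) \<inter> {s k..r k}"
    "\<And>x b. (\<And>k. k \<in> F \<Longrightarrow> supp (x k) \<subseteq> {s k..r k}) \<Longrightarrow> (\<And>k. k \<in> F \<Longrightarrow> 0 \<le> b k) \<Longrightarrow>
      (\<Sum>i\<in>I. (pair (h i) (\<lambda>a. \<Sum>k\<in>F. sqrt (b k) * x k a))\<^sup>2) \<le> (\<Sum>k\<in>F. b k * (\<Sum>i\<in>I. (pair (g i k) (x k))\<^sup>2))"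
    using split_family[where I = I and h = h and w = w, OF _ sa'(1) bd(1)] w by blast
  define N where "N t = {i\<in>I. s t \<le> Min (supp (h i)) \<and> supp (g i t) \<noteq> {}}" for t
  define Old where "Old t = {i\<in>I. Min (supp (h i)) < s t \<and> supp (g i t) \<noteq> {}}" for t
  \<comment> \<open>A unit functional that begins before the block has no support in it, so every
    old member that meets the block carries a weight.\<close>
  have Ow: "\<exists>v. w i = Some v" if i: "i \<in> Old t" "t \<in> F" for i t
  proof (cases "w i")
    case None
    have iI: "i \<in> I" using i by (simp add: Old_def)
    have "W (h i) None" using w iI None by metis
    then obtain k where k: "supp (h i) = {k}" by (cases rule: W_cases) auto
    then have "k < s t" using i by (simp add: Old_def)
    moreover have "supp (g i t) \<subseteq> {k} \<inter> {s t..r t}" using g(3)[OF iI i(2)] k by simp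
    ultimately have "supp (g i t) = {}" by auto
    then show ?thesis using i by (simp add: Old_def)
  qed simp
  define O1 where "O1 t = {i\<in>Old t. the (w i) < m (q t)}" for t
  define O2 where "O2 t = {i\<in>Old t. m (q t) \<le> the (w i) \<and> the (w i) < m (q (Suc t))}" for t
  define O3 where "O3 t = {i\<in>Old t. m (q (Suc t)) \<le> the (w i)}" for t
  let ?G1 = "{t\<in>F. \<exists>i\<in>I. s t \<le> Min (supp (h i)) \<and> supp (g i t) \<noteq> {}}"
  let ?G2 = "{t\<in>F. O2 t \<noteq> {}}"
  have G1: "r ` ?G1 \<in> mschreier p" by (rule allowable_new[OF a bd(1) g(3)])
  have G2: "r ` ?G2 \<in> mschreier p"
  proof (rule allowable_marks[OF a, where P = "\<lambda>i t. i \<in> O2 t"])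
    fix t assume "t \<in> ?G2"
    then obtain i where t: "t \<in> F" and i: "i \<in> O2 t" by blast
    then have iO: "i \<in> I" "supp (g i t) \<noteq> {}" "Min (supp (h i)) < s t" by (auto simp: O2_def Old_def)
    have "supp (h i) \<noteq> {}" using g(3)[OF iO(1) t] iO(2) by blast
    then show "\<exists>i\<in>I. i \<in> O2 t \<and> supp (h i) \<noteq> {} \<and> Min (supp (h i)) \<le> r t"
      using i iO R'(3)[of t] by (intro bexI[of _ i]) auto
  next
    fix i t t' assume tt: "t \<in> ?G2" "t' \<in> ?G2" "i \<in> O2 t" "i \<in> O2 t'"
    have "\<not> t < t'" if "i \<in> O2 t" "i \<in> O2 t'" for t t'
    proof
      assume "t < t'"
      then have "m (q (Suc t)) \<le> m (q t')" by (intro m_mono qmono) simp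
      then show False using that by (auto simp: O2_def)
    qed
    then show "t = t'" using tt by (metis linorder_neqE_nat)
  qed
  have "(\<Sum>i\<in>I. (pair (h i) (\<lambda>a. \<Sum>t\<in>F. sqrt (b t) * x t a))\<^sup>2) \<le> (\<Sum>t\<in>F. b t * (\<Sum>i\<in>I. (pair (g i t) (x t))\<^sup>2))"
    by (rule g(4)) (use R'(8) sa'(2) in auto)
  also have "... \<le> 2 * (C\<^sup>2 / M) + \<epsilon> * (4 ^ Suc p * C\<^sup>2 + 4 * C\<^sup>2 + 0)"
  proof (rule small_average_sum_le[OF sa, where ?G1.0 = ?G1 and ?G2.0 = ?G2 and ?G3.0 = "{}"])
    fix t assume t: "t \<in> F"
    have OI: "Old t \<subseteq> I" "O1 t \<subseteq> Old t" "O2 t \<subseteq> Old t" "O3 t \<subseteq> Old t" by (auto simp: Old_def O1_def O2_def O3_def)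
    have sub: "supp (g i t) \<subseteq> supp (h i) \<inter> {s t..}" if "i \<in> I" for i using g(3)[OF that t] by auto
    have old: "allowable 1 I' (\<lambda>i. g i t)" if I': "I' \<subseteq> Old t" for I'
    proof (rule allowable_old[OF a, where s = "s t"])
      show "I' \<subseteq> I" using I' OI by blast
      fix i assume "i \<in> I'"
      then have "i \<in> I" "Min (supp (h i)) < s t" using I' by (auto simp: Old_def)
      then show "D (g i t)" "supp (g i t) \<subseteq> supp (h i) \<inter> {s t..}" "Min (supp (h i)) < s t"
        using g(1)[OF _ t] sub by blast+
    qed
    have 1: "(\<Sum>i\<in>O1 t. (pair (g i t) (x t))\<^sup>2) \<le> C\<^sup>2 / M"
    proof -
      have "\<exists>v. m s1 \<le> v \<and> v < m (Suc (q t - 1)) \<and> W (g i t) (Some v)" if i: "i \<in> O1 t" for i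
      proof -
        have iI: "i \<in> I" "i \<in> Old t" using i OI by blast+
        obtain v where v: "w i = Some v" using Ow[OF iI(2) t] by blast
        have "m s1 \<le> v" using w iI v by blast
        moreover have "v < m (Suc (q t - 1))" using i v R'(5)[of t] by (simp add: O1_def)
        ultimately show ?thesis using g(2)[OF iI(1) t v] by blast
      qed
      from allowable_children[OF old[OF OI(2)] this] obtain J :: "_ \<Rightarrow> nat set" and u where
        J: "allowable (1 + n (q t - 1)) (Sigma (O1 t) J) (\<lambda>z. u (fst z) (snd z))"
        "\<forall>x. (\<Sum>i\<in>O1 t. (pair (g i t) x)\<^sup>2) \<le> (\<Sum>z\<in>Sigma (O1 t) J. (pair (u (fst z) (snd z)) x)\<^sup>2) / (real (m s1))\<^sup>2"
        by blast
      have "(\<Sum>z\<in>Sigma (O1 t) J. (pair (u (fst z) (snd z)) (x t))\<^sup>2) \<le> C\<^sup>2"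
        by (rule square_boundD[OF R'(9)[of t]]) (use J(1) in simp)
      then have "(\<Sum>z\<in>Sigma (O1 t) J. (pair (u (fst z) (snd z)) (x t))\<^sup>2) / M \<le> C\<^sup>2 / M"
        using M by (intro divide_right_mono) auto
      then show ?thesis using J(2)[rule_format, of "x t"] unfolding M_def by linarith
    qed
    have 2: "(\<Sum>i\<in>O2 t. (pair (g i t) (x t))\<^sup>2) \<le> of_bool (t \<in> ?G2) * (4 * C\<^sup>2)"
    proof (cases "O2 t = {}")
      case False
      then show ?thesis using norm_le_1_allowable[OF R'(10)[of t] old[OF OI(3)]] t by simp
    qed simp
    \<comment> \<open>At most \<open>r t\<close> functionals, with coordinates of modulus at most
      \<open>1 / ?Q\<close>, are summed over at most \<open>r t\<close> coordinates. The resulting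
      cube of \<open>r t\<close> is absorbed by one of the two powers of \<open>?Q\<close>.\<close>
    have 3: "(\<Sum>i\<in>O3 t. (pair (g i t) (x t))\<^sup>2) \<le> C\<^sup>2 / M"
    proof -
      let ?Q = "real (m (q (Suc t)))"
      have Q0: "0 < ?Q" using m_ge2[of "q (Suc t)"] by simp
      have each: "(pair (g i t) (x t))\<^sup>2 \<le> (real (r t) * C / ?Q)\<^sup>2" if i: "i \<in> O3 t" for i
      proof -
        have iI: "i \<in> I" "i \<in> Old t" using i OI by blast+
        obtain v where v: "w i = Some v" using Ow[OF iI(2) t] by blast
        have Wv: "W (g i t) (Some v)" by (rule g(2)[OF iI(1) t v])
        have vQ: "?Q \<le> real v" using i v by (simp add: O3_def)
        have "pair (g i t) (x t) = (\<Sum>k\<in>{s t..r t}. g i t k * x t k)"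
          by (rule pair_superset) (use g(3)[OF iI(1) t] in auto)
        then have "\<bar>pair (g i t) (x t)\<bar> \<le> (\<Sum>k\<in>{s t..r t}. \<bar>g i t k\<bar> * \<bar>x t k\<bar>)"
          using sum_abs[of "\<lambda>k. g i t k * x t k" "{s t..r t}"] by (simp add: abs_mult)
        also have "... \<le> (\<Sum>k\<in>{s t..r t}. 1 / ?Q * C)"
        proof (rule sum_mono, rule mult_mono)
          fix k assume k: "k \<in> {s t..r t}"
          have "\<bar>g i t k\<bar> \<le> 1 / real v" by (rule W_coordinate[OF Wv])
          also have "... \<le> 1 / ?Q" using vQ Q0 by (simp add: frac_le)
          finally show "\<bar>g i t k\<bar> \<le> 1 / ?Q" .
          show "\<bar>x t k\<bar> \<le> C" by (rule norm_le_coordinate[OF R'(10)]) (use k spos[of t] in simp)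
        qed (use Q0 in auto)
        also have "... = real (card {s t..r t}) * (C / ?Q)" by simp
        also have "... \<le> real (r t) * (C / ?Q)"
          using spos[of t] R'(1) Q0 by (intro mult_right_mono) auto
        finally have "\<bar>pair (g i t) (x t)\<bar> \<le> real (r t) * C / ?Q" by simp
        then show ?thesis using R'(1) Q0 by (simp add: abs_le_square_iff[symmetric])
      qed
      have card: "card (O3 t) \<le> r t"
      proof -
        have fin: "finite (O3 t)" using fI OI by (meson finite_subset)
        have "card (O3 t) = card ((\<lambda>i. Min (supp (h i))) ` O3 t)"
        proof (rule card_image[symmetric], rule inj_on_subset[OF allowable_inj_Min[OF a]], rule subsetI)
          fix i assume i: "i \<in> O3 t"
          then have "i \<in> I" "supp (g i t) \<noteq> {}" by (auto simp: O3_def Old_def)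
          then show "i \<in> {i\<in>I. supp (h i) \<noteq> {}}" using g(3)[OF _ t, of i] by blast
        qed
        also have "... \<le> card {..<s t}" by (rule card_mono) (auto simp: O3_def Old_def)
        finally show ?thesis using R'(3)[of t] by simp
      qed
      have "(\<Sum>i\<in>O3 t. (pair (g i t) (x t))\<^sup>2) \<le> real (card (O3 t)) * (real (r t) * C / ?Q)\<^sup>2"
        using sum_mono[of "O3 t", OF each] by simp
      also have "... \<le> real (r t) * (real (r t) * C / ?Q)\<^sup>2" using card by (intro mult_right_mono) auto
      also have "... = real (r t ^ 3) * C\<^sup>2 / ?Q\<^sup>2"
        by (simp add: power_mult_distrib power_divide power2_eq_square power3_eq_cube)
      also have "... \<le> ?Q * C\<^sup>2 / ?Q\<^sup>2"
        using R'(7)[of t] by (intro divide_right_mono mult_right_mono) (auto simp del: of_nat_power)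
      also have "... = C\<^sup>2 / ?Q" using Q0 by (simp add: power2_eq_square)
      also have "... \<le> C\<^sup>2 / M"
      proof (rule divide_left_mono)
        have "m s1 ^ 2 \<le> m (q t) ^ 2" using m_mono[OF le[OF t]] by (intro power_mono) auto
        also have "... \<le> m (q t) ^ 3" using m_ge2[of "q t"] by (intro power_increasing) auto
        also have "... \<le> m (Suc (q t))" using R'(5)[of t] by (intro m_cube) simp
        also have "... \<le> m (q (Suc t))" using R'(6)[of t] by (intro m_mono) simp
        finally have "real (m s1 ^ 2) \<le> ?Q" by (simp only: of_nat_le_iff)
        then show "M \<le> ?Q" unfolding M_def by simp
      qed (use Q0 M in auto)
      finally show ?thesis .
    qed
    have 4: "(\<Sum>i\<in>N t. (pair (g i t) (x t))\<^sup>2) \<le> of_bool (t \<in> ?G1) * (4 ^ Suc p * C\<^sup>2)"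
    proof (cases "N t = {}")
      case False
      then have "t \<in> ?G1" using t by (auto simp: N_def)
      moreover have "(\<Sum>i\<in>N t. (pair (g i t) (x t))\<^sup>2) \<le> 4 ^ Suc p * C\<^sup>2"
        by (rule new_sum_bound[OF R'(10)[of t] a]) (use g(1)[OF _ t] g(3)[OF _ t] in \<open>auto simp: N_def\<close>)
      ultimately show ?thesis by simp
    qed simp
    have "(\<Sum>i\<in>I. (pair (g i t) (x t))\<^sup>2) = (\<Sum>i\<in>N t \<union> (O1 t \<union> (O2 t \<union> O3 t)). (pair (g i t) (x t))\<^sup>2)"
      using fI by (intro sum.mono_neutral_right) (auto simp: pair_def N_def Old_def O1_def O2_def O3_def)
    also have "... = (\<Sum>i\<in>N t. (pair (g i t) (x t))\<^sup>2) + ((\<Sum>i\<in>O1 t. (pair (g i t) (x t))\<^sup>2)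
        + ((\<Sum>i\<in>O2 t. (pair (g i t) (x t))\<^sup>2) + (\<Sum>i\<in>O3 t. (pair (g i t) (x t))\<^sup>2)))"
    proof -
      have fin: "finite (N t)" "finite (O1 t)" "finite (O2 t)" "finite (O3 t)"
        using fI by (simp_all add: N_def Old_def O1_def O2_def O3_def)
      have q: "m (q t) \<le> m (q (Suc t))" using R'(6)[of t] by (intro m_mono) simp
      have "O2 t \<inter> O3 t = {}" "O1 t \<inter> (O2 t \<union> O3 t) = {}" "N t \<inter> (O1 t \<union> (O2 t \<union> O3 t)) = {}"
        using q by (auto simp: N_def Old_def O1_def O2_def O3_def)
      then show ?thesis using fin by (simp add: sum.union_disjoint)
    qed
    finally show "(\<Sum>i\<in>I. (pair (g i t) (x t))\<^sup>2) \<le> 2 * (C\<^sup>2 / M) + of_bool (t \<in> ?G1) * (4 ^ Suc p * C\<^sup>2)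
        + of_bool (t \<in> ?G2) * (4 * C\<^sup>2) + of_bool (t \<in> {}) * 0"
      using 1 2 3 4 by simp
  qed (use G1 G2 mschreier_empty in auto)
  \<comment> \<open>Two units come from the light and the very heavy weights; the two exceptional
    sets of blocks add at most one unit each.\<close>
  also have "... \<le> 4 * C\<^sup>2 / M"
  proof -
    have "\<epsilon> * 4 ^ Suc p \<le> 1 / M" using eps M unfolding M_def[symmetric] by (subst pos_le_divide_eq) auto
    moreover have "\<epsilon> * 4 \<le> \<epsilon> * 4 ^ Suc p" using sa'(5) by (intro mult_left_mono) auto
    ultimately have "(\<epsilon> * 4 ^ Suc p + \<epsilon> * 4) * C\<^sup>2 \<le> (2 / M) * C\<^sup>2" by (intro mult_right_mono) auto
    then show ?thesis by (simp add: algebra_simps)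
  qed
  finally show ?thesis unfolding M_def .
qed

text \<open>Members of weight at least \<open>m k\<close> are handled by \<open>rapid_heavy\<close>.
  Lighter ones are expanded \<open>L\<close> times with \<open>2 ^ L \<ge> m k\<close>, which brings
  the trivial bound \<open>5 * C^2\<close> down to the same size; the gap between
  \<open>n (k - 1)\<close> and \<open>n k\<close> provides the orders. The constant is 2 * 4 +
  5.\<close>

lemma rapid_average_bound:
  assumes R: "rapid s r q x C" and k: "2 \<le> k" and sa: "small_average (n k - 1) \<epsilon> F b r"
    and le: "\<And>t. t \<in> F \<Longrightarrow> Suc k \<le> q t" and eps: "\<epsilon> * 4 ^ n k * (real (m (Suc k)))\<^sup>2 \<le> 1"
  shows "square_bound (2 * n (k - 1) + 1) (\<lambda>a. \<Sum>t\<in>F. sqrt (b t) * x t a) (13 * C\<^sup>2 / (real (m k))\<^sup>2)"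
proof -
  note R' = rapidD[OF R] and sa' = small_averageD[OF sa]
  define M where "M = (real (m k))\<^sup>2"
  have M: "4 \<le> M" unfolding M_def using m_ge2[of k] power_mono[of 2 "real (m k)" 2] by simp
  have nk: "Suc (n k - 1) = n k" using n_pos[of k] by simp
  have bd: "disjoint_family_on (\<lambda>t. {s t..r t}) F"
    by (rule blocks_disjoint[of s r]; rule R')
  have "M \<le> (real (m (Suc k)))\<^sup>2" unfolding M_def using m_mono[of k "Suc k"] by (intro power_mono) auto
  then have "\<epsilon> * 4 ^ n k * M \<le> \<epsilon> * 4 ^ n k * (real (m (Suc k)))\<^sup>2"
    using sa'(5) by (intro mult_left_mono) auto
  then have epsM: "\<epsilon> * 4 ^ n k * M \<le> 1" using eps by simp
  have "\<epsilon> * 4 ^ n k * 1 \<le> \<epsilon> * 4 ^ n k * M" using M sa'(5) by (intro mult_left_mono) auto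
  then have eps1: "\<epsilon> * 4 ^ n k \<le> 1" using epsM by simp
  have "square_bound (n k - 1) (\<lambda>a. \<Sum>t\<in>F. sqrt (b t) * x t a) ((4 + \<epsilon> * 4 ^ Suc (n k - 1)) * C\<^sup>2)"
    by (rule average_square_bound[OF sa bd R'(8) R'(10)])
  moreover have "(4 + \<epsilon> * 4 ^ Suc (n k - 1)) * C\<^sup>2 \<le> 5 * C\<^sup>2"
    unfolding nk using eps1 by (intro mult_right_mono) auto
  ultimately have K: "square_bound (n k - 1) (\<lambda>a. \<Sum>t\<in>F. sqrt (b t) * x t a) (5 * C\<^sup>2)"
    using square_bound_mono by blast
  obtain L where L: "m k \<le> 2 ^ L" "2 ^ L \<le> 2 * m k"
    using power_two_between[of "m k"] m_ge2[of k] by auto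
  \<comment> \<open>\<open>Suc L\<close> instead of \<open>L\<close> reserves the order
    \<open>2 * n (k - 1) + 1\<close> at which the expansion starts.\<close>
  have "2 ^ Suc L \<le> m k ^ 3"
  proof -
    have "2 ^ Suc L \<le> (2 * 2) * m k" using L(2) by simp
    also have "... \<le> (m k * m k) * m k" by (intro mult_right_mono mult_mono m_ge2) auto
    finally show ?thesis by (simp add: power3_eq_cube)
  qed
  from n_gap_levels[OF k this] have g: "(2 * n (k - 1) + 1) + L * n (k - 1) \<le> n k - 1"
    by (simp add: algebra_simps)
  have "square_bound (2 * n (k - 1) + 1) (\<lambda>a. \<Sum>t\<in>F. sqrt (b t) * x t a) (2 * (4 * C\<^sup>2 / M) + 5 * C\<^sup>2 / 4 ^ L)"
  proof (rule square_bound_expand[OF K _ _ _ _ g])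
    fix A assume A: "allowable (n k - 1) A (\<lambda>f. f)" "\<forall>f\<in>A. heavy k f"
    show "(\<Sum>f\<in>A. (pair f (\<lambda>a. \<Sum>t\<in>F. sqrt (b t) * x t a))\<^sup>2) \<le> 4 * C\<^sup>2 / M"
      unfolding M_def
    proof (rule rapid_heavy[OF R sa _ _ A(1)])
      show "k \<le> q t" if "t \<in> F" for t using le[OF that] by simp
      show "\<epsilon> * 4 ^ Suc (n k - 1) * (real (m k))\<^sup>2 \<le> 1" unfolding nk using epsM by (simp add: M_def)
    qed (use A(2) in blast)
  qed (use M k in auto)
  moreover have "5 * C\<^sup>2 / 4 ^ L \<le> 5 * C\<^sup>2 / M"
  proof (rule divide_left_mono)
    have "real (m k) \<le> 2 ^ L" using L(1) by (metis of_nat_le_iff of_nat_numeral of_nat_power)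
    then have "M \<le> (2 ^ L)\<^sup>2" unfolding M_def by (intro power_mono) auto
    also have "(2 ^ L)\<^sup>2 = (4::real) ^ L" by (simp add: power2_eq_square power_mult_distrib[symmetric])
    finally show "M \<le> 4 ^ L" .
  qed (use M in auto)
  ultimately show ?thesis unfolding M_def by (elim square_bound_mono) (auto simp: field_simps)
qed

text \<open>Excluding the weight \<open>m k\<close> gains a further factor \<open>1 / m s0\<close>,
  squared. Lighter members are replaced by their children, whose order is still one at which the
  average is known to be of size \<open>C / m k\<close>. Heavier ones have weight at least
  \<open>m (Suc k) \<ge> m k ^ 3\<close>, where \<open>rapid_heavy\<close> suffices. The constant is
  13 + 4.\<close>

lemma rapid_average_weights:
  fixes h :: "'i \<Rightarrow> nat \<Rightarrow> real"
  assumes R: "rapid s r q x C" and k: "2 \<le> k" and sa: "small_average (n k - 1) \<epsilon> F b r"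
    and le: "\<And>t. t \<in> F \<Longrightarrow> Suc k \<le> q t" and eps: "\<epsilon> * 4 ^ n k * (real (m (Suc k)))\<^sup>2 \<le> 1"
    and a: "allowable (n (k - 1) + 1) I h" and s0: "s0 \<le> k"
    and w: "\<And>i. i \<in> I \<Longrightarrow> \<exists>w. m s0 \<le> w \<and> w \<noteq> m k \<and> W (h i) (Some w)"
  shows "(\<Sum>i\<in>I. (pair (h i) (\<lambda>a. \<Sum>t\<in>F. sqrt (b t) * x t a))\<^sup>2) \<le> 17 * C\<^sup>2 / ((real (m k))\<^sup>2 * (real (m s0))\<^sup>2)"
proof -
  note sa' = small_averageD[OF sa]
  define y where "y = (\<lambda>a. \<Sum>t\<in>F. sqrt (b t) * x t a)"
  define I1 where "I1 = {i\<in>I. \<exists>w. m s0 \<le> w \<and> w < m k \<and> W (h i) (Some w)}"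
  have nk: "Suc (n k - 1) = n k" using n_pos[of k] by simp
  have fI: "finite I" by (rule allowableD(1)[OF a])
  have I12: "I1 \<subseteq> I" "I - I1 \<subseteq> I" by (auto simp: I1_def)
  have pos: "0 < real (m k)" "0 < real (m s0)" "0 < real (m (Suc k))"
    using m_ge2[of k] m_ge2[of s0] m_ge2[of "Suc k"] by simp_all
  have "(\<Sum>i\<in>I1. (pair (h i) y)\<^sup>2) \<le> 13 * C\<^sup>2 / (real (m k))\<^sup>2 / (real (m s0))\<^sup>2"
  proof -
    have "\<exists>w. m s0 \<le> w \<and> w < m (Suc (k - 1)) \<and> W (h i) (Some w)" if "i \<in> I1" for i
      using that k by (simp add: I1_def)
    from allowable_children[OF allowable_subset[OF a I12(1)] this] obtain J :: "_ \<Rightarrow> nat set" and u where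
      J: "allowable (n (k - 1) + 1 + n (k - 1)) (Sigma I1 J) (\<lambda>z. u (fst z) (snd z))"
      "\<forall>x. (\<Sum>i\<in>I1. (pair (h i) x)\<^sup>2) \<le> (\<Sum>z\<in>Sigma I1 J. (pair (u (fst z) (snd z)) x)\<^sup>2) / (real (m s0))\<^sup>2"
      by blast
    have J': "allowable (2 * n (k - 1) + 1) (Sigma I1 J) (\<lambda>z. u (fst z) (snd z))"
      by (rule allowable_mono[OF J(1)]) simp
    have "(\<Sum>z\<in>Sigma I1 J. (pair (u (fst z) (snd z)) y)\<^sup>2) \<le> 13 * C\<^sup>2 / (real (m k))\<^sup>2"
      unfolding y_def by (rule square_boundD[OF rapid_average_bound[OF R k sa le eps] J'])
    then have "(\<Sum>z\<in>Sigma I1 J. (pair (u (fst z) (snd z)) y)\<^sup>2) / (real (m s0))\<^sup>2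
        \<le> 13 * C\<^sup>2 / (real (m k))\<^sup>2 / (real (m s0))\<^sup>2" by (intro divide_right_mono) auto
    then show ?thesis using J(2)[rule_format, of y] by linarith
  qed
  moreover have "(\<Sum>i\<in>I - I1. (pair (h i) y)\<^sup>2) \<le> 4 * C\<^sup>2 / (real (m k))\<^sup>2 / (real (m s0))\<^sup>2"
  proof -
    have "2 ^ 0 \<le> m k ^ 3" using m_ge2[of k] by simp
    from n_gap_levels[OF k this] have "n (k - 1) + 1 \<le> n k - 1" by simp
    then have a2: "allowable (n k - 1) (I - I1) h"
      by (rule allowable_mono[OF allowable_subset[OF a I12(2)]])
    have hv: "heavy (Suc k) (h i)" if i: "i \<in> I - I1" for i
    proof -
      obtain w where w: "m s0 \<le> w" "w \<noteq> m k" "W (h i) (Some w)" using w i by blast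
      then have "m k < w" using i by (metis (mono_tags, lifting) DiffE I1_def linorder_neqE_nat mem_Collect_eq)
      moreover obtain j where j: "w = m j" using W_weight[OF w(3)] by blast
      ultimately have "\<not> j \<le> k" using m_mono[of j k] by auto
      then have "m (Suc k) \<le> w" unfolding j by (intro m_mono) simp
      then show ?thesis unfolding heavy_def using w(3) by blast
    qed
    have "(\<Sum>i\<in>I - I1. (pair (h i) y)\<^sup>2) \<le> 4 * C\<^sup>2 / (real (m (Suc k)))\<^sup>2"
      unfolding y_def by (rule rapid_heavy[OF R sa le _ a2 hv]) (use eps nk in simp_all)
    also have "... \<le> 4 * C\<^sup>2 / (real (m k) * real (m s0))\<^sup>2"
    proof (rule divide_left_mono)
      have "m k * m s0 \<le> m k * m k * m k"
        using m_mono[OF s0] m_ge2[of k] by (simp add: mult_le_mono)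
      also have "... \<le> m (Suc k)" using m_cube[OF k] by (simp add: power3_eq_cube)
      finally have "real (m k * m s0) \<le> real (m (Suc k))" by (simp only: of_nat_le_iff)
      then show "(real (m k) * real (m s0))\<^sup>2 \<le> (real (m (Suc k)))\<^sup>2" by (intro power_mono) auto
    qed (use pos in auto)
    finally show ?thesis by (simp add: power_mult_distrib)
  qed
  moreover have "(\<Sum>i\<in>I. (pair (h i) y)\<^sup>2) = (\<Sum>i\<in>I1. (pair (h i) y)\<^sup>2) + (\<Sum>i\<in>I - I1. (pair (h i) y)\<^sup>2)"
    using fI I12(1) by (simp add: sum.subset_diff add.commute)
  moreover have "13 * C\<^sup>2 / (real (m k))\<^sup>2 / (real (m s0))\<^sup>2 + 4 * C\<^sup>2 / (real (m k))\<^sup>2 / (real (m s0))\<^sup>2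
      = 17 * C\<^sup>2 / ((real (m k))\<^sup>2 * (real (m s0))\<^sup>2)"
    by (simp add: add_divide_distrib[symmetric])
  ultimately show ?thesis unfolding y_def by linarith
qed

text \<open>The bound of \<open>repeated_averages\<close> is inversely proportional to the first
  starting point, so every late enough starting index works. This freedom lets averages be placed
  beyond any given position.\<close>

lemma small_average_exists:
  assumes sr: "\<And>k. s k \<le> r k" and rs: "\<And>k. r k < s (Suc k)" and s0: "1 \<le> s 0" and \<epsilon>: "0 < \<epsilon>" and p: "1 \<le> p"
  shows "\<exists>K. \<forall>K'\<ge>K. \<exists>K'' b. K' < K'' \<and> s ` {K'..<K''} \<in> schreier p \<and> small_average (p - 1) \<epsilon> {K'..<K''} b r"
proof -
  obtain p' where p': "p = Suc p'" using p by (cases p) auto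
  have sm: "strict_mono s" using blocks_disjoint(2)[of s r] sr rs by blast
  obtain K :: nat where K: "3 ^ p / \<epsilon> \<le> real K" using real_arch_simple by blast
  show ?thesis
  proof (rule exI[of _ K], intro allI impI)
    fix K' assume K': "K \<le> K'"
    obtain K'' b where b: "K' < K''" "\<forall>k. 0 \<le> b k" "(\<Sum>k\<in>{K'..<K''}. b k) = (1::real)"
      "s ` {K'..<K''} \<in> schreier p"
      "\<forall>G\<subseteq>{K'..<K''}. r ` G \<in> mschreier p' \<longrightarrow> (\<Sum>k\<in>G. b k) \<le> 3 ^ p / real (s K')"
      using repeated_averages[OF sr rs s0, of K' p'] unfolding p' by blast
    have "3 ^ p / \<epsilon> \<le> real (s K')" using K K' strict_mono_imp_increasing[OF sm, of K'] by linarith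
    moreover have "0 < real (s K')"
      using calculation \<epsilon> by (smt (verit) divide_pos_pos zero_less_power)
    ultimately have "3 ^ p / real (s K') \<le> \<epsilon>" using \<epsilon> by (simp add: field_simps)
    then have "small_average (p - 1) \<epsilon> {K'..<K''} b r"
      unfolding small_average_def using b(2,3,5) p' by (auto intro: order_trans)
    then show "\<exists>K'' b. K' < K'' \<and> s ` {K'..<K''} \<in> schreier p \<and> small_average (p - 1) \<epsilon> {K'..<K''} b r"
      using b by blast
  qed
qed

section \<open>Special sequences\<close>

lemma \<sigma>_N2: "l \<in> wh_sequences N1 N2 \<Longrightarrow> \<sigma> l \<in> N2"
  using coding unfolding wh_coding_def by blast

lemma \<sigma>_inj: "l \<in> wh_sequences N1 N2 \<Longrightarrow> l' \<in> wh_sequences N1 N2 \<Longrightarrow> \<sigma> l = \<sigma> l' \<Longrightarrow> l = l'"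
  using coding unfolding wh_coding_def by (meson inj_onD)

text \<open>The sets consist of positive integers, so the factor
  \<open>Max (fst (last l)) ^ 2\<close> in the coding condition is at least 1, and monotonicity of
  \<open>m\<close> turns the inequality of weights into one of indices.\<close>

lemma \<sigma>_greater:
  assumes l: "l \<in> wh_sequences N1 N2" shows "snd (last l) < \<sigma> l"
proof -
  have ne: "l \<noteq> []" and E: "\<forall>E \<in> fst ` set l. finite E \<and> E \<noteq> {} \<and> E \<subseteq> {1..}"
    using l unfolding wh_sequences_def by auto
  have "fst (last l) \<in> fst ` set l" using ne by simp
  then have E': "finite (fst (last l))" "fst (last l) \<noteq> {}" "fst (last l) \<subseteq> {1..}" using E by blast+
  then have "1 \<le> Max (fst (last l))" using Max_in by fastforce
  then have "m (2 * snd (last l)) * 1 \<le> m (2 * snd (last l)) * Max (fst (last l)) ^ 2"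
    by (intro mult_left_mono) auto
  also have "... < m (2 * \<sigma> l)" using coding l unfolding wh_coding_def by blast
  finally have "\<not> 2 * \<sigma> l \<le> 2 * snd (last l)" using m_mono[of "2 * \<sigma> l" "2 * snd (last l)"] by auto
  then show ?thesis by simp
qed

lemma wh_sequences_snoc:
  assumes l: "l \<in> wh_sequences N1 N2" and E: "finite E" "E \<noteq> {}" "E \<subseteq> {1..}"
    and disj: "\<And>p. p \<in> set l \<Longrightarrow> fst p \<inter> E = {}"
  shows "l @ [(E, \<sigma> l)] \<in> wh_sequences N1 N2"
proof -
  have l': "l \<noteq> []" "\<forall>E \<in> fst ` set l. finite E \<and> E \<noteq> {} \<and> E \<subseteq> {1..}" "sorted_wrt disjnt (map fst l)"
    "sorted_wrt (<) (map snd l)" "snd (hd l) \<in> N1" "snd ` set (tl l) \<subseteq> N2"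
    using l unfolding wh_sequences_def by auto
  have "snd p < \<sigma> l" if "p \<in> set l" for p
  proof -
    obtain i where i: "i < length l" "p = l ! i" using \<open>p \<in> set l\<close> by (metis in_set_conv_nth)
    have "snd p \<le> snd (last l)"
    proof (cases "i = length l - 1")
      case True then show ?thesis using i l'(1) by (simp add: last_conv_nth)
    next
      case False
      then have "map snd l ! i < map snd l ! (length l - 1)"
        using sorted_wrt_nth_less[OF l'(4), of i "length l - 1"] i by simp
      then show ?thesis using i l'(1) by (simp add: last_conv_nth)
    qed
    then show ?thesis using \<sigma>_greater[OF l] by simp
  qed
  moreover have "\<forall>p\<in>set l. disjnt (fst p) E" using disj by (auto simp: disjnt_def)
  ultimately show ?thesis
    using l' E \<sigma>_N2[OF l] unfolding wh_sequences_def by (auto simp: sorted_wrt_append)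
qed

lemma wh_sequences_take:
  assumes l: "l \<in> wh_sequences N1 N2" and i: "0 < i" shows "take i l \<in> wh_sequences N1 N2"
proof -
  have l': "l \<noteq> []" "\<forall>E \<in> fst ` set l. finite E \<and> E \<noteq> {} \<and> E \<subseteq> {1..}" "sorted_wrt disjnt (map fst l)"
    "sorted_wrt (<) (map snd l)" "snd (hd l) \<in> N1" "snd ` set (tl l) \<subseteq> N2"
    using l unfolding wh_sequences_def by auto
  have "tl (take i l) = take (i - 1) (tl l)" using i by (cases i; cases l) auto
  then have "set (tl (take i l)) \<subseteq> set (tl l)" by (metis set_take_subset)
  then have 1: "snd ` set (tl (take i l)) \<subseteq> N2" using l'(6) by blast
  have "set (take i l) \<subseteq> set l" by (rule set_take_subset)
  then have 2: "\<forall>E \<in> fst ` set (take i l). finite E \<and> E \<noteq> {} \<and> E \<subseteq> {1..}" using l'(2) by blast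
  have 3: "take i l \<noteq> []" "snd (hd (take i l)) \<in> N1" using i l'(1,5) by auto
  have 4: "sorted_wrt disjnt (map fst (take i l))" "sorted_wrt (<) (map snd (take i l))"
    using sorted_wrt_take[OF l'(3), of i] sorted_wrt_take[OF l'(4), of i] by (simp_all only: take_map)
  show ?thesis unfolding wh_sequences_def mem_Collect_eq by (intro conjI 1 2 3 4)
qed

text \<open>The index prescribed by the coding depends only on the history, so it is known before
  the next block is chosen, and a block that is good for this very index can be taken. What a block
  consists of is left abstract: only its set \<open>E d\<close> and the interval from
  \<open>lo d\<close> to \<open>hi d\<close> enter.\<close>

lemma special_blocks:
  fixes Good :: "nat \<Rightarrow> 'd \<Rightarrow> bool" and E :: "'d \<Rightarrow> nat set" and lo hi :: "'d \<Rightarrow> nat"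
  assumes ex: "\<And>j K. j0 \<le> j \<Longrightarrow> \<exists>d. Good j d \<and> K \<le> lo d"
    and Good: "\<And>j d. Good j d \<Longrightarrow> E d \<noteq> {} \<and> E d \<subseteq> {lo d..hi d} \<and> 1 \<le> lo d \<and> lo d \<le> hi d"
    and j1: "j1 \<in> N1" "j0 \<le> j1"
  shows "\<exists>d j. (\<forall>i. Good (j i) (d i) \<and> K0 \<le> lo (d i) \<and> hi (d i) < lo (d (Suc i))) \<and> j 0 = j1 \<and>
    (\<forall>i. map (\<lambda>k. (E (d k), j k)) [0..<Suc i] \<in> wh_sequences N1 N2 \<and>
      j (Suc i) = \<sigma> (map (\<lambda>k. (E (d k), j k)) [0..<Suc i]))"
proof -
  define e where "e = (\<lambda>p. (E (fst p), snd p :: nat))"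
  \<comment> \<open>The last conjunct keeps the largest end at the last entry, so a block that
    begins after it is disjoint from all earlier ones.\<close>
  define V where "V l \<longleftrightarrow> l \<noteq> [] \<and> map e l \<in> wh_sequences N1 N2 \<and> snd (hd l) = j1 \<and>
    (\<forall>p\<in>set l. Good (snd p) (fst p) \<and> K0 \<le> lo (fst p) \<and> j0 \<le> snd p) \<and>
    (\<forall>p\<in>set l. hi (fst p) \<le> hi (fst (last l)))" for l
  have base: "\<exists>l. V l \<and> length l = Suc 0"
  proof -
    obtain d where d: "Good j1 d" "K0 \<le> lo d" using ex[OF j1(2)] by blast
    have "[(E d, j1)] \<in> wh_sequences N1 N2"
    proof -
      have "E d \<subseteq> {lo d..hi d}" "E d \<noteq> {}" "1 \<le> lo d" using Good[OF d(1)] by auto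
      moreover from this have "finite (E d)" "E d \<subseteq> {1..}" by (auto intro: finite_subset)
      ultimately show ?thesis using j1 unfolding wh_sequences_def by simp
    qed
    then show ?thesis using d j1 by (intro exI[of _ "[(d, j1)]"]) (simp add: V_def e_def)
  qed
  have step: "\<exists>l'. (V l' \<and> length l' = Suc (Suc i)) \<and>
      (\<exists>d. l' = l @ [(d, \<sigma> (map e l))] \<and> hi (fst (last l)) < lo d)" if l: "V l \<and> length l = Suc i" for l i
  proof -
    have ml: "map e l \<in> wh_sequences N1 N2" and ne: "l \<noteq> []" using l by (auto simp: V_def)
    have "snd (last (map e l)) = snd (last l)" using ne by (simp add: last_map e_def)
    then have lt: "snd (last l) < \<sigma> (map e l)" using \<sigma>_greater[OF ml] by simp
    have "j0 \<le> snd (last l)" using l by (simp add: V_def)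
    then have "j0 \<le> \<sigma> (map e l)" using lt by simp
    from ex[OF this] obtain d where d: "Good (\<sigma> (map e l)) d" "max K0 (Suc (hi (fst (last l)))) \<le> lo d" by blast
    note Gd = Good[OF d(1)]
    have "map e l @ [(E d, \<sigma> (map e l))] \<in> wh_sequences N1 N2"
    proof (rule wh_sequences_snoc[OF ml])
      show "finite (E d)" using Gd finite_subset by blast
      show "E d \<noteq> {}" using Gd by blast
      show "E d \<subseteq> {1..}" using Gd by force
      fix p assume "p \<in> set (map e l)"
      then obtain p' where p': "p' \<in> set l" "p = e p'" by auto
      have "Good (snd p') (fst p')" "hi (fst p') \<le> hi (fst (last l))" using l p'(1) by (auto simp: V_def)
      then have "E (fst p') \<subseteq> {..hi (fst (last l))}" using Good[of "snd p'" "fst p'"] by force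
      moreover have "E d \<subseteq> {Suc (hi (fst (last l)))..}" using Gd d(2) by force
      ultimately show "fst p \<inter> E d = {}" using p' by (force simp: e_def)
    qed
    then have "V (l @ [(d, \<sigma> (map e l))])"
      using l d Gd ne \<open>j0 \<le> \<sigma> (map e l)\<close> unfolding V_def by (auto simp: e_def intro: less_imp_le order_trans)
    then show ?thesis using l d(2) by (intro exI[of _ "l @ [(d, \<sigma> (map e l))]"]) auto
  qed
  obtain L where L: "\<And>i. V (L i) \<and> length (L i) = Suc i"
    "\<And>i. \<exists>d. L (Suc i) = L i @ [(d, \<sigma> (map e (L i)))] \<and> hi (fst (last (L i))) < lo d"
    using dependent_nat_choice[of "\<lambda>i l. V l \<and> length l = Suc i"
      "\<lambda>i l l'. \<exists>d. l' = l @ [(d, \<sigma> (map e l))] \<and> hi (fst (last l)) < lo d", OF base step] by blast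
  define d where "d i = fst (last (L i))" for i
  define j where "j i = snd (last (L i))" for i
  have Ln: "L i \<noteq> []" for i using L(1)[of i] by auto
  have LS: "L (Suc i) = L i @ [(d (Suc i), j (Suc i))] \<and> j (Suc i) = \<sigma> (map e (L i)) \<and> hi (d i) < lo (d (Suc i))" for i
    using L(2)[of i] by (auto simp: d_def j_def)
  have Leq: "L i = map (\<lambda>k. (d k, j k)) [0..<Suc i]" for i
  proof (induction i)
    case 0
    have "length (L 0) = 1" using L(1)[of 0] by simp
    then obtain p where "L 0 = [p]" by (metis One_nat_def length_0_conv length_Suc_conv)
    then show ?case by (simp add: d_def j_def)
  next
    case (Suc i)
    then show ?case using LS[of i] by simp
  qed
  have eq: "map e (L i) = map (\<lambda>k. (E (d k), j k)) [0..<Suc i]" for i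
    unfolding Leq by (simp add: e_def)
  have "j 0 = j1"
  proof -
    have "snd (hd (L 0)) = j1" using L(1)[of 0] by (simp add: V_def)
    then show ?thesis unfolding Leq by simp
  qed
  moreover have "Good (j i) (d i) \<and> K0 \<le> lo (d i)" for i
  proof -
    have "last (L i) \<in> set (L i)" using Ln by simp
    then show ?thesis using L(1)[of i] unfolding V_def d_def j_def by blast
  qed
  moreover have "map e (L i) \<in> wh_sequences N1 N2" for i using L(1)[of i] by (simp add: V_def)
  ultimately show ?thesis using LS unfolding eq by blast
qed

text \<open>At most \<open>s\<close> members begin before \<open>s\<close>, so the parts of their
  children beyond \<open>s\<close> fall into at most \<open>s\<close> sets of order
  \<open>p'\<close>. The order \<open>p\<close> of the parents thereby drops out.\<close>

lemma allowable_old_Sigma: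
  assumes a: "allowable p I h" and I': "I' \<subseteq> I"
    and old: "\<And>i. i \<in> I' \<Longrightarrow> supp (h i) \<noteq> {} \<and> Min (supp (h i)) < s"
    and g: "\<And>i. i \<in> I' \<Longrightarrow> allowable p' (J i) (g i)"
    and sub: "\<And>i j. i \<in> I' \<Longrightarrow> j \<in> J i \<Longrightarrow> supp (g i j) \<subseteq> supp (h i) \<inter> {s..}"
  shows "allowable (Suc p') (Sigma I' J) (\<lambda>z. g (fst z) (snd z))"
proof -
  have "allowable (p + p') (Sigma I' J) (\<lambda>z. g (fst z) (snd z))"
    by (rule allowable_Sigma[OF allowable_subset[OF a I'] g]) (use sub in auto)
  note S = allowableD[OF this]
  define B where "B i = (\<lambda>j. Min (supp (g i j))) ` {j\<in>J i. supp (g i j) \<noteq> {}}" for i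
  have fin: "finite I'" using allowableD(1)[OF a] I' finite_subset by blast
  have "card I' = card ((\<lambda>i. Min (supp (h i))) ` I')"
    by (rule card_image[symmetric], rule inj_on_subset[OF allowable_inj_Min[OF a]]) (use I' old in auto)
  also have "... \<le> card {..<s}" by (rule card_mono) (use old in auto)
  finally have card: "card I' \<le> s" by simp
  have "\<Union> (B ` I') \<in> mschreier (Suc p')"
  proof (rule mschreier_SucI)
    show "finite (B ` I')" using fin by simp
    show "B ` I' \<subseteq> mschreier p'" unfolding B_def using allowableD(4)[OF g] by blast
    fix x assume "x \<in> \<Union> (B ` I')"
    then obtain i j where ij: "i \<in> I'" "j \<in> J i" "supp (g i j) \<noteq> {}" "x = Min (supp (g i j))"
      by (auto simp: B_def)
    have "x \<in> supp (g i j)" unfolding ij(4) by (rule allowable_Min_in[OF g[OF ij(1)] ij(2,3)])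
    then have "s \<le> x" using sub[OF ij(1,2)] by auto
    then show "card (B ` I') \<le> x" using card_image_le[OF fin, of B] card by linarith
  qed
  moreover have "(\<lambda>z. Min (supp (g (fst z) (snd z)))) ` {z\<in>Sigma I' J. supp (g (fst z) (snd z)) \<noteq> {}} \<subseteq> \<Union> (B ` I')"
  proof (rule image_subsetI)
    fix z assume "z \<in> {z\<in>Sigma I' J. supp (g (fst z) (snd z)) \<noteq> {}}"
    then have "fst z \<in> I'" "Min (supp (g (fst z) (snd z))) \<in> B (fst z)" by (auto simp: B_def)
    then show "Min (supp (g (fst z) (snd z))) \<in> \<Union> (B ` I')" by blast
  qed
  ultimately have "(\<lambda>z. Min (supp (g (fst z) (snd z)))) ` {z\<in>Sigma I' J. supp (g (fst z) (snd z)) \<noteq> {}}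
      \<in> mschreier (Suc p')" by (rule mschreier_subset)
  then show ?thesis unfolding allowable_def using S by blast
qed

text \<open>Expansion of the members lighter than \<open>m Q\<close> leaves the following cases.
  Weights from \<open>m (Suc Q)\<close> on, other than \<open>m (2 * j i)\<close>, are small on
  \<open>u i\<close> by \<open>U\<close>. The weight \<open>m (2 * j i)\<close> is critical for a
  single \<open>i\<close>, so such blocks have small mass. Weight \<open>m Q\<close> belongs to
  special functionals: their children are compared with the given special sequence, and
  \<open>Eu\<close> removes every coincidence but the last. The order \<open>C / M^2\<close> results
  from \<open>m (Suc Q) \<ge> M^2\<close>.\<close>

lemma special_average_bound:
  fixes u :: "nat \<Rightarrow> nat \<Rightarrow> real" and E :: "nat \<Rightarrow> nat set" and j :: "nat \<Rightarrow> nat"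
  assumes j0: "1 \<le> j0" and Q: "Q = 2 * j0 + 1"
    and sr: "\<And>i. s i \<le> r i" and rs: "\<And>i. r i < s (Suc i)"
    and l: "\<And>i. map (\<lambda>k. (E k, j k)) [0..<Suc i] \<in> wh_sequences N1 N2"
    and jS: "\<And>i. j (Suc i) = \<sigma> (map (\<lambda>k. (E k, j k)) [0..<Suc i])" and j_0: "j0 + 2 \<le> j 0"
    and us: "\<And>i. supp (u i) \<subseteq> {s i..r i}" and Eu: "\<And>i. E i \<inter> supp (u i) = {}"
    and C: "\<And>i. norm_le (u i) C"
    and U: "\<And>i A. allowable (n Q + 1) A (\<lambda>f. f) \<Longrightarrow>
        \<forall>f\<in>A. \<exists>w. m (Suc Q) \<le> w \<and> w \<noteq> m (2 * j i) \<and> W f (Some w) \<Longrightarrow>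
        (\<Sum>f\<in>A. (pair f (u i))\<^sup>2) \<le> C\<^sup>2 / (real (m (Suc Q)))\<^sup>2"
    and sa: "small_average (n Q - 1) \<epsilon> {..<P} b r"
    and eps: "\<epsilon> * 4 ^ (2 * n Q) * (real (m Q)) ^ 4 \<le> 1"
  shows "norm_le (\<lambda>a. \<Sum>i<P. sqrt (b i) * u i a) (5 * C / (real (m Q))\<^sup>2)"
proof -
  note sa' = small_averageD[OF sa]
  have C0: "0 \<le> C" using norm_le_nonneg[OF C[of 0]] .
  define p where "p = n Q - 1"
  have Sp: "Suc p = n Q" unfolding p_def using n_pos[of Q] by simp
  have Q3: "3 \<le> Q" using j0 Q by simp
  define M where "M = real (m Q)"
  have M2: "2 \<le> M" unfolding M_def using m_ge2[of Q] by simp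
  have M4: "16 \<le> M ^ 4" using power_mono[OF M2, of 4] by simp
  have MS: "(M ^ 2)\<^sup>2 \<le> (real (m (Suc Q)))\<^sup>2"
  proof (rule power_mono)
    have "m Q ^ 2 \<le> m Q ^ 3" using m_ge2[of Q] by (intro power_increasing) auto
    also have "... \<le> m (Suc Q)" using Q3 by (intro m_cube) simp
    finally have "real (m Q ^ 2) \<le> real (m (Suc Q))" by (simp only: of_nat_le_iff)
    then show "M ^ 2 \<le> real (m (Suc Q))" by (simp add: M_def)
  qed simp
  have MS4: "C\<^sup>2 / (real (m (Suc Q)))\<^sup>2 \<le> C\<^sup>2 / M ^ 4"
  proof (rule divide_left_mono)
    show "M ^ 4 \<le> (real (m (Suc Q)))\<^sup>2" using MS by (simp add: power_mult[symmetric])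
    have "0 < M ^ 4" "0 < (real (m (Suc Q)))\<^sup>2" using M4 m_ge2[of "Suc Q"] by auto
    then show "0 < (real (m (Suc Q)))\<^sup>2 * M ^ 4" by (rule mult_pos_pos[OF _ _, rotated])
  qed simp
  have bd: "disjoint_family_on (\<lambda>t. {s t..r t}) {..<P}"
    by (rule blocks_disjoint(1)[of s r]; rule sr rs)
  \<comment> \<open>The crude bounds on exceptional blocks reach the exponent
    \<open>Suc (p + n Q)\<close>, which equals \<open>2 * n Q\<close>.\<close>
  have eps': "\<epsilon> * (4 ^ a * C\<^sup>2) \<le> C\<^sup>2 / M ^ 4" if "a \<le> 2 * n Q" for a
  proof -
    have "\<epsilon> * 4 ^ a * M ^ 4 \<le> \<epsilon> * 4 ^ (2 * n Q) * M ^ 4"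
      using that sa'(5) M4 by (intro mult_right_mono mult_left_mono power_increasing) auto
    then have "\<epsilon> * 4 ^ a * M ^ 4 \<le> 1" using eps by (simp add: M_def)
    then have "\<epsilon> * 4 ^ a \<le> 1 / M ^ 4" using M4 by (subst pos_le_divide_eq) auto
    then have "\<epsilon> * 4 ^ a * C\<^sup>2 \<le> 1 / M ^ 4 * C\<^sup>2" by (intro mult_right_mono) auto
    then show ?thesis by (simp add: mult.assoc)
  qed
  have smj: "j i < j (Suc i)" for i
  proof -
    have "snd (last (map (\<lambda>k. (E k, j k)) [0..<Suc i])) = j i" by simp
    then show ?thesis using \<sigma>_greater[OF l[of i]] jS[of i] by simp
  qed
  then have sm: "strict_mono j" by (simp add: strict_mono_Suc_iff)
  have jge: "j0 + 2 \<le> j i" for i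
    using j_0 sm by (metis le_trans strict_mono_less_eq zero_le)
  have minj: "m (2 * j i) \<noteq> m w" if "w \<noteq> 2 * j i" for i w
    using m_inject[of "2 * j i" w] jge[of i] that by auto
  define y where "y = (\<lambda>a. \<Sum>i<P. sqrt (b i) * u i a)"
  have K: "square_bound p y (5 * C\<^sup>2)"
  proof (rule square_bound_mono[OF average_square_bound[OF sa bd us C, folded y_def p_def]])
    have "\<epsilon> * 4 ^ Suc p * 1 \<le> \<epsilon> * 4 ^ (2 * n Q) * M ^ 4"
      using sa'(5) M4 Sp by (intro mult_mono mult_left_mono power_increasing) auto
    then have "\<epsilon> * 4 ^ Suc p \<le> 1" using eps by (simp add: M_def)
    then show "(4 + \<epsilon> * 4 ^ Suc p) * C\<^sup>2 \<le> 5 * C\<^sup>2" by (intro mult_right_mono) auto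
  qed simp
  have H1: "(\<Sum>f\<in>A. (pair f y)\<^sup>2) \<le> 3 * (C\<^sup>2 / M ^ 4)"
    if a: "allowable p A (\<lambda>f. f)" and hv: "\<forall>f\<in>A. heavy (Suc Q) f" for A
  proof -
    have "\<forall>f\<in>A. \<exists>w. W f w \<and> (\<forall>v. w = Some v \<longrightarrow> m (Suc Q) \<le> v)" using hv unfolding heavy_def by fastforce
    from bchoice[OF this] obtain w where w: "\<forall>f\<in>A. W f (w f) \<and> (\<forall>v. w f = Some v \<longrightarrow> m (Suc Q) \<le> v)" ..
    have fA: "finite A" by (rule allowableD(1)[OF a])
    obtain g where g: "\<And>i k. i \<in> A \<Longrightarrow> k \<in> {..<P} \<Longrightarrow> D (g i k)"
      "\<And>i k v. i \<in> A \<Longrightarrow> k \<in> {..<P} \<Longrightarrow> w i = Some v \<Longrightarrow> W (g i k) (Some v)"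
      "\<And>i k. i \<in> A \<Longrightarrow> k \<in> {..<P} \<Longrightarrow> supp (g i k) \<subseteq> supp i \<inter> {s k..r k}"
      "\<And>x b. (\<And>k. k \<in> {..<P} \<Longrightarrow> supp (x k) \<subseteq> {s k..r k}) \<Longrightarrow> (\<And>k. k \<in> {..<P} \<Longrightarrow> 0 \<le> b k) \<Longrightarrow>
        (\<Sum>i\<in>A. (pair i (\<lambda>a. \<Sum>k<P. sqrt (b k) * x k a))\<^sup>2) \<le> (\<Sum>k<P. b k * (\<Sum>i\<in>A. (pair (g i k) (x k))\<^sup>2))"
      using split_family[where I = A and h = "\<lambda>f. f" and w = w, OF _ finite_lessThan bd] w by blast
    let ?G1 = "{k\<in>{..<P}. \<exists>f\<in>A. s k \<le> Min (supp f) \<and> supp (g f k) \<noteq> {}}"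
    have G1: "r ` ?G1 \<in> mschreier p" by (rule allowable_new[OF a bd g(3)])
    define old where "old k = {f\<in>A. Min (supp f) < s k \<and> supp (g f k) \<noteq> {}}" for k
    \<comment> \<open>A member has one recorded weight and the weights \<open>m (2 * j k)\<close>
      are pairwise distinct, so it is bad for at most one block.\<close>
    define bad where "bad k = {f\<in>old k. w f = Some (m (2 * j k))}" for k
    let ?G2 = "{k\<in>{..<P}. bad k \<noteq> {}}"
    have G2: "r ` ?G2 \<in> mschreier p"
    proof (rule allowable_marks[OF a, where P = "\<lambda>f k. f \<in> bad k"])
      fix k assume "k \<in> ?G2"
      then obtain f where f: "f \<in> bad k" "k \<in> {..<P}" by blast
      then have fA: "f \<in> A" "Min (supp f) < s k" "supp (g f k) \<noteq> {}" by (auto simp: bad_def old_def)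
      have "supp f \<noteq> {}" using g(3)[OF fA(1) f(2)] fA(3) by blast
      then show "\<exists>f\<in>A. f \<in> bad k \<and> supp f \<noteq> {} \<and> Min (supp f) \<le> r k"
        using f fA sr[of k] by (intro bexI[of _ f]) auto
    next
      fix f k k' assume "f \<in> bad k" "f \<in> bad k'"
      then have "m (2 * j k) = m (2 * j k')" by (auto simp: bad_def)
      then have "2 * j k = 2 * j k'" using minj by metis
      then show "k = k'" using sm by (simp add: strict_mono_eq)
    qed
    have "(\<Sum>f\<in>A. (pair f y)\<^sup>2) \<le> (\<Sum>k<P. b k * (\<Sum>f\<in>A. (pair (g f k) (u k))\<^sup>2))"
      unfolding y_def by (rule g(4)) (use us sa'(2) in auto)
    also have "... \<le> C\<^sup>2 / M ^ 4 + \<epsilon> * (4 ^ Suc p * C\<^sup>2 + 4 * C\<^sup>2 + 0)"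
    proof (rule small_average_sum_le[OF sa[folded p_def], where ?G1.0 = ?G1 and ?G2.0 = ?G2 and ?G3.0 = "{}"])
      fix k assume k: "k \<in> {..<P}"
      let ?N = "{f\<in>A. s k \<le> Min (supp f) \<and> supp (g f k) \<noteq> {}}"
      have sub: "supp (g f k) \<subseteq> supp f \<inter> {s k..}" if "f \<in> A" for f using g(3)[OF that k] by auto
      have aold: "allowable 1 I' (\<lambda>f. g f k)" if I': "I' \<subseteq> old k" for I'
      proof (rule allowable_old[OF a, where s = "s k"])
        show "I' \<subseteq> A" using I' by (auto simp: old_def)
        fix f assume "f \<in> I'"
        then have "f \<in> A" "Min (supp f) < s k" using I' by (auto simp: old_def)
        then show "D (g f k)" "supp (g f k) \<subseteq> supp f \<inter> {s k..}" "Min (supp f) < s k"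
          using g(1)[OF _ k] sub by blast+
      qed
      have 1: "(\<Sum>f\<in>?N. (pair (g f k) (u k))\<^sup>2) \<le> of_bool (k \<in> ?G1) * (4 ^ Suc p * C\<^sup>2)"
      proof (cases "?N = {}")
        case False
        then have "k \<in> ?G1" using k by blast
        moreover have "(\<Sum>f\<in>?N. (pair (g f k) (u k))\<^sup>2) \<le> 4 ^ Suc p * C\<^sup>2"
          by (rule new_sum_bound[OF C a]) (use g(1)[OF _ k] g(3)[OF _ k] in auto)
        ultimately show ?thesis by simp
      next
        case True then show ?thesis unfolding True by simp
      qed
      have 2: "(\<Sum>f\<in>bad k. (pair (g f k) (u k))\<^sup>2) \<le> of_bool (k \<in> ?G2) * (4 * C\<^sup>2)"
      proof (cases "bad k = {}")
        case False
        have "bad k \<subseteq> old k" by (auto simp: bad_def)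
        from norm_le_1_allowable[OF C aold[OF this]] show ?thesis using False k by simp
      qed simp
      have 3: "(\<Sum>f\<in>old k - bad k. (pair (g f k) (u k))\<^sup>2) \<le> C\<^sup>2 / M ^ 4"
      proof -
        have ok: "old k - bad k \<subseteq> old k" by blast
        obtain J where J: "J \<subseteq> old k - bad k" "allowable 1 ((\<lambda>f. g f k) ` J) (\<lambda>f. f)"
          "(\<Sum>f\<in>(\<lambda>f. g f k) ` J. (pair f (u k))\<^sup>2) = (\<Sum>f\<in>old k - bad k. (pair (g f k) (u k))\<^sup>2)"
          using allowable_image[OF aold[OF ok], of "u k"] by blast
        have "(\<Sum>f\<in>(\<lambda>f. g f k) ` J. (pair f (u k))\<^sup>2) \<le> C\<^sup>2 / (real (m (Suc Q)))\<^sup>2"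
        proof (rule U)
          show "allowable (n Q + 1) ((\<lambda>f. g f k) ` J) (\<lambda>f. f)" by (rule allowable_mono[OF J(2)]) simp
          show "\<forall>f\<in>(\<lambda>f. g f k) ` J. \<exists>w. m (Suc Q) \<le> w \<and> w \<noteq> m (2 * j k) \<and> W f (Some w)"
          proof
            fix f' assume "f' \<in> (\<lambda>f. g f k) ` J"
            then obtain f where f: "f \<in> old k" "f \<notin> bad k" "f' = g f k" using J(1) by blast
            then have fA: "f \<in> A" "Min (supp f) < s k" "supp (g f k) \<noteq> {}" by (auto simp: old_def)
            obtain v where v: "w f = Some v"
            proof (cases "w f")
              case None
              then have "W f None" using w fA by metis
              then obtain c where c: "supp f = {c}" by (cases rule: W_cases) auto
              then have "c < s k" using fA(2) by simp
              moreover have "supp (g f k) \<subseteq> {c} \<inter> {s k..}" using sub[OF fA(1)] c by simp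
              ultimately have "supp (g f k) = {}" by auto
              then show ?thesis using fA(3) by simp
            qed
            have "v \<noteq> m (2 * j k)" using f v by (auto simp: bad_def)
            moreover have "m (Suc Q) \<le> v" using w fA(1) v by blast
            ultimately show "\<exists>w. m (Suc Q) \<le> w \<and> w \<noteq> m (2 * j k) \<and> W f' (Some w)"
              using g(2)[OF fA(1) k v] f(3) by blast
          qed
        qed
        then show ?thesis using J(3) MS4 by simp
      qed
      have "(\<Sum>f\<in>A. (pair (g f k) (u k))\<^sup>2) = (\<Sum>f\<in>?N \<union> (bad k \<union> (old k - bad k)). (pair (g f k) (u k))\<^sup>2)"
        using fA by (intro sum.mono_neutral_right) (auto simp: pair_def old_def bad_def)
      also have "... = (\<Sum>f\<in>?N. (pair (g f k) (u k))\<^sup>2)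
          + ((\<Sum>f\<in>bad k. (pair (g f k) (u k))\<^sup>2) + (\<Sum>f\<in>old k - bad k. (pair (g f k) (u k))\<^sup>2))"
      proof -
        have fin: "finite ?N" "finite (bad k)" "finite (old k - bad k)" using fA by (simp_all add: old_def bad_def)
        have "?N \<inter> (bad k \<union> (old k - bad k)) = {}" by (auto simp: old_def bad_def)
        then have "(\<Sum>f\<in>?N \<union> (bad k \<union> (old k - bad k)). (pair (g f k) (u k))\<^sup>2)
          = (\<Sum>f\<in>?N. (pair (g f k) (u k))\<^sup>2) + (\<Sum>f\<in>bad k \<union> (old k - bad k). (pair (g f k) (u k))\<^sup>2)"
          using fin by (intro sum.union_disjoint) auto
        also have "(\<Sum>f\<in>bad k \<union> (old k - bad k). (pair (g f k) (u k))\<^sup>2)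
          = (\<Sum>f\<in>bad k. (pair (g f k) (u k))\<^sup>2) + (\<Sum>f\<in>old k - bad k. (pair (g f k) (u k))\<^sup>2)"
          using fin by (intro sum.union_disjoint) auto
        finally show ?thesis .
      qed
      finally show "(\<Sum>f\<in>A. (pair (g f k) (u k))\<^sup>2) \<le> C\<^sup>2 / M ^ 4 + of_bool (k \<in> ?G1) * (4 ^ Suc p * C\<^sup>2)
          + of_bool (k \<in> ?G2) * (4 * C\<^sup>2) + of_bool (k \<in> {}) * 0"
        using 1 2 3 by simp
    qed (use G1 G2 mschreier_empty in auto)
    also have "... \<le> 3 * (C\<^sup>2 / M ^ 4)"
      using eps'[of "Suc p"] eps'[of 1] Sp n_pos[of Q] by (simp add: distrib_left)
    finally show ?thesis .
  qed
  have H2: "(\<Sum>f\<in>A. (pair f y)\<^sup>2) \<le> 3 * (C\<^sup>2 / M ^ 4)"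
    if a: "allowable p A (\<lambda>f. f)" and hv: "\<forall>f\<in>A. W f (Some (m Q))" for A
  proof -
    have fA: "finite A" by (rule allowableD(1)[OF a])
    have "\<forall>f\<in>A. \<exists>z :: nat set \<times> (nat \<Rightarrow> nat \<Rightarrow> real) \<times> (nat set \<times> nat) list.
      allowable (n Q) (fst z) (fst (snd z)) \<and> (\<forall>a\<in>fst z. supp (fst (snd z) a) \<subseteq> supp f) \<and>
      schreier_sigma_special n N1 N2 \<sigma> j0 (snd (snd z)) \<and>
      (\<forall>a\<in>fst z. a < length (snd (snd z)) \<and> W (fst (snd z) a) (Some (m (2 * snd (snd (snd z) ! a)))) \<and>
        supp (fst (snd z) a) \<subseteq> fst (snd (snd z) ! a)) \<and>
      (pair f y)\<^sup>2 \<le> (\<Sum>a\<in>fst z. (pair (fst (snd z) a) y)\<^sup>2) / M\<^sup>2"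
    proof
      fix f assume "f \<in> A"
      then have "W f (Some (m Q))" using hv by blast
      then obtain i and J :: "nat set" and h l where c: "m Q = m i" "finite J"
        "\<And>k. i = 2 * k + 1 \<Longrightarrow> \<exists>s. schreier_sigma_special n N1 N2 \<sigma> k s \<and>
          (\<forall>j\<in>J. j < length s \<and> W (h j) (Some (m (2 * snd (s ! j)))) \<and> supp (h j) \<subseteq> fst (s ! j))"
        "\<And>j. j \<in> J \<Longrightarrow> D (h j)" "disjoint_family_on (\<lambda>j. supp (h j)) J"
        "(\<lambda>j. Min (supp (h j))) ` {j\<in>J. supp (h j) \<noteq> {}} \<in> mschreier (n i)"
        "(\<Sum>j\<in>J. (l j)\<^sup>2) \<le> 1" "\<And>j. j \<in> J \<Longrightarrow> supp (h j) \<subseteq> supp f"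
        "f = (\<lambda>k. 1 / real (m i) * (\<Sum>j\<in>J. l j * h j k))"
        by (cases rule: W_cases) auto
      have i: "i = Q" using m_inject[OF Q3 c(1)] by simp
      obtain z where z: "schreier_sigma_special n N1 N2 \<sigma> j0 z"
        "\<forall>j\<in>J. j < length z \<and> W (h j) (Some (m (2 * snd (z ! j)))) \<and> supp (h j) \<subseteq> fst (z ! j)"
        using c(3)[of j0] i Q by blast
      have "allowable (n Q) J h" unfolding allowable_def using c(2,4,5,6) i by blast
      moreover have "(pair f y)\<^sup>2 \<le> (\<Sum>a\<in>J. (pair (h a) y)\<^sup>2) / M\<^sup>2"
      proof -
        have "pair f y = 1 / M * (\<Sum>j\<in>J. l j * pair (h j) y)"
          unfolding c(9) i M_def by (rule pair_combo[OF c(2)]) (use D_finite[OF c(4)] in auto)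
        then have "(pair f y)\<^sup>2 = (\<Sum>j\<in>J. l j * pair (h j) y)\<^sup>2 / M\<^sup>2" by (simp add: power_divide)
        also have "... \<le> (\<Sum>j\<in>J. (pair (h j) y)\<^sup>2) / M\<^sup>2"
          by (rule divide_right_mono[OF sum_mult_square_le[OF c(7)]]) simp
        finally show ?thesis .
      qed
      ultimately show "\<exists>z :: nat set \<times> (nat \<Rightarrow> nat \<Rightarrow> real) \<times> (nat set \<times> nat) list.
        allowable (n Q) (fst z) (fst (snd z)) \<and> (\<forall>a\<in>fst z. supp (fst (snd z) a) \<subseteq> supp f) \<and>
        schreier_sigma_special n N1 N2 \<sigma> j0 (snd (snd z)) \<and>
        (\<forall>a\<in>fst z. a < length (snd (snd z)) \<and> W (fst (snd z) a) (Some (m (2 * snd (snd (snd z) ! a)))) \<and>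
          supp (fst (snd z) a) \<subseteq> fst (snd (snd z) ! a)) \<and>
        (pair f y)\<^sup>2 \<le> (\<Sum>a\<in>fst z. (pair (fst (snd z) a) y)\<^sup>2) / M\<^sup>2"
        using z c(8) by (intro exI[of _ "(J, h, z)"]) simp
    qed
    from bchoice[OF this] obtain Z :: "(nat \<Rightarrow> real) \<Rightarrow> nat set \<times> (nat \<Rightarrow> nat \<Rightarrow> real) \<times> (nat set \<times> nat) list" where
      Z: "\<forall>f\<in>A. allowable (n Q) (fst (Z f)) (fst (snd (Z f))) \<and> (\<forall>a\<in>fst (Z f). supp (fst (snd (Z f)) a) \<subseteq> supp f) \<and>
      schreier_sigma_special n N1 N2 \<sigma> j0 (snd (snd (Z f))) \<and>
      (\<forall>a\<in>fst (Z f). a < length (snd (snd (Z f))) \<and> W (fst (snd (Z f)) a) (Some (m (2 * snd (snd (snd (Z f)) ! a)))) \<and>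
        supp (fst (snd (Z f)) a) \<subseteq> fst (snd (snd (Z f)) ! a)) \<and>
      (pair f y)\<^sup>2 \<le> (\<Sum>a\<in>fst (Z f). (pair (fst (snd (Z f)) a) y)\<^sup>2) / M\<^sup>2" ..
    define J where "J f = fst (Z f)" for f
    define H where "H f = fst (snd (Z f))" for f
    define S where "S f = snd (snd (Z f))" for f
    have ZJ: "allowable (n Q) (J f) (H f)" and ZS: "schreier_sigma_special n N1 N2 \<sigma> j0 (S f)"
      and Zy: "(pair f y)\<^sup>2 \<le> (\<Sum>a\<in>J f. (pair (H f a) y)\<^sup>2) / M\<^sup>2" if "f \<in> A" for f
      using Z that by (simp_all add: J_def H_def S_def)
    have ZH: "supp (H f a) \<subseteq> supp f" "a < length (S f)" "W (H f a) (Some (m (2 * snd (S f ! a))))"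
      "supp (H f a) \<subseteq> fst (S f ! a)" if "f \<in> A" "a \<in> J f" for f a
      using Z that by (simp_all add: J_def H_def S_def)
    let ?I = "Sigma A J"
    define h where "h z = H (fst z) (snd z)" for z
    have aS: "allowable (p + n Q) ?I h"
      unfolding h_def by (rule allowable_Sigma[OF a ZJ ZH(1)])
    have fI: "finite ?I" by (rule allowableD(1)[OF aS])
    define w where "w z = Some (m (2 * snd (S (fst z) ! snd z)))" for z :: "(nat \<Rightarrow> real) \<times> nat"
    have Ww: "W (h z) (w z)" if "z \<in> ?I" for z using that ZH(3) by (auto simp: h_def w_def)
    obtain g where g: "\<And>z k. z \<in> ?I \<Longrightarrow> k \<in> {..<P} \<Longrightarrow> D (g z k)"
      "\<And>z k v. z \<in> ?I \<Longrightarrow> k \<in> {..<P} \<Longrightarrow> w z = Some v \<Longrightarrow> W (g z k) (Some v)"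
      "\<And>z k. z \<in> ?I \<Longrightarrow> k \<in> {..<P} \<Longrightarrow> supp (g z k) \<subseteq> supp (h z) \<inter> {s k..r k}"
      "\<And>x b. (\<And>k. k \<in> {..<P} \<Longrightarrow> supp (x k) \<subseteq> {s k..r k}) \<Longrightarrow> (\<And>k. k \<in> {..<P} \<Longrightarrow> 0 \<le> b k) \<Longrightarrow>
        (\<Sum>z\<in>?I. (pair (h z) (\<lambda>a. \<Sum>k<P. sqrt (b k) * x k a))\<^sup>2) \<le> (\<Sum>k<P. b k * (\<Sum>z\<in>?I. (pair (g z k) (x k))\<^sup>2))"
      using split_family[where I = ?I and h = h and w = w, OF Ww finite_lessThan bd] by blast
    have gs: "supp (g (f, a) k) \<subseteq> supp f \<inter> {s k..r k} \<inter> fst (S f ! a)" if "f \<in> A" "a \<in> J f" "k < P" for f a k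
      using g(3)[of "(f, a)" k] ZH(1,4)[of f a] that by (auto simp: h_def)
    define new where "new k = {z\<in>?I. s k \<le> Min (supp (fst z)) \<and> supp (g z k) \<noteq> {}}" for k
    define old where "old k = {f\<in>A. supp f \<noteq> {} \<and> Min (supp f) < s k}" for k
    \<comment> \<open>Badness is a property of the parent: one of its children has the critical
      weight of block \<open>k\<close> and does not vanish on \<open>u k\<close>. Blocks have to be
      charged to parents, whose family has order \<open>p\<close>; that of the children has order
      \<open>p + n Q\<close>, for which the average is not known to be small.\<close>
    define badf where "badf k = {f\<in>old k. \<exists>a\<in>J f. snd (S f ! a) = j k \<and> pair (g (f, a) k) (u k) \<noteq> 0}" for k
    define good where "good k = {z\<in>?I. fst z \<in> old k - badf k \<and> pair (g z k) (u k) \<noteq> 0}" for k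
    let ?G1 = "{k\<in>{..<P}. new k \<noteq> {}}" and ?G2 = "{k\<in>{..<P}. badf k \<noteq> {}}"
    have G1: "r ` ?G1 \<in> mschreier p"
    proof (rule mschreier_subset)
      \<comment> \<open>Indicators of the parts of \<open>supp f\<close> in the blocks stand in for
        pieces of \<open>f\<close>, so that \<open>allowable_new\<close> can be applied to the
        parents; it looks at supports alone.\<close>
      let ?r = "\<lambda>f k a. if a \<in> supp f \<inter> {s k..r k} then 1 else 0 :: real"
      have rs': "supp (?r f k) = supp f \<inter> {s k..r k}" for f k by (auto simp: supp_def)
      show "r ` {k\<in>{..<P}. \<exists>f\<in>A. s k \<le> Min (supp f) \<and> supp (?r f k) \<noteq> {}} \<in> mschreier p"
        by (rule allowable_new[OF a bd]) (simp only: rs' subset_refl)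
      have "\<exists>f\<in>A. s k \<le> Min (supp f) \<and> supp f \<inter> {s k..r k} \<noteq> {}" if k: "k < P" "new k \<noteq> {}" for k
      proof -
        obtain f a where z: "(f, a) \<in> new k" using k(2) by auto
        then have z': "f \<in> A" "a \<in> J f" "s k \<le> Min (supp f)" "supp (g (f, a) k) \<noteq> {}" by (auto simp: new_def)
        then have "supp f \<inter> {s k..r k} \<noteq> {}" using gs[OF z'(1,2) k(1)] by blast
        then show ?thesis using z' by blast
      qed
      then show "r ` ?G1 \<subseteq> r ` {k\<in>{..<P}. \<exists>f\<in>A. s k \<le> Min (supp f) \<and> supp (?r f k) \<noteq> {}}"
        unfolding rs' by auto
    qed
    text \<open>Two special sequences share the weights of a common initial segment only, by injectivity
      of the coding. Along that segment, except for its last entry, the functional sits on the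
      sets \<open>E k\<close> and does not see the vectors.\<close>
    have agree: "a = k \<and> take k (S f) = map (\<lambda>k. (E k, j k)) [0..<k]"
      if f: "f \<in> A" and a: "a < length (S f)" and eq: "snd (S f ! a) = j k" for f a k
    proof -
      have Sw: "S f \<in> wh_sequences N1 N2" "\<forall>i. 1 \<le> i \<and> i < length (S f) \<longrightarrow> \<sigma> (take i (S f)) = snd (S f ! i)"
        using ZS[OF f] unfolding schreier_sigma_special_def sigma_special_def by blast+
      have S0: "snd (S f ! 0) \<in> N1" "S f \<noteq> []"
        using Sw(1) unfolding wh_sequences_def by (auto simp: hd_conv_nth)
      have lN1: "j 0 \<in> N1" using l[of 0] unfolding wh_sequences_def by simp
      show ?thesis
      proof (cases "a = 0")
        case True
        have "k = 0"
        proof (rule ccontr)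
          assume "k \<noteq> 0"
          then obtain k' where "k = Suc k'" by (cases k) auto
          then have "j k \<in> N2" using jS[of k'] \<sigma>_N2[OF l[of k']] by simp
          then show False using eq True S0 N12(3) by auto
        qed
        then show ?thesis using True by simp
      next
        case False
        then have sa: "\<sigma> (take a (S f)) = j k" and ta: "take a (S f) \<in> wh_sequences N1 N2"
          using Sw a eq wh_sequences_take[OF Sw(1), of a] by auto
        have "k \<noteq> 0"
        proof
          assume "k = 0"
          then show False using sa \<sigma>_N2[OF ta] lN1 N12(3) by auto
        qed
        then obtain k' where k': "k = Suc k'" by (cases k) auto
        have "take a (S f) = map (\<lambda>k. (E k, j k)) [0..<Suc k']"
          by (rule \<sigma>_inj[OF ta l]) (use sa jS[of k'] k' in simp)
        moreover from arg_cong[OF this, of length] have "a = k" using a k' by simp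
        ultimately show ?thesis using k' by simp
      qed
    qed
    have G2: "r ` ?G2 \<in> mschreier p"
    proof (rule allowable_marks[OF a, where P = "\<lambda>f k. f \<in> badf k"])
      fix k assume "k \<in> ?G2"
      then obtain f where f: "f \<in> badf k" by blast
      then have "f \<in> A" "supp f \<noteq> {}" "Min (supp f) < s k" by (auto simp: badf_def old_def)
      then show "\<exists>f\<in>A. f \<in> badf k \<and> supp f \<noteq> {} \<and> Min (supp f) \<le> r k"
        using f sr[of k] by (intro bexI[of _ f]) auto
    next
      fix f k k' assume k: "k \<in> ?G2" "k' \<in> ?G2" and f: "f \<in> badf k" "f \<in> badf k'"
      \<comment> \<open>The earlier of two bad blocks lies in the common initial segment, so the
        child found there is supported in \<open>E k\<close> and vanishes on
        \<open>u k\<close>.\<close>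
      have False if kk: "k < k'" and f: "f \<in> badf k" "f \<in> badf k'" and kP: "k < P" for k k'
      proof -
        obtain a where a: "f \<in> A" "a \<in> J f" "snd (S f ! a) = j k" "pair (g (f, a) k) (u k) \<noteq> 0"
          using f(1) by (auto simp: badf_def old_def)
        obtain a' where a': "a' \<in> J f" "snd (S f ! a') = j k'" using f(2) by (auto simp: badf_def)
        have ak: "a = k" using agree[OF a(1) ZH(2)[OF a(1,2)] a(3)] by blast
        have t': "a' = k'" "take k' (S f) = map (\<lambda>k. (E k, j k)) [0..<k']"
          using agree[OF a(1) ZH(2)[OF a(1) a'(1)] a'(2)] by blast+
        have "S f ! k = take k' (S f) ! k" using kk by simp
        also have "... = (E k, j k)" unfolding t'(2) using kk by simp
        finally have "supp (g (f, a) k) \<subseteq> E k" using gs[OF a(1,2) kP] ak by auto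
        then have "pair (g (f, a) k) (u k) = 0" using Eu[of k] by (intro pair_disjoint) blast
        then show False using a(4) by simp
      qed
      then show "k = k'" using k f by (metis (no_types, lifting) lessThan_iff linorder_neqE_nat mem_Collect_eq)
    qed
    have "(\<Sum>f\<in>A. (pair f y)\<^sup>2) \<le> (\<Sum>f\<in>A. (\<Sum>a\<in>J f. (pair (H f a) y)\<^sup>2) / M\<^sup>2)"
      by (rule sum_mono) (rule Zy)
    also have "... = (\<Sum>z\<in>?I. (pair (h z) y)\<^sup>2) / M\<^sup>2"
      unfolding sum_divide_distrib[symmetric] h_def
      using fA allowableD(1)[OF ZJ] by (simp add: sum.Sigma case_prod_beta)
    \<comment> \<open>The gain from the weight \<open>m Q\<close> is given away. The bound
      \<open>C^2 / M ^ 4\<close> comes from the children, whose weights are at least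
      \<open>m (Suc Q)\<close>.\<close>
    also have "... \<le> (\<Sum>z\<in>?I. (pair (h z) y)\<^sup>2) / 1"
      using M2 power_mono[OF M2, of 2] by (intro divide_left_mono) (auto intro: sum_nonneg)
    also have "(\<Sum>z\<in>?I. (pair (h z) y)\<^sup>2) / 1 \<le> (\<Sum>k<P. b k * (\<Sum>z\<in>?I. (pair (g z k) (u k))\<^sup>2))"
      unfolding y_def div_by_1 by (rule g(4)) (use us sa'(2) in auto)
    also have "... \<le> C\<^sup>2 / M ^ 4 + \<epsilon> * (4 ^ Suc (p + n Q) * C\<^sup>2 + 4 ^ Suc (n Q) * C\<^sup>2 + 0)"
    proof (rule small_average_sum_le[OF sa[folded p_def], where ?G1.0 = ?G1 and ?G2.0 = ?G2 and ?G3.0 = "{}"])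
      fix k assume k: "k \<in> {..<P}"
      have kP: "k < P" using k by simp
      have 1: "(\<Sum>z\<in>new k. (pair (g z k) (u k))\<^sup>2) \<le> of_bool (k \<in> ?G1) * (4 ^ Suc (p + n Q) * C\<^sup>2)"
      proof (cases "new k = {}")
        case False
        moreover have "(\<Sum>z\<in>new k. (pair (g z k) (u k))\<^sup>2) \<le> 4 ^ Suc (p + n Q) * C\<^sup>2"
          by (rule new_sum_bound[OF C aS]) (use g(1)[OF _ k] g(3)[OF _ k] in \<open>auto simp: new_def\<close>)
        ultimately show ?thesis using k by simp
      qed simp
      have aold: "allowable (Suc (n Q)) (Sigma I' J) (\<lambda>z. g z k)" if I': "I' \<subseteq> old k" for I'
      proof -
        have "allowable (Suc (n Q)) (Sigma I' J) (\<lambda>z. g (fst z, snd z) k)"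
        proof (rule allowable_old_Sigma[OF a, where s = "s k"])
          show IA: "I' \<subseteq> A" using I' by (auto simp: old_def)
          fix f assume f: "f \<in> I'"
          then have fA: "f \<in> A" using IA by blast
          show "supp f \<noteq> {} \<and> Min (supp f) < s k" using f I' by (auto simp: old_def)
          show "allowable (n Q) (J f) (\<lambda>a. g (f, a) k)"
          proof (rule allowable_shrink[OF ZJ[OF fA]])
            fix a assume "a \<in> J f"
            then have "(f, a) \<in> ?I" using fA by simp
            from g(1)[OF this k] g(3)[OF this k]
            show "D (g (f, a) k)" "supp (g (f, a) k) \<subseteq> supp (H f a)" by (auto simp: h_def)
          qed
          show "supp (g (f, a) k) \<subseteq> supp f \<inter> {s k..}" if "a \<in> J f" for a
            using gs[OF fA that kP] by auto
        qed
        then show ?thesis by simp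
      qed
      have 2: "(\<Sum>z\<in>Sigma (badf k) J. (pair (g z k) (u k))\<^sup>2) \<le> of_bool (k \<in> ?G2) * (4 ^ Suc (n Q) * C\<^sup>2)"
      proof (cases "badf k = {}")
        case False
        have "badf k \<subseteq> old k" by (auto simp: badf_def)
        from square_boundD[OF norm_le_square_bound[OF C] aold[OF this]]
        show ?thesis using False k by simp
      qed simp
      have 3: "(\<Sum>z\<in>good k. (pair (g z k) (u k))\<^sup>2) \<le> C\<^sup>2 / M ^ 4"
      proof -
        have "allowable (Suc (n Q)) (good k) (\<lambda>z. g z k)"
          by (rule allowable_subset[OF aold[OF order_refl]]) (auto simp: good_def)
        then obtain J' where J': "J' \<subseteq> good k" "allowable (Suc (n Q)) ((\<lambda>z. g z k) ` J') (\<lambda>f. f)"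
          "(\<Sum>f\<in>(\<lambda>z. g z k) ` J'. (pair f (u k))\<^sup>2) = (\<Sum>z\<in>good k. (pair (g z k) (u k))\<^sup>2)"
          using allowable_image[of "Suc (n Q)" "good k" "\<lambda>z. g z k" "u k"] by blast
        have "(\<Sum>f\<in>(\<lambda>z. g z k) ` J'. (pair f (u k))\<^sup>2) \<le> C\<^sup>2 / (real (m (Suc Q)))\<^sup>2"
        proof (rule U)
          show "allowable (n Q + 1) ((\<lambda>z. g z k) ` J') (\<lambda>f. f)" using J'(2) by simp
          show "\<forall>f\<in>(\<lambda>z. g z k) ` J'. \<exists>w. m (Suc Q) \<le> w \<and> w \<noteq> m (2 * j k) \<and> W f (Some w)"
          proof
            fix f' assume "f' \<in> (\<lambda>z. g z k) ` J'"
            then obtain f a where fa: "(f, a) \<in> good k" "f' = g (f, a) k" using J'(1) by auto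
            then have f: "f \<in> A" "a \<in> J f" "f \<in> old k" "f \<notin> badf k" "pair (g (f, a) k) (u k) \<noteq> 0"
              by (auto simp: good_def)
            have ne: "snd (S f ! a) \<noteq> j k" using f by (auto simp: badf_def)
            have len: "a < length (S f)" by (rule ZH(2)[OF f(1,2)])
            have "snd (hd (S f)) \<le> snd (S f ! a)"
            proof -
              have "sorted_wrt (<) (map snd (S f))"
                using ZS[OF f(1)] unfolding schreier_sigma_special_def sigma_special_def wh_sequences_def by auto
              have "snd (S f ! 0) \<le> snd (S f ! a)"
              proof (cases "a = 0")
                case False
                have "0 < length (S f)" using len by linarith
                then have "map snd (S f) ! 0 = snd (S f ! 0)" by (rule nth_map)
                moreover have "map snd (S f) ! a = snd (S f ! a)" using len by (rule nth_map)
                moreover have "map snd (S f) ! 0 < map snd (S f) ! a"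
                  using sorted_wrt_nth_less[OF \<open>sorted_wrt (<) (map snd (S f))\<close>, of 0 a] len False by simp
                ultimately show ?thesis by simp
              qed simp
              moreover have "S f \<noteq> []" using len by (metis list.size(3) not_less_zero)
              ultimately show ?thesis by (simp add: hd_conv_nth)
            qed
            moreover have "2 * snd (hd (S f)) > 2 * j0 + 2"
              using ZS[OF f(1)] unfolding schreier_sigma_special_def by blast
            ultimately have "m (Suc Q) \<le> m (2 * snd (S f ! a))" unfolding Q by (intro m_mono) simp
            moreover have "m (2 * snd (S f ! a)) \<noteq> m (2 * j k)" using minj[of "2 * snd (S f ! a)" k] ne by auto
            moreover have "W f' (Some (m (2 * snd (S f ! a))))"
              unfolding fa(2) by (rule g(2)[OF _ k]) (use f in \<open>auto simp: w_def\<close>)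
            ultimately show "\<exists>w. m (Suc Q) \<le> w \<and> w \<noteq> m (2 * j k) \<and> W f' (Some w)" by blast
          qed
        qed
        then show ?thesis using J'(3) MS4 by simp
      qed
      have fin: "finite (new k)" "finite (Sigma (badf k) J)" "finite (good k)"
        using fI finite_subset[of "Sigma (badf k) J" ?I]
        by (auto simp: new_def good_def badf_def old_def)
      have "(\<Sum>z\<in>?I. (pair (g z k) (u k))\<^sup>2) = (\<Sum>z\<in>new k \<union> (Sigma (badf k) J \<union> good k). (pair (g z k) (u k))\<^sup>2)"
      proof (rule sum.mono_neutral_right[OF fI])
        show "new k \<union> (Sigma (badf k) J \<union> good k) \<subseteq> ?I" by (auto simp: new_def good_def badf_def old_def)
        show "\<forall>z\<in>?I - (new k \<union> (Sigma (badf k) J \<union> good k)). (pair (g z k) (u k))\<^sup>2 = 0"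
        proof
          fix z assume z: "z \<in> ?I - (new k \<union> (Sigma (badf k) J \<union> good k))"
          obtain f a where fa: "z = (f, a)" by (cases z)
          then have f: "f \<in> A" "a \<in> J f" using z by auto
          show "(pair (g z k) (u k))\<^sup>2 = 0"
          proof (rule ccontr)
            assume "(pair (g z k) (u k))\<^sup>2 \<noteq> 0"
            then have nz: "pair (g (f, a) k) (u k) \<noteq> 0" using fa by simp
            then have sne: "supp (g (f, a) k) \<noteq> {}" by (auto simp: pair_def)
            then have fne: "supp f \<noteq> {}" using gs[OF f kP] by blast
            show False
              using z f nz sne fne unfolding fa by (auto simp: new_def good_def old_def not_le)
          qed
        qed
      qed
      also have "... \<le> (\<Sum>z\<in>new k. (pair (g z k) (u k))\<^sup>2)
          + ((\<Sum>z\<in>Sigma (badf k) J. (pair (g z k) (u k))\<^sup>2) + (\<Sum>z\<in>good k. (pair (g z k) (u k))\<^sup>2))"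
      proof -
        have un: "sum F (X \<union> Y) \<le> sum F X + sum F Y" if "finite X" "finite Y" "\<And>z. 0 \<le> F z"
          for X Y and F :: "(nat \<Rightarrow> real) \<times> nat \<Rightarrow> real"
          using sum.union_inter[OF that(1,2), of F] sum_nonneg[of "X \<inter> Y" F] that(3) by simp
        show ?thesis using fin
          by (intro order_trans[OF un] add_mono order_refl un) auto
      qed
      finally show "(\<Sum>z\<in>?I. (pair (g z k) (u k))\<^sup>2) \<le> C\<^sup>2 / M ^ 4 + of_bool (k \<in> ?G1) * (4 ^ Suc (p + n Q) * C\<^sup>2)
          + of_bool (k \<in> ?G2) * (4 ^ Suc (n Q) * C\<^sup>2) + of_bool (k \<in> {}) * 0"
        using 1 2 3 by simp
    qed (use G1 G2 mschreier_empty in auto)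
    also have "... \<le> 3 * (C\<^sup>2 / M ^ 4)"
      using eps'[of "Suc (p + n Q)"] eps'[of "Suc (n Q)"] Sp n_pos[of Q] by (simp add: distrib_left)
    finally show ?thesis .
  qed
  \<comment> \<open>With this \<open>L\<close> the remainder of the expansion is divided by
    \<open>4 ^ L \<ge> M ^ 4\<close>, and \<open>m Q \<ge> 2\<close> keeps \<open>2 ^ L\<close>
    below \<open>m Q ^ 3\<close>, as \<open>n_gap_levels\<close> demands.\<close>
  obtain L where L: "m Q ^ 2 \<le> 2 ^ L" "2 ^ L \<le> 2 * m Q ^ 2"
    using power_two_between[of "m Q ^ 2"] m_ge2[of Q] by auto
  have "2 * m Q ^ 2 \<le> m Q ^ 3" using m_ge2[of Q] by (simp add: power2_eq_square power3_eq_cube)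
  then have "2 ^ L \<le> m Q ^ 3" using L(2) by simp
  from n_gap_levels[OF _ this] Q3 have gap: "0 + L * n (Q - 1) \<le> p"
    by (simp add: p_def algebra_simps)
  have "square_bound 0 y (2 * (6 * (C\<^sup>2 / M ^ 4)) + 5 * C\<^sup>2 / 4 ^ L)"
  proof (rule square_bound_expand[OF K _ _ _ _ gap])
    fix A assume a: "allowable p A (\<lambda>f. f)" and hv: "\<forall>f\<in>A. heavy Q f"
    let ?A1 = "{f\<in>A. heavy (Suc Q) f}" and ?A2 = "{f\<in>A. \<not> heavy (Suc Q) f}"
    have "(\<Sum>f\<in>?A1. (pair f y)\<^sup>2) \<le> 3 * (C\<^sup>2 / M ^ 4)"
      by (rule H1[OF allowable_subset[OF a]]) auto
    moreover have "(\<Sum>f\<in>?A2. (pair f y)\<^sup>2) \<le> 3 * (C\<^sup>2 / M ^ 4)"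
    proof (rule H2[OF allowable_subset[OF a]])
      show "\<forall>f\<in>?A2. W f (Some (m Q))"
      proof
        fix f assume f: "f \<in> ?A2"
        then obtain w where w: "m Q \<le> w" "W f (Some w)" using hv unfolding heavy_def by blast
        obtain i where i: "w = m i" using W_weight[OF w(2)] by blast
        have "w < m (Suc Q)" using f w unfolding heavy_def by (metis (mono_tags, lifting) linorder_not_less mem_Collect_eq)
        then have "\<not> Suc Q \<le> i" using m_mono[of "Suc Q" i] i by auto
        then have "m i \<le> m Q" by (intro m_mono) simp
        then show "W f (Some (m Q))" using w i by simp
      qed
    qed auto
    moreover have "(\<Sum>f\<in>A. (pair f y)\<^sup>2) = (\<Sum>f\<in>?A1. (pair f y)\<^sup>2) + (\<Sum>f\<in>?A2. (pair f y)\<^sup>2)"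
      using allowableD(1)[OF a] by (subst sum.union_disjoint[symmetric]) (auto intro: sum.cong)
    ultimately show "(\<Sum>f\<in>A. (pair f y)\<^sup>2) \<le> 6 * (C\<^sup>2 / M ^ 4)" by linarith
  qed (use Q3 M4 in auto)
  moreover have "2 * (6 * (C\<^sup>2 / M ^ 4)) + 5 * C\<^sup>2 / 4 ^ L \<le> (5 * C / M\<^sup>2)\<^sup>2"
  proof -
    have "real (m Q ^ 2) \<le> 2 ^ L" using L(1) by (metis of_nat_le_iff of_nat_numeral of_nat_power)
    then have "(M\<^sup>2)\<^sup>2 \<le> (2 ^ L)\<^sup>2" unfolding M_def by (intro power_mono) auto
    also have "(2 ^ L)\<^sup>2 = (4::real) ^ L" by (simp add: power2_eq_square power_mult_distrib[symmetric])
    finally have "5 * C\<^sup>2 / 4 ^ L \<le> 5 * C\<^sup>2 / M ^ 4"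
    proof (intro divide_left_mono)
      have "0 < M ^ 4" using M2 by simp
      then show "0 < 4 ^ L * M ^ 4" by (intro mult_pos_pos) simp_all
    qed (simp_all add: power_mult[symmetric])
    then have "2 * (6 * (C\<^sup>2 / M ^ 4)) + 5 * C\<^sup>2 / 4 ^ L \<le> 17 * (C\<^sup>2 / M ^ 4)" by simp
    \<comment> \<open>12 + 5 = 17 is rounded up to the square of 5.\<close>
    also have "... \<le> 25 * (C\<^sup>2 / M ^ 4)" using M4 by (intro mult_right_mono) auto
    also have "... = (5 * C / M\<^sup>2)\<^sup>2" by (simp add: power_mult_distrib power_divide power_mult[symmetric])
    finally show ?thesis .
  qed
  ultimately have "square_bound 0 y ((5 * C / M\<^sup>2)\<^sup>2)" using square_bound_mono by blast
  then show ?thesis unfolding y_def M_def by (rule square_bound_norm_le) (use C0 in simp)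
qed

text \<open>Two nested averages. The inner ones, over \<open>t\<close>, give vectors
  \<open>u i\<close> of norm at most \<open>5 * C\<close> and functionals \<open>G i\<close> of
  weight \<open>m (2 * j i)\<close>; the outer one, over \<open>i\<close>, joins the
  \<open>G i\<close> to a special functional of weight \<open>m (2 * j0 + 1)\<close>.
  \<open>A\<close> and \<open>B\<close> are the coefficients after flattening. The factor
  \<open>m (2 * j i)\<close> in \<open>u i\<close> cancels the one in \<open>G i\<close>, so the
  products \<open>A t * B t\<close> sum to the reciprocal of the outer weight. The bound
  \<open>B t \<le> m (q t)\<close> will absorb perturbations of the \<open>x t\<close>.\<close>

lemma rapid_special_functional:
  fixes f x :: "nat \<Rightarrow> nat \<Rightarrow> real"
  assumes R: "rapid s r q x C" and fD: "\<And>t. D (f t)" and fs: "\<And>t. supp (f t) \<subseteq> {s t..r t}"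
    and fne: "\<And>t. supp (f t) \<noteq> {}" and fx: "\<And>t. supp (f t) \<inter> supp (x t) = {}" and j0: "1 \<le> j0"
  shows "\<exists>T A B. finite T \<and> T \<subseteq> {t0..} \<and>
    (\<forall>t\<in>T. 0 \<le> A t \<and> A t \<le> 1 \<and> 0 \<le> B t \<and> B t \<le> real (m (q t))) \<and>
    (\<Sum>t\<in>T. A t * B t) = 1 / real (m (2 * j0 + 1)) \<and> D (\<lambda>k. \<Sum>t\<in>T. A t * f t k) \<and>
    norm_le (\<lambda>k. \<Sum>t\<in>T. B t * x t k) (25 * C / (real (m (2 * j0 + 1)))\<^sup>2)"
proof -
  note R' = rapidD[OF R]
  define Q where "Q = 2 * j0 + 1"
  have bd: "disjoint_family_on (\<lambda>t. {s t..r t}) UNIV" and sm: "strict_mono s" and rm: "strict_mono r"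
    by (rule blocks_disjoint[of s r]; rule R')+
  have sle: "s i \<le> s k" and rle: "r i \<le> r k" if "i \<le> k" for i k
    using that sm rm by (simp_all add: strict_mono_less_eq)
  have qm: "strict_mono q" using R'(6) by (simp add: strict_mono_Suc_iff)
  define \<epsilon> where "\<epsilon> k = 1 / (4 ^ n k * (real (m (Suc k)))\<^sup>2)" for k
  have \<epsilon>0: "0 < \<epsilon> k" for k unfolding \<epsilon>_def using m_ge2[of "Suc k"] by simp
  have \<epsilon>1: "\<epsilon> k * 4 ^ n k * (real (m (Suc k)))\<^sup>2 \<le> 1" for k unfolding \<epsilon>_def using m_ge2[of "Suc k"] by simp
  define F where "F d = {fst d..<fst (snd d)}" for d :: "nat \<times> nat \<times> (nat \<Rightarrow> real)"
  define b where "b d = snd (snd d)" for d :: "nat \<times> nat \<times> (nat \<Rightarrow> real)"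
  define lo where "lo d = s (fst d)" for d :: "nat \<times> nat \<times> (nat \<Rightarrow> real)"
  define hi where "hi d = r (fst (snd d) - 1)" for d :: "nat \<times> nat \<times> (nat \<Rightarrow> real)"
  \<comment> \<open>This will be the support of \<open>G i\<close>. Recording supports rather than
    intervals keeps the sets of the special sequence disjoint from the supports of the
    vectors.\<close>
  define E where "E d = (\<Union>t\<in>{t\<in>F d. sqrt (b d t) \<noteq> 0}. supp (f t))" for d
  define Good where "Good j d \<longleftrightarrow> j0 + 2 \<le> j \<and> fst d < fst (snd d) \<and> t0 \<le> fst d \<and>
    s ` F d \<in> schreier (n (2 * j)) \<and> small_average (n (2 * j) - 1) (\<epsilon> (2 * j)) (F d) (b d) r \<and>
    (\<forall>t\<in>F d. Suc (2 * j) \<le> q t)" for j d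
  have Fin: "finite (F d)" for d by (simp add: F_def)
  have block: "{s t..r t} \<subseteq> {lo d..hi d}" if "t \<in> F d" for t d
  proof -
    have "s (fst d) \<le> s t" "r t \<le> r (fst (snd d) - 1)" using that by (auto simp: F_def intro!: sle rle)
    then show ?thesis by (auto simp: lo_def hi_def)
  qed
  have ex: "\<exists>d. Good j d \<and> K \<le> lo d" if j: "j0 + 2 \<le> j" for j K
  proof -
    obtain K1 where K1: "\<forall>K'\<ge>K1. \<exists>K'' b. K' < K'' \<and> s ` {K'..<K''} \<in> schreier (n (2 * j)) \<and>
        small_average (n (2 * j) - 1) (\<epsilon> (2 * j)) {K'..<K''} b r"
      using small_average_exists[of s r, OF R'(3) R'(4) R'(2) \<epsilon>0 n_pos] by blast
    define K' where "K' = K1 + t0 + K + Suc (2 * j)"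
    obtain K'' b' where K'': "K' < K''" "s ` {K'..<K''} \<in> schreier (n (2 * j))"
        "small_average (n (2 * j) - 1) (\<epsilon> (2 * j)) {K'..<K''} b' r"
      using K1[rule_format, of K'] by (auto simp: K'_def)
    have "Suc (2 * j) \<le> q t" if "K' \<le> t" for t
      using strict_mono_imp_increasing[OF qm, of t] that by (simp add: K'_def)
    moreover have "K \<le> s K'" using strict_mono_imp_increasing[OF sm, of K'] by (simp add: K'_def)
    ultimately show ?thesis using j K''
      by (intro exI[of _ "(K', K'', b')"]) (auto simp: Good_def F_def b_def lo_def K'_def)
  qed
  have Good: "E d \<noteq> {} \<and> E d \<subseteq> {lo d..hi d} \<and> 1 \<le> lo d \<and> lo d \<le> hi d" if g: "Good j d" for j d
  proof -
    have sa: "small_average (n (2 * j) - 1) (\<epsilon> (2 * j)) (F d) (b d) r" and lt: "fst d < fst (snd d)"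
      using g by (auto simp: Good_def)
    have "\<exists>t\<in>F d. b d t \<noteq> 0"
    proof (rule ccontr)
      assume "\<not> ?thesis"
      then have "(\<Sum>t\<in>F d. b d t) = 0" by (intro sum.neutral) auto
      then show False using small_averageD(3)[OF sa] by simp
    qed
    then obtain t where "t \<in> F d" "b d t \<noteq> 0" by blast
    then have "t \<in> {t\<in>F d. sqrt (b d t) \<noteq> 0}" by simp
    then have "E d \<noteq> {}" unfolding E_def using fne[of t] by blast
    moreover have "E d \<subseteq> {lo d..hi d}" unfolding E_def using fs block by blast
    moreover have "1 \<le> lo d" using sle[of 0 "fst d"] R'(2) by (simp add: lo_def)
    moreover have "lo d \<le> hi d"
    proof -
      have "s (fst d) \<le> s (fst (snd d) - 1)" by (rule sle) (use lt in simp)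
      also have "... \<le> r (fst (snd d) - 1)" by (rule R'(3))
      finally show ?thesis by (simp add: lo_def hi_def)
    qed
    ultimately show ?thesis by blast
  qed
  obtain j1 where j1: "j1 \<in> N1" "j0 + 2 \<le> j1"
    using N12(1) unfolding infinite_nat_iff_unbounded_le by blast
  define \<epsilon>' where "\<epsilon>' = 1 / (4 ^ (2 * n Q) * (real (m Q)) ^ 4)"
  have \<epsilon>': "0 < \<epsilon>'" "\<epsilon>' * 4 ^ (2 * n Q) * (real (m Q)) ^ 4 \<le> 1"
    unfolding \<epsilon>'_def using m_ge2[of Q] by simp_all
  \<comment> \<open>The outer average has to begin with the first term of the special sequence, at
    index 0. Its smallness therefore comes from the late position \<open>K0\<close> of the first
    block, not from a late starting index.\<close>
  obtain K0 :: nat where K0: "3 ^ n Q / \<epsilon>' \<le> real K0" using real_arch_simple by blast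
  obtain d j where dj: "\<And>i. Good (j i) (d i) \<and> K0 \<le> lo (d i) \<and> hi (d i) < lo (d (Suc i))" "j 0 = j1"
    "\<And>i. map (\<lambda>k. (E (d k), j k)) [0..<Suc i] \<in> wh_sequences N1 N2"
    "\<And>i. j (Suc i) = \<sigma> (map (\<lambda>k. (E (d k), j k)) [0..<Suc i])"
  proof -
    have "\<exists>d j. (\<forall>i. Good (j i) (d i) \<and> K0 \<le> lo (d i) \<and> hi (d i) < lo (d (Suc i))) \<and> j 0 = j1 \<and>
      (\<forall>i. map (\<lambda>k. (E (d k), j k)) [0..<Suc i] \<in> wh_sequences N1 N2 \<and>
        j (Suc i) = \<sigma> (map (\<lambda>k. (E (d k), j k)) [0..<Suc i]))"
    proof (rule special_blocks)
      show "\<exists>d. Good j d \<and> K \<le> lo d" if "j0 + 2 \<le> j" for j K using ex[OF that] .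
      show "E d \<noteq> {} \<and> E d \<subseteq> {lo d..hi d} \<and> 1 \<le> lo d \<and> lo d \<le> hi d" if "Good j d" for j d
        using Good[OF that] .
    qed (rule j1)+
    then show ?thesis using that by blast
  qed
  have Gi: "Good (j i) (d i)" for i using dj(1) by blast
  have jge: "j0 + 2 \<le> j i" and sch: "s ` F (d i) \<in> schreier (n (2 * j i))"
    and sa: "small_average (n (2 * j i) - 1) (\<epsilon> (2 * j i)) (F (d i)) (b (d i)) r"
    and Fq: "\<And>t. t \<in> F (d i) \<Longrightarrow> Suc (2 * j i) \<le> q t" and Ft0: "F (d i) \<subseteq> {t0..}" for i
    using Gi[of i] by (auto simp: Good_def F_def)
  have lohi: "lo (d i) \<le> hi (d i)" "hi (d i) < lo (d (Suc i))" "1 \<le> lo (d i)"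
    and Ei: "E (d i) \<noteq> {}" "E (d i) \<subseteq> {lo (d i)..hi (d i)}" for i
    using Good[OF Gi[of i]] dj(1) by blast+
  define y where "y i = (\<lambda>a. \<Sum>t\<in>F (d i). sqrt (b (d i) t) * x t a)" for i
  define u where "u i = (\<lambda>a. real (m (2 * j i)) * y i a)" for i
  define G where "G i = (\<lambda>a. 1 / real (m (2 * j i)) * (\<Sum>t\<in>F (d i). sqrt (b (d i) t) * f t a))" for i
  have mpos: "0 < real (m k)" for k using m_ge2[of k] by simp
  have pu: "(pair h (u i))\<^sup>2 = (real (m (2 * j i)))\<^sup>2 * (pair h (y i))\<^sup>2" for h i
    unfolding u_def pair_scale by (simp add: power_mult_distrib)
  have k2: "2 \<le> 2 * j i" for i using jge[of i] by simp
  have suppy: "supp (y i) \<subseteq> (\<Union>t\<in>F (d i). supp (x t))" for i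
  proof
    fix a assume "a \<in> supp (y i)"
    then have "(\<Sum>t\<in>F (d i). sqrt (b (d i) t) * x t a) \<noteq> 0" by (simp add: supp_def y_def)
    then obtain t where "t \<in> F (d i)" "sqrt (b (d i) t) * x t a \<noteq> 0" by (rule sum.not_neutral_contains_not_neutral)
    then show "a \<in> (\<Union>t\<in>F (d i). supp (x t))" by (auto simp: supp_def)
  qed
  have suppu: "supp (u i) \<subseteq> (\<Union>t\<in>F (d i). supp (x t))" for i
    using suppy[of i] by (auto simp: u_def supp_def)
  have dxf: "supp (f t) \<inter> supp (x t') = {}" for t t'
  proof (cases "t = t'")
    case False
    then have "{s t..r t} \<inter> {s t'..r t'} = {}" using bd unfolding disjoint_family_on_def by blast
    then show ?thesis using fs[of t] R'(8)[of t'] by blast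
  qed (use fx in simp)
  have blk: "disjoint_family_on (\<lambda>i. {lo (d i)..hi (d i)}) UNIV" and slo: "strict_mono (\<lambda>i. lo (d i))"
    by (rule blocks_disjoint[of "\<lambda>i. lo (d i)" "\<lambda>i. hi (d i)"]; rule lohi)+
  have disjF: "F (d i) \<inter> F (d i') = {}" if "i \<noteq> i'" for i i'
  proof -
    have "{lo (d i)..hi (d i)} \<inter> {lo (d i')..hi (d i')} = {}"
      using blk that unfolding disjoint_family_on_def by blast
    moreover have "s t \<in> {lo (d i)..hi (d i)}" if "t \<in> F (d i)" for t i
      using block[OF that] R'(3)[of t] by auto
    ultimately show ?thesis by blast
  qed
  obtain P b3 where P: "0 < P" "\<forall>k. 0 \<le> b3 k" "(\<Sum>k\<in>{0..<P}. b3 k) = (1::real)"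
    "(\<lambda>i. lo (d i)) ` {0..<P} \<in> schreier (Suc (n Q - 1))"
    "\<forall>G\<subseteq>{0..<P}. (\<lambda>i. hi (d i)) ` G \<in> mschreier (n Q - 1) \<longrightarrow> (\<Sum>k\<in>G. b3 k) \<le> 3 ^ Suc (n Q - 1) / real (lo (d 0))"
    using repeated_averages[of "\<lambda>i. lo (d i)" "\<lambda>i. hi (d i)" 0 "n Q - 1", OF lohi] by blast
  have SnQ: "Suc (n Q - 1) = n Q" using n_pos[of Q] by simp
  have sa3: "small_average (n Q - 1) \<epsilon>' {..<P} b3 (\<lambda>i. hi (d i))"
  proof -
    have "3 ^ n Q / \<epsilon>' \<le> real (lo (d 0))" using K0 dj(1)[of 0] by linarith
    then have "3 ^ n Q / real (lo (d 0)) \<le> \<epsilon>'" using \<epsilon>'(1) lohi(3)[of 0] by (simp add: field_simps)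
    then show ?thesis
      unfolding small_average_def using P(2,3,5) SnQ by (auto simp: atLeast0LessThan intro: order_trans)
  qed
  have main: "norm_le (\<lambda>a. \<Sum>i<P. sqrt (b3 i) * u i a) (5 * (5 * C) / (real (m Q))\<^sup>2)"
  proof (rule special_average_bound[where E = "\<lambda>i. E (d i)" and j = j, OF j0 Q_def lohi(1,2) dj(3,4) _ _ _ _ _ sa3 \<epsilon>'(2)])
    show "j0 + 2 \<le> j 0" by (rule jge)
    fix i
    show "supp (u i) \<subseteq> {lo (d i)..hi (d i)}" using suppu[of i] R'(8) block[of _ "d i"] by blast
    show "E (d i) \<inter> supp (u i) = {}" unfolding E_def using suppu[of i] dxf by blast
    have sb: "square_bound (2 * n (2 * j i - 1) + 1) (y i) (13 * C\<^sup>2 / (real (m (2 * j i)))\<^sup>2)"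
      unfolding y_def by (rule rapid_average_bound[OF R k2 sa Fq \<epsilon>1])
    have "13 * C\<^sup>2 / (real (m (2 * j i)))\<^sup>2 \<le> (5 * C / real (m (2 * j i)))\<^sup>2"
      unfolding power_divide by (rule divide_right_mono) (simp_all add: power_mult_distrib)
    then have "square_bound 0 (y i) ((5 * C / real (m (2 * j i)))\<^sup>2)"
      using square_bound_mono[OF sb] by simp
    then have ny: "norm_le (y i) (5 * C / real (m (2 * j i)))"
      by (rule square_bound_norm_le) (use R'(1) in simp)
    show "norm_le (u i) (5 * C)"
      unfolding norm_le_def
    proof (intro allI impI)
      fix h assume "D h"
      then have "\<bar>pair h (y i)\<bar> \<le> 5 * C / real (m (2 * j i))" using ny unfolding norm_le_def by blast
      then show "\<bar>pair h (u i)\<bar> \<le> 5 * C"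
        using mpos[of "2 * j i"] unfolding u_def pair_scale by (simp add: abs_mult field_simps)
    qed
    fix A assume A: "allowable (n Q + 1) A (\<lambda>f. f)"
      "\<forall>f\<in>A. \<exists>w. m (Suc Q) \<le> w \<and> w \<noteq> m (2 * j i) \<and> W f (Some w)"
    have "n Q \<le> n (2 * j i - 1)" using jge[of i] by (intro n_mono) (simp add: Q_def)
    then have A': "allowable (n (2 * j i - 1) + 1) A (\<lambda>f. f)" using allowable_mono[OF A(1)] by simp
    have "(\<Sum>f\<in>A. (pair f (y i))\<^sup>2) \<le> 17 * C\<^sup>2 / ((real (m (2 * j i)))\<^sup>2 * (real (m (Suc Q)))\<^sup>2)"
      unfolding y_def
      by (rule rapid_average_weights[OF R k2 sa Fq \<epsilon>1 A']) (use A(2) jge[of i] in \<open>auto simp: Q_def\<close>)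
    then have "(real (m (2 * j i)))\<^sup>2 * (\<Sum>f\<in>A. (pair f (y i))\<^sup>2)
        \<le> (real (m (2 * j i)))\<^sup>2 * (17 * C\<^sup>2 / ((real (m (2 * j i)))\<^sup>2 * (real (m (Suc Q)))\<^sup>2))"
      by (rule mult_left_mono) simp
    also have "... = 17 * C\<^sup>2 / (real (m (Suc Q)))\<^sup>2" using mpos[of "2 * j i"] by simp
    also have "... \<le> (5 * C)\<^sup>2 / (real (m (Suc Q)))\<^sup>2" by (rule divide_right_mono) (simp_all add: power_mult_distrib)
    finally show "(\<Sum>f\<in>A. (pair f (u i))\<^sup>2) \<le> (5 * C)\<^sup>2 / (real (m (Suc Q)))\<^sup>2"
      unfolding pu sum_distrib_left .
  qed
  have WG: "W (G i) (Some (m (2 * j i)))" for i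
    unfolding G_def
  proof (rule even_functional)
    have Mf: "Min (supp (f t)) \<in> {s t..r t}" for t using D_Min[OF fD fne, of t] fs[of t] by blast
    show df: "disjoint_family_on (\<lambda>t. supp (f t)) (F (d i))"
      using bd fs unfolding disjoint_family_on_def by blast
    have inj: "inj_on (\<lambda>t. Min (supp (f t))) (F (d i))"
      by (rule inj_on_Min_supp[OF df]) (use D_Min[OF fD fne] in auto)
    have "(\<lambda>t. Min (supp (f t))) ` F (d i) \<in> schreier (n (2 * j i))"
    proof (rule schreier_dominate[OF sch n_pos _ inj, of s])
      show "inj_on s (F (d i))" using sm by (meson inj_on_subset strict_mono_imp_inj_on subset_UNIV)
    qed (use Mf in auto)
    then show "(\<lambda>t. Min (supp (f t))) ` {t\<in>F (d i). supp (f t) \<noteq> {}} \<in> schreier (n (2 * j i))"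
      using fne by simp
    have "(\<Sum>t\<in>F (d i). (sqrt (b (d i) t))\<^sup>2) = (\<Sum>t\<in>F (d i). b (d i) t)"
      by (rule sum.cong) (use small_averageD(2)[OF sa] in auto)
    then show "(\<Sum>t\<in>F (d i). (sqrt (b (d i) t))\<^sup>2) \<le> 1" using small_averageD(3)[OF sa] by simp
  qed (use fD Fin in auto)
  have GE: "supp (G i) = E (d i)" for i
    unfolding G_def E_def
  proof (rule supp_combo[OF Fin])
    show "disjoint_family_on (\<lambda>t. supp (f t)) (F (d i))"
      using bd fs unfolding disjoint_family_on_def by blast
  qed (use mpos[of "2 * j i"] in simp)
  define l where "l = map (\<lambda>k. (E (d k), j k)) [0..<P]"
  have special: "schreier_sigma_special n N1 N2 \<sigma> j0 l"
    unfolding schreier_sigma_special_def sigma_special_def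
  proof (intro conjI allI impI)
    obtain P' where P': "P = Suc P'" using P(1) by (cases P) auto
    show "l \<in> wh_sequences N1 N2" unfolding l_def P' by (rule dj(3))
    fix i assume i: "1 \<le> i \<and> i < length l"
    then obtain i' where i': "i = Suc i'" by (cases i) auto
    have "take i l = map (\<lambda>k. (E (d k), j k)) [0..<i]" using i by (simp add: l_def take_map)
    then show "\<sigma> (take i l) = snd (l ! i)" using dj(4)[of i'] i i' by (simp add: l_def)
  next
    have MinE: "Min (E (d i)) \<in> {lo (d i)..hi (d i)}" for i
      using Ei[of i] Min_in[of "E (d i)"] finite_subset[OF Ei(2)[of i]] by blast
    have "(\<lambda>i. Min (E (d i))) ` {0..<P} \<in> schreier (n Q)"
    proof (rule schreier_dominate[OF P(4)[unfolded SnQ] n_pos, of "\<lambda>i. lo (d i)"])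
      show "inj_on (\<lambda>i. lo (d i)) {0..<P}" using slo by (meson inj_on_subset strict_mono_imp_inj_on subset_UNIV)
      show "inj_on (\<lambda>i. Min (E (d i))) {0..<P}"
      proof (rule inj_onI)
        fix i i' assume "Min (E (d i)) = Min (E (d i'))"
        then have "Min (E (d i)) \<in> {lo (d i)..hi (d i)} \<inter> {lo (d i')..hi (d i')}"
          using MinE[of i] MinE[of i'] by simp
        then show "i = i'" using blk unfolding disjoint_family_on_def by blast
      qed
    qed (use MinE in auto)
    then show "Min ` fst ` set l \<in> schreier (n (2 * j0 + 1))"
      by (simp add: l_def image_image Q_def)
    show "2 * snd (hd l) > 2 * j0 + 2" using P(1) jge[of 0] by (simp add: l_def hd_map)
  qed
  have DG: "W (\<lambda>k. 1 / real (m (2 * j0 + 1)) * (\<Sum>i<P. sqrt (b3 i) * G i k)) (Some (m (2 * j0 + 1)))"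
  proof (rule wh_functional.odd[OF special])
    show "length l = P" by (simp add: l_def)
    show "\<forall>i<P. W (G i) (Some (m (2 * snd (l ! i)))) \<and> supp (G i) \<subseteq> fst (l ! i)"
      using WG GE by (simp add: l_def)
    have "(\<Sum>i<P. (sqrt (b3 i))\<^sup>2) = (\<Sum>i<P. b3 i)" by (rule sum.cong) (use P(2) in auto)
    then show "(\<Sum>i<P. (sqrt (b3 i))\<^sup>2) \<le> 1" using P(3) by (simp add: atLeast0LessThan)
  qed
  define T where "T = (\<Union>i<P. F (d i))"
  define \<iota> where "\<iota> t = (THE i. t \<in> F (d i))" for t
  have \<iota>: "\<iota> t = i" if "t \<in> F (d i)" for t i
    unfolding \<iota>_def
  proof (rule the_equality)
    fix i' assume "t \<in> F (d i')"
    then show "i' = i" using disjF[of i i'] that by blast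
  qed (rule that)
  define A where "A t = sqrt (b3 (\<iota> t)) * sqrt (b (d (\<iota> t)) t) / (real (m Q) * real (m (2 * j (\<iota> t))))" for t
  define B where "B t = sqrt (b3 (\<iota> t)) * real (m (2 * j (\<iota> t))) * sqrt (b (d (\<iota> t)) t)" for t
  have sumT: "(\<Sum>t\<in>T. \<phi> t) = (\<Sum>i<P. \<Sum>t\<in>F (d i). \<phi> t)" for \<phi> :: "nat \<Rightarrow> real"
    unfolding T_def by (rule sum.UNION_disjoint) (use Fin disjF in auto)
  have b01: "0 \<le> b (d i) t" "b (d i) t \<le> 1" if "t \<in> F (d i)" for i t
    using small_averageD(2)[OF sa that] member_le_sum[OF that, of "b (d i)"] small_averageD(2,3)[OF sa] Fin by auto
  have b301: "0 \<le> b3 i" "b3 i \<le> 1" if "i < P" for i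
    using P(2) member_le_sum[of i "{0..<P}" b3] P(3) that by auto
  have "0 \<le> A t \<and> A t \<le> 1 \<and> 0 \<le> B t \<and> B t \<le> real (m (q t))" if t: "t \<in> T" for t
  proof -
    obtain i where i: "i < P" "t \<in> F (d i)" using t by (auto simp: T_def)
    have s1: "0 \<le> sqrt (b3 i)" "sqrt (b3 i) \<le> 1" "0 \<le> sqrt (b (d i) t)" "sqrt (b (d i) t) \<le> 1"
      using b01[OF i(2)] b301[OF i(1)] by auto
    then have p1: "sqrt (b3 i) * sqrt (b (d i) t) \<le> 1" "0 \<le> sqrt (b3 i) * sqrt (b (d i) t)"
      by (auto intro: mult_le_one)
    have "1 \<le> real (m Q) * real (m (2 * j i))"
      using m_ge2[of Q] m_ge2[of "2 * j i"] mult_mono[of 1 "real (m Q)" 1 "real (m (2 * j i))"] by simp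
    then have "A t \<le> 1" "0 \<le> A t" using p1 by (auto simp: A_def \<iota>[OF i(2)] divide_le_eq)
    moreover have "m (2 * j i) \<le> m (q t)" using Fq[OF i(2)] by (intro m_mono) simp
    moreover have "B t = (sqrt (b3 i) * sqrt (b (d i) t)) * real (m (2 * j i))" by (simp add: B_def \<iota>[OF i(2)])
    moreover have "... \<le> 1 * real (m (2 * j i))" by (rule mult_right_mono[OF p1(1)]) simp
    ultimately show ?thesis using p1(2) by simp
  qed
  moreover have "(\<Sum>t\<in>T. A t * B t) = 1 / real (m Q)"
  proof -
    have "(\<Sum>t\<in>T. A t * B t) = (\<Sum>i<P. \<Sum>t\<in>F (d i). b3 i / real (m Q) * b (d i) t)"
      unfolding sumT
    proof (intro sum.cong refl)
      fix i t assume i: "i \<in> {..<P}" "t \<in> F (d i)"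
      have "sqrt (b3 i) * sqrt (b3 i) = b3 i" "sqrt (b (d i) t) * sqrt (b (d i) t) = b (d i) t"
        using b301[of i] b01[OF i(2)] i by auto
      moreover have "A t * B t = (sqrt (b3 i) * sqrt (b3 i)) * (sqrt (b (d i) t) * sqrt (b (d i) t)) / real (m Q)"
        using mpos[of "2 * j i"] by (simp add: A_def B_def \<iota>[OF i(2)] field_simps)
      ultimately show "A t * B t = b3 i / real (m Q) * b (d i) t" by simp
    qed
    also have "... = (\<Sum>i<P. b3 i / real (m Q))"
      unfolding sum_distrib_left[symmetric] using small_averageD(3)[OF sa] by simp
    also have "... = 1 / real (m Q)"
      unfolding sum_divide_distrib[symmetric] using P(3) by (simp add: atLeast0LessThan)
    finally show ?thesis .
  qed
  moreover have "(\<lambda>k. \<Sum>t\<in>T. A t * f t k) = (\<lambda>k. 1 / real (m (2 * j0 + 1)) * (\<Sum>i<P. sqrt (b3 i) * G i k))"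
  proof
    fix k
    have "(\<Sum>t\<in>T. A t * f t k) = (\<Sum>i<P. 1 / real (m Q) * (sqrt (b3 i) * G i k))"
      unfolding sumT
    proof (intro sum.cong refl)
      fix i
      have "(\<Sum>t\<in>F (d i). A t * f t k)
          = (\<Sum>t\<in>F (d i). 1 / real (m Q) * (sqrt (b3 i) * (1 / real (m (2 * j i)) * (sqrt (b (d i) t) * f t k))))"
        by (rule sum.cong) (auto simp: A_def \<iota>)
      then show "(\<Sum>t\<in>F (d i). A t * f t k) = 1 / real (m Q) * (sqrt (b3 i) * G i k)"
        unfolding G_def by (simp only: sum_distrib_left)
    qed
    then show "(\<Sum>t\<in>T. A t * f t k) = 1 / real (m (2 * j0 + 1)) * (\<Sum>i<P. sqrt (b3 i) * G i k)"
      by (simp only: sum_distrib_left Q_def)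
  qed
  moreover have "(\<lambda>k. \<Sum>t\<in>T. B t * x t k) = (\<lambda>a. \<Sum>i<P. sqrt (b3 i) * u i a)"
  proof
    fix k
    show "(\<Sum>t\<in>T. B t * x t k) = (\<Sum>i<P. sqrt (b3 i) * u i k)"
      unfolding sumT
    proof (intro sum.cong refl)
      fix i
      have "(\<Sum>t\<in>F (d i). B t * x t k)
          = (\<Sum>t\<in>F (d i). sqrt (b3 i) * (real (m (2 * j i)) * (sqrt (b (d i) t) * x t k)))"
        by (rule sum.cong) (auto simp: B_def \<iota>)
      then show "(\<Sum>t\<in>F (d i). B t * x t k) = sqrt (b3 i) * u i k"
        unfolding u_def y_def by (simp only: sum_distrib_left)
    qed
  qed
  moreover have "finite T" using Fin by (simp add: T_def)
  moreover have "T \<subseteq> {t0..}" unfolding T_def using Ft0 by blast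
  ultimately show ?thesis using main DG unfolding Q_def
    by (intro exI[of _ T] exI[of _ A] exI[of _ B]) auto
qed

end

lemma subspace_closed_span: "subspace (closed_span A)"
  unfolding closed_span_def
proof (rule subspaceI)
  show "0 \<in> closure (span A)" using closure_subset span_zero by blast
  fix u assume u: "u \<in> closure (span A)"
  then obtain a where a: "\<And>i. a i \<in> span A" "a \<longlonglongrightarrow> u" unfolding closure_sequential by blast
  show "c *\<^sub>R u \<in> closure (span A)" for c
    unfolding closure_sequential
    by (rule exI[of _ "\<lambda>i. c *\<^sub>R a i"]) (intro conjI allI span_scale tendsto_intros a)
  fix v assume "v \<in> closure (span A)"
  then obtain b where b: "\<And>i. b i \<in> span A" "b \<longlonglongrightarrow> v" unfolding closure_sequential by blast
  show "u + v \<in> closure (span A)"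
    unfolding closure_sequential
    by (rule exI[of _ "\<lambda>i. a i + b i"]) (intro conjI allI span_add tendsto_intros a b)
qed

locale wh_banach = wh_space m n N1 N2 \<sigma>
  for m n N1 N2 \<sigma> +
  fixes e :: "nat \<Rightarrow> 'x::banach"
  assumes emb: "wh_embedding m n N1 N2 \<sigma> e"
begin

section \<open>Coordinates in the completion\<close>

definition synth :: "(nat \<Rightarrow> real) \<Rightarrow> 'x" where
  "synth x = (\<Sum>k\<in>supp x. x k *\<^sub>R e k)"

abbreviation V :: "'x set" where "V \<equiv> span (e ` {1..})"
abbreviation X :: "'x set" where "X \<equiv> X_wh e"

lemma X_closure: "X = closure V" by (simp add: X_wh_def closed_span_def)

lemma embed_superset: "finite A \<Longrightarrow> supp x \<subseteq> A \<Longrightarrow> synth x = (\<Sum>k\<in>A. x k *\<^sub>R e k)"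
  unfolding synth_def by (intro sum.mono_neutral_left) (auto simp: supp_def)

lemma supp_add: "supp (\<lambda>k. x k + y k) \<subseteq> supp x \<union> supp y" and supp_scale: "supp (\<lambda>k. c * x k) \<subseteq> supp x"
  by (auto simp: supp_def)

lemma c00_add: "x \<in> c00 \<Longrightarrow> y \<in> c00 \<Longrightarrow> (\<lambda>k. x k + y k) \<in> c00"
  using finite_subset[OF supp_add] by (auto simp: c00_def)

lemma c00_mult: "x \<in> c00 \<Longrightarrow> (\<lambda>k. \<mu> k * x k) \<in> c00"
  by (auto simp: c00_def supp_def intro: finite_subset[rotated])

lemma c00_scale: "x \<in> c00 \<Longrightarrow> (\<lambda>k. c * x k) \<in> c00"
  by (rule c00_mult)

lemma embed_add: assumes "x \<in> c00" "y \<in> c00" shows "synth (\<lambda>k. x k + y k) = synth x + synth y"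
proof -
  have f: "finite (supp x \<union> supp y)" using assms by (auto simp: c00_def)
  show ?thesis
    using embed_superset[OF f supp_add] embed_superset[OF f, of x] embed_superset[OF f, of y]
    by (simp add: scaleR_add_left sum.distrib)
qed

lemma embed_scale: assumes "x \<in> c00" shows "synth (\<lambda>k. c * x k) = c *\<^sub>R synth x"
proof -
  have f: "finite (supp x)" using assms by (auto simp: c00_def)
  show ?thesis using embed_superset[OF f supp_scale] by (simp add: synth_def scaleR_sum_right)
qed

lemma embed_in_V: "x \<in> c00 \<Longrightarrow> synth x \<in> V"
  unfolding synth_def
proof (rule span_sum)
  fix k assume "x \<in> c00" "k \<in> supp x"
  then have "1 \<le> k" by (cases k) (auto simp: c00_def supp_def)
  then show "x k *\<^sub>R e k \<in> V" by (intro span_scale span_base) auto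
qed

lemma V_embed: "v \<in> V \<Longrightarrow> \<exists>x\<in>c00. v = synth x"
proof (induction rule: span_induct_alt)
  case base
  have "(\<lambda>k. 0) \<in> c00" "synth (\<lambda>k. 0) = 0" by (auto simp: c00_def supp_def synth_def)
  then show ?case by metis
next
  case (step c v w)
  obtain k where k: "1 \<le> k" "v = e k" using step(1) by auto
  obtain x where x: "x \<in> c00" "w = synth x" using step(2) by blast
  let ?u = "\<lambda>i. if i = k then 1 else 0 :: real"
  have s: "supp ?u = {k}" by (auto simp: supp_def)
  have u: "?u \<in> c00" using k s by (auto simp: c00_def)
  have "synth ?u = e k" unfolding synth_def s by simp
  then have "c *\<^sub>R v + w = synth (\<lambda>i. c * ?u i + x i)"
    using embed_add[OF c00_scale[OF u] x(1)] embed_scale[OF u] k x by simp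
  then show ?case using c00_add[OF c00_scale[OF u] x(1)] by blast
qed

lemma norm_embed_le_iff:
  assumes x: "x \<in> c00" shows "norm (synth x) \<le> C \<longleftrightarrow> norm_le x C"
proof -
  have fin: "finite (supp x)" using x by (simp add: c00_def)
  have eq: "(\<Sum>k\<in>supp x. f k * x k) = pair f x" if "D f" for f
  proof -
    have "(\<Sum>k\<in>supp x. f k * x k) = (\<Sum>k\<in>supp x \<union> supp f. f k * x k)"
      using fin D_finite[OF that] by (intro sum.mono_neutral_left) (auto simp: supp_def)
    then show ?thesis using pair_superset[of "supp x \<union> supp f" f x] fin D_finite[OF that] by simp
  qed
  have nrm: "norm (synth x) = (SUP f\<in>D_wh m n N1 N2 \<sigma>. pair f x)"
  proof -
    have "norm (synth x) = wh_norm m n N1 N2 \<sigma> x" using emb x unfolding wh_embedding_def synth_def by blast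
    also have "... = (SUP f\<in>D_wh m n N1 N2 \<sigma>. pair f x)"
      unfolding wh_norm_def by (rule SUP_cong) (auto simp: D_wh_def eq)
    finally show ?thesis .
  qed
  have bdd: "bdd_above ((\<lambda>f. pair f x) ` D_wh m n N1 N2 \<sigma>)"
  proof (rule bdd_aboveI2)
    fix f assume "f \<in> D_wh m n N1 N2 \<sigma>"
    then have f: "D f" by (simp add: D_wh_def)
    have "(\<Sum>k\<in>supp x. f k * x k) \<le> (\<Sum>k\<in>supp x. \<bar>x k\<bar>)"
    proof (rule sum_mono)
      fix k
      have "\<bar>f k * x k\<bar> \<le> 1 * \<bar>x k\<bar>" unfolding abs_mult by (rule mult_right_mono[OF D_bounded[OF f]]) simp
      then show "f k * x k \<le> \<bar>x k\<bar>" by simp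
    qed
    then show "pair f x \<le> (\<Sum>k\<in>supp x. \<bar>x k\<bar>)" using eq[OF f] by simp
  qed
  have ne: "D_wh m n N1 N2 \<sigma> \<noteq> {}" using W_zero[of 0] by (auto simp: D_wh_def)
  show ?thesis
  proof
    assume "norm (synth x) \<le> C"
    then have up: "pair f x \<le> C" if "D f" for f
      using cSUP_upper[OF _ bdd, of f] that unfolding nrm by (force simp: D_wh_def)
    show "norm_le x C" unfolding norm_le_def
    proof (intro allI impI)
      fix f assume "D f"
      then obtain w where "W f w" by blast
      \<comment> \<open>The norm is a supremum without absolute values; the constant multiplier 1
        yields a functional whose value is at least the modulus.\<close>
      then obtain g where g: "W g w" "\<bar>pair f (\<lambda>k. 1 * x k)\<bar> \<le> pair g x"
        using W_multiplier[of f w "\<lambda>_. 1" x] by auto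
      then have "D g" by blast
      then have "pair g x \<le> C" by (rule up)
      then show "\<bar>pair f x\<bar> \<le> C" using g(2) by simp
    qed
  next
    assume "norm_le x C"
    then show "norm (synth x) \<le> C" unfolding nrm
      by (intro cSUP_least[OF ne]) (auto simp: norm_le_def D_wh_def abs_le_iff)
  qed
qed

text \<open>One and the same finitely supported vector approximates \<open>u\<close> in norm and
  \<open>x\<close> uniformly in the coordinates. As coordinates are bounded by the norm, this
  determines \<open>x\<close>.\<close>

definition near :: "'x \<Rightarrow> (nat \<Rightarrow> real) \<Rightarrow> bool" where
  "near u x \<longleftrightarrow> (\<forall>\<epsilon>>0. \<exists>v\<in>c00. norm (u - synth v) < \<epsilon> \<and> (\<forall>k. \<bar>x k - v k\<bar> < \<epsilon>))"

definition coef :: "'x \<Rightarrow> nat \<Rightarrow> real" where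
  "coef u = (THE x. near u x)"

lemma c00_coordinate_le: assumes "x \<in> c00" shows "\<bar>x k\<bar> \<le> norm (synth x)"
proof (cases "k = 0")
  case True then show ?thesis using assms by (simp add: c00_def)
next
  case False
  have "norm_le x (norm (synth x))" using norm_embed_le_iff[OF assms] by blast
  then show ?thesis using norm_le_coordinate False by simp
qed

lemma c00_diff_le: assumes "x \<in> c00" "y \<in> c00" shows "\<bar>x k - y k\<bar> \<le> norm (synth x - synth y)"
proof -
  have z: "(\<lambda>k. x k + (-1) * y k) \<in> c00" by (intro c00_add c00_scale assms)
  have "synth (\<lambda>k. x k + (-1) * y k) = synth x - synth y"
    using embed_add[OF assms(1) c00_scale[OF assms(2)], of "-1"] embed_scale[OF assms(2), of "-1"] by simp
  then show ?thesis using c00_coordinate_le[OF z, of k] by simp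
qed

lemma near_unique: assumes "near u x" "near u y" shows "x = y"
proof
  fix k
  have "\<bar>x k - y k\<bar> \<le> \<epsilon>" if "0 < \<epsilon>" for \<epsilon>
  proof -
    have e4: "0 < \<epsilon> / 4" using that by simp
    obtain v where v: "v \<in> c00" "norm (u - synth v) < \<epsilon> / 4" "\<bar>x k - v k\<bar> < \<epsilon> / 4"
      using assms(1) e4 unfolding near_def by blast
    obtain w where w: "w \<in> c00" "norm (u - synth w) < \<epsilon> / 4" "\<bar>y k - w k\<bar> < \<epsilon> / 4"
      using assms(2) e4 unfolding near_def by blast
    have "\<bar>v k - w k\<bar> \<le> norm (synth v - synth w)" by (rule c00_diff_le[OF v(1) w(1)])
    also have "... \<le> norm (u - synth v) + norm (u - synth w)"
      using norm_triangle_ineq4[of "u - synth w" "u - synth v"] by simp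
    finally show ?thesis using v w by linarith
  qed
  then have "\<bar>x k - y k\<bar> \<le> 0" using field_le_epsilon[of "\<bar>x k - y k\<bar>" 0] by simp
  then show "x k = y k" by simp
qed

lemma near_exists: assumes "u \<in> X" shows "\<exists>x. near u x"
proof -
  have "\<exists>v\<in>c00. norm (u - synth v) < inverse (real (Suc i))" for i
  proof -
    have "u \<in> closure V" using assms X_closure by simp
    then obtain v where "v \<in> V" "dist v u < inverse (real (Suc i))"
      unfolding closure_approachable by (meson inverse_positive_iff_positive of_nat_0_less_iff zero_less_Suc)
    then show ?thesis using V_embed by (metis dist_commute dist_norm)
  qed
  then obtain v where v: "\<And>i. v i \<in> c00" "\<And>i. norm (u - synth (v i)) < inverse (real (Suc i))" by metis
  have d: "\<bar>v i k - v j k\<bar> \<le> norm (u - synth (v i)) + norm (u - synth (v j))" for i j k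
    using c00_diff_le[OF v(1)[of i] v(1)[of j], of k]
      norm_triangle_ineq4[of "u - synth (v j)" "u - synth (v i)"] by simp
  have lim0: "(\<lambda>i. norm (u - synth (v i))) \<longlonglongrightarrow> 0"
    by (rule tendsto_sandwich[OF _ _ tendsto_const LIMSEQ_inverse_real_of_nat])
      (use v(2) in \<open>auto intro!: always_eventually less_imp_le\<close>)
  have "Cauchy (\<lambda>i. v i k)" for k
  proof (rule metric_CauchyI)
    fix \<epsilon> :: real assume "0 < \<epsilon>"
    then obtain N where N: "\<And>i. N \<le> i \<Longrightarrow> norm (u - synth (v i)) < \<epsilon> / 2"
      using LIMSEQ_D[OF lim0, of "\<epsilon> / 2"] by auto
    have "dist (v i k) (v j k) < \<epsilon>" if "N \<le> i" "N \<le> j" for i j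
      using d[of i k j] N[OF that(1)] N[OF that(2)] by (simp add: dist_real_def)
    then show "\<exists>M. \<forall>i\<ge>M. \<forall>j\<ge>M. dist (v i k) (v j k) < \<epsilon>" by blast
  qed
  then have "\<exists>l. (\<lambda>i. v i k) \<longlonglongrightarrow> l" for k using Cauchy_convergent convergent_def by blast
  then obtain x where x: "\<And>k. (\<lambda>i. v i k) \<longlonglongrightarrow> x k" by metis
  have "\<bar>x k - v i k\<bar> \<le> norm (u - synth (v i))" for i k
  proof -
    have "(\<lambda>j. \<bar>v j k - v i k\<bar>) \<longlonglongrightarrow> \<bar>x k - v i k\<bar>" by (intro tendsto_intros x)
    moreover have "(\<lambda>j. norm (u - synth (v j)) + norm (u - synth (v i))) \<longlonglongrightarrow> 0 + norm (u - synth (v i))"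
      by (intro tendsto_intros lim0)
    ultimately have "\<bar>x k - v i k\<bar> \<le> 0 + norm (u - synth (v i))" by (rule LIMSEQ_le) (use d in auto)
    then show ?thesis by simp
  qed
  moreover have "\<exists>i. norm (u - synth (v i)) < \<epsilon>" if "0 < \<epsilon>" for \<epsilon>
    using LIMSEQ_D[OF lim0 that] by auto
  ultimately have "near u x" unfolding near_def using v(1) by (meson le_less_trans)
  then show ?thesis by blast
qed

lemma near_coef: "u \<in> X \<Longrightarrow> near u (coef u)"
  unfolding coef_def using near_exists near_unique by (metis theI)

lemma coef_eqI: "near u x \<Longrightarrow> coef u = x"
  unfolding coef_def using near_unique by blast

lemma embed_in_X: "x \<in> c00 \<Longrightarrow> synth x \<in> X"
  using embed_in_V closure_subset unfolding X_closure by blast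

lemma coef_embed: "x \<in> c00 \<Longrightarrow> coef (synth x) = x"
  by (rule coef_eqI) (auto simp: near_def intro!: bexI[of _ x])

lemma subspace_X: "subspace X" unfolding X_wh_def by (rule subspace_closed_span)

lemma closed_X: "closed X" unfolding X_closure by simp

lemma X_add: "u \<in> X \<Longrightarrow> v \<in> X \<Longrightarrow> u + v \<in> X" and X_scale: "u \<in> X \<Longrightarrow> c *\<^sub>R u \<in> X"
  and X_diff: "u \<in> X \<Longrightarrow> v \<in> X \<Longrightarrow> u - v \<in> X" and X_0: "0 \<in> X"
  using subspace_X by (auto simp: subspace_add subspace_scale subspace_diff subspace_0)

lemma coef_add: assumes "u \<in> X" "v \<in> X" shows "coef (u + v) = (\<lambda>k. coef u k + coef v k)"
proof (rule coef_eqI, unfold near_def, intro allI impI)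
  fix \<epsilon> :: real assume "0 < \<epsilon>"
  then have e2: "0 < \<epsilon> / 2" by simp
  obtain x where x: "x \<in> c00" "norm (u - synth x) < \<epsilon> / 2" "\<forall>k. \<bar>coef u k - x k\<bar> < \<epsilon> / 2"
    using near_coef[OF assms(1)] e2 unfolding near_def by blast
  obtain y where y: "y \<in> c00" "norm (v - synth y) < \<epsilon> / 2" "\<forall>k. \<bar>coef v k - y k\<bar> < \<epsilon> / 2"
    using near_coef[OF assms(2)] e2 unfolding near_def by blast
  show "\<exists>w\<in>c00. norm (u + v - synth w) < \<epsilon> \<and> (\<forall>k. \<bar>coef u k + coef v k - w k\<bar> < \<epsilon>)"
  proof (rule bexI[OF _ c00_add[OF x(1) y(1)]], intro conjI allI)
    have "norm ((u - synth x) + (v - synth y)) < \<epsilon>" using x(2) y(2) norm_triangle_ineq by (smt (verit) field_sum_of_halves)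
    then show "norm (u + v - synth (\<lambda>k. x k + y k)) < \<epsilon>" unfolding embed_add[OF x(1) y(1)] by (simp add: algebra_simps)
    show "\<bar>coef u k + coef v k - (x k + y k)\<bar> < \<epsilon>" for k
      using spec[OF x(3), of k] spec[OF y(3), of k] by linarith
  qed
qed

lemma coef_scale: assumes "u \<in> X" shows "coef (c *\<^sub>R u) = (\<lambda>k. c * coef u k)"
proof (rule coef_eqI, unfold near_def, intro allI impI)
  fix \<epsilon> :: real assume "0 < \<epsilon>"
  define \<delta> where "\<delta> = \<epsilon> / (\<bar>c\<bar> + 1)"
  have \<delta>: "\<bar>c\<bar> * a < \<epsilon>" if "a < \<delta>" "0 \<le> a" for a
  proof -
    have "\<bar>c\<bar> * a \<le> (\<bar>c\<bar> + 1) * a" using that by (intro mult_right_mono) auto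
    also have "... < (\<bar>c\<bar> + 1) * \<delta>" using that by (intro mult_strict_left_mono) auto
    also have "... = \<epsilon>" by (simp add: \<delta>_def)
    finally show ?thesis .
  qed
  have d0: "0 < \<delta>" using \<open>0 < \<epsilon>\<close> by (simp add: \<delta>_def)
  obtain x where x: "x \<in> c00" "norm (u - synth x) < \<delta>" "\<forall>k. \<bar>coef u k - x k\<bar> < \<delta>"
    using near_coef[OF assms] d0 unfolding near_def by blast
  show "\<exists>w\<in>c00. norm (c *\<^sub>R u - synth w) < \<epsilon> \<and> (\<forall>k. \<bar>c * coef u k - w k\<bar> < \<epsilon>)"
  proof (rule bexI[OF _ c00_scale[OF x(1)]], intro conjI allI)
    have "norm (c *\<^sub>R (u - synth x)) < \<epsilon>" unfolding norm_scaleR by (rule \<delta>[OF x(2)]) simp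
    then show "norm (c *\<^sub>R u - synth (\<lambda>k. c * x k)) < \<epsilon>" unfolding embed_scale[OF x(1)] by (simp add: scaleR_diff_right)
    show "\<bar>c * coef u k - c * x k\<bar> < \<epsilon>" for k
    proof -
      have "\<bar>c\<bar> * \<bar>coef u k - x k\<bar> < \<epsilon>" by (rule \<delta>) (use x(3) in auto)
      then show ?thesis unfolding abs_mult[symmetric] by (simp add: right_diff_distrib)
    qed
  qed
qed

lemma coef_diff: assumes "u \<in> X" "v \<in> X" shows "coef (u - v) = (\<lambda>k. coef u k - coef v k)"
  using coef_add[OF assms(1) X_scale[OF assms(2), of "-1"]] coef_scale[OF assms(2), of "-1"] by simp

lemma coef_zero: "coef 0 = (\<lambda>k. 0)"
  using coef_scale[OF X_0, of 0] by simp

lemma coef_sum: "finite I \<Longrightarrow> (\<And>i. i \<in> I \<Longrightarrow> u i \<in> X) \<Longrightarrow>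
    (\<Sum>i\<in>I. c i *\<^sub>R u i) \<in> X \<and> coef (\<Sum>i\<in>I. c i *\<^sub>R u i) = (\<lambda>k. \<Sum>i\<in>I. c i * coef (u i) k)"
  by (induction I rule: finite_induct) (auto simp: X_0 coef_zero X_add X_scale coef_add coef_scale)

lemma approx_V: assumes "u \<in> X" "0 < \<epsilon>" shows "\<exists>x\<in>c00. norm (u - synth x) < \<epsilon>"
  using near_coef[OF assms(1)] assms(2) unfolding near_def by blast

lemma norm_le_norm: assumes u: "u \<in> X" shows "norm_le (coef u) (norm u)"
  unfolding norm_le_def
proof (intro allI impI)
  fix f assume f: "D f"
  show "\<bar>pair f (coef u)\<bar> \<le> norm u"
  proof (rule field_le_epsilon)
    fix \<epsilon> :: real assume "0 < \<epsilon>"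
    define N where "N = real (card (supp f)) + 1"
    have N: "0 < N" by (simp add: N_def)
    define \<delta> where "\<delta> = \<epsilon> / (N + 1)"
    have \<delta>: "0 < \<delta>" using \<open>0 < \<epsilon>\<close> N by (simp add: \<delta>_def)
    obtain x where x: "x \<in> c00" "norm (u - synth x) < \<delta>" "\<forall>k. \<bar>coef u k - x k\<bar> < \<delta>"
      using near_coef[OF u] \<delta> unfolding near_def by blast
    have "\<bar>pair f x\<bar> \<le> norm (synth x)" using norm_embed_le_iff[OF x(1)] f unfolding norm_le_def by blast
    moreover have "norm (synth x) \<le> norm u + \<delta>"
      using x(2) norm_triangle_sub[of "synth x" u] by (simp add: norm_minus_commute)
    moreover have "\<bar>pair f (coef u) - pair f x\<bar> \<le> N * \<delta>"
    proof -
      have "\<bar>pair f (coef u) - pair f x\<bar> \<le> (\<Sum>k\<in>supp f. \<bar>f k * (coef u k - x k)\<bar>)"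
        unfolding pair_def sum_subtractf[symmetric] right_diff_distrib[symmetric] by (rule sum_abs)
      also have "... \<le> (\<Sum>k\<in>supp f. 1 * \<delta>)"
        unfolding abs_mult using x(3) D_bounded[OF f] by (intro sum_mono mult_mono) (auto intro: less_imp_le)
      also have "... \<le> N * \<delta>" using \<delta> by (simp add: N_def)
      finally show ?thesis .
    qed
    moreover have "(N + 1) * \<delta> = \<epsilon>" using N by (simp add: \<delta>_def)
    then have "N * \<delta> + \<delta> = \<epsilon>" by (simp only: distrib_right mult_1)
    ultimately show "\<bar>pair f (coef u)\<bar> \<le> norm u + \<epsilon>" by linarith
  qed
qed

text \<open>The norm formula extends from finitely supported vectors to the completion by
  approximation: each functional of the norming set has finite support, so it is continuous in the
  coordinates. This carries all estimates on sequences over to \<open>X\<close>.\<close>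

lemma norm_le_iff: assumes u: "u \<in> X" shows "norm u \<le> C \<longleftrightarrow> norm_le (coef u) C"
proof
  assume "norm u \<le> C"
  then show "norm_le (coef u) C" using norm_le_norm[OF u] unfolding norm_le_def by force
next
  assume C: "norm_le (coef u) C"
  show "norm u \<le> C"
  proof (rule field_le_epsilon)
    fix \<epsilon> :: real assume "0 < \<epsilon>"
    then obtain x where x: "x \<in> c00" "norm (u - synth x) < \<epsilon> / 2" using approx_V[OF u, of "\<epsilon> / 2"] by auto
    have "norm_le x (C + \<epsilon> / 2)"
      unfolding norm_le_def
    proof (intro allI impI)
      fix f assume f: "D f"
      have "\<bar>pair f (coef (u - synth x))\<bar> \<le> norm (u - synth x)"
        using norm_le_norm[OF X_diff[OF u embed_in_X[OF x(1)]]] f unfolding norm_le_def by blast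
      moreover have "pair f (coef (u - synth x)) = pair f (coef u) - pair f x"
        unfolding coef_diff[OF u embed_in_X[OF x(1)]] coef_embed[OF x(1)] by (rule pair_diff)
      moreover have "\<bar>pair f (coef u)\<bar> \<le> C" using C f unfolding norm_le_def by blast
      ultimately show "\<bar>pair f x\<bar> \<le> C + \<epsilon> / 2" using x(2) by linarith
    qed
    then have "norm (synth x) \<le> C + \<epsilon> / 2" using norm_embed_le_iff[OF x(1)] by blast
    then show "norm u \<le> C + \<epsilon>" using x(2) norm_triangle_sub[of u "synth x"] by linarith
  qed
qed

lemma coef_le: assumes "u \<in> X" shows "\<bar>coef u k\<bar> \<le> norm u" and "coef u 0 = 0"
proof -
  have "\<bar>coef u 0\<bar> < \<epsilon>" if "0 < \<epsilon>" for \<epsilon>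
  proof -
    obtain x where x: "x \<in> c00" "\<forall>k. \<bar>coef u k - x k\<bar> < \<epsilon>" using near_coef[OF assms] \<open>0 < \<epsilon>\<close> unfolding near_def by blast
    then have "\<bar>coef u 0 - x 0\<bar> < \<epsilon>" by blast
    then show ?thesis using x(1) by (simp add: c00_def)
  qed
  then show 0: "coef u 0 = 0" by (metis abs_ge_zero less_irrefl zero_less_abs_iff)
  show "\<bar>coef u k\<bar> \<le> norm u"
    using norm_le_coordinate[OF norm_le_norm[OF assms], of k] 0 by (cases "k = 0") auto
qed

lemma coef_inject: assumes "u \<in> X" "v \<in> X" "coef u = coef v" shows "u = v"
proof -
  have "coef (u - v) = (\<lambda>k. 0)" using coef_diff[OF assms(1,2)] assms(3) by simp
  then have "norm_le (coef (u - v)) 0" by (simp add: norm_le_def pair_def)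
  then have "norm (u - v) \<le> 0" using norm_le_iff[OF X_diff[OF assms(1,2)]] by blast
  then show ?thesis by simp
qed

lemma norm_le_multiplier:
  assumes "norm_le x C" "\<And>k. \<bar>\<mu> k\<bar> \<le> K" "0 < K" shows "norm_le (\<lambda>k. \<mu> k * x k) (K * C)"
  unfolding norm_le_def
proof (intro allI impI)
  fix f assume "D f"
  then obtain w where w: "W f w" by blast
  have "\<bar>\<mu> k / K\<bar> \<le> 1" for k using assms(2,3) by simp
  then obtain g where g: "W g w" "\<bar>pair f (\<lambda>k. \<mu> k / K * x k)\<bar> \<le> pair g x"
    using W_multiplier[OF w, of "\<lambda>k. \<mu> k / K" x] by blast
  have "pair f (\<lambda>k. \<mu> k * x k) = K * pair f (\<lambda>k. \<mu> k / K * x k)"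
    unfolding pair_scale[symmetric] using assms(3) by simp
  then have "\<bar>pair f (\<lambda>k. \<mu> k * x k)\<bar> = K * \<bar>pair f (\<lambda>k. \<mu> k / K * x k)\<bar>" using assms(3) by (simp add: abs_mult)
  also have "... \<le> K * C"
  proof -
    have "\<bar>pair g x\<bar> \<le> C" using assms(1) g(1) unfolding norm_le_def by blast
    then show ?thesis using g(2) assms(3) by (intro mult_left_mono) auto
  qed
  finally show "\<bar>pair f (\<lambda>k. \<mu> k * x k)\<bar> \<le> K * C" .
qed

section \<open>Diagonal operators\<close>

definition mul :: "(nat \<Rightarrow> real) \<Rightarrow> 'x \<Rightarrow> 'x" where
  "mul \<mu> u = (SOME v. v \<in> X \<and> coef v = (\<lambda>k. \<mu> k * coef u k))"

text \<open>Finitely supported approximations of \<open>u\<close> are multiplied by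
  \<open>\<mu>\<close>. The products form a Cauchy sequence by \<open>norm_le_multiplier\<close>,
  and coordinates are continuous.\<close>

lemma mul_exists:
  assumes u: "u \<in> X" and \<mu>: "\<And>k. \<bar>\<mu> k\<bar> \<le> K"
  shows "\<exists>v. v \<in> X \<and> coef v = (\<lambda>k. \<mu> k * coef u k)"
proof -
  define L where "L = \<bar>K\<bar> + 1"
  have L: "0 < L" "\<And>k. \<bar>\<mu> k\<bar> \<le> L" unfolding L_def using \<mu> by (simp, metis abs_ge_self add_increasing2 order_trans zero_le_one)
  have "\<exists>x\<in>c00. norm (u - synth x) < inverse (real (Suc i))" for i by (rule approx_V[OF u]) simp
  then obtain x where x: "\<And>i. x i \<in> c00" "\<And>i. norm (u - synth (x i)) < inverse (real (Suc i))" by metis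
  define w where "w i = synth (\<lambda>k. \<mu> k * x i k)" for i
  have wX: "w i \<in> X" for i unfolding w_def by (intro embed_in_X c00_mult x)
  have cw: "coef (w i) = (\<lambda>k. \<mu> k * x i k)" for i unfolding w_def by (intro coef_embed c00_mult x)
  have exX: "synth (x i) \<in> X" for i by (intro embed_in_X x)
  have dist: "norm (w i - w j) \<le> L * norm (synth (x i) - synth (x j))" for i j
  proof -
    have "norm_le (coef (synth (x i) - synth (x j))) (norm (synth (x i) - synth (x j)))"
      by (rule norm_le_norm[OF X_diff[OF exX exX]])
    from norm_le_multiplier[OF this L(2,1)]
    have "norm_le (coef (w i - w j)) (L * norm (synth (x i) - synth (x j)))"
      unfolding coef_diff[OF exX exX] coef_diff[OF wX wX] cw coef_embed[OF x(1)] by (simp add: right_diff_distrib)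
    then show ?thesis using norm_le_iff[OF X_diff[OF wX wX]] by blast
  qed
  have lim: "(\<lambda>i. synth (x i)) \<longlonglongrightarrow> u"
  proof (rule LIM_zero_cancel, rule tendsto_norm_zero_cancel,
      rule tendsto_sandwich[OF _ _ tendsto_const LIMSEQ_inverse_real_of_nat])
    show "\<forall>\<^sub>F i in sequentially. norm (synth (x i) - u) \<le> inverse (real (Suc i))"
      using x(2) by (intro always_eventually allI) (metis less_imp_le norm_minus_commute)
  qed auto
  have "Cauchy w"
  proof (rule CauchyI)
    fix \<epsilon> :: real assume "0 < \<epsilon>"
    then have "0 < \<epsilon> / L" using L by simp
    from CauchyD[OF LIMSEQ_imp_Cauchy[OF lim] this] obtain M where
      M: "\<forall>i\<ge>M. \<forall>j\<ge>M. norm (synth (x i) - synth (x j)) < \<epsilon> / L" by blast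
    have "norm (w i - w j) < \<epsilon>" if "M \<le> i" "M \<le> j" for i j
    proof -
      have "L * norm (synth (x i) - synth (x j)) < L * (\<epsilon> / L)"
        by (rule mult_strict_left_mono) (use M that L in auto)
      then show ?thesis using dist[of i j] L by simp
    qed
    then show "\<exists>M. \<forall>i\<ge>M. \<forall>j\<ge>M. norm (w i - w j) < \<epsilon>" by blast
  qed
  then obtain v where v: "w \<longlonglongrightarrow> v" using Cauchy_convergent convergent_def by blast
  have vX: "v \<in> X" by (rule closed_sequentially[OF closed_X wX v])
  have limc: "(\<lambda>i. coef (a i) k) \<longlonglongrightarrow> coef b k" if "\<And>i. a i \<in> X" "b \<in> X" "a \<longlonglongrightarrow> b" for a b k
  proof (rule LIM_zero_cancel, rule tendsto_norm_zero_cancel,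
      rule tendsto_sandwich[OF _ _ tendsto_const tendsto_norm_zero[OF LIM_zero[OF that(3)]]])
    show "\<forall>\<^sub>F i in sequentially. norm (coef (a i) k - coef b k) \<le> norm (a i - b)"
      using coef_le(1)[OF X_diff[OF that(1,2)], of _ k] coef_diff[OF that(1,2)]
      by (intro always_eventually) simp
  qed auto
  have "coef v k = \<mu> k * coef u k" for k
  proof (rule LIMSEQ_unique)
    show "(\<lambda>i. coef (w i) k) \<longlonglongrightarrow> coef v k" by (rule limc[OF wX vX v])
    have "(\<lambda>i. x i k) \<longlonglongrightarrow> coef u k" using limc[OF exX u lim, of k] coef_embed[OF x(1)] by simp
    then show "(\<lambda>i. coef (w i) k) \<longlonglongrightarrow> \<mu> k * coef u k" unfolding cw by (intro tendsto_intros)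
  qed
  then show ?thesis using vX by blast
qed

lemma mul_X: assumes "u \<in> X" "\<And>k. \<bar>\<mu> k\<bar> \<le> K"
  shows "mul \<mu> u \<in> X" "coef (mul \<mu> u) = (\<lambda>k. \<mu> k * coef u k)"
  using someI_ex[OF mul_exists[of u \<mu> K, OF assms]] unfolding mul_def by blast+

lemma mul_add: assumes "\<And>k. \<bar>\<mu> k\<bar> \<le> K" "u \<in> X" "v \<in> X" shows "mul \<mu> (u + v) = mul \<mu> u + mul \<mu> v"
  by (rule coef_inject) (simp_all add: mul_X[OF _ assms(1)] X_add assms(2,3) coef_add distrib_left)

lemma mul_scale: assumes "\<And>k. \<bar>\<mu> k\<bar> \<le> K" "u \<in> X" shows "mul \<mu> (c *\<^sub>R u) = c *\<^sub>R mul \<mu> u"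
  by (rule coef_inject) (simp_all add: mul_X[OF _ assms(1)] X_scale assms(2) coef_scale mult.left_commute)

lemma mul_norm: assumes "\<And>k. \<bar>\<mu> k\<bar> \<le> K" "0 < K" "u \<in> X" shows "norm (mul \<mu> u) \<le> K * norm u"
  unfolding norm_le_iff[OF mul_X(1)[OF assms(3,1)]] mul_X(2)[OF assms(3,1)]
  by (rule norm_le_multiplier[OF norm_le_norm[OF assms(3)] assms(1,2)])

abbreviation proj :: "nat set \<Rightarrow> 'x \<Rightarrow> 'x" where "proj A \<equiv> mul (indicator A)"

lemma indicator_le: "\<bar>indicator A k :: real\<bar> \<le> 1" by (simp add: indicator_def)

lemmas proj_X = mul_X[where \<mu> = "indicator A" for A, OF _ indicator_le]
lemmas proj_add = mul_add[where \<mu> = "indicator A" for A, OF indicator_le]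
lemmas proj_scale = mul_scale[where \<mu> = "indicator A" for A, OF indicator_le]

lemma proj_norm: "u \<in> X \<Longrightarrow> norm (proj A u) \<le> norm u"
  using mul_norm[of "indicator A" 1 u, OF indicator_le] by simp

lemma proj_diff: "u \<in> X \<Longrightarrow> v \<in> X \<Longrightarrow> proj A (u - v) = proj A u - proj A v"
  using proj_add[of u "(-1) *\<^sub>R v" A] proj_scale[of v A "-1"] X_scale[of v "-1"] by simp

text \<open>Late truncations fix a finitely supported approximation of \<open>u\<close>, and all
  truncations are contractions.\<close>

lemma truncate:
  assumes u: "u \<in> X" and \<epsilon>: "0 < \<epsilon>"
  shows "\<exists>N0. \<forall>N\<ge>N0. norm (u - proj {..N} u) \<le> \<epsilon>"
proof -
  obtain x where x: "x \<in> c00" "norm (u - synth x) < \<epsilon> / 2" using approx_V[OF u, of "\<epsilon> / 2"] \<epsilon> by auto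
  obtain N0 where N0: "supp x \<subseteq> {..N0}"
    using x(1) finite_nat_iff_bounded_le[of "supp x"] by (auto simp: c00_def)
  have xX: "synth x \<in> X" by (rule embed_in_X[OF x(1)])
  show ?thesis
  proof (intro exI[of _ N0] allI impI)
    fix N assume N: "N0 \<le> N"
    have "proj {..N} (synth x) = synth x"
    proof (rule coef_inject)
      have "indicator {..N} k * x k = x k" for k using N0 N by (auto simp: supp_def indicator_def)
      then have "(\<lambda>k. indicator {..N} k * x k) = x" by (rule ext)
      then show "coef (proj {..N} (synth x)) = coef (synth x)" unfolding proj_X(2)[OF xX] coef_embed[OF x(1)] .
    qed (use xX proj_X(1) in auto)
    then have "u - proj {..N} u = (u - synth x) - proj {..N} (u - synth x)"
      using proj_diff[OF u xX, of "{..N}"] by simp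
    then have "norm (u - proj {..N} u) \<le> norm (u - synth x) + norm (proj {..N} (u - synth x))"
      by (metis norm_triangle_ineq4)
    also have "... \<le> \<epsilon>" using proj_norm[OF X_diff[OF u xX], of "{..N}"] x(2) by linarith
    finally show "norm (u - proj {..N} u) \<le> \<epsilon>" .
  qed
qed

lemma coef_e: assumes "1 \<le> k" shows "e k \<in> X" "coef (e k) = (\<lambda>i. if i = k then 1 else 0)"
proof -
  let ?u = "\<lambda>i. if i = k then 1 else 0 :: real"
  have s: "supp ?u = {k}" by (auto simp: supp_def)
  have u: "?u \<in> c00" using assms s by (auto simp: c00_def)
  have "synth ?u = e k" unfolding synth_def s by simp
  then show "e k \<in> X" "coef (e k) = ?u" using embed_in_X[OF u] coef_embed[OF u] by auto
qed

text \<open>The bridge between supports defined by basis expansions and the coefficients obtained by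
  approximation; it contains existence and uniqueness of the expansion.\<close>

lemma basis_support_coef:
  assumes u: "u \<in> X" shows "basis_support e u = supp (coef u)"
proof -
  \<comment> \<open>The vector \<open>e 0\<close> is arbitrary; the condition \<open>a 0 = 0\<close>
    removes it from the partial sums.\<close>
  have part: "(\<Sum>i<N. a i *\<^sub>R e i) \<in> X \<and> coef (\<Sum>i<N. a i *\<^sub>R e i) = (\<lambda>k. if k < N then a k else 0)"
    if a0: "a 0 = 0" for a :: "nat \<Rightarrow> real" and N
  proof (induction N)
    case 0 then show ?case by (simp add: X_0 coef_zero)
  next
    case (Suc N)
    show ?case
    proof (cases "N = 0")
      case True then show ?thesis using a0 by (auto simp: X_0 coef_zero)
    next
      case False
      then show ?thesis using Suc coef_e[of N]
        by (auto simp: X_add X_scale coef_add coef_scale fun_eq_iff less_Suc_eq)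
    qed
  qed
  have uniq: "a = coef u" if a: "a 0 = 0" "(\<lambda>i. a i *\<^sub>R e i) sums u" for a
  proof
    fix k
    have "(\<lambda>N. norm ((\<Sum>i<N. a i *\<^sub>R e i) - u)) \<longlonglongrightarrow> 0"
      using a(2) unfolding sums_def by (intro tendsto_norm_zero LIM_zero)
    moreover have "\<bar>a k - coef u k\<bar> \<le> norm ((\<Sum>i<N. a i *\<^sub>R e i) - u)" if "k < N" for N
      using coef_le(1)[OF X_diff[OF _ u], of "\<Sum>i<N. a i *\<^sub>R e i" k] part[of a N, OF a(1)] that
      by (simp add: coef_diff[OF _ u])
    ultimately have "\<bar>a k - coef u k\<bar> \<le> 0"
      by (intro LIMSEQ_le_const) (auto intro!: exI[of _ "Suc k"])
    then show "a k = coef u k" by simp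
  qed
  have sums: "(\<lambda>i. coef u i *\<^sub>R e i) sums u"
    unfolding sums_def
  proof (rule LIMSEQ_I)
    fix \<epsilon> :: real assume "0 < \<epsilon>"
    then obtain N0 where N0: "\<forall>N\<ge>N0. norm (u - proj {..N} u) \<le> \<epsilon> / 2" using truncate[OF u, of "\<epsilon> / 2"] by auto
    have "norm ((\<Sum>i<N. coef u i *\<^sub>R e i) - u) < \<epsilon>" if N: "Suc N0 \<le> N" for N
    proof -
      obtain N' where N': "N = Suc N'" using N by (cases N) auto
      have "(\<Sum>i<N. coef u i *\<^sub>R e i) = proj {..N'} u"
      proof (rule coef_inject)
        show "coef (\<Sum>i<N. coef u i *\<^sub>R e i) = coef (proj {..N'} u)"
          using part[of "coef u" N, OF coef_le(2)[OF u]] by (simp add: proj_X(2)[OF u] N' less_Suc_eq_le indicator_def fun_eq_iff)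
      qed (use part[of "coef u" N, OF coef_le(2)[OF u]] proj_X(1)[OF u] in auto)
      moreover have "norm (u - proj {..N'} u) \<le> \<epsilon> / 2" using N0 N N' by simp
      ultimately show ?thesis using \<open>0 < \<epsilon>\<close> by (simp add: norm_minus_commute)
    qed
    then show "\<exists>N0. \<forall>N\<ge>N0. norm ((\<Sum>i<N. coef u i *\<^sub>R e i) - u) < \<epsilon>" by blast
  qed
  show ?thesis
    unfolding basis_support_def supp_def using uniq sums coef_le(2)[OF u] by blast
qed

text \<open>\<open>schreier 0\<close> is empty by convention, whereas the rounds of averaging start
  from a single functional. Order 0 therefore stands for sets of at most one point, which makes
  orders additive from 0 on.\<close>

definition schreier0 :: "nat \<Rightarrow> nat set set" where
  "schreier0 k = (if k = 0 then mschreier 0 else schreier k)"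

lemma schreier0_blocks:
  fixes s r :: "nat \<Rightarrow> nat"
  assumes F: "finite F" and a: "1 \<le> a" "s ` F \<in> schreier a"
    and G: "\<And>k. k \<in> F \<Longrightarrow> G k \<in> schreier0 b" "\<And>k. k \<in> F \<Longrightarrow> G k \<noteq> {}" "\<And>k. k \<in> F \<Longrightarrow> G k \<subseteq> {s k..r k}"
    and sr: "\<And>k. s k \<le> r k" and rs: "\<And>k. r k < s (Suc k)"
  shows "(\<Union>k\<in>F. G k) \<in> schreier0 (a + b)"
proof -
  have bd: "disjoint_family_on (\<lambda>t. {s t..r t}) F" "strict_mono s"
    by (rule blocks_disjoint[of s r]; rule sr rs)+
  have sinj: "inj_on s F" using bd(2) by (meson inj_on_subset strict_mono_imp_inj_on subset_UNIV)
  have finG: "finite (G k)" if "k \<in> F" for k using G(3)[OF that] finite_subset by blast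
  have MinG: "Min (G k) \<in> G k" if "k \<in> F" for k using finG[OF that] G(2)[OF that] by (rule Min_in)
  have injM: "inj_on (\<lambda>k. Min (G k)) F"
  proof (rule inj_onI)
    fix k k' assume k: "k \<in> F" "k' \<in> F" "Min (G k) = Min (G k')"
    then have "Min (G k) \<in> {s k..r k} \<inter> {s k'..r k'}" using MinG G(3) by (metis IntI subsetD)
    then show "k = k'" using bd(1) k unfolding disjoint_family_on_def by blast
  qed
  have M: "(\<lambda>k. Min (G k)) ` F \<in> schreier a"
    by (rule schreier_dominate[OF a(2,1) sinj injM]) (use MinG G(3) in \<open>force+\<close>)
  show ?thesis
  proof (cases "b = 0")
    case True
    have "G k = {Min (G k)}" if k: "k \<in> F" for k
    proof -
      have "card (G k) \<le> 1" using G(1)[OF k] True by (simp add: schreier0_def)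
      then have "x = Min (G k)" if "x \<in> G k" for x
        using MinG[OF k] that finG[OF k] by (metis One_nat_def card_le_Suc0_iff_eq)
      then show ?thesis using MinG[OF k] by blast
    qed
    then have "(\<Union>k\<in>F. G k) = (\<lambda>k. Min (G k)) ` F" by blast
    then show ?thesis using M a True by (simp add: schreier0_def)
  next
    case False
    define Gs where "Gs = map G (sorted_list_of_set F)"
    have set: "set Gs = G ` F" using F by (simp add: Gs_def)
    have "\<Union> (set Gs) \<in> schreier (a + b)"
    proof (rule schreier_convolution)
      show "set Gs \<subseteq> schreier b" using G(1) False unfolding set by (auto simp: schreier0_def)
      show "{} \<notin> set Gs" using G(2) unfolding set by blast
      show "Min ` set Gs \<in> schreier a" using M unfolding set by (simp add: image_image)
      have "sorted_wrt (<) (sorted_list_of_set F)" by (rule strict_sorted_list_of_set)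
      then show "sorted_wrt (\<lambda>A B. \<forall>a\<in>A. \<forall>b\<in>B. a < b) Gs"
        unfolding Gs_def sorted_wrt_map
      proof (rule sorted_wrt_mono_rel[rotated])
        fix k k' assume k: "k \<in> set (sorted_list_of_set F)" "k' \<in> set (sorted_list_of_set F)" "k < k'"
        then have kF: "k \<in> F" "k' \<in> F" using F by auto
        have "r k < s k'"
          using rs[of k] bd(2) k(3) by (metis Suc_leI le_less_trans less_le_trans not_le strict_mono_less_eq)
        then show "\<forall>a\<in>G k. \<forall>b\<in>G k'. a < b" using G(3)[OF kF(1)] G(3)[OF kF(2)] by force
      qed
    qed (use a(1) False in auto)
    then show ?thesis using a(1) set by (simp add: schreier0_def)
  qed
qed

section \<open>Further norm estimates for coefficient sequences\<close>

lemma norm_le_sum_triangle: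
  assumes "finite I" "\<And>i. i \<in> I \<Longrightarrow> norm_le (x i) (C i)"
  shows "norm_le (\<lambda>k. \<Sum>i\<in>I. c i * x i k) (\<Sum>i\<in>I. \<bar>c i\<bar> * C i)"
  unfolding norm_le_def
proof (intro allI impI)
  fix f assume f: "D f"
  have "\<bar>pair f (\<lambda>k. \<Sum>i\<in>I. c i * x i k)\<bar> \<le> (\<Sum>i\<in>I. \<bar>c i * pair f (x i)\<bar>)"
    unfolding pair_sum by (rule sum_abs)
  also have "... \<le> (\<Sum>i\<in>I. \<bar>c i\<bar> * C i)"
    using assms(2) f by (intro sum_mono) (auto simp: abs_mult norm_le_def intro!: mult_left_mono)
  finally show "\<bar>pair f (\<lambda>k. \<Sum>i\<in>I. c i * x i k)\<bar> \<le> (\<Sum>i\<in>I. \<bar>c i\<bar> * C i)" .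
qed

lemma norm_le_scale: assumes "norm_le x C" shows "norm_le (\<lambda>k. c * x k) (\<bar>c\<bar> * C)"
  unfolding norm_le_def pair_scale abs_mult
proof (intro allI impI)
  fix f assume "D f"
  then have "\<bar>pair f x\<bar> \<le> C" using assms unfolding norm_le_def by blast
  then show "\<bar>c\<bar> * \<bar>pair f x\<bar> \<le> \<bar>c\<bar> * C" by (rule mult_left_mono) simp
qed

lemma norm_le_mono: "norm_le x C \<Longrightarrow> C \<le> C' \<Longrightarrow> norm_le x C'"
  unfolding norm_le_def by force

lemma not_norm_le: assumes "\<not> norm_le x c" shows "\<exists>f. D f \<and> c < pair f x"
proof -
  obtain f w where f: "W f w" "c < \<bar>pair f x\<bar>" using assms unfolding norm_le_def by (auto simp: not_le)
  obtain g where "W g w" "\<bar>pair f (\<lambda>k. 1 * x k)\<bar> \<le> pair g x"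
    using W_multiplier[OF f(1), of "\<lambda>_. 1" x] by auto
  then show ?thesis using f(2) by (intro exI[of _ g]) auto
qed

text \<open>Cut \<open>f\<close> to the single block \<open>B\<close> and then adjust signs. The
  coefficient of the block has modulus at most 1, so dropping it does not lower the value.\<close>

lemma D_restrict:
  assumes f: "D f"
  shows "\<exists>g. D g \<and> supp g \<subseteq> supp f \<inter> B \<and> \<bar>pair f (\<lambda>k. indicator B k * x k)\<bar> \<le> pair g x"
proof -
  obtain w where w: "W f w" using f by blast
  let ?x = "\<lambda>k. indicator B k * x k"
  have B: "disjoint_family_on (\<lambda>_::nat. B) {0}" by (simp add: disjoint_family_on_def)
  obtain g where g: "\<forall>k\<in>{0::nat}. (\<exists>w'. W (g k) w' \<and> (w \<noteq> None \<longrightarrow> w' = w)) \<and> supp (g k) \<subseteq> supp f \<inter> B"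
    "\<forall>x c. (\<forall>k\<in>{0::nat}. supp (x k) \<subseteq> B) \<longrightarrow>
      (pair f (\<lambda>a. \<Sum>k\<in>{0}. c k * x k a))\<^sup>2 \<le> (\<Sum>k\<in>{0}. (c k)\<^sup>2 * (pair (g k) (x k))\<^sup>2)"
    using W_split_pair[OF w _ B] by auto
  have "supp ?x \<subseteq> B" by (auto simp: supp_def indicator_def split: if_splits)
  then have "(pair f ?x)\<^sup>2 \<le> (pair (g 0) ?x)\<^sup>2"
    using g(2)[rule_format, of "\<lambda>_. ?x" "\<lambda>_. 1"] by simp
  then have le: "\<bar>pair f ?x\<bar> \<le> \<bar>pair (g 0) ?x\<bar>" by (simp add: abs_le_square_iff)
  obtain w' where w': "W (g 0) w'" using g(1) by blast
  have pg: "pair (g 0) ?x = pair (g 0) x"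
    by (rule pair_cong) (use g(1) in \<open>auto simp: indicator_def\<close>)
  obtain g' where g': "W g' w'" "supp g' \<subseteq> supp (g 0)" "\<bar>pair (g 0) (\<lambda>k. 1 * x k)\<bar> \<le> pair g' x"
    using W_multiplier[OF w', of "\<lambda>_. 1" x] by auto
  show ?thesis
    by (rule exI[of _ g']) (use g' g(1) le pg in auto)
qed

section \<open>Infinite-dimensional subspaces\<close>

text \<open>Each further vanishing coordinate lowers the dimension by at most one: one vector
  \<open>z0\<close> with a nonzero coordinate \<open>K\<close> corrects all the others.\<close>

lemma tail_infinite_dimensional:
  assumes Z: "subspace Z" "Z \<subseteq> X" "infinite_dimensional Z"
  shows "infinite_dimensional {z\<in>Z. \<forall>i<K. coef z i = 0}"
proof (induction K)
  case 0 then show ?case using Z(3) by simp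
next
  case (Suc K)
  let ?Z = "\<lambda>K. {z\<in>Z. \<forall>i<K. coef z i = 0}"
  show ?case
    unfolding infinite_dimensional_def
  proof
    assume "\<exists>B. finite B \<and> ?Z (Suc K) \<subseteq> span B"
    then obtain B where B: "finite B" "?Z (Suc K) \<subseteq> span B" by blast
    have "\<exists>B. finite B \<and> ?Z K \<subseteq> span B"
    proof (cases "\<exists>z\<in>?Z K. coef z K \<noteq> 0")
      case True
      then obtain z0 where z0: "z0 \<in> ?Z K" "coef z0 K \<noteq> 0" by blast
      have "?Z K \<subseteq> span (insert z0 B)"
      proof
        fix z assume z: "z \<in> ?Z K"
        define c where "c = coef z K / coef z0 K"
        have zX: "z \<in> X" "z0 \<in> X" using z z0 Z(2) by auto
        have cf: "coef (z - c *\<^sub>R z0) = (\<lambda>k. coef z k - c * coef z0 k)"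
          by (simp add: coef_diff coef_scale zX X_scale)
        have "z - c *\<^sub>R z0 \<in> Z" using z z0 Z(1) by (auto intro: subspace_diff subspace_scale)
        moreover have "coef (z - c *\<^sub>R z0) i = 0" if "i < Suc K" for i
          using that z z0 unfolding cf by (cases "i = K") (auto simp: c_def)
        ultimately have "z - c *\<^sub>R z0 \<in> span B" using B(2) by blast
        then have "z - c *\<^sub>R z0 \<in> span (insert z0 B)" using span_mono[of B "insert z0 B"] by blast
        moreover have "c *\<^sub>R z0 \<in> span (insert z0 B)" by (intro span_scale span_base) simp
        ultimately have "(z - c *\<^sub>R z0) + c *\<^sub>R z0 \<in> span (insert z0 B)" by (rule span_add)
        then show "z \<in> span (insert z0 B)" by simp
      qed
      then show ?thesis using B(1) by (intro exI[of _ "insert z0 B"]) simp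
    next
      case False
      then have "?Z K \<subseteq> ?Z (Suc K)" by (auto simp: less_Suc_eq)
      then have "?Z K \<subseteq> span B" using B(2) by (rule subset_trans)
      then show ?thesis using B(1) by (intro exI[of _ B] conjI)
    qed
    then show False using Suc.IH unfolding infinite_dimensional_def by blast
  qed
qed

lemma unit_vector:
  assumes Z: "subspace Z" "Z \<subseteq> X" "infinite_dimensional Z"
  shows "\<exists>z\<in>Z. norm z = 1 \<and> (\<forall>i<K. coef z i = 0)"
proof -
  let ?Z = "{z\<in>Z. \<forall>i<K. coef z i = 0}"
  have "\<not> ?Z \<subseteq> span {}"
    using tail_infinite_dimensional[OF Z, of K] unfolding infinite_dimensional_def by blast
  then obtain z where z: "z \<in> Z" "\<forall>i<K. coef z i = 0" "z \<noteq> 0" by auto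
  have zX: "z \<in> X" using z Z by blast
  show ?thesis
    by (rule bexI[of _ "inverse (norm z) *\<^sub>R z"]) (use z Z zX in \<open>auto simp: coef_scale intro: subspace_scale\<close>)
qed

text \<open>If averages of normalized blocks always lost half of their norm, then iterating would make
  them too small for the lower estimate given by the functionals of even weight.\<close>

lemma normalized_averages:
  assumes Z: "subspace Z" "Z \<subseteq> X" "infinite_dimensional Z" and j: "2 \<le> j" and \<eta>0: "0 < \<eta>0"
  shows "\<exists>z w r. z \<in> Z \<and> supp w \<subseteq> {K0..r} \<and> norm_le (\<lambda>k. coef z k - w k) \<eta>0 \<and> norm_le w 1 \<and>
    \<not> norm_le w (1/2) \<and> square_bound (n (2 * j - 1) - 1) w 5"
proof (rule ccontr)
  assume neg: "\<not> ?thesis"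
  define N where "N = n (2 * j - 1)"
  have N1: "1 \<le> N" unfolding N_def by (rule n_pos)
  have half: "norm_le w (1/2)" if "z \<in> Z" "supp w \<subseteq> {K0..r}" "norm_le (\<lambda>k. coef z k - w k) \<eta>0"
    "norm_le w 1" "square_bound (N - 1) w 5" for z w r
    using neg that unfolding N_def by blast
  \<comment> \<open>The state after \<open>i\<close> rounds: \<open>z\<close> in \<open>Z\<close> is
    approximated by \<open>w\<close>, whose norm has been halved \<open>i\<close> times, while
    \<open>A\<close> and \<open>\<gamma>\<close> keep a lower witness with the value 1/2. Each round
    averages with order \<open>N\<close>, so the order of \<open>A\<close> is
    \<open>i * N\<close>.\<close>
  define Pr where "Pr i K \<eta> = (\<lambda>(z, w, r, A, \<gamma>). z \<in> Z \<and> supp w \<subseteq> {K..r} \<and> K \<le> r \<and> norm_le (\<lambda>k. coef z k - w k) \<eta> \<and>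
    norm_le w ((1/2) ^ i) \<and> finite A \<and> A \<noteq> {} \<and> (\<forall>f\<in>A. D f \<and> supp f \<noteq> {} \<and> supp f \<subseteq> {K..r}) \<and>
    disjoint_family_on supp A \<and> (\<lambda>f. Min (supp f)) ` A \<in> schreier0 (i * N) \<and>
    (\<Sum>f\<in>A. (\<gamma> f)\<^sup>2) \<le> 1 \<and> 1/2 \<le> (\<Sum>f\<in>A. \<gamma> f * pair f w))" for i K \<eta>
  have iterate: "\<exists>t. Pr i K \<eta> t" if "0 < \<eta>" for i K \<eta>
    using that
  proof (induction i arbitrary: K \<eta>)
    case 0
    obtain z where z: "z \<in> Z" "norm z = 1" "\<forall>i<K. coef z i = 0" using unit_vector[OF Z] by blast
    have zX: "z \<in> X" using z Z by blast
    have "0 < min \<eta> (1/4)" using 0 by simp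
    then obtain R where R: "\<forall>M\<ge>R. norm (z - proj {..M} z) \<le> min \<eta> (1/4)" using truncate[OF zX] by blast
    define r where "r = max R K"
    define w where "w = coef (proj {..r} z)"
    have pX: "proj {..r} z \<in> X" by (rule proj_X(1)[OF zX])
    have d: "norm (z - proj {..r} z) \<le> min \<eta> (1/4)" using R by (simp add: r_def)
    have w: "w = (\<lambda>k. indicator {..r} k * coef z k)" unfolding w_def by (rule proj_X(2)[OF zX])
    have sw: "supp w \<subseteq> {K..r}"
    proof
      fix k assume "k \<in> supp w"
      then have "k \<le> r" "coef z k \<noteq> 0" unfolding w by (auto simp: supp_def indicator_def split: if_splits)
      then show "k \<in> {K..r}" using z(3) by (metis atLeastAtMost_iff not_le)
    qed
    have n1: "norm_le (\<lambda>k. coef z k - w k) \<eta>"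
      using norm_le_iff[OF X_diff[OF zX pX], of \<eta>] d unfolding coef_diff[OF zX pX] w_def by simp
    have n2: "norm_le w 1"
      using norm_le_iff[OF pX, of 1] proj_norm[OF zX, of "{..r}"] z(2) unfolding w_def by simp
    have "\<not> norm (proj {..r} z) \<le> 1/2"
      using d z(2) norm_triangle_sub[of z "proj {..r} z"] by simp
    then have "\<not> norm_le w (1/2)" using norm_le_iff[OF pX] unfolding w_def by blast
    then obtain f where f: "D f" "1/2 < pair f w" using not_norm_le by blast
    obtain g where g: "D g" "supp g \<subseteq> supp f \<inter> {K..r}" "\<bar>pair f (\<lambda>k. indicator {K..r} k * w k)\<bar> \<le> pair g w"
      using D_restrict[OF f(1)] by blast
    have "(\<lambda>k. indicator {K..r} k * w k) = w"
    proof
      fix k show "indicator {K..r} k * w k = w k" using sw by (cases "k \<in> {K..r}") (auto simp: supp_def)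
    qed
    then have gw: "1/2 < pair g w" using g(3) f(2) by simp
    then have gne: "supp g \<noteq> {}" by (auto simp: pair_def)
    have "Min (supp g) \<noteq> 0" using D_Min[OF g(1) gne] D_0[OF g(1)] by metis
    then have "(\<lambda>f. Min (supp f)) ` {g} \<in> schreier0 (0 * N)" by (simp add: schreier0_def)
    then show ?case
      using z(1) sw n1 n2 g(1,2) gne gw
      by (intro exI[of _ "(z, w, r, {g}, \<lambda>_. 1)"]) (auto simp: Pr_def r_def disjoint_family_on_def)
  next
    case (Suc i)
    \<comment> \<open>The average is multiplied by \<open>2 ^ i\<close> before \<open>half\<close>
      is applied to it, so the approximation must be finer than \<open>\<eta>0\<close> by this
      factor.\<close>
    define \<delta> where "\<delta> = min \<eta> (\<eta>0 / 2 ^ i)"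
    have \<delta>: "0 < \<delta>" "\<delta> \<le> \<eta>" "2 ^ i * \<delta> \<le> \<eta>0" using Suc.prems \<eta>0 by (auto simp: \<delta>_def min_def field_simps)
    have "\<exists>t. \<forall>k. (max (max K K0) 1 \<le> fst (t k) \<and> Pr i (fst (t k)) (\<delta> * (1/2) ^ Suc k) (snd (t k))) \<and>
      fst (snd (snd (snd (t k)))) < fst (t (Suc k))"
    proof (rule dependent_nat_choice)
      have "0 < \<delta> * (1/2) ^ Suc 0" using \<delta> by simp
      from Suc.IH[OF this, of "max (max K K0) 1"] obtain t where "Pr i (max (max K K0) 1) (\<delta> * (1/2) ^ Suc 0) t" by blast
      then show "\<exists>t. max (max K K0) 1 \<le> fst t \<and> Pr i (fst t) (\<delta> * (1/2) ^ Suc 0) (snd t)"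
        by (intro exI[of _ "(max (max K K0) 1, t)"]) simp
    next
      fix t k assume t: "max (max K K0) 1 \<le> fst t \<and> Pr i (fst t) (\<delta> * (1/2) ^ Suc k) (snd t)"
      define K' where "K' = Suc (fst (snd (snd (snd t)))) + fst t"
      have "0 < \<delta> * (1/2) ^ Suc (Suc k)" using \<delta> by simp
      from Suc.IH[OF this, of K'] obtain t' where t': "Pr i K' (\<delta> * (1/2) ^ Suc (Suc k)) t'" by blast
      show "\<exists>y. (max (max K K0) 1 \<le> fst y \<and> Pr i (fst y) (\<delta> * (1/2) ^ Suc (Suc k)) (snd y)) \<and>
        fst (snd (snd (snd t))) < fst y"
        by (rule exI[of _ "(K', t')"]) (use t t' in \<open>auto simp: K'_def\<close>)
    qed
    then obtain t where t: "\<And>k. max (max K K0) 1 \<le> fst (t k)" "\<And>k. Pr i (fst (t k)) (\<delta> * (1/2) ^ Suc k) (snd (t k))"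
      "\<And>k. fst (snd (snd (snd (t k)))) < fst (t (Suc k))" by blast
    define s where "s k = fst (t k)" for k
    define z where "z k = fst (snd (t k))" for k
    define w where "w k = fst (snd (snd (t k)))" for k
    define r where "r k = fst (snd (snd (snd (t k))))" for k
    define A where "A k = fst (snd (snd (snd (snd (t k)))))" for k
    define \<gamma> where "\<gamma> k = snd (snd (snd (snd (snd (t k)))))" for k
    have P: "z k \<in> Z" "supp (w k) \<subseteq> {s k..r k}" "s k \<le> r k" "norm_le (\<lambda>a. coef (z k) a - w k a) (\<delta> * (1/2) ^ Suc k)"
      "norm_le (w k) ((1/2) ^ i)" "finite (A k)" "A k \<noteq> {}"
      "disjoint_family_on supp (A k)" "(\<lambda>f. Min (supp f)) ` A k \<in> schreier0 (i * N)"
      "(\<Sum>f\<in>A k. (\<gamma> k f)\<^sup>2) \<le> 1" "1/2 \<le> (\<Sum>f\<in>A k. \<gamma> k f * pair f (w k))" for k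
      using t(2)[of k] unfolding Pr_def s_def z_def w_def r_def A_def \<gamma>_def by (simp_all add: case_prod_beta)
    have PA: "D f" "supp f \<noteq> {}" "supp f \<subseteq> {s k..r k}" if "f \<in> A k" for k f
      using t(2)[of k] that unfolding Pr_def s_def r_def A_def by (simp_all add: case_prod_beta)
    have rs: "r k < s (Suc k)" for k using t(3)[of k] by (simp add: r_def s_def)
    have s1: "1 \<le> s k" "K \<le> s k" "K0 \<le> s k" for k using t(1)[of k] by (simp_all add: s_def)
    have bd: "disjoint_family_on (\<lambda>t. {s t..r t}) UNIV" and sm: "strict_mono s" and rm: "strict_mono r"
      by (rule blocks_disjoint[of s r]; rule P rs)+
    \<comment> \<open>With mass \<open>1 / 4 ^ N\<close> the constant in
      \<open>average_square_bound\<close> becomes 4 + 1 = 5.\<close>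
    obtain k1 k2 b where b: "k1 < k2" "s ` {k1..<k2} \<in> schreier N" "small_average (N - 1) (1 / 4 ^ N) {k1..<k2} b r"
      using small_average_exists[of s r "1 / 4 ^ N" N, OF P(3) rs s1(1) _ N1] by auto
    define F where "F = {k1..<k2}"
    have F: "finite F" by (simp add: F_def)
    note sa = b(3)[folded F_def] and sch = b(2)[folded F_def]
    note sa' = small_averageD[OF sa]
    have bd': "disjoint_family_on (\<lambda>t. {s t..r t}) F" by (rule disjoint_family_on_mono[OF subset_UNIV bd])
    define zz where "zz = (\<Sum>k\<in>F. sqrt (b k) *\<^sub>R z k)"
    define ww where "ww = (\<lambda>a. \<Sum>k\<in>F. sqrt (b k) * w k a)"
    define R where "R = r (k2 - 1)"
    have kF: "{s k..r k} \<subseteq> {K..R} \<inter> {K0..R}" if "k \<in> F" for k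
    proof -
      have "r k \<le> R" unfolding R_def using that rm by (auto simp: F_def strict_mono_less_eq)
      then show ?thesis using s1(2,3)[of k] by auto
    qed
    have zzX: "zz \<in> X" "coef zz = (\<lambda>a. \<Sum>k\<in>F. sqrt (b k) * coef (z k) a)"
      unfolding zz_def using coef_sum[OF F, of z "\<lambda>k. sqrt (b k)"] P(1) Z(2) by auto
    have zzZ: "zz \<in> Z" unfolding zz_def using P(1) Z(1) by (auto intro!: subspace_sum subspace_scale)
    have b01: "0 \<le> sqrt (b k)" "sqrt (b k) \<le> 1" if "k \<in> F" for k
      using sa'(2)[OF that] member_le_sum[OF that, of b] sa'(2,3) F by auto
    have sww: "supp ww \<subseteq> (\<Union>k\<in>F. {s k..r k})"
    proof
      fix a assume "a \<in> supp ww"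
      then have "(\<Sum>k\<in>F. sqrt (b k) * w k a) \<noteq> 0" by (simp add: supp_def ww_def)
      then obtain k where "k \<in> F" "sqrt (b k) * w k a \<noteq> 0" by (rule sum.not_neutral_contains_not_neutral)
      moreover from this have "a \<in> supp (w k)" by (simp add: supp_def)
      ultimately show "a \<in> (\<Union>k\<in>F. {s k..r k})" using P(2)[of k] by blast
    qed
    have diff: "norm_le (\<lambda>a. coef zz a - ww a) \<delta>"
    proof (rule norm_le_mono)
      have "(\<lambda>a. coef zz a - ww a) = (\<lambda>a. \<Sum>k\<in>F. sqrt (b k) * (coef (z k) a - w k a))"
        unfolding zzX(2) ww_def by (simp add: sum_subtractf right_diff_distrib)
      then show "norm_le (\<lambda>a. coef zz a - ww a) (\<Sum>k\<in>F. \<bar>sqrt (b k)\<bar> * (\<delta> * (1/2) ^ Suc k))"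
        using norm_le_sum_triangle[OF F P(4), of "\<lambda>k. sqrt (b k)"] by simp
      have "(\<Sum>k\<in>F. \<bar>sqrt (b k)\<bar> * (\<delta> * (1/2) ^ Suc k)) \<le> (\<Sum>k\<in>F. 1 * (\<delta> * (1/2) ^ Suc k))"
        using b01 \<delta>(1) by (intro sum_mono mult_right_mono) auto
      also have "... \<le> (\<Sum>k<k2. 1 * (\<delta> * (1/2) ^ Suc k))"
        using \<delta>(1) by (intro sum_mono2) (auto simp: F_def)
      also have "... = \<delta> * (1/2) * (\<Sum>k<k2. (1/2) ^ k)" by (simp add: sum_distrib_left mult_ac)
      also have "... = \<delta> * (1 - (1/2) ^ k2)" by (simp add: geometric_sum)
      also have "... \<le> \<delta>" using \<delta>(1) by simp
      finally show "(\<Sum>k\<in>F. \<bar>sqrt (b k)\<bar> * (\<delta> * (1/2) ^ Suc k)) \<le> \<delta>" .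
    qed
    define v where "v k = (\<lambda>a. 2 ^ i * w k a)" for k
    have nv: "norm_le (v k) 1" for k
      using norm_le_scale[OF P(5)[of k], of "2 ^ i"] by (simp add: v_def power_divide)
    have sv: "supp (v k) \<subseteq> {s k..r k}" for k using P(2)[of k] by (auto simp: v_def supp_def)
    have vw: "(\<lambda>a. \<Sum>k\<in>F. sqrt (b k) * v k a) = (\<lambda>a. 2 ^ i * ww a)"
      unfolding v_def ww_def by (simp add: sum_distrib_left mult.left_commute)
    have "norm_le (\<lambda>a. 2 ^ i * ww a) (1/2)"
    proof (rule half)
      show "2 ^ i *\<^sub>R zz \<in> Z" using zzZ Z(1) by (rule subspace_scale[rotated])
      show "supp (\<lambda>a. 2 ^ i * ww a) \<subseteq> {K0..R}" using sww kF by (fastforce simp: supp_def)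
      have "(\<lambda>k. coef (2 ^ i *\<^sub>R zz) k - 2 ^ i * ww k) = (\<lambda>k. 2 ^ i * (coef zz k - ww k))"
        unfolding coef_scale[OF zzX(1)] by (simp add: right_diff_distrib)
      then show "norm_le (\<lambda>k. coef (2 ^ i *\<^sub>R zz) k - 2 ^ i * ww k) \<eta>0"
        using norm_le_mono[OF norm_le_scale[OF diff, of "2 ^ i"]] \<delta>(3) by simp
      show "norm_le (\<lambda>a. 2 ^ i * ww a) 1"
        unfolding vw[symmetric] by (rule norm_le_sum[OF F bd' sv nv]) (use sa' in auto)
      have "square_bound (N - 1) (\<lambda>a. 2 ^ i * ww a) ((4 + 1 / 4 ^ N * 4 ^ Suc (N - 1)) * 1\<^sup>2)"
        unfolding vw[symmetric] by (rule average_square_bound[OF sa bd' sv nv])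
      then show "square_bound (N - 1) (\<lambda>a. 2 ^ i * ww a) 5" using N1 by simp
    qed
    from norm_le_scale[OF this, of "(1/2) ^ i"] have nww: "norm_le ww ((1/2) ^ Suc i)"
      by (simp add: power_divide mult.commute)
    define AA where "AA = (\<Union>k\<in>F. A k)"
    define \<kappa> where "\<kappa> f = (THE k. f \<in> A k)" for f
    have disjA: "k = k'" if "f \<in> A k" "f \<in> A k'" for f k k'
    proof -
      have "{s k..r k} \<inter> {s k'..r k'} \<noteq> {}" using PA[OF that(1)] PA[OF that(2)] by blast
      then show ?thesis using bd unfolding disjoint_family_on_def by blast
    qed
    have \<kappa>: "\<kappa> f = k" if "f \<in> A k" for f k
      unfolding \<kappa>_def using that disjA by (intro the_equality) auto
    define \<Gamma> where "\<Gamma> f = sqrt (b (\<kappa> f)) * \<gamma> (\<kappa> f) f" for f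
    have sumA: "(\<Sum>f\<in>AA. \<phi> f) = (\<Sum>k\<in>F. \<Sum>f\<in>A k. \<phi> f)" for \<phi> :: "_ \<Rightarrow> real"
      unfolding AA_def by (rule sum.UNION_disjoint) (use F P(6) disjA in auto)
    have "Pr (Suc i) K \<eta> (zz, ww, R, AA, \<Gamma>)"
      unfolding Pr_def split_conv
    proof (intro conjI ballI)
      show "zz \<in> Z" by (rule zzZ)
      show "supp ww \<subseteq> {K..R}" using sww kF by blast
      have "k1 \<in> F" using b(1) by (simp add: F_def)
      then show "K \<le> R" using kF[of k1] P(3)[of k1] by auto
      show "norm_le (\<lambda>k. coef zz k - ww k) \<eta>" by (rule norm_le_mono[OF diff \<delta>(2)])
      show "norm_le ww ((1/2) ^ Suc i)" by (rule nww)
      show "finite AA" using F P(6) by (simp add: AA_def)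
      show "AA \<noteq> {}" using \<open>k1 \<in> F\<close> P(7)[of k1] by (auto simp: AA_def)
      fix f assume "f \<in> AA"
      then obtain k where k: "k \<in> F" "f \<in> A k" by (auto simp: AA_def)
      show "D f" "supp f \<noteq> {}" using PA[OF k(2)] by blast+
      show "supp f \<subseteq> {K..R}" using PA(3)[OF k(2)] kF[OF k(1)] by blast
    next
      show "disjoint_family_on supp AA"
        unfolding disjoint_family_on_def
      proof (intro ballI impI)
        fix f g assume fg: "f \<in> AA" "g \<in> AA" "f \<noteq> g"
        then obtain k k' where k: "f \<in> A k" "g \<in> A k'" by (auto simp: AA_def)
        show "supp f \<inter> supp g = {}"
        proof (cases "k = k'")
          case True
          then show ?thesis using P(8)[of k] k fg(3) unfolding disjoint_family_on_def by blast
        next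
          case False
          then have "{s k..r k} \<inter> {s k'..r k'} = {}" using bd unfolding disjoint_family_on_def by blast
          then show ?thesis using PA(3)[OF k(1)] PA(3)[OF k(2)] by blast
        qed
      qed
      have "(\<Union>k\<in>F. (\<lambda>f. Min (supp f)) ` A k) \<in> schreier0 (N + i * N)"
      proof (rule schreier0_blocks[where G = "\<lambda>k. (\<lambda>f. Min (supp f)) ` A k" and s = s and r = r, OF F N1 sch P(9) _ _ P(3) rs])
        show "(\<lambda>f. Min (supp f)) ` A k \<noteq> {}" for k using P(7) by blast
        show "(\<lambda>f. Min (supp f)) ` A k \<subseteq> {s k..r k}" for k
        proof (rule image_subsetI)
          fix f assume f: "f \<in> A k"
          have "Min (supp f) \<in> supp f" by (rule D_Min[OF PA(1,2)[OF f]])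
          then show "Min (supp f) \<in> {s k..r k}" using PA(3)[OF f] by blast
        qed
      qed
      moreover have "(\<Union>k\<in>F. (\<lambda>f. Min (supp f)) ` A k) = (\<lambda>f. Min (supp f)) ` AA" by (auto simp: AA_def)
      ultimately show "(\<lambda>f. Min (supp f)) ` AA \<in> schreier0 (Suc i * N)" by simp
      have "(\<Sum>f\<in>AA. (\<Gamma> f)\<^sup>2) = (\<Sum>k\<in>F. \<Sum>f\<in>A k. b k * (\<gamma> k f)\<^sup>2)"
        unfolding sumA by (intro sum.cong refl) (simp add: \<Gamma>_def \<kappa> power_mult_distrib sa'(2))
      also have "... \<le> (\<Sum>k\<in>F. b k * 1)"
        unfolding sum_distrib_left[symmetric] by (rule sum_mono, rule mult_left_mono) (use P(10) sa'(2) in auto)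
      finally show "(\<Sum>f\<in>AA. (\<Gamma> f)\<^sup>2) \<le> 1" using sa'(3) by simp
      have pw: "pair f ww = sqrt (b k) * pair f (w k)" if k: "k \<in> F" "f \<in> A k" for f k
      proof -
        have "pair f ww = (\<Sum>k'\<in>F. sqrt (b k') * pair f (w k'))" unfolding ww_def by (rule pair_sum)
        also have "... = (\<Sum>k'\<in>{k}. sqrt (b k') * pair f (w k'))"
        proof (rule sum.mono_neutral_right)
          show "\<forall>k'\<in>F - {k}. sqrt (b k') * pair f (w k') = 0"
          proof
            fix k' assume "k' \<in> F - {k}"
            then have "{s k..r k} \<inter> {s k'..r k'} = {}" using bd unfolding disjoint_family_on_def by blast
            then have "supp f \<inter> supp (w k') = {}" using PA(3)[OF k(2)] P(2)[of k'] by blast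
            then show "sqrt (b k') * pair f (w k') = 0" by (simp add: pair_disjoint)
          qed
        qed (use F k in auto)
        finally show ?thesis by simp
      qed
      have "1/2 = (\<Sum>k\<in>F. b k * (1/2))" using sa'(3) by (simp add: sum_divide_distrib[symmetric])
      also have "... \<le> (\<Sum>k\<in>F. b k * (\<Sum>f\<in>A k. \<gamma> k f * pair f (w k)))"
        by (rule sum_mono, rule mult_left_mono) (use P(11) sa'(2) in auto)
      also have "... = (\<Sum>f\<in>AA. \<Gamma> f * pair f ww)"
        unfolding sumA sum_distrib_left
      proof (intro sum.cong refl)
        fix k f assume k: "k \<in> F" "f \<in> A k"
        have "sqrt (b k) * sqrt (b k) = b k" using sa'(2)[OF k(1)] by simp
        then have "b k * (\<gamma> k f * pair f (w k)) = (sqrt (b k) * sqrt (b k)) * (\<gamma> k f * pair f (w k))" by (simp only:)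
        then show "b k * (\<gamma> k f * pair f (w k)) = \<Gamma> f * pair f ww"
          unfolding \<Gamma>_def \<kappa>[OF k(2)] pw[OF k] by (simp add: mult_ac)
      qed
      finally show "1/2 \<le> (\<Sum>f\<in>AA. \<Gamma> f * pair f ww)" .
    qed
    then show ?case by blast
  qed
  define M where "M = m (2 * j)"
  have "m 3 ^ 3 \<le> m 4" using m_cube[of 3] by simp
  moreover have "2 ^ 3 \<le> m 3 ^ 3" by (rule power_mono[OF m_ge2]) simp
  moreover have "m 4 \<le> M" unfolding M_def using j by (intro m_mono) simp
  ultimately have M8: "8 \<le> M" by simp
  \<comment> \<open>As long as \<open>L * N\<close> stays below \<open>n (2 * j)\<close>, one
    functional of weight \<open>M\<close> collects the whole witness and takes a value of at least
    \<open>1 / (2 * M)\<close> on \<open>w\<close>. This exceeds the norm bound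
    \<open>(1/2) ^ L\<close> once \<open>2 ^ L > 2 * M\<close>.\<close>
  obtain L where L: "2 * M + 1 \<le> 2 ^ L" "2 ^ L \<le> 2 * (2 * M + 1)" using power_two_between[of "2 * M + 1"] by auto
  have "2 ^ L \<le> 8 * M" using L(2) M8 by simp
  also have "... \<le> M * M * M" using M8 mult_le_mono[of 8 "M * M" M M] mult_le_mono[of 8 M 1 M] by simp
  finally have "2 ^ L \<le> M ^ 3" by (simp add: power3_eq_cube)
  then have gap: "Suc L * (N + 1) < n (2 * j)"
    using n_gap_levels[of "2 * j" L] j by (simp add: M_def N_def)
  have L0: "L \<noteq> 0" using L(1) M8 by (cases L) auto
  obtain z w r A \<gamma> where t: "Pr L 1 1 (z, w, r, A, \<gamma>)" using iterate[of 1 L 1] by (metis surj_pair zero_less_one)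
  then have A: "norm_le w ((1/2) ^ L)" "finite A" "\<forall>f\<in>A. D f \<and> supp f \<noteq> {} \<and> supp f \<subseteq> {1..r}" "disjoint_family_on supp A"
    "(\<lambda>f. Min (supp f)) ` A \<in> schreier0 (L * N)" "(\<Sum>f\<in>A. (\<gamma> f)\<^sup>2) \<le> 1" "1/2 \<le> (\<Sum>f\<in>A. \<gamma> f * pair f w)"
    by (simp_all add: Pr_def)
  have LN: "1 \<le> L * N" "L * N \<le> n (2 * j)" using L0 N1 gap by (auto simp: Suc_le_eq algebra_simps)
  have "(\<lambda>f. Min (supp f)) ` A \<in> schreier (n (2 * j))"
    using A(5) schreier_mono[OF LN] LN(1) by (auto simp: schreier0_def)
  moreover have "{f\<in>A. supp f \<noteq> {}} = A" using A(3) by blast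
  ultimately have "W (\<lambda>k. 1 / real M * (\<Sum>f\<in>A. \<gamma> f * f k)) (Some M)"
    unfolding M_def using A by (intro even_functional) auto
  then have "\<bar>pair (\<lambda>k. 1 / real M * (\<Sum>f\<in>A. \<gamma> f * f k)) w\<bar> \<le> (1/2) ^ L"
    using A(1) unfolding norm_le_def by blast
  moreover have "pair (\<lambda>k. 1 / real M * (\<Sum>f\<in>A. \<gamma> f * f k)) w = 1 / real M * (\<Sum>f\<in>A. \<gamma> f * pair f w)"
    by (rule pair_combo[OF A(2)]) (use A(3) D_finite in blast)
  moreover have "1 / real M * (1/2) \<le> 1 / real M * (\<Sum>f\<in>A. \<gamma> f * pair f w)"
    by (rule mult_left_mono[OF A(7)]) simp
  ultimately have "1 / real M * (1/2) \<le> (1/2) ^ L" by linarith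
  then have "2 ^ L \<le> 2 * real M" using M8 by (simp add: field_simps power_divide)
  moreover have "real (2 * M + 1) \<le> 2 ^ L" using L(1) by (metis of_nat_le_iff of_nat_numeral of_nat_power)
  ultimately show False by simp
qed

end

section \<open>Bounded linear maps on subspaces and closed spans\<close>

lemma bounded_linear_onD:
  assumes "bounded_linear_on U h"
  shows "u \<in> U \<Longrightarrow> v \<in> U \<Longrightarrow> h (u + v) = h u + h v" "u \<in> U \<Longrightarrow> h (c *\<^sub>R u) = c *\<^sub>R h u"
    "\<exists>K. 0 < K \<and> (\<forall>u\<in>U. norm (h u) \<le> K * norm u)"
proof -
  show "u \<in> U \<Longrightarrow> v \<in> U \<Longrightarrow> h (u + v) = h u + h v" "u \<in> U \<Longrightarrow> h (c *\<^sub>R u) = c *\<^sub>R h u"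
    using assms unfolding bounded_linear_on_def by blast+
  obtain K where K: "\<forall>u\<in>U. norm (h u) \<le> K * norm u" using assms unfolding bounded_linear_on_def by blast
  have "norm (h u) \<le> (\<bar>K\<bar> + 1) * norm u" if "u \<in> U" for u
  proof -
    have "K * norm u \<le> (\<bar>K\<bar> + 1) * norm u" by (rule mult_right_mono) auto
    then show ?thesis using K that by force
  qed
  then show "\<exists>K. 0 < K \<and> (\<forall>u\<in>U. norm (h u) \<le> K * norm u)" by (intro exI[of _ "\<bar>K\<bar> + 1"]) auto
qed

lemma bounded_linear_on_diff:
  assumes "bounded_linear_on U h" "subspace U" "u \<in> U" "v \<in> U" shows "h (u - v) = h u - h v"
proof -
  have 1: "(-1) *\<^sub>R v \<in> U" using assms by (intro subspace_scale)
  have "h (u + (-1) *\<^sub>R v) = h u + (-1) *\<^sub>R h v"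
    unfolding bounded_linear_onD(1)[OF assms(1,3) 1] bounded_linear_onD(2)[OF assms(1,4)] ..
  then show ?thesis by simp
qed

lemma bounded_linear_on_zero: assumes "bounded_linear_on U h" "subspace U" shows "h 0 = 0"
  using bounded_linear_onD(2)[OF assms(1), of 0 0] assms(2) by (simp add: subspace_0)

lemma bounded_linear_on_sum:
  assumes "bounded_linear_on U h" "subspace U" "finite I" "\<And>i. i \<in> I \<Longrightarrow> u i \<in> U"
  shows "h (\<Sum>i\<in>I. c i *\<^sub>R u i) = (\<Sum>i\<in>I. c i *\<^sub>R h (u i))"
  using assms(3,4)
proof (induction I rule: finite_induct)
  case empty
  then show ?case using bounded_linear_on_zero[OF assms(1,2)] by simp
next
  case (insert i I)
  have "(\<Sum>i\<in>I. c i *\<^sub>R u i) \<in> U" using insert.prems assms(2) by (auto intro!: subspace_sum subspace_scale)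
  then show ?case
    using insert bounded_linear_onD(1)[OF assms(1), of "c i *\<^sub>R u i"] bounded_linear_onD(2)[OF assms(1)] assms(2)
    by (simp add: subspace_scale)
qed

text \<open>Membership in a closed subspace needs checking on the generators only. With
  \<open>S\<close> the zero space this also proves linear identities on closed spans.\<close>

lemma closed_span_map:
  assumes h: "bounded_linear_on U h" and A: "closed_span A \<subseteq> U" and S: "\<And>a. a \<in> A \<Longrightarrow> h a \<in> S" "subspace S" "closed S"
    and u: "u \<in> closed_span A"
  shows "h u \<in> S"
proof -
  have sp: "span A \<subseteq> U" using A closure_subset unfolding closed_span_def by blast
  have 0: "h v \<in> S" if "v \<in> span A" for v
  proof -
    have "v \<in> span A \<and> h v \<in> S"
      using that
  proof (induction rule: span_induct_alt)
    case base
    have "0 \<in> U" using sp span_zero by blast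
    then have "h 0 = 0" using bounded_linear_onD(2)[OF h, of 0 0] by simp
    then show ?case using S(2) by (simp add: subspace_0 span_zero)
  next
    case (step c a v)
    have sA: "v \<in> span A" "a \<in> span A" "c *\<^sub>R a \<in> span A" using step span_base[of a A] span_scale[of a A c] by auto
    then have U: "a \<in> U" "v \<in> U" "c *\<^sub>R a \<in> U" using sp by auto
    have "h (c *\<^sub>R a + v) = c *\<^sub>R h a + h v"
      using bounded_linear_onD(1)[OF h U(3,2)] bounded_linear_onD(2)[OF h U(1)] by simp
    then show ?case using S(1)[OF step(1)] step S(2) sA by (simp add: subspace_add subspace_scale span_add)
  qed
  then show ?thesis ..
  qed
  obtain v where v: "\<And>i. v i \<in> span A" "v \<longlonglongrightarrow> u"
    using u unfolding closed_span_def closure_sequential by blast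
  obtain K where K: "0 < K" "\<forall>u\<in>U. norm (h u) \<le> K * norm u" using bounded_linear_onD(3)[OF h] by blast
  have uU: "u \<in> U" using u A by blast
  have "(\<lambda>i. h (v i)) \<longlonglongrightarrow> h u"
  proof (rule LIM_zero_cancel, rule tendsto_norm_zero_cancel, rule tendsto_sandwich[OF _ _ tendsto_const])
    show "(\<lambda>i. K * norm (v i - u)) \<longlonglongrightarrow> 0"
      using tendsto_mult_left[OF tendsto_norm_zero[OF LIM_zero[OF v(2)]], of K] by simp
    have "norm (h (v i) - h u) \<le> K * norm (v i - u)" for i
    proof -
      have vi: "v i \<in> closed_span A" "u \<in> closed_span A"
        using v(1) u closure_subset unfolding closed_span_def by auto
      have d: "v i - u \<in> closed_span A" by (rule subspace_diff[OF subspace_closed_span vi])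
      have m: "(-1) *\<^sub>R u \<in> closed_span A" by (rule subspace_scale[OF subspace_closed_span u])
      have "h (v i - u) = h (v i) - h u"
        using bounded_linear_onD(1)[OF h, of "v i" "(-1) *\<^sub>R u"] bounded_linear_onD(2)[OF h uU, of "-1"] vi m A by auto
      then show ?thesis using K(2) d A by (metis subsetD)
    qed
    then show "\<forall>\<^sub>F i in sequentially. norm (h (v i) - h u) \<le> K * norm (v i - u)" by (intro always_eventually) simp
  qed auto
  then show ?thesis using closed_sequentially[OF S(3), of "\<lambda>i. h (v i)"] 0 v(1) by blast
qed

text \<open>The expectation over a uniformly random subset \<open>A\<close> is a quarter of the full sum; the linear terms make the
  induction go through.\<close>

lemma max_cut_aux:
  fixes \<psi> :: "'i \<Rightarrow> 'i \<Rightarrow> real"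
  assumes "finite G"
  shows "\<exists>A\<subseteq>G. (\<Sum>i\<in>G. \<Sum>j\<in>G. if i = j then 0 else \<psi> i j) / 4 + (\<Sum>i\<in>G. (a i + b i) / 2)
    \<le> (\<Sum>i\<in>G - A. \<Sum>j\<in>A. \<psi> i j) + (\<Sum>i\<in>A. a i) + (\<Sum>i\<in>G - A. b i)"
  using assms
proof (induction G arbitrary: a b rule: finite_induct)
  case empty then show ?case by simp
next
  case (insert g G)
  let ?S = "\<Sum>i\<in>G. \<Sum>j\<in>G. if i = j then 0 else \<psi> i j"
  have tot: "(\<Sum>i\<in>insert g G. \<Sum>j\<in>insert g G. if i = j then 0 else \<psi> i j)
      = ?S + (\<Sum>i\<in>G. \<psi> i g) + (\<Sum>j\<in>G. \<psi> g j)"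
  proof -
    have 1: "(\<Sum>j\<in>insert g G. if g = j then 0 else \<psi> g j) = (\<Sum>j\<in>G. \<psi> g j)"
      using insert.hyps by (auto intro!: sum.cong)
    have 2: "(\<Sum>j\<in>insert g G. if i = j then 0 else \<psi> i j) = \<psi> i g + (\<Sum>j\<in>G. if i = j then 0 else \<psi> i j)" if "i \<in> G" for i
      using insert.hyps that by auto
    have "(\<Sum>i\<in>G. \<Sum>j\<in>insert g G. if i = j then 0 else \<psi> i j) = (\<Sum>i\<in>G. \<psi> i g) + ?S"
      by (simp add: 2 sum.distrib cong: sum.cong)
    then show ?thesis using insert.hyps 1 by simp
  qed
  let ?R = "?S / 4 + (\<Sum>i\<in>G. (a i + b i) / 2)"
  \<comment> \<open>\<open>A1\<close> anticipates that \<open>g\<close> joins the set: every element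
    outside then gains \<open>\<psi> i g\<close>, which is added to \<open>b\<close>.
    \<open>A2\<close> anticipates that \<open>g\<close> stays outside: every element inside gains
    \<open>\<psi> g i\<close>, which is added to \<open>a\<close>.\<close>
  obtain A1 where A1: "A1 \<subseteq> G" "?S / 4 + (\<Sum>i\<in>G. (a i + (b i + \<psi> i g)) / 2)
    \<le> (\<Sum>i\<in>G - A1. \<Sum>j\<in>A1. \<psi> i j) + (\<Sum>i\<in>A1. a i) + (\<Sum>i\<in>G - A1. b i + \<psi> i g)"
    using insert.IH[of a "\<lambda>i. b i + \<psi> i g"] by auto
  obtain A2 where A2: "A2 \<subseteq> G" "?S / 4 + (\<Sum>i\<in>G. ((a i + \<psi> g i) + b i) / 2)
    \<le> (\<Sum>i\<in>G - A2. \<Sum>j\<in>A2. \<psi> i j) + (\<Sum>i\<in>A2. a i + \<psi> g i) + (\<Sum>i\<in>G - A2. b i)"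
    using insert.IH[of "\<lambda>i. a i + \<psi> g i" b] by auto
  let ?T = "\<lambda>A. (\<Sum>i\<in>insert g G - A. \<Sum>j\<in>A. \<psi> i j) + (\<Sum>i\<in>A. a i) + (\<Sum>i\<in>insert g G - A. b i)"
  have fin: "finite A1" "finite A2" using A1(1) A2(1) insert.hyps(1) finite_subset by auto
  have g: "g \<notin> A1" "g \<notin> A2" using A1(1) A2(1) insert.hyps(2) by auto
  have T1: "?T (insert g A1) \<ge> ?R + (\<Sum>i\<in>G. \<psi> i g) / 2 + a g"
  proof -
    have "insert g G - insert g A1 = G - A1" using insert.hyps(2) by auto
    then have "?T (insert g A1) = (\<Sum>i\<in>G - A1. \<Sum>j\<in>A1. \<psi> i j) + (\<Sum>i\<in>A1. a i) + (\<Sum>i\<in>G - A1. b i + \<psi> i g) + a g"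
      using fin g by (simp add: sum.distrib)
    moreover have "(\<Sum>i\<in>G. (a i + (b i + \<psi> i g)) / 2) = (\<Sum>i\<in>G. (a i + b i) / 2) + (\<Sum>i\<in>G. \<psi> i g) / 2"
      by (simp add: add_divide_distrib sum.distrib sum_divide_distrib)
    ultimately show ?thesis using A1(2) by linarith
  qed
  have T2: "?T A2 \<ge> ?R + (\<Sum>i\<in>G. \<psi> g i) / 2 + b g"
  proof -
    have "insert g G - A2 = insert g (G - A2)" "g \<notin> G - A2" using g insert.hyps(2) by auto
    then have "?T A2 = (\<Sum>i\<in>G - A2. \<Sum>j\<in>A2. \<psi> i j) + (\<Sum>i\<in>A2. a i + \<psi> g i) + (\<Sum>i\<in>G - A2. b i) + b g"
      using insert.hyps(1) by (simp add: sum.distrib)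
    moreover have "(\<Sum>i\<in>G. ((a i + \<psi> g i) + b i) / 2) = (\<Sum>i\<in>G. (a i + b i) / 2) + (\<Sum>i\<in>G. \<psi> g i) / 2"
      by (simp add: add_divide_distrib sum.distrib sum_divide_distrib)
    ultimately show ?thesis using A2(2) by linarith
  qed
  let ?goal = "(\<Sum>i\<in>insert g G. \<Sum>j\<in>insert g G. if i = j then 0 else \<psi> i j) / 4 + (\<Sum>i\<in>insert g G. (a i + b i) / 2)"
  have "?goal = ?R + (\<Sum>i\<in>G. \<psi> i g) / 4 + (\<Sum>i\<in>G. \<psi> g i) / 4 + (a g + b g) / 2"
    unfolding tot using insert.hyps by (simp add: add_divide_distrib)
  \<comment> \<open>The required value is the mean of the two lower bounds, so the better choice
    reaches it.\<close>
  moreover have "P \<le> Q1 \<or> P \<le> Q2" if "Q1 \<ge> r + p / 2 + x" "Q2 \<ge> r + q / 2 + y" "P = r + p / 4 + q / 4 + (x + y) / 2"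
    for P Q1 Q2 p q r x y :: real using that by argo
  ultimately have "?goal \<le> ?T (insert g A1) \<or> ?goal \<le> ?T A2" using T1 T2 by blast
  then show ?case using A1(1) A2(1) by blast
qed

lemma max_cut:
  fixes \<psi> :: "'i \<Rightarrow> 'i \<Rightarrow> real"
  assumes "finite G" "\<And>i. i \<in> G \<Longrightarrow> \<psi> i i = 0"
  shows "\<exists>A\<subseteq>G. (\<Sum>i\<in>G. \<Sum>j\<in>G. \<psi> i j) / 4 \<le> (\<Sum>i\<in>G - A. \<Sum>j\<in>A. \<psi> i j)"
proof -
  have "(\<Sum>i\<in>G. \<Sum>j\<in>G. if i = j then 0 else \<psi> i j) = (\<Sum>i\<in>G. \<Sum>j\<in>G. \<psi> i j)"
    using assms(2) by (intro sum.cong refl) auto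
  then show ?thesis using max_cut_aux[OF assms(1), of \<psi> "\<lambda>_. 0" "\<lambda>_. 0"] by auto
qed

context wh_banach
begin

section \<open>Multipliers, coordinates and shrinking\<close>

lemma mul_bounded_linear_on:
  assumes "\<And>k. \<bar>\<mu> k\<bar> \<le> K" "0 < K" shows "bounded_linear_on X (mul \<mu>)"
  unfolding bounded_linear_on_def
  using mul_add[of \<mu> K, OF assms(1)] mul_scale[of \<mu> K, OF assms(1)] mul_norm[of \<mu> K, OF assms] by blast

lemma proj_bounded_linear_on: "bounded_linear_on X (proj A)"
  by (rule mul_bounded_linear_on[of "indicator A" 1]) (auto simp: indicator_def)

lemma coef_bounded_linear_on: "bounded_linear_on X (\<lambda>u. coef u k)"
  unfolding bounded_linear_on_def using coef_le(1)
  by (auto simp: coef_add coef_scale intro!: exI[of _ 1])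

lemma pair_coef_le: "D f \<Longrightarrow> u \<in> X \<Longrightarrow> \<bar>pair f (coef u)\<bar> \<le> norm u"
  using norm_le_norm unfolding norm_le_def by blast

text \<open>Otherwise the sum of \<open>M\<^sup>2\<close> successive witnesses has norm of order \<open>M\<close>, by the upper 2-estimate,
  while the functional takes a value of order \<open>M\<^sup>2\<close> on it.\<close>

lemma shrinking:
  fixes \<phi> :: "'x \<Rightarrow> real"
  assumes Y: "subspace Y" "Y \<subseteq> X" and \<phi>: "bounded_linear_on Y \<phi>" and \<eta>: "0 < \<eta>"
  shows "\<exists>K. \<forall>K'\<ge>K. \<forall>y\<in>Y. (\<forall>i<K'. coef y i = 0) \<longrightarrow> \<bar>\<phi> y\<bar> \<le> \<eta> * norm y"
proof (rule ccontr)
  assume "\<not> ?thesis"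
  then have "\<forall>K. \<exists>K'\<ge>K. \<exists>y\<in>Y. (\<forall>i<K'. coef y i = 0) \<and> \<eta> * norm y < \<bar>\<phi> y\<bar>" by (simp add: not_le)
  then have neg: "\<exists>y\<in>Y. (\<forall>i<K. coef y i = 0) \<and> \<eta> * norm y < \<bar>\<phi> y\<bar>" for K by (meson less_le_trans)
  obtain C where C: "0 < C" "\<forall>u\<in>Y. norm (\<phi> u) \<le> C * norm u" using bounded_linear_onD(3)[OF \<phi>] by blast
  have unit: "\<exists>u\<in>Y. norm u = 1 \<and> (\<forall>i<K. coef u i = 0) \<and> \<eta> < \<phi> u" for K
  proof -
    obtain y where y: "y \<in> Y" "\<forall>i<K. coef y i = 0" "\<eta> * norm y < \<bar>\<phi> y\<bar>" using neg by blast
    have "y \<noteq> 0" using y(3) bounded_linear_on_zero[OF \<phi> Y(1)] by auto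
    then have ny: "0 < norm y" by simp
    define c where "c = sgn (\<phi> y) / norm y"
    have "0 \<le> \<eta> * norm y" using \<eta> by simp
    then have py: "\<phi> y \<noteq> 0" using y(3) by auto
    have "\<phi> (c *\<^sub>R y) = \<bar>\<phi> y\<bar> / norm y"
      using bounded_linear_onD(2)[OF \<phi> y(1), of c] by (simp add: c_def abs_sgn mult.commute)
    moreover have "\<eta> < \<bar>\<phi> y\<bar> / norm y" using y(3) ny by (simp add: pos_less_divide_eq)
    moreover have "norm (c *\<^sub>R y) = 1" using py ny by (simp add: c_def abs_sgn_eq)
    moreover have "c *\<^sub>R y \<in> Y" using y(1) Y(1) by (rule subspace_scale[rotated])
    moreover have "coef (c *\<^sub>R y) i = 0" if "i < K" for i using y(1,2) Y(2) that by (auto simp: coef_scale)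
    ultimately show ?thesis by (intro bexI[of _ "c *\<^sub>R y"]) auto
  qed
  define Pr where "Pr k = (\<lambda>(s, u, r). u \<in> Y \<and> norm u = 1 \<and> (\<forall>i<s. coef u i = 0) \<and> \<eta> < \<phi> u \<and> s \<le> r \<and>
    norm (u - proj {..r} u) \<le> (1/2) ^ Suc k)" for k
  have ex: "\<exists>u r. Pr k (K, u, r)" for k K
  proof -
    obtain u where u: "u \<in> Y" "norm u = 1" "\<forall>i<K. coef u i = 0" "\<eta> < \<phi> u" using unit by blast
    have "0 < (1/2::real) ^ Suc k" by simp
    then obtain R where "\<forall>N\<ge>R. norm (u - proj {..N} u) \<le> (1/2) ^ Suc k" using truncate u(1) Y(2) by blast
    then have "norm (u - proj {..max K R} u) \<le> (1/2) ^ Suc k" by simp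
    then show ?thesis using u unfolding Pr_def split_conv by (intro exI[of _ u] exI[of _ "max K R"]) simp
  qed
  have "\<exists>t. \<forall>k. Pr k (t k) \<and> snd (snd (t k)) < fst (t (Suc k))"
  proof (rule dependent_nat_choice)
    show "\<exists>t. Pr 0 t" using ex by blast
    fix t k
    obtain u r where "Pr (Suc k) (Suc (snd (snd t)), u, r)" using ex by blast
    then show "\<exists>t'. Pr (Suc k) t' \<and> snd (snd t) < fst t'" by (intro exI[of _ "(Suc (snd (snd t)), u, r)"]) simp
  qed
  then obtain t where t: "\<And>k. Pr k (t k)" "\<And>k. snd (snd (t k)) < fst (t (Suc k))" by blast
  define s where "s k = fst (t k)" for k
  define u where "u k = fst (snd (t k))" for k
  define r where "r k = snd (snd (t k))" for k
  have u: "u k \<in> Y" "norm (u k) = 1" "\<forall>i<s k. coef (u k) i = 0" "\<eta> < \<phi> (u k)" "s k \<le> r k"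
    "norm (u k - proj {..r k} (u k)) \<le> (1/2) ^ Suc k" for k
    using t(1)[of k] unfolding Pr_def s_def u_def r_def by (simp_all add: case_prod_beta)
  have rs: "r k < s (Suc k)" for k using t(2)[of k] by (simp add: s_def r_def)
  have bd: "disjoint_family_on (\<lambda>t. {s t..r t}) F" for F by (rule blocks_disjoint(1)[of s r]; rule u rs)
  define p where "p k = proj {..r k} (u k)" for k
  have uX: "u k \<in> X" for k using u(1) Y(2) by blast
  have pX: "p k \<in> X" for k unfolding p_def by (rule proj_X(1)[OF uX])
  have cp: "coef (p k) = (\<lambda>i. indicator {..r k} i * coef (u k) i)" for k unfolding p_def by (rule proj_X(2)[OF uX])
  have sp: "supp (coef (p k)) \<subseteq> {s k..r k}" for k
  proof
    fix i assume "i \<in> supp (coef (p k))"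
    then have "i \<le> r k" "coef (u k) i \<noteq> 0" unfolding cp by (auto simp: supp_def indicator_def split: if_splits)
    then show "i \<in> {s k..r k}" using u(3)[of k] by (metis atLeastAtMost_iff not_le)
  qed
  have np: "norm_le (coef (p k)) 1" for k
    using norm_le_iff[OF pX[of k], of 1] proj_norm[OF uX[of k], of "{..r k}"] u(2)[of k] by (simp add: p_def)
  have main: "real M * \<eta> \<le> 2 * C" if M: "1 \<le> M" for M
  proof -
    \<comment> \<open>A square number of vectors, so that the upper 2-estimate gives the norm
      \<open>M\<close> for their sum.\<close>
    let ?N = "M\<^sup>2"
    have N0: "0 < real ?N" using M by simp
    define y where "y = (\<Sum>k<?N. 1 *\<^sub>R u k)"
    define v where "v = (\<Sum>k<?N. 1 *\<^sub>R p k)"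
    have yY: "y \<in> Y" unfolding y_def using u(1) Y(1) by (auto intro!: subspace_sum subspace_scale)
    have vX: "v \<in> X" "coef v = (\<lambda>a. \<Sum>k<?N. 1 * coef (p k) a)"
      unfolding v_def using coef_sum[OF finite_lessThan[of ?N], of p "\<lambda>_. 1"] pX by auto
    have "norm_le (\<lambda>a. \<Sum>k<?N. sqrt (1 / real ?N) * coef (p k) a) 1"
      by (rule norm_le_sum[OF finite_lessThan bd sp np]) (use N0 in auto)
    from norm_le_scale[OF this, of "real M"]
    have "norm_le (\<lambda>a. real M * (\<Sum>k<?N. sqrt (1 / real ?N) * coef (p k) a)) (real M)" by simp
    moreover have "real M * (\<Sum>k<?N. sqrt (1 / real ?N) * coef (p k) a) = (\<Sum>k<?N. 1 * coef (p k) a)" for a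
      using M by (simp add: sum_distrib_left real_sqrt_divide)
    ultimately have "norm_le (coef v) (real M)" unfolding vX(2) by simp
    then have nv: "norm v \<le> real M" using norm_le_iff[OF vX(1)] by blast
    have "norm (y - v) \<le> 1"
    proof -
      have "y - v = (\<Sum>k<?N. u k - p k)" by (simp add: y_def v_def sum_subtractf)
      also have "norm ... \<le> (\<Sum>k<?N. norm (u k - p k))" by (rule norm_sum)
      also have "... \<le> (\<Sum>k<?N. (1/2) ^ Suc k)" by (rule sum_mono) (use u(6) in \<open>simp add: p_def\<close>)
      also have "... = 1/2 * (\<Sum>k<?N. (1/2) ^ k)" by (simp add: sum_distrib_left)
      also have "... = 1 - (1/2) ^ ?N" by (simp add: geometric_sum)
      also have "... \<le> 1" by simp
      finally show ?thesis .
    qed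
    then have ny: "norm y \<le> 2 * real M" using nv norm_triangle_sub[of y v] M by simp
    have "real ?N * \<eta> = (\<Sum>k<?N. \<eta>)" by simp
    also have "... \<le> (\<Sum>k<?N. 1 * \<phi> (u k))" by (rule sum_mono) (use u(4) in \<open>simp add: less_imp_le\<close>)
    also have "... = \<phi> y"
      unfolding y_def using bounded_linear_on_sum[OF \<phi> Y(1) finite_lessThan[of ?N], of u "\<lambda>_. 1"] u(1) by simp
    also have "... \<le> C * norm y" using C(2) yY by (metis abs_le_D1 real_norm_def)
    also have "... \<le> C * (2 * real M)" using C(1) ny by (intro mult_left_mono) auto
    finally have "real M * (real M * \<eta>) \<le> real M * (2 * C)" by (simp add: power2_eq_square mult_ac)
    then show ?thesis using M by simp
  qed
  obtain M :: nat where M: "2 * C / \<eta> < real M" using reals_Archimedean2 by blast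
  have "0 < 2 * C / \<eta>" using C(1) \<eta> by simp
  then have "0 < real M" using M by linarith
  then have "1 \<le> M" by simp
  from main[OF this] show False using M \<eta> by (simp add: pos_divide_less_eq)
qed

lemma square_bound_indicator:
  assumes "square_bound p w K" shows "square_bound p (\<lambda>k. indicator B k * w k) K"
  unfolding square_bound_def
proof (intro allI impI)
  fix A assume a: "allowable p A (\<lambda>f. f)"
  have "\<forall>f\<in>A. \<exists>g. D g \<and> supp g \<subseteq> supp f \<inter> B \<and> \<bar>pair f (\<lambda>k. indicator B k * w k)\<bar> \<le> pair g w"
    using D_restrict allowableD(2)[OF a] by blast
  from bchoice[OF this] obtain g where
    g: "\<forall>f\<in>A. D (g f) \<and> supp (g f) \<subseteq> supp f \<inter> B \<and> \<bar>pair f (\<lambda>k. indicator B k * w k)\<bar> \<le> pair (g f) w" ..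
  have "allowable p A g" by (rule allowable_shrink[OF a]) (use g in blast)+
  then have "(\<Sum>f\<in>A. (pair (g f) w)\<^sup>2) \<le> K" by (rule square_boundD[OF assms])
  moreover have "(\<Sum>f\<in>A. (pair f (\<lambda>k. indicator B k * w k))\<^sup>2) \<le> (\<Sum>f\<in>A. (pair (g f) w)\<^sup>2)"
    by (rule sum_mono) (use g in \<open>force simp: abs_le_square_iff[symmetric]\<close>)
  ultimately show "(\<Sum>f\<in>A. (pair f (\<lambda>k. indicator B k * w k))\<^sup>2) \<le> K" by linarith
qed

end

lemma bounded_linear_on_compose:
  assumes "bounded_linear_on U h" "h ` U \<subseteq> W" "bounded_linear_on W g"
  shows "bounded_linear_on U (\<lambda>u. g (h u))"
proof -
  obtain K where K: "0 < K" "\<forall>u\<in>U. norm (h u) \<le> K * norm u" using bounded_linear_onD(3)[OF assms(1)] by blast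
  obtain L where L: "0 < L" "\<forall>u\<in>W. norm (g u) \<le> L * norm u" using bounded_linear_onD(3)[OF assms(3)] by blast
  have hW: "h u \<in> W" if "u \<in> U" for u using assms(2) that by blast
  have "norm (g (h u)) \<le> (L * K) * norm u" if u: "u \<in> U" for u
  proof -
    have "norm (g (h u)) \<le> L * norm (h u)" using L(2) hW[OF u] by blast
    also have "... \<le> L * (K * norm u)" using L(1) K(2) u by (intro mult_left_mono) auto
    finally show ?thesis by (simp add: mult.assoc)
  qed
  moreover have "g (h (u + v)) = g (h u) + g (h v)" if "u \<in> U" "v \<in> U" for u v
    using bounded_linear_onD(1)[OF assms(1) that] bounded_linear_onD(1)[OF assms(3) hW[OF that(1)] hW[OF that(2)]] by simp
  moreover have "g (h (c *\<^sub>R u)) = c *\<^sub>R g (h u)" if "u \<in> U" for u c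
    using bounded_linear_onD(2)[OF assms(1) that] bounded_linear_onD(2)[OF assms(3) hW[OF that]] by simp
  ultimately show ?thesis unfolding bounded_linear_on_def by blast
qed

section \<open>The off-diagonal part of an operator\<close>

locale wh_sub = wh_banach m n N1 N2 \<sigma> e
  for m n N1 N2 \<sigma> and e :: "nat \<Rightarrow> 'x::banach" +
  fixes y :: "nat \<Rightarrow> 'x" and T :: "'x \<Rightarrow> 'x"
  assumes range_y: "range y \<subseteq> X_wh e" and disjoint_y: "disjoint_family (\<lambda>i. supp (coef (y i)))"
    and T: "T \<in> operators (closed_span (range y))"
begin

abbreviation Y :: "'x set" where "Y \<equiv> closed_span (range y)"

definition B :: "nat \<Rightarrow> nat set" where "B l = supp (coef (y l))"

abbreviation BL :: "nat set \<Rightarrow> nat set" where "BL L \<equiv> (\<Union>l\<in>L. B l)"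

lemma y_X: "y l \<in> X" using range_y by blast

lemma Y_X: "Y \<subseteq> X"
  unfolding closed_span_def by (intro closure_minimal span_minimal range_y subspace_X closed_X)

lemma subspace_Y: "subspace Y" by (rule subspace_closed_span)

lemma closed_Y: "closed Y" by (simp add: closed_span_def)

lemma span_Y: "span (range y) \<subseteq> Y" unfolding closed_span_def by (rule closure_subset)

lemma y_Y: "y l \<in> Y" using span_Y span_base[of "y l" "range y"] by blast

lemma Y_in_X: "u \<in> Y \<Longrightarrow> u \<in> X" using Y_X by blast

lemma T_Y: "u \<in> Y \<Longrightarrow> T u \<in> Y" and T_linear: "bounded_linear_on Y T"
  using T unfolding operators_def by auto

lemma B_unique: "k \<in> B l \<Longrightarrow> k \<in> B l' \<Longrightarrow> l = l'"
  using disjoint_y unfolding B_def disjoint_family_on_def by blast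

lemma proj_y: "proj (BL L) (y l) = (if l \<in> L then y l else 0)"
proof (rule coef_inject)
  show "proj (BL L) (y l) \<in> X" by (rule proj_X(1)[OF y_X])
  show "(if l \<in> L then y l else 0) \<in> X" using y_X X_0 by simp
  have "indicator (BL L) k * coef (y l) k = (if l \<in> L then coef (y l) k else 0)" for k
  proof (cases "k \<in> B l")
    case True
    then have "k \<in> BL L \<longleftrightarrow> l \<in> L" using B_unique by blast
    then show ?thesis by (simp add: indicator_def)
  next
    case False
    then show ?thesis by (simp add: B_def supp_def)
  qed
  then show "coef (proj (BL L) (y l)) = coef (if l \<in> L then y l else 0)"
    unfolding proj_X(2)[OF y_X] by (auto simp: coef_zero)
qed

lemma proj_Y: assumes "u \<in> Y" shows "proj (BL L) u \<in> Y"
  by (rule closed_span_map[OF proj_bounded_linear_on Y_X _ subspace_Y closed_Y assms])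
    (use y_Y subspace_0[OF subspace_Y] in \<open>auto simp: proj_y\<close>)

lemma coef_outside: assumes "u \<in> Y" "\<And>l. k \<notin> B l" shows "coef u k = 0"
proof -
  have "coef u k \<in> {0}"
    by (rule closed_span_map[OF coef_bounded_linear_on Y_X _ subspace_single_0 _ assms(1)])
      (use assms(2) in \<open>auto simp: B_def supp_def\<close>)
  then show ?thesis by simp
qed

text \<open>In this cross-multiplied form proportionality to \<open>y l\<close> on
  \<open>B l\<close> is linear in \<open>u\<close>, so it passes from the generators to the closed
  span.\<close>

lemma coef_proportional:
  assumes "u \<in> Y" "k \<in> B l" "k0 \<in> B l"
  shows "coef u k * coef (y l) k0 = coef u k0 * coef (y l) k"
proof -
  define a b where "a = coef (y l) k0" and "b = coef (y l) k"
  have lin: "bounded_linear_on X (\<lambda>u. coef u k * a - coef u k0 * b)"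
    unfolding bounded_linear_on_def
  proof (intro conjI ballI allI)
    fix u v c assume u: "u \<in> X"
    show "coef (c *\<^sub>R u) k * a - coef (c *\<^sub>R u) k0 * b = c *\<^sub>R (coef u k * a - coef u k0 * b)"
      using u by (simp add: coef_scale algebra_simps)
    assume v: "v \<in> X"
    show "coef (u + v) k * a - coef (u + v) k0 * b = coef u k * a - coef u k0 * b + (coef v k * a - coef v k0 * b)"
      using u v by (simp add: coef_add algebra_simps)
  next
    have "norm (coef u k * a - coef u k0 * b) \<le> (\<bar>a\<bar> + \<bar>b\<bar>) * norm u" if u: "u \<in> X" for u
    proof -
      have "\<bar>coef u k * a\<bar> \<le> norm u * \<bar>a\<bar>" "\<bar>coef u k0 * b\<bar> \<le> norm u * \<bar>b\<bar>"
        unfolding abs_mult by (intro mult_right_mono coef_le(1) u; simp)+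
      then show ?thesis by (simp add: algebra_simps abs_le_iff)
    qed
    then show "\<exists>K. \<forall>u\<in>X. norm (coef u k * a - coef u k0 * b) \<le> K * norm u" by blast
  qed
  have "coef u k * a - coef u k0 * b \<in> {0}"
  proof (rule closed_span_map[OF lin Y_X _ subspace_single_0 _ assms(1)])
    fix v assume "v \<in> range y"
    then obtain l' where v: "v = y l'" by blast
    show "coef v k * a - coef v k0 * b \<in> {0}"
    proof (cases "l' = l")
      case False
      then have "k \<notin> B l'" "k0 \<notin> B l'" using B_unique assms(2,3) by blast+
      then show ?thesis by (simp add: v B_def supp_def)
    qed (simp add: v a_def b_def)
  qed simp
  then show ?thesis by (simp add: a_def b_def)
qed

lemma proj_B: assumes "u \<in> Y" shows "\<exists>c. proj (B l) u = c *\<^sub>R y l"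
proof (cases "B l = {}")
  case True
  have "proj (B l) u = 0"
    by (rule coef_inject[OF proj_X(1)[OF Y_in_X[OF assms]] X_0]) (simp add: proj_X(2)[OF Y_in_X[OF assms]] True coef_zero)
  then show ?thesis by (intro exI[of _ 0]) simp
next
  case False
  then obtain k0 where k0: "k0 \<in> B l" by blast
  then have nz: "coef (y l) k0 \<noteq> 0" by (simp add: B_def supp_def)
  have "proj (B l) u = (coef u k0 / coef (y l) k0) *\<^sub>R y l"
  proof (rule coef_inject[OF proj_X(1)[OF Y_in_X[OF assms]] X_scale[OF y_X]])
    have "indicator (B l) k * coef u k = coef u k0 / coef (y l) k0 * coef (y l) k" for k
    proof (cases "k \<in> B l")
      case True
      then show ?thesis using coef_proportional[OF assms True k0] nz by (simp add: field_simps)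
    qed (simp add: B_def supp_def)
    then show "coef (proj (B l) u) = coef ((coef u k0 / coef (y l) k0) *\<^sub>R y l)"
      unfolding proj_X(2)[OF Y_in_X[OF assms]] coef_scale[OF y_X] by blast
  qed
  then show ?thesis by blast
qed

text \<open>For \<open>y l = 0\<close> every scalar satisfies the defining equation; the value 0
  keeps the sequence bounded.\<close>

definition diag :: "nat \<Rightarrow> real" where
  "diag l = (if y l = 0 then 0 else SOME t. proj (B l) (T (y l)) = t *\<^sub>R y l)"

lemma diag: "proj (B l) (T (y l)) = diag l *\<^sub>R y l"
proof (cases "y l = 0")
  case True
  have "T (y l) = 0" unfolding True by (rule bounded_linear_on_zero[OF T_linear subspace_Y])
  then have "proj (B l) (T (y l)) = 0" using proj_norm[OF X_0, of "B l"] by simp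
  then show ?thesis by (simp add: True)
next
  case False
  then show ?thesis using someI_ex[OF proj_B[OF T_Y[OF y_Y], of l l]] by (simp add: diag_def)
qed

lemma diag_bounded: "\<exists>K>0. \<forall>l. \<bar>diag l\<bar> \<le> K"
proof -
  obtain K where K: "0 < K" "\<forall>u\<in>Y. norm (T u) \<le> K * norm u" using bounded_linear_onD(3)[OF T_linear] by blast
  have "\<bar>diag l\<bar> \<le> K" for l
  proof (cases "y l = 0")
    case True then show ?thesis using K(1) by (simp add: diag_def)
  next
    case False
    have "\<bar>diag l\<bar> * norm (y l) = norm (proj (B l) (T (y l)))" by (simp add: diag)
    also have "... \<le> norm (T (y l))" by (rule proj_norm[OF Y_in_X[OF T_Y[OF y_Y]]])
    also have "... \<le> K * norm (y l)" using K(2) y_Y by blast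
    finally show ?thesis using False by simp
  qed
  then show ?thesis using K(1) by blast
qed

definition mu :: "nat \<Rightarrow> real" where
  "mu k = (if \<exists>l. k \<in> B l then diag (THE l. k \<in> B l) else 0)"

lemma mu_eq: assumes "k \<in> B l" shows "mu k = diag l"
proof -
  have "(THE l. k \<in> B l) = l" using assms B_unique by (intro the_equality) auto
  then show ?thesis using assms by (auto simp: mu_def)
qed

lemma mu_bounded: "\<exists>K>0. \<forall>k. \<bar>mu k\<bar> \<le> K"
proof -
  obtain K where "0 < K" "\<forall>l. \<bar>diag l\<bar> \<le> K" using diag_bounded by blast
  then show ?thesis by (intro exI[of _ K]) (auto simp: mu_def)
qed

lemma mul_mu_linear: "bounded_linear_on X (mul mu)"
proof -
  obtain K where "0 < K" "\<forall>k. \<bar>mu k\<bar> \<le> K" using mu_bounded by blast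
  then show ?thesis by (intro mul_bounded_linear_on[of mu K]) auto
qed

lemma mul_mu_X: "u \<in> X \<Longrightarrow> mul mu u \<in> X" "u \<in> X \<Longrightarrow> coef (mul mu u) = (\<lambda>k. mu k * coef u k)"
proof -
  obtain K where "0 < K" "\<forall>k. \<bar>mu k\<bar> \<le> K" using mu_bounded by blast
  then show "u \<in> X \<Longrightarrow> mul mu u \<in> X" "u \<in> X \<Longrightarrow> coef (mul mu u) = (\<lambda>k. mu k * coef u k)"
    using mul_X[of u mu K] by blast+
qed

lemma mul_mu_diagonal: "mul mu \<in> diagonal_operators e"
proof -
  have "mul mu (e k) = mu k *\<^sub>R e k" if "1 \<le> k" for k
    by (rule coef_inject)
      (use that in \<open>auto simp: mul_mu_X coef_e X_scale coef_scale\<close>)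
  then show ?thesis
    using mul_mu_linear mul_mu_X(1) unfolding diagonal_operators_def operators_def by blast
qed

lemma mul_mu_y: "mul mu (y l) = diag l *\<^sub>R y l"
proof (rule coef_inject[OF mul_mu_X(1)[OF y_X] X_scale[OF y_X]])
  have "mu k * coef (y l) k = diag l * coef (y l) k" for k
    by (cases "k \<in> B l") (simp add: mu_eq, simp add: B_def supp_def)
  then show "coef (mul mu (y l)) = coef (diag l *\<^sub>R y l)"
    unfolding mul_mu_X(2)[OF y_X] coef_scale[OF y_X] by blast
qed

lemma mul_mu_Y: assumes "u \<in> Y" shows "mul mu u \<in> Y"
  by (rule closed_span_map[OF mul_mu_linear Y_X _ subspace_Y closed_Y assms])
    (use y_Y subspace_scale[OF subspace_Y] in \<open>auto simp: mul_mu_y\<close>)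

definition U :: "'x \<Rightarrow> 'x" where "U u = T u - mul mu u"

lemma U_Y: "u \<in> Y \<Longrightarrow> U u \<in> Y"
  unfolding U_def by (intro subspace_diff[OF subspace_Y] T_Y mul_mu_Y)

lemma U_linear: "bounded_linear_on Y U"
proof -
  obtain K where K: "0 < K" "\<forall>u\<in>Y. norm (T u) \<le> K * norm u" using bounded_linear_onD(3)[OF T_linear] by blast
  obtain L where L: "0 < L" "\<forall>u\<in>X. norm (mul mu u) \<le> L * norm u" using bounded_linear_onD(3)[OF mul_mu_linear] by blast
  have "norm (U u) \<le> (K + L) * norm u" if u: "u \<in> Y" for u
  proof -
    have "norm (T u) \<le> K * norm u" "norm (mul mu u) \<le> L * norm u" using K(2) L(2) u Y_in_X[OF u] by blast+
    then show ?thesis using norm_triangle_ineq4[of "T u" "mul mu u"] by (simp add: U_def distrib_right)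
  qed
  moreover have "U (u + v) = U u + U v" if "u \<in> Y" "v \<in> Y" for u v
    using bounded_linear_onD(1)[OF T_linear that] bounded_linear_onD(1)[OF mul_mu_linear Y_in_X[OF that(1)] Y_in_X[OF that(2)]]
    by (simp add: U_def)
  moreover have "U (c *\<^sub>R u) = c *\<^sub>R U u" if "u \<in> Y" for u c
    using bounded_linear_onD(2)[OF T_linear that] bounded_linear_onD(2)[OF mul_mu_linear Y_in_X[OF that]]
    by (simp add: U_def scaleR_diff_right)
  ultimately show ?thesis unfolding bounded_linear_on_def by blast
qed

lemma U_operator: "U \<in> operators Y" unfolding operators_def using U_Y U_linear by blast

lemma U_X: "u \<in> Y \<Longrightarrow> U u \<in> X" by (rule Y_in_X[OF U_Y])

lemma proj_B_Y: "u \<in> Y \<Longrightarrow> proj (B l) u \<in> Y" using proj_Y[of u "{l}"] by simp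

lemma U_diagonal: assumes "z \<in> Y" shows "proj (B l) (U (proj (B l) z)) = 0"
proof -
  obtain c where c: "proj (B l) z = c *\<^sub>R y l" using proj_B[OF assms] by blast
  have "proj (B l) (y l) = y l" using proj_y[of "{l}" l] by simp
  then have "proj (B l) (U (y l)) = 0"
    unfolding U_def using proj_diff[OF Y_in_X[OF T_Y[OF y_Y[of l]]] X_scale[OF y_X[of l], of "diag l"], of "B l"]
    by (simp add: diag mul_mu_y proj_scale[OF y_X])
  then show ?thesis
    unfolding c bounded_linear_onD(2)[OF U_linear y_Y] by (simp add: proj_scale[OF U_X[OF y_Y]])
qed

text \<open>The conclusion allows any larger set of blocks, because blocks that meet a given
  functional will be added.\<close>

lemma span_finite_projection:
  assumes "v \<in> span (range y)" shows "\<exists>G. finite G \<and> (\<forall>H. G \<subseteq> H \<longrightarrow> proj (BL H) v = v)"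
proof -
  have "v \<in> X \<and> (\<exists>G. finite G \<and> (\<forall>H. G \<subseteq> H \<longrightarrow> proj (BL H) v = v))"
    using assms
  proof (induction rule: span_induct_alt)
    case base
    have "proj A 0 = 0" for A using proj_norm[OF X_0, of A] by simp
    then show ?case using X_0 by blast
  next
    case (step c a v)
    then obtain l G where l: "a = y l" "finite G" "\<forall>H. G \<subseteq> H \<longrightarrow> proj (BL H) v = v" "v \<in> X" by blast
    have "proj (BL H) (c *\<^sub>R a + v) = c *\<^sub>R a + v" if "insert l G \<subseteq> H" for H
      using proj_add[OF X_scale[OF y_X[of l], of c] l(4), of "BL H"] proj_scale[OF y_X[of l], of "BL H" c] proj_y[of H l] l that
      by simp
    then show ?case using l X_add X_scale y_X by (meson finite_insert)
  qed
  then show ?thesis ..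
qed

text \<open>For finitely many blocks let \<open>\<psi> i l\<close> be the value of \<open>f\<close>,
  cut to \<open>B i\<close>, on the image under \<open>U\<close> of the component of
  \<open>z\<close> in \<open>B l\<close>. The diagonal of \<open>\<psi>\<close> vanishes, so by
  \<open>max_cut\<close> some \<open>A\<close> keeps a quarter of the total when rows outside
  \<open>A\<close> meet columns inside. Cutting \<open>f\<close> to the blocks outside
  \<open>A\<close> gives \<open>g\<close>.\<close>

lemma off_diagonal:
  assumes z: "z \<in> Y" and f: "D f" and c: "c < pair f (coef (U z))"
  shows "\<exists>A g. D g \<and> supp g \<inter> BL A = {} \<and> c / 4 \<le> pair g (coef (U (proj (BL A) z)))"
proof -
  obtain K where K: "0 < K" "\<forall>u\<in>Y. norm (U u) \<le> K * norm u" using bounded_linear_onD(3)[OF U_linear] by blast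
  \<comment> \<open>Passing from \<open>z\<close> to finitely many of its blocks costs less than
    \<open>2 * K * \<epsilon>\<close>, which is exactly the slack above \<open>c\<close>.\<close>
  define \<epsilon> where "\<epsilon> = (pair f (coef (U z)) - c) / (2 * K)"
  have \<epsilon>: "0 < \<epsilon>" using c K(1) by (simp add: \<epsilon>_def)
  obtain v where v: "v \<in> span (range y)" "dist v z < \<epsilon>"
    using z \<epsilon> unfolding closed_span_def closure_approachable by blast
  obtain G0 where G0: "finite G0" "\<And>H. G0 \<subseteq> H \<Longrightarrow> proj (BL H) v = v" using span_finite_projection[OF v(1)] by blast
  \<comment> \<open>Including the blocks that meet \<open>supp f\<close> ensures that
    \<open>f\<close> loses nothing when it is cut to the blocks of \<open>G\<close>: outside all
    blocks the members of \<open>Y\<close> vanish.\<close>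
  define G where "G = G0 \<union> (\<Union>k\<in>supp f. {l. k \<in> B l})"
  have "finite {l. k \<in> B l}" for k
    by (rule finite_subset[of _ "{THE l. k \<in> B l}"]) (use B_unique in \<open>auto intro!: the_equality[symmetric]\<close>)
  then have G: "finite G" using G0(1) D_finite[OF f] by (simp add: G_def)
  have zX: "z \<in> X" "v \<in> X" using z v(1) span_Y Y_X by blast+
  have "norm (z - proj (BL G) z) \<le> 2 * norm (v - z)"
  proof -
    have "proj (BL G) v = v" by (rule G0(2)) (simp add: G_def)
    then have "z - proj (BL G) z = proj (BL G) (v - z) - (v - z)" by (simp add: proj_diff[OF zX(2,1)])
    then have "norm (z - proj (BL G) z) \<le> norm (proj (BL G) (v - z)) + norm (v - z)"
      using norm_triangle_ineq4[of "proj (BL G) (v - z)" "v - z"] by (simp only:)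
    then show ?thesis using proj_norm[OF X_diff[OF zX(2,1)], of "BL G"] by linarith
  qed
  then have nz: "norm (z - proj (BL G) z) < 2 * \<epsilon>" using v(2) by (simp add: dist_norm)
  have zG: "proj (BL G) z \<in> Y" by (rule proj_Y[OF z])
  have "pair f (coef (U z)) - pair f (coef (U (proj (BL G) z))) \<le> K * norm (z - proj (BL G) z)"
  proof -
    have dY: "z - proj (BL G) z \<in> Y" by (rule subspace_diff[OF subspace_Y z zG])
    have "pair f (coef (U z)) - pair f (coef (U (proj (BL G) z))) = pair f (coef (U (z - proj (BL G) z)))"
      unfolding bounded_linear_on_diff[OF U_linear subspace_Y z zG] coef_diff[OF U_X[OF z] U_X[OF zG]] pair_diff ..
    also have "... \<le> norm (U (z - proj (BL G) z))" using pair_coef_le[OF f U_X[OF dY]] by linarith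
    also have "... \<le> K * norm (z - proj (BL G) z)" using K(2) dY by blast
    finally show ?thesis .
  qed
  also have "... < K * (2 * \<epsilon>)" using nz K(1) by simp
  also have "... = pair f (coef (U z)) - c" using K(1) by (simp add: \<epsilon>_def)
  finally have cG: "c < pair f (coef (U (proj (BL G) z)))" by simp
  define \<psi> where "\<psi> i l = pair f (\<lambda>k. indicator (B i) k * coef (U (proj (B l) z)) k)" for i l
  have BY: "proj (B l) z \<in> Y" for l by (rule proj_B_Y[OF z])
  have expand: "(\<Sum>i\<in>I. \<Sum>l\<in>A. \<psi> i l) = pair f (\<lambda>k. indicator (BL I) k * coef (U (proj (BL A) z)) k)"
    if IA: "finite I" "finite A" for I A :: "nat set"
  proof -
    have ind: "indicator (BL I) k = (\<Sum>i\<in>I. indicator (B i) k :: real)" if "finite I" for I k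
      by (rule indicator_UN_disjoint[OF that]) (use B_unique in \<open>auto simp: disjoint_family_on_def\<close>)
    have "proj (BL A) z = (\<Sum>l\<in>A. 1 *\<^sub>R proj (B l) z)"
    proof (rule coef_inject)
      show "proj (BL A) z \<in> X" by (rule proj_X(1)[OF zX(1)])
      have s: "(\<Sum>l\<in>A. 1 *\<^sub>R proj (B l) z) \<in> X \<and> coef (\<Sum>l\<in>A. 1 *\<^sub>R proj (B l) z) = (\<lambda>k. \<Sum>l\<in>A. 1 * coef (proj (B l) z) k)"
        by (rule coef_sum[OF IA(2) proj_X(1)[OF zX(1)]])
      then show "(\<Sum>l\<in>A. 1 *\<^sub>R proj (B l) z) \<in> X" ..
      show "coef (proj (BL A) z) = coef (\<Sum>l\<in>A. 1 *\<^sub>R proj (B l) z)"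
        unfolding conjunct2[OF s] proj_X(2)[OF zX(1)] ind[OF IA(2)] by (simp add: sum_distrib_right)
    qed
    then have "U (proj (BL A) z) = (\<Sum>l\<in>A. 1 *\<^sub>R U (proj (B l) z))"
      using bounded_linear_on_sum[OF U_linear subspace_Y IA(2), of "\<lambda>l. proj (B l) z" "\<lambda>_. 1"] BY by simp
    then have cU: "coef (U (proj (BL A) z)) k = (\<Sum>l\<in>A. 1 * coef (U (proj (B l) z)) k)" for k
      using coef_sum[OF IA(2), of "\<lambda>l. U (proj (B l) z)" "\<lambda>_. 1"] U_X[OF BY] by simp
    have "(\<Sum>i\<in>I. \<Sum>l\<in>A. \<psi> i l) = (\<Sum>i\<in>I. 1 * pair f (\<lambda>k. \<Sum>l\<in>A. 1 * (indicator (B i) k * coef (U (proj (B l) z)) k)))"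
      unfolding pair_sum \<psi>_def by simp
    also have "... = pair f (\<lambda>k. \<Sum>i\<in>I. 1 * (\<Sum>l\<in>A. 1 * (indicator (B i) k * coef (U (proj (B l) z)) k)))"
      by (rule pair_sum[symmetric])
    finally show ?thesis unfolding cU ind[OF IA(1)] by (simp only: sum_product mult_1)
  qed
  have "\<psi> i i = 0" for i
  proof -
    have "(\<lambda>k. indicator (B i) k * coef (U (proj (B i) z)) k) = coef (proj (B i) (U (proj (B i) z)))"
      by (rule proj_X(2)[OF U_X[OF BY], symmetric])
    then show ?thesis unfolding \<psi>_def U_diagonal[OF z] coef_zero by (simp add: pair_def)
  qed
  then obtain A where A: "A \<subseteq> G" "(\<Sum>i\<in>G. \<Sum>l\<in>G. \<psi> i l) / 4 \<le> (\<Sum>i\<in>G - A. \<Sum>l\<in>A. \<psi> i l)"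
    using max_cut[OF G, of \<psi>] by blast
  have "pair f (\<lambda>k. indicator (BL G) k * coef (U (proj (BL G) z)) k) = pair f (coef (U (proj (BL G) z)))"
  proof (rule pair_cong)
    fix k assume k: "k \<in> supp f"
    show "indicator (BL G) k * coef (U (proj (BL G) z)) k = coef (U (proj (BL G) z)) k"
    proof (cases "\<exists>l. k \<in> B l")
      case True
      then have "k \<in> BL G" using k by (auto simp: G_def)
      then show ?thesis by simp
    next
      case False
      then have "coef (U (proj (BL G) z)) k = 0" by (intro coef_outside[OF U_Y[OF zG]]) blast
      then show ?thesis by simp
    qed
  qed
  then have "c / 4 \<le> pair f (\<lambda>k. indicator (BL (G - A)) k * coef (U (proj (BL A) z)) k)"
    using A(2) cG expand[OF G G] expand[of "G - A" A] G finite_subset[OF A(1) G] by simp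
  moreover obtain g where g: "D g" "supp g \<subseteq> supp f \<inter> BL (G - A)"
    "\<bar>pair f (\<lambda>k. indicator (BL (G - A)) k * coef (U (proj (BL A) z)) k)\<bar> \<le> pair g (coef (U (proj (BL A) z)))"
    using D_restrict[OF f] by blast
  moreover have "BL (G - A) \<inter> BL A = {}" using B_unique by blast
  ultimately show ?thesis by (intro exI[of _ A] exI[of _ g]) auto
qed

end

text \<open>Each term may depend on all earlier ones, which matters because the cross terms with
  every earlier index have to be controlled.\<close>

lemma history_choice:
  assumes "\<And>L. \<exists>\<tau>. P L \<tau>"
  shows "\<exists>F. \<forall>t. P (map F [0..<t]) (F t)"
proof -
  define hist where "hist = rec_nat [] (\<lambda>_ L. L @ [SOME \<tau>. P L \<tau>])"
  define F where "F t = (SOME \<tau>. P (hist t) \<tau>)" for t :: nat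
  have h: "hist t = map F [0..<t]" for t
    by (induction t) (simp_all add: hist_def F_def)
  have "P (map F [0..<t]) (F t)" for t
    unfolding h[symmetric] F_def by (rule someI_ex[OF assms])
  then show ?thesis by blast
qed

context wh_space
begin

lemma norm_le_add: "norm_le x a \<Longrightarrow> norm_le z b \<Longrightarrow> norm_le (\<lambda>k. x k + z k) (a + b)"
  unfolding norm_le_def pair_add by (meson abs_triangle_ineq add_mono order_trans)

lemma norm_le_diff: "norm_le x a \<Longrightarrow> norm_le z b \<Longrightarrow> norm_le (\<lambda>k. x k - z k) (a + b)"
  unfolding norm_le_def pair_diff by (meson abs_triangle_ineq4 add_mono order_trans)

end

context wh_sub
begin

section \<open>Construction of the block sequence\<close>

lemma U_pair_linear: assumes "D f" shows "bounded_linear_on Y (\<lambda>u. pair f (coef (U u)))"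
proof (rule bounded_linear_on_compose[OF U_linear])
  show "U ` Y \<subseteq> X" using U_X by blast
  have "\<forall>u\<in>X. norm (pair f (coef u)) \<le> 1 * norm u" using pair_coef_le[OF assms] by simp
  then have "\<exists>K. \<forall>u\<in>X. norm (pair f (coef u)) \<le> K * norm u" by blast
  then show "bounded_linear_on X (\<lambda>u. pair f (coef u))"
    unfolding bounded_linear_on_def by (simp add: coef_add coef_scale pair_add pair_scale)
qed

lemma U_coef_linear: "bounded_linear_on Y (\<lambda>u. coef (U u) i)"
  by (rule bounded_linear_on_compose[OF U_linear _ coef_bounded_linear_on]) (use U_X in blast)

text \<open>The smallness conditions decide how late the block begins. Functionals beyond
  \<open>K1\<close> hardly see the images \<open>U u\<close> of the earlier vectors. A vector beyond
  \<open>K2\<close> has, by \<open>shrinking\<close>, an image that the earlier functionals hardly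
  see and whose coordinates below \<open>K1\<close> are tiny, so cutting the new functional to
  \<open>{K1..}\<close> costs little.\<close>

lemma next_block:
  assumes Z: "subspace Z" "Z \<subseteq> Y" "infinite_dimensional Z" and \<delta>: "0 < \<delta>" "\<And>z. z \<in> Z \<Longrightarrow> \<delta> * norm z \<le> norm (U z)"
    and Fs: "finite Fs" "\<And>f. f \<in> Fs \<Longrightarrow> D f" and Xs: "finite Xs" "Xs \<subseteq> Y" and j: "2 \<le> j" and \<epsilon>: "0 < \<epsilon>"
  shows "\<exists>s r x x' g. K0 \<le> s \<and> 1 \<le> s \<and> s \<le> r \<and> x' \<in> Y \<and> supp x \<subseteq> {s..r} \<and> supp g \<subseteq> {s..r} \<and> supp g \<noteq> {} \<and>
    D g \<and> supp g \<inter> supp x = {} \<and> square_bound (n (2 * j - 1) - 1) x 5 \<and> norm_le (\<lambda>k. coef x' k - x k) \<epsilon> \<and>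
    \<delta> / 64 \<le> pair g (coef (U x')) \<and> (\<forall>u\<in>Xs. \<bar>pair g (coef (U u))\<bar> \<le> \<epsilon>) \<and> (\<forall>f\<in>Fs. \<bar>pair f (coef (U x'))\<bar> \<le> \<epsilon>)"
proof -
  have "\<forall>u\<in>Xs. \<exists>N0. \<forall>N\<ge>N0. norm (U u - proj {..N} (U u)) \<le> \<epsilon>"
    using truncate[OF U_X \<epsilon>] Xs(2) by blast
  from bchoice[OF this] obtain N0 where N0: "\<forall>u\<in>Xs. \<forall>N\<ge>N0 u. norm (U u - proj {..N} (U u)) \<le> \<epsilon>" ..
  define K1 where "K1 = 1 + K0 + (\<Sum>u\<in>Xs. N0 u)"
  have tail: "\<bar>pair g (coef (U u))\<bar> \<le> \<epsilon>" if g: "D g" "supp g \<subseteq> {K1..}" and u: "u \<in> Xs" for g u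
  proof -
    have uX: "U u \<in> X" using u Xs(2) U_X by blast
    have "N0 u \<le> K1 - 1" using member_le_sum[OF u, of N0] Xs(1) by (simp add: K1_def)
    then have "norm (U u - proj {..K1 - 1} (U u)) \<le> \<epsilon>" using N0 u by blast
    moreover have "pair g (coef (U u - proj {..K1 - 1} (U u))) = pair g (coef (U u))"
      unfolding coef_diff[OF uX proj_X(1)[OF uX]] proj_X(2)[OF uX]
    proof (rule pair_cong)
      fix k assume "k \<in> supp g"
      then have "K1 \<le> k" using g(2) by auto
      then have "k \<notin> {..K1 - 1}" by (auto simp: K1_def)
      then show "coef (U u) k - indicator {..K1 - 1} k * coef (U u) k = coef (U u) k" by simp
    qed
    ultimately show ?thesis using pair_coef_le[OF g(1) X_diff[OF uX proj_X(1)[OF uX]], of "{..K1 - 1}"] by linarith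
  qed
  \<comment> \<open>\<open>K1\<close> coordinates of modulus at most \<open>2 * \<epsilon>2\<close>,
    since \<open>x'\<close> will have norm at most 2, add up to at most
    \<open>\<delta> / 64\<close>. The summand 1 keeps the denominator positive in any case.\<close>
  define \<epsilon>2 where "\<epsilon>2 = \<delta> / (128 * (real K1 + 1))"
  have \<epsilon>2: "0 < \<epsilon>2" using \<delta>(1) by (simp add: \<epsilon>2_def)
  have "\<forall>f\<in>Fs. \<exists>K. \<forall>K'\<ge>K. \<forall>u\<in>Y. (\<forall>i<K'. coef u i = 0) \<longrightarrow> \<bar>pair f (coef (U u))\<bar> \<le> \<epsilon> / 2 * norm u"
    using shrinking[OF subspace_Y Y_X U_pair_linear[OF Fs(2)], of _ "\<epsilon> / 2"] \<epsilon> by simp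
  from bchoice[OF this] obtain Ka where
    Ka: "\<forall>f\<in>Fs. \<forall>K'\<ge>Ka f. \<forall>u\<in>Y. (\<forall>i<K'. coef u i = 0) \<longrightarrow> \<bar>pair f (coef (U u))\<bar> \<le> \<epsilon> / 2 * norm u" ..
  have "\<forall>i. \<exists>K. \<forall>K'\<ge>K. \<forall>u\<in>Y. (\<forall>i<K'. coef u i = 0) \<longrightarrow> \<bar>coef (U u) i\<bar> \<le> \<epsilon>2 * norm u"
    using shrinking[OF subspace_Y Y_X U_coef_linear \<epsilon>2] by blast
  from choice[OF this] obtain Kb where
    Kb: "\<forall>i. \<forall>K'\<ge>Kb i. \<forall>u\<in>Y. (\<forall>i<K'. coef u i = 0) \<longrightarrow> \<bar>coef (U u) i\<bar> \<le> \<epsilon>2 * norm u" ..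
  define K2 where "K2 = K1 + (\<Sum>f\<in>Fs. Ka f) + (\<Sum>i<K1. Kb i)"
  have K2a: "Ka f \<le> K2" if "f \<in> Fs" for f using member_le_sum[OF that, of Ka] Fs(1) by (simp add: K2_def)
  have K2b: "Kb i \<le> K2" if "i < K1" for i using member_le_sum[of i "{..<K1}" Kb] that by (simp add: K2_def)
  define Z' where "Z' = {z\<in>Z. \<forall>i<K2. coef z i = 0}"
  have ZX: "Z \<subseteq> X" using Z(2) Y_X by blast
  have Z': "subspace Z'" "Z' \<subseteq> X" "infinite_dimensional Z'"
  proof -
    show "subspace Z'"
      unfolding subspace_def Z'_def
      using Z(1) ZX by (auto simp: subspace_0 subspace_add subspace_scale coef_zero coef_add coef_scale subset_iff)
    show "Z' \<subseteq> X" using ZX by (auto simp: Z'_def)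
    show "infinite_dimensional Z'" unfolding Z'_def by (rule tail_infinite_dimensional[OF Z(1) ZX Z(3)])
  qed
  \<comment> \<open>The bound 1/4 keeps \<open>z\<close> away from 0, as the norm of its
    approximation \<open>w\<close> exceeds 1/2.\<close>
  have "0 < min \<epsilon> (1/4)" using \<epsilon> by simp
  from normalized_averages[OF Z' j this, of K2] obtain z w r0 where
    z: "z \<in> Z'" "supp w \<subseteq> {K2..r0}" "norm_le (\<lambda>k. coef z k - w k) (min \<epsilon> (1/4))" "norm_le w 1"
    "\<not> norm_le w (1/2)" "square_bound (n (2 * j - 1) - 1) w 5" by blast
  have zZ: "z \<in> Z" "z \<in> Y" "z \<in> X" and z0: "\<And>i. i < K2 \<Longrightarrow> coef z i = 0" using z(1) Z(2) ZX by (auto simp: Z'_def)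
  have "norm_le (coef z) 2"
    using norm_le_mono[OF norm_le_add[OF z(3,4)], of 2] by simp
  then have z2: "norm z \<le> 2" using norm_le_iff[OF zZ(3)] by blast
  have z4: "1/4 < norm z"
  proof (rule ccontr)
    assume "\<not> 1/4 < norm z"
    then have "norm_le (coef z) (1/4)" using norm_le_iff[OF zZ(3), of "1/4"] by linarith
    moreover have "1/4 + min \<epsilon> (1/4) \<le> 1/2" using min.cobounded2[of \<epsilon> "1/4"] by linarith
    ultimately show False using norm_le_mono[OF norm_le_diff[OF _ z(3)]] z(5) by fastforce
  qed
  \<comment> \<open>The chain of constants: the image of \<open>z\<close> has norm above
    \<open>\<delta> / 8\<close>, the cut keeps a quarter, \<open>\<delta> / 32\<close>, and
    restriction to \<open>{K1..}\<close> loses at most half of that.\<close>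
  have "\<delta> * (1/4) < \<delta> * norm z" using \<delta>(1) z4 by (intro mult_strict_left_mono)
  then have "\<delta> / 8 < norm (U z)" using \<delta>(2)[OF zZ(1)] \<delta>(1) by linarith
  then have "\<not> norm_le (coef (U z)) (\<delta> / 8)" using norm_le_iff[OF U_X[OF zZ(2)], of "\<delta> / 8"] by linarith
  then obtain f0 where "D f0" "\<delta> / 8 < pair f0 (coef (U z))" using not_norm_le by blast
  from off_diagonal[OF zZ(2) this] obtain A f1 where
    f1: "D f1" "supp f1 \<inter> BL A = {}" "\<delta> / 32 \<le> pair f1 (coef (U (proj (BL A) z)))" by auto
  define x' where "x' = proj (BL A) z"
  define x where "x k = indicator (BL A) k * w k" for k
  have x'Y: "x' \<in> Y" unfolding x'_def by (rule proj_Y[OF zZ(2)])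
  have cx': "coef x' = (\<lambda>k. indicator (BL A) k * coef z k)" unfolding x'_def by (rule proj_X(2)[OF zZ(3)])
  have x'0: "\<forall>i<K2. coef x' i = 0" using z0 by (simp add: cx')
  have x'2: "norm x' \<le> 2" unfolding x'_def using proj_norm[OF zZ(3), of "BL A"] z2 by linarith
  have small: "\<bar>coef (U x') i\<bar> \<le> \<epsilon>2 * 2" if "i < K1" for i
  proof -
    have "\<bar>coef (U x') i\<bar> \<le> \<epsilon>2 * norm x'" using Kb K2b[OF that] x'Y x'0 by blast
    also have "... \<le> \<epsilon>2 * 2" using x'2 \<epsilon>2 by (intro mult_left_mono) auto
    finally show ?thesis .
  qed
  obtain g where g: "D g" "supp g \<subseteq> supp f1 \<inter> {K1..}"
    "\<bar>pair f1 (\<lambda>k. indicator {K1..} k * coef (U x') k)\<bar> \<le> pair g (coef (U x'))"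
    using D_restrict[OF f1(1)] by blast
  have "\<bar>pair f1 (\<lambda>k. \<Sum>i<K1. coef (U x') i * (if k = i then 1 else 0))\<bar> \<le> (\<Sum>i<K1. \<epsilon>2 * 2)"
  proof -
    have u: "pair f1 (\<lambda>k. if k = i then 1 else 0) = f1 i" for i
      unfolding pair_def using D_finite[OF f1(1)] by (auto simp: sum.delta if_distrib[of "\<lambda>x. _ * x"] supp_def cong: if_cong)
    have "\<bar>\<Sum>i<K1. coef (U x') i * f1 i\<bar> \<le> (\<Sum>i<K1. \<bar>coef (U x') i * f1 i\<bar>)" by (rule sum_abs)
    also have "... \<le> (\<Sum>i<K1. \<epsilon>2 * 2)"
    proof (rule sum_mono)
      fix i assume "i \<in> {..<K1}"
      then have "\<bar>coef (U x') i\<bar> * \<bar>f1 i\<bar> \<le> (\<epsilon>2 * 2) * 1"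
        using small[of i] D_bounded[OF f1(1), of i] \<epsilon>2 by (intro mult_mono) auto
      then show "\<bar>coef (U x') i * f1 i\<bar> \<le> \<epsilon>2 * 2" by (simp add: abs_mult)
    qed
    finally show ?thesis unfolding pair_sum u .
  qed
  also have "(\<Sum>i<K1. \<epsilon>2 * 2) \<le> \<delta> / 64"
    using \<delta>(1) by (simp add: \<epsilon>2_def field_simps)
  finally have head: "\<bar>pair f1 (\<lambda>k. \<Sum>i<K1. coef (U x') i * (if k = i then 1 else 0))\<bar> \<le> \<delta> / 64" .
  have "coef (U x') k = indicator {K1..} k * coef (U x') k + (\<Sum>i<K1. coef (U x') i * (if k = i then 1 else 0))" for k
    by (auto simp: indicator_def if_distrib[of "\<lambda>x. _ * x"] sum.delta' not_le cong: if_cong)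
  then have "pair f1 (coef (U x')) = pair f1 (\<lambda>k. indicator {K1..} k * coef (U x') k + (\<Sum>i<K1. coef (U x') i * (if k = i then 1 else 0)))"
    by (intro pair_cong)
  then have gU: "\<delta> / 64 \<le> pair g (coef (U x'))"
    unfolding pair_add using f1(3)[folded x'_def] g(3) head by linarith
  have gne: "supp g \<noteq> {}"
  proof
    assume "supp g = {}"
    then have "pair g (coef (U x')) = 0" by (simp add: pair_def)
    then show False using gU \<delta>(1) by simp
  qed
  define r where "r = max r0 (Max (supp g))"
  have gr: "supp g \<subseteq> {K1..r}" using g(2) Max_ge[OF D_finite[OF g(1)]] by (force simp: r_def)
  have K12: "K1 \<le> K2" "K0 \<le> K1" "1 \<le> K1" by (simp_all add: K1_def K2_def)
  have sx: "supp x \<subseteq> BL A \<inter> {K1..r}"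
  proof
    fix k assume "k \<in> supp x"
    then have "k \<in> BL A" "k \<in> supp w" by (auto simp: x_def supp_def indicator_def split: if_splits)
    moreover from this have "K1 \<le> k" "k \<le> r" using z(2) K12(1) by (force simp: r_def)+
    ultimately show "k \<in> BL A \<inter> {K1..r}" by simp
  qed
  show ?thesis
  proof (rule exI[of _ K1], rule exI[of _ r], rule exI[of _ x], rule exI[of _ x'], rule exI[of _ g], intro conjI ballI)
    show "K0 \<le> K1" "1 \<le> K1" by (rule K12)+
    show "K1 \<le> r" using gr gne by fastforce
    show "x' \<in> Y" "supp g \<subseteq> {K1..r}" "supp g \<noteq> {}" "D g" "\<delta> / 64 \<le> pair g (coef (U x'))"
      by (fact x'Y gr gne g(1) gU)+
    show "supp x \<subseteq> {K1..r}" using sx by blast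
    show "supp g \<inter> supp x = {}" using g(2) f1(2) sx by blast
    show "square_bound (n (2 * j - 1) - 1) x 5" unfolding x_def by (rule square_bound_indicator[OF z(6)])
    have "norm_le (\<lambda>k. indicator (BL A) k * (coef z k - w k)) (1 * min \<epsilon> (1/4))"
      by (rule norm_le_multiplier[OF z(3)]) (auto simp: indicator_def)
    then show "norm_le (\<lambda>k. coef x' k - x k) \<epsilon>"
      unfolding cx' x_def right_diff_distrib[symmetric] by (rule norm_le_mono) simp
    fix u assume "u \<in> Xs"
    then show "\<bar>pair g (coef (U u))\<bar> \<le> \<epsilon>"
      by (intro tail[OF g(1)]) (use g(2) in blast)+
  next
    fix f assume f: "f \<in> Fs"
    show "\<bar>pair f (coef (U x'))\<bar> \<le> \<epsilon>"
    proof -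
      have "\<bar>pair f (coef (U x'))\<bar> \<le> \<epsilon> / 2 * norm x'" using Ka f K2a[OF f] x'Y x'0 by blast
      also have "... \<le> \<epsilon> / 2 * 2" using x'2 \<epsilon> by (intro mult_left_mono) auto
      finally show ?thesis by simp
    qed
  qed
qed


text \<open>Perturbations and cross terms are divided by \<open>m (q t)\<close> because the
  coefficients of the vectors may later be that large. The factor \<open>4 ^ t\<close>, with the
  larger index for cross terms, makes the whole matrix of errors summable.\<close>

lemma block_sequence:
  assumes Z: "subspace Z" "Z \<subseteq> Y" "infinite_dimensional Z" and \<delta>: "0 < \<delta>" "\<And>z. z \<in> Z \<Longrightarrow> \<delta> * norm z \<le> norm (U z)"
  shows "\<exists>s r q x x' g. rapid s r q x 3 \<and> (\<forall>t. x' t \<in> Y \<and> supp (g t) \<subseteq> {s t..r t} \<and> supp (g t) \<noteq> {} \<and> D (g t) \<and>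
      supp (g t) \<inter> supp (x t) = {} \<and> norm_le (\<lambda>k. coef (x' t) k - x t k) (1 / (4 ^ t * real (m (q t)))) \<and>
      \<delta> / 64 \<le> pair (g t) (coef (U (x' t)))) \<and>
    (\<forall>t u. t \<noteq> u \<longrightarrow> \<bar>pair (g t) (coef (U (x' u)))\<bar> \<le> 1 / (4 ^ max t u * real (m (q (max t u)))))"
proof -
  \<comment> \<open>The comparison with earlier entries is guarded by \<open>D g0\<close> and
    \<open>x0' \<in> Y\<close>, so that \<open>P L\<close> can be satisfied for every list
    \<open>L\<close>, as \<open>history_choice\<close> demands.\<close>
  define P where "P L = (\<lambda>(s, r, q, x, x', g). 1 \<le> s \<and> s \<le> r \<and> 3 \<le> q \<and> x' \<in> Y \<and> supp x \<subseteq> {s..r} \<and>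
      supp g \<subseteq> {s..r} \<and> supp g \<noteq> {} \<and> D g \<and> supp g \<inter> supp x = {} \<and> square_bound (n (q - 1) + 1) x 9 \<and>
      norm_le (\<lambda>k. coef x' k - x k) (1 / (4 ^ length L * real (m q))) \<and> \<delta> / 64 \<le> pair g (coef (U x')) \<and>
      (\<forall>(s0, r0, q0, x0, x0', g0)\<in>set L. D g0 \<longrightarrow> x0' \<in> Y \<longrightarrow> r0 < s \<and> q0 < q \<and> r0 ^ 3 \<le> m q \<and>
        \<bar>pair g (coef (U x0'))\<bar> \<le> 1 / (4 ^ length L * real (m q)) \<and>
        \<bar>pair g0 (coef (U x'))\<bar> \<le> 1 / (4 ^ length L * real (m q))))"
    for L :: "(nat \<times> nat \<times> nat \<times> (nat \<Rightarrow> real) \<times> 'x \<times> (nat \<Rightarrow> real)) list"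
  have "\<exists>\<tau>. P L \<tau>" for L
  proof -
    define N where "N = (\<Sum>(s, r, q, x, x', g)\<in>set L. r + q + r ^ 3)"
    have N: "r \<le> N" "q \<le> N" "r ^ 3 \<le> N" if "(s, r, q, x, x', g) \<in> set L" for s r q x x' g
      using member_le_sum[OF that, of "\<lambda>(s, r, q, x, x', g). r + q + r ^ 3"] by (simp_all add: N_def)
    \<comment> \<open>\<open>next_block\<close> controls orders below \<open>n (2 * j - 1)\<close>,
      so \<open>q\<close> has this odd form with \<open>j = N + 2\<close>, where \<open>N\<close>
      bounds all earlier ends, their cubes and the earlier indices.\<close>
    define q where "q = 2 * (N + 2) - 1"
    have q: "N < q" "3 \<le> q" by (simp_all add: q_def)
    have "N < m (N + 2)" by (rule m_gt)
    also have "m (N + 2) \<le> m q" by (rule m_mono) (simp add: q_def)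
    finally have mq: "N < m q" .
    define \<epsilon> where "\<epsilon> = 1 / (4 ^ length L * real (m q))"
    have \<epsilon>: "0 < \<epsilon>" using mq by (simp add: \<epsilon>_def)
    define Fs where "Fs = {g. \<exists>s r q x x'. (s, r, q, x, x', g) \<in> set L \<and> D g}"
    define Xs where "Xs = {x'. x' \<in> Y \<and> (\<exists>s r q x g. (s, r, q, x, x', g) \<in> set L)}"
    have "Fs \<subseteq> (\<lambda>(s, r, q, x, x', g). g) ` set L" "Xs \<subseteq> (\<lambda>(s, r, q, x, x', g). x') ` set L"
      by (force simp: Fs_def Xs_def)+
    then have fin: "finite Fs" "finite Xs" by (auto intro: finite_subset)
    have "2 \<le> N + 2" by simp
    have FsD: "\<And>f. f \<in> Fs \<Longrightarrow> D f" and XsY: "Xs \<subseteq> Y" by (auto simp: Fs_def Xs_def)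
    have nb: "\<exists>s r x x' g. N + 1 \<le> s \<and> 1 \<le> s \<and> s \<le> r \<and> x' \<in> Y \<and> supp x \<subseteq> {s..r} \<and> supp g \<subseteq> {s..r} \<and> supp g \<noteq> {} \<and>
        D g \<and> supp g \<inter> supp x = {} \<and> square_bound (n q - 1) x 5 \<and> norm_le (\<lambda>k. coef x' k - x k) \<epsilon> \<and>
        \<delta> / 64 \<le> pair g (coef (U x')) \<and> (\<forall>u\<in>Xs. \<bar>pair g (coef (U u))\<bar> \<le> \<epsilon>) \<and> (\<forall>f\<in>Fs. \<bar>pair f (coef (U x'))\<bar> \<le> \<epsilon>)"
      unfolding q_def by (rule next_block[OF Z \<delta>(1) _ fin(1) _ fin(2) XsY \<open>2 \<le> N + 2\<close> \<epsilon>]) (erule \<delta>(2) FsD)+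
    obtain s r x x' g where
      b: "N + 1 \<le> s" "1 \<le> s" "s \<le> r" "x' \<in> Y" "supp x \<subseteq> {s..r}" "supp g \<subseteq> {s..r}" "supp g \<noteq> {}"
        "D g" "supp g \<inter> supp x = {}" "square_bound (n q - 1) x 5" "norm_le (\<lambda>k. coef x' k - x k) \<epsilon>"
        "\<delta> / 64 \<le> pair g (coef (U x'))" "\<forall>u\<in>Xs. \<bar>pair g (coef (U u))\<bar> \<le> \<epsilon>" "\<forall>f\<in>Fs. \<bar>pair f (coef (U x'))\<bar> \<le> \<epsilon>"
      using nb by blast
    have "2 ^ 0 \<le> m q ^ 3" using mq by simp
    then have "n (q - 1) + 1 < n q" using n_gap_levels[of q 0] q(2) by simp
    then have sq: "square_bound (n (q - 1) + 1) x 9" by (intro square_bound_mono[OF b(10)]) auto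
    have "P L (s, r, q, x, x', g)"
      unfolding P_def split_conv \<epsilon>_def[symmetric]
    proof (intro conjI b q(2) sq ballI)
      fix \<tau> assume \<tau>L: "\<tau> \<in> set L"
      obtain s0 r0 q0 x0 x0' g0 where \<tau>: "\<tau> = (s0, r0, q0, x0, x0', g0)" by (cases \<tau>)
      note L = \<tau>L[unfolded \<tau>]
      show "case \<tau> of (s0, r0, q0, x0, x0', g0) \<Rightarrow> D g0 \<longrightarrow> x0' \<in> Y \<longrightarrow> r0 < s \<and> q0 < q \<and> r0 ^ 3 \<le> m q \<and>
          \<bar>pair g (coef (U x0'))\<bar> \<le> \<epsilon> \<and> \<bar>pair g0 (coef (U x'))\<bar> \<le> \<epsilon>"
        unfolding \<tau> split_conv
      proof (intro impI)
        assume "D g0" "x0' \<in> Y"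
        then have "x0' \<in> Xs" "g0 \<in> Fs" unfolding Xs_def Fs_def using L by blast+
        then show "r0 < s \<and> q0 < q \<and> r0 ^ 3 \<le> m q \<and> \<bar>pair g (coef (U x0'))\<bar> \<le> \<epsilon> \<and> \<bar>pair g0 (coef (U x'))\<bar> \<le> \<epsilon>"
          using N[OF L] b(1,13,14) q(1) mq by auto
      qed
    qed
    then show ?thesis by blast
  qed
  from history_choice[of P, OF this] obtain F where F: "\<And>t. P (map F [0..<t]) (F t)" by blast
  define s where "s t = fst (F t)" for t
  define r where "r t = fst (snd (F t))" for t
  define q where "q t = fst (snd (snd (F t)))" for t
  define x where "x t = fst (snd (snd (snd (F t))))" for t
  define x' where "x' t = fst (snd (snd (snd (snd (F t)))))" for t
  define g where "g t = snd (snd (snd (snd (snd (F t)))))" for t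
  have Ft: "F t = (s t, r t, q t, x t, x' t, g t)" for t
    by (simp add: s_def r_def q_def x_def x'_def g_def)
  have Pt: "P (map F [0..<t]) (s t, r t, q t, x t, x' t, g t)" for t using F[of t] unfolding Ft[of t] .
  note PP = Pt[unfolded P_def split_conv length_map length_upt diff_zero]
  have G: "1 \<le> s t" "s t \<le> r t" "3 \<le> q t" "x' t \<in> Y" "supp (x t) \<subseteq> {s t..r t}" "supp (g t) \<subseteq> {s t..r t}"
    "supp (g t) \<noteq> {}" "D (g t)" "supp (g t) \<inter> supp (x t) = {}" "square_bound (n (q t - 1) + 1) (x t) 9"
    "norm_le (\<lambda>k. coef (x' t) k - x t k) (1 / (4 ^ t * real (m (q t))))" "\<delta> / 64 \<le> pair (g t) (coef (U (x' t)))" for t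
    using PP[of t] by blast+
  have C: "r u < s t \<and> q u < q t \<and> r u ^ 3 \<le> m (q t) \<and> \<bar>pair (g t) (coef (U (x' u)))\<bar> \<le> 1 / (4 ^ t * real (m (q t))) \<and>
      \<bar>pair (g u) (coef (U (x' t)))\<bar> \<le> 1 / (4 ^ t * real (m (q t)))" if "u < t" for u t
  proof -
    have "F u \<in> set (map F [0..<t])" using that by auto
    then have "(s u, r u, q u, x u, x' u, g u) \<in> set (map F [0..<t])" unfolding Ft .
    moreover have "\<forall>(s0, r0, q0, x0, x0', g0)\<in>set (map F [0..<t]). D g0 \<longrightarrow> x0' \<in> Y \<longrightarrow> r0 < s t \<and> q0 < q t \<and> r0 ^ 3 \<le> m (q t) \<and>
        \<bar>pair (g t) (coef (U x0'))\<bar> \<le> 1 / (4 ^ t * real (m (q t))) \<and>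
        \<bar>pair g0 (coef (U (x' t)))\<bar> \<le> 1 / (4 ^ t * real (m (q t)))"
      using PP[of t] by (elim conjE)
    ultimately show ?thesis using G(4,8)[of u] by blast
  qed
  show ?thesis
  proof (rule exI[of _ s], rule exI[of _ r], rule exI[of _ q], rule exI[of _ x], rule exI[of _ x'], rule exI[of _ g],
      intro conjI allI impI)
    have nine: "(9::real) = 3\<^sup>2" by simp
    show "rapid s r q x 3"
      unfolding rapid_def using G(1-3,5) G(10)[unfolded nine] C[OF lessI] by auto
  next
    fix t u :: nat assume "t \<noteq> u"
    then consider "u < t" | "t < u" by linarith
    then show "\<bar>pair (g t) (coef (U (x' u)))\<bar> \<le> 1 / (4 ^ max t u * real (m (q (max t u))))"
      by cases (use C in \<open>auto simp: max_def\<close>)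
  qed (fact G)+
qed

section \<open>Two incompatible bounds on one special combination\<close>

lemma U_strictly_singular: "strictly_singular Y U"
  unfolding strictly_singular_def
proof (intro allI impI notI)
  fix Z assume "subspace Z \<and> Z \<subseteq> Y \<and> infinite_dimensional Z" and iso: "isomorphism_onto_image Z U"
  then have Z: "subspace Z" "Z \<subseteq> Y" "infinite_dimensional Z" by auto
  obtain R where R: "bounded_linear_on (U ` Z) R" "\<forall>z\<in>Z. R (U z) = z"
    using iso unfolding isomorphism_onto_image_def by blast
  obtain L where L: "0 < L" "\<forall>u\<in>U ` Z. norm (R u) \<le> L * norm u" using bounded_linear_onD(3)[OF R(1)] by blast
  define \<delta> where "\<delta> = 1 / L"
  have \<delta>: "0 < \<delta>" "\<delta> * norm z \<le> norm (U z)" if "z \<in> Z" for z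
  proof -
    show "0 < \<delta>" using L(1) by (simp add: \<delta>_def)
    have "norm z \<le> L * norm (U z)" using L(2) R(2) that by force
    then show "\<delta> * norm z \<le> norm (U z)" using L(1) by (simp add: \<delta>_def divide_le_eq mult.commute)
  qed
  have \<delta>0: "0 < \<delta>" using L(1) by (simp add: \<delta>_def)
  obtain s r q x x' g where rap: "rapid s r q x 3" and
    b: "\<And>t. x' t \<in> Y \<and> supp (g t) \<subseteq> {s t..r t} \<and> supp (g t) \<noteq> {} \<and> D (g t) \<and>
      supp (g t) \<inter> supp (x t) = {} \<and> norm_le (\<lambda>k. coef (x' t) k - x t k) (1 / (4 ^ t * real (m (q t)))) \<and>
      \<delta> / 64 \<le> pair (g t) (coef (U (x' t)))" and
    cross: "\<And>t u. t \<noteq> u \<longrightarrow> \<bar>pair (g t) (coef (U (x' u)))\<bar> \<le> 1 / (4 ^ max t u * real (m (q (max t u))))"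
    using block_sequence[OF Z \<delta>0 \<delta>(2)] by blast
  have x'Y: "x' t \<in> Y" and gD: "D (g t)" and near: "norm_le (\<lambda>k. coef (x' t) k - x t k) (1 / (4 ^ t * real (m (q t))))"
    and large: "\<delta> / 64 \<le> pair (g t) (coef (U (x' t)))" for t
    using b[of t] by blast+
  obtain K where K: "0 < K" "\<forall>u\<in>Y. norm (U u) \<le> K * norm u" using bounded_linear_onD(3)[OF U_linear] by blast
  \<comment> \<open>The upper bound will be of order \<open>1 / M^2\<close> and the lower one of
    order \<open>1 / M\<close>; they clash once \<open>M * \<delta>\<close> exceeds
    \<open>64 * (76 * K + 1)\<close>. Here 76 is 25 * 3 for the special combination plus 1 for its
    perturbation.\<close>
  obtain j :: nat where j: "64 * (76 * K + 1) / \<delta> < real j" using reals_Archimedean2 by blast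
  define j0 where "j0 = j + 1"
  define M where "M = real (m (2 * j0 + 1))"
  have "j < m (j + 2)" by (rule m_gt)
  also have "m (j + 2) \<le> m (2 * j0 + 1)" by (rule m_mono) (simp add: j0_def)
  finally have "real j < M" by (simp add: M_def)
  then have MK: "64 * (76 * K + 1) < M * \<delta>" using j \<delta>0 by (simp add: pos_divide_less_eq)
      (meson less_trans mult_strict_right_mono)
  have M2: "2 \<le> M" using m_ge2[of "2 * j0 + 1"] unfolding M_def by linarith
  \<comment> \<open>All indices will be at least \<open>t0\<close>, so the geometric errors add up
    to at most \<open>1 / M^2\<close>.\<close>
  obtain t0 :: nat where "(1/2::real) ^ t0 < 1 / (2 * M\<^sup>2)"
    using real_arch_pow_inv[of "1 / (2 * M\<^sup>2)" "1/2"] M2 by auto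
  then have t0: "2 * (1/2) ^ t0 \<le> 1 / M\<^sup>2" using M2 by (simp add: field_simps)
  have "\<exists>Tt A Bt. finite Tt \<and> Tt \<subseteq> {t0..} \<and>
    (\<forall>t\<in>Tt. 0 \<le> A t \<and> A t \<le> 1 \<and> 0 \<le> Bt t \<and> Bt t \<le> real (m (q t))) \<and>
    (\<Sum>t\<in>Tt. A t * Bt t) = 1 / real (m (2 * j0 + 1)) \<and> D (\<lambda>k. \<Sum>t\<in>Tt. A t * g t k) \<and>
    norm_le (\<lambda>k. \<Sum>t\<in>Tt. Bt t * x t k) (25 * 3 / (real (m (2 * j0 + 1)))\<^sup>2)"
    by (rule rapid_special_functional[OF rap]) (use b in \<open>auto simp: j0_def\<close>)
  then obtain Tt A Bt where TT: "finite Tt \<and> Tt \<subseteq> {t0..} \<and>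
    (\<forall>t\<in>Tt. 0 \<le> A t \<and> A t \<le> 1 \<and> 0 \<le> Bt t \<and> Bt t \<le> real (m (q t))) \<and>
    (\<Sum>t\<in>Tt. A t * Bt t) = 1 / M \<and> D (\<lambda>k. \<Sum>t\<in>Tt. A t * g t k) \<and>
    norm_le (\<lambda>k. \<Sum>t\<in>Tt. Bt t * x t k) (25 * 3 / M\<^sup>2)"
    unfolding M_def[symmetric] by blast
  then have T: "finite Tt" "Tt \<subseteq> {t0..}" and
    AB: "\<And>t. t \<in> Tt \<Longrightarrow> 0 \<le> A t \<and> A t \<le> 1 \<and> 0 \<le> Bt t \<and> Bt t \<le> real (m (q t))" and
    sum1: "(\<Sum>t\<in>Tt. A t * Bt t) = 1 / M" and \<phi>D: "D (\<lambda>k. \<Sum>t\<in>Tt. A t * g t k)"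
    by blast+
  have nx: "norm_le (\<lambda>k. \<Sum>t\<in>Tt. Bt t * x t k) (75 / M\<^sup>2)" using TT by simp
  define \<phi> where "\<phi> = (\<lambda>k. \<Sum>t\<in>Tt. A t * g t k)"
  define G where "G = (\<Sum>t\<in>Tt. (1/2::real) ^ t)"
  have G0: "0 \<le> G" unfolding G_def by (intro sum_nonneg) simp
  have "G \<le> 1 / M\<^sup>2"
  proof -
    obtain u where u: "Tt \<subseteq> {..<u}" using T(1) finite_nat_iff_bounded by blast
    have "G \<le> (\<Sum>t\<in>{t0..<t0 + u}. (1/2) ^ t)" unfolding G_def using T u by (intro sum_mono2) fastforce+
    also have "... = (\<Sum>t<u. (1/2) ^ t0 * (1/2) ^ t)"
      using sum.shift_bounds_nat_ivl[of "\<lambda>t. (1/2::real) ^ t" 0 t0 u] by (simp add: power_add mult.commute add.commute atLeast0LessThan)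
    also have "... = (1/2) ^ t0 * (2 * (1 - (1/2) ^ u))" by (simp add: sum_distrib_left[symmetric] geometric_sum)
    also have "... \<le> (1/2) ^ t0 * 2" by (intro mult_left_mono) auto
    finally show ?thesis using t0 by simp
  qed
  moreover have "1 / M\<^sup>2 \<le> 1" using M2 by (simp add: one_le_power)
  ultimately have GM: "G \<le> 1 / M\<^sup>2" "G * G \<le> 1 / M\<^sup>2" using G0 mult_mono[of G "1 / M\<^sup>2" G 1] by auto
  \<comment> \<open>The vector is built from the \<open>x' t\<close>, which lie in \<open>Y\<close>
    where \<open>U\<close> acts; the norm estimate was obtained for their approximations
    \<open>x t\<close>, which need not come from \<open>Y\<close>.\<close>
  define v where "v = (\<Sum>t\<in>Tt. Bt t *\<^sub>R x' t)"
  have vY: "v \<in> Y" unfolding v_def using x'Y subspace_Y by (intro subspace_sum subspace_scale)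
  have cv: "v \<in> X" "coef v = (\<lambda>k. \<Sum>t\<in>Tt. Bt t * coef (x' t) k)"
    unfolding v_def using coef_sum[OF T(1), of x' Bt] Y_in_X[OF x'Y] by auto
  have nv: "norm v \<le> 76 / M\<^sup>2"
  proof -
    have "norm_le (\<lambda>k. \<Sum>t\<in>Tt. Bt t * (coef (x' t) k - x t k)) (\<Sum>t\<in>Tt. \<bar>Bt t\<bar> * (1 / (4 ^ t * real (m (q t)))))"
      by (rule norm_le_sum_triangle[OF T(1) near])
    from norm_le_add[OF this nx]
    have "norm_le (coef v) ((\<Sum>t\<in>Tt. \<bar>Bt t\<bar> * (1 / (4 ^ t * real (m (q t))))) + 75 / M\<^sup>2)"
      unfolding cv by (simp add: sum_subtractf right_diff_distrib)
    moreover have "(\<Sum>t\<in>Tt. \<bar>Bt t\<bar> * (1 / (4 ^ t * real (m (q t))))) \<le> G"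
      unfolding G_def
    proof (rule sum_mono)
      fix t assume t: "t \<in> Tt"
      have mq: "0 < real (m (q t))" using m_ge2[of "q t"] by simp
      have "\<bar>Bt t\<bar> * (1 / (4 ^ t * real (m (q t)))) \<le> real (m (q t)) * (1 / (4 ^ t * real (m (q t))))"
        using AB[OF t] by (intro mult_right_mono) auto
      also have "... = (1/4) ^ t" using mq by (simp add: power_divide)
      also have "... \<le> (1/2) ^ t" by (intro power_mono) auto
      finally show "\<bar>Bt t\<bar> * (1 / (4 ^ t * real (m (q t)))) \<le> (1/2) ^ t" .
    qed
    ultimately have "norm_le (coef v) (1 / M\<^sup>2 + 75 / M\<^sup>2)" using GM(1) by (elim norm_le_mono) linarith
    then show ?thesis using norm_le_iff[OF cv(1)] by (simp add: add_divide_distrib[symmetric])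
  qed
  have "\<bar>pair \<phi> (coef (U v))\<bar> \<le> norm (U v)" unfolding \<phi>_def by (rule pair_coef_le[OF \<phi>D U_X[OF vY]])
  also have "... \<le> K * norm v" using K(2) vY by blast
  also have "... \<le> K * (76 / M\<^sup>2)" using nv K(1) by (intro mult_left_mono) auto
  finally have upper: "pair \<phi> (coef (U v)) \<le> K * (76 / M\<^sup>2)" by linarith
  have "U v = (\<Sum>t\<in>Tt. Bt t *\<^sub>R U (x' t))"
    unfolding v_def by (rule bounded_linear_on_sum[OF U_linear subspace_Y T(1) x'Y])
  then have cU: "coef (U v) = (\<lambda>k. \<Sum>u\<in>Tt. Bt u * coef (U (x' u)) k)"
    using coef_sum[OF T(1), of "\<lambda>t. U (x' t)" Bt] U_X[OF x'Y] by simp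
  have p\<phi>: "pair \<phi> w = (\<Sum>t\<in>Tt. A t * pair (g t) w)" for w
    using pair_combo[OF T(1), of g 1 A w] D_finite[OF gD] by (simp add: \<phi>_def)
  have "pair \<phi> (coef (U v)) = (\<Sum>t\<in>Tt. \<Sum>u\<in>Tt. A t * (Bt u * pair (g t) (coef (U (x' u)))))"
  proof -
    have "pair (g t) (coef (U v)) = (\<Sum>u\<in>Tt. Bt u * pair (g t) (coef (U (x' u))))" for t
      unfolding cU by (rule pair_sum)
    then show ?thesis unfolding p\<phi> by (simp only: sum_distrib_left)
  qed
  \<comment> \<open>The diagonal contributes \<open>1 / M * (\<delta> / 64)\<close>. An off-diagonal
    term with larger index \<open>c\<close> is at most \<open>(1/4) ^ c\<close>, hence at most
    \<open>(1/2) ^ t * (1/2) ^ u\<close>, and these products sum to \<open>G * G\<close>.\<close>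
  also have "... \<ge> (\<Sum>t\<in>Tt. \<Sum>u\<in>Tt. (if t = u then A t * Bt t * (\<delta> / 64) else 0) - (1/2) ^ t * (1/2) ^ u)"
  proof (intro sum_mono)
    fix t u assume tu: "t \<in> Tt" "u \<in> Tt"
    note ab = AB[OF tu(1)] AB[OF tu(2)]
    show "(if t = u then A t * Bt t * (\<delta> / 64) else 0) - (1/2) ^ t * (1/2) ^ u \<le> A t * (Bt u * pair (g t) (coef (U (x' u))))"
    proof (cases "t = u")
      case True
      have "A t * Bt t * (\<delta> / 64) \<le> A t * Bt t * pair (g t) (coef (U (x' t)))"
        using ab large by (intro mult_left_mono) auto
      moreover have "0 \<le> (1/2::real) ^ t * (1/2) ^ t" by simp
      ultimately show ?thesis unfolding True[symmetric] mult.assoc[of "A t" "Bt t"] by (simp only: refl if_True)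
    next
      case False
      define c where "c = max t u"
      have mc: "0 < real (m (q c))" using m_ge2[of "q c"] by simp
      have qm: "strict_mono q" using rap unfolding rapid_def strict_mono_Suc_iff by blast
      have "m (q u) \<le> m (q c)" using qm by (intro m_mono) (simp add: c_def strict_mono_less_eq)
      then have "A t * Bt u \<le> 1 * real (m (q c))" using ab by (intro mult_mono) auto
      then have "\<bar>A t * Bt u\<bar> * \<bar>pair (g t) (coef (U (x' u)))\<bar> \<le> real (m (q c)) * (1 / (4 ^ c * real (m (q c))))"
        using cross[of t u] False ab by (intro mult_mono) (auto simp: c_def)
      also have "... = (1/2) ^ c * (1/2) ^ c" using mc by (simp add: power_divide power_mult_distrib[symmetric])
      also have "... \<le> (1/2) ^ t * (1/2) ^ u" by (intro mult_mono power_decreasing) (auto simp: c_def)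
      finally have "\<bar>A t * (Bt u * pair (g t) (coef (U (x' u))))\<bar> \<le> (1/2) ^ t * (1/2) ^ u" by (simp add: abs_mult mult.assoc)
      then show ?thesis using False by (simp add: abs_le_iff)
    qed
  qed
  also have "(\<Sum>t\<in>Tt. \<Sum>u\<in>Tt. (if t = u then A t * Bt t * (\<delta> / 64) else 0) - (1/2) ^ t * (1/2) ^ u) = 1 / M * (\<delta> / 64) - G * G"
  proof -
    have "G * G = (\<Sum>t\<in>Tt. \<Sum>u\<in>Tt. (1/2) ^ t * (1/2) ^ u)" unfolding G_def by (rule sum_product)
    then show ?thesis using T(1) by (simp add: sum_subtractf sum.delta sum1[symmetric] sum_distrib_right sum_divide_distrib)
  qed
  finally have "1 / M * (\<delta> / 64) \<le> K * (76 / M\<^sup>2) + 1 / M\<^sup>2" using upper GM(2) by linarith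
  then have "M\<^sup>2 * (1 / M * (\<delta> / 64)) \<le> M\<^sup>2 * (K * (76 / M\<^sup>2) + 1 / M\<^sup>2)" by (rule mult_left_mono) simp
  moreover have "M\<^sup>2 * (1 / M * (\<delta> / 64)) = M * \<delta> / 64" using M2 by (simp add: power2_eq_square)
  moreover have "M\<^sup>2 * (K * (76 / M\<^sup>2) + 1 / M\<^sup>2) = 76 * K + 1" using M2 by (simp add: distrib_left)
  ultimately have "M * \<delta> / 64 \<le> 76 * K + 1" by (simp only:)
  then have "M * \<delta> \<le> 64 * (76 * K + 1)" by (simp add: pos_divide_le_eq mult.commute)
  then show False using MK by (metis not_le)
qed

end

theorem mainTheorem4:
  fixes m n :: "nat \<Rightarrow> nat" and N1 N2 :: "nat set"
    and \<sigma> :: "(nat set \<times> nat) list \<Rightarrow> nat"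
    and e y :: "nat \<Rightarrow> 'x::banach" and Y :: "'x set" and T :: "'x \<Rightarrow> 'x"
  assumes "wh_parameters m n N1 N2" and "wh_coding m N1 N2 \<sigma>"
    and "wh_embedding m n N1 N2 \<sigma> e"
    and "range y \<subseteq> X_wh e"
    and "disjoint_family (\<lambda>i. basis_support e (y i))"
    and "Y = closed_span (range y)"
    and "T \<in> operators Y"
  shows "\<exists>D' \<in> diagonal_operators e. \<exists>S \<in> operators Y.
           strictly_singular Y S \<and> (\<forall>u\<in>Y. T u = D' u + S u)"
proof -
  interpret wh_banach m n N1 N2 \<sigma> e by unfold_locales (fact assms)+
  have "basis_support e (y i) = supp (coef (y i))" for i
    using basis_support_coef assms(4) by blast
  then have "disjoint_family (\<lambda>i. supp (coef (y i)))" using assms(5) by simp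
  then interpret wh_sub m n N1 N2 \<sigma> e y T by unfold_locales (use assms in auto)
  show ?thesis
    unfolding assms(6) using mul_mu_diagonal U_operator U_strictly_singular
    by (intro bexI[of _ "mul mu"] bexI[of _ U]) (auto simp: U_def)
qed

end
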